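(* Let $K$ be a complete algebraically closed non-trivially valued field. Let $W \subseteq \mathbb{P}^n$ be Zariski closed (defined over $K$), and let $u$ be a reduced homogeneous $K$-sub-valuation on $K[W]$, almost finitely generated over $K$ by homogeneous conditions $C = \{ (f_k,\gamma_k) : k \in \mathbb{N} \}$ (with each $f_k$ non-constant). (1) We have $u^* = \inf_k \bigl( \hat{f_k} - \frac{\gamma_k}{\deg f_k} \bigr)$ uniformly, i.e. $$\min_{k < m} \Bigl( \hat{f_k} - \frac{\gamma_k}{\deg f_k} \Bigr) \longrightarrow u^* \quad\text{uniformly on } W \text{ as } m\to\infty.$$ In particular, $u^*$ is a virtual divisor on $W$. Conversely, every virtual divisor on $W$ arises in this manner (as $u^*$ for some such $u$), and moreover with all $\gamma_k = 0$. (2) The double dual $u^{**}$ is equal to $u$. Consequently, for any virtual divisor $\eta$ on $W$ we have $\eta^{**} = \eta$. (3) This bijection between virtual divisors on $W$ and reduced almost finitely generated homogeneous sub-valuations on $K[W]$ is isometric: $d(u,w) = d(u^*,w^* )$ for any two reduced almost finitely generated homogeneous sub-valuations $u,w$ on $K[W]$.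
   Context: Valuations are maps $v\colon K\to\mathbb{R}\cup\{\infty\}$. $X=(X_0,\dots,X_n)$; $K[W]=K[X]/I(W)$ is the graded homogeneous coordinate ring, $I(W)$ the radical homogeneous ideal of $W$. For a tuple $x$, $\tilde v(x)=\min_i v(x_i)$. For $f$ homogeneous of degree $m$ and $\xi=[x]\in\mathbb{P}^n$, $vf(\xi)=v(f(x))-m\tilde v(x)$, and for $m\ge1$, $\hat f(\xi)=vf(\xi)/m$. Virtual divisors. A virtual divisor of degree $d\ge1$ on $W$ (over $K$) is a function $\eta\colon W(K)\to\mathbb{R}$ of the form $\hat f|_{W(K)}$ with $f\in L[X]_d$ homogeneous of degree $d$ over some valued field extension $L/K$. A virtual divisor is a uniform limit on $W(K)$ of virtual divisors of various degrees. $d(\eta,\theta)=\sup_{\xi\in W(K)}|\eta(\xi)-\theta(\xi)|$. Sub-valuations. A sub-valuation on a commutative unital ring $A$ is $u\colon A\to\mathbb{R}\cup\{\infty\}$ with $u(ab)\ge u(a)+u(b)$, $u(a^2)=2u(a)$, $u(a+b)\ge\min(u(a),u(b))$, $u(0)=\infty$. It is reduced if $u(a)=\infty$ only for $a=0$. If $A$ is graded, $u$ is homogeneous if $u(\sum a_m)=\min_m u(a_m)$ for the decomposition into homogeneous components. A $K$-sub-valuation on a $K$-algebra $A$ is a sub-valuation with $u(c)\ge v(c)$ for all $c\in K$; sub-valuations on $K[W]$ are understood to be $K$-sub-valuations. A condition is a pair $(a,\alpha)$ with $a\in A$, $\alpha\in\mathbb{R}\cup\{\infty\}$; it is homogeneous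 if $a$ is. If $C$ is a set of conditions whose first coordinates generate $A$ as a $K$-algebra, the $K$-sub-valuation generated by $C$ is the least $K$-sub-valuation $u$ with $u(a)\ge\alpha$ for all $(a,\alpha)\in C$. Let $A$ be finitely generated over $K$ with a finite generating tuple $c$; $\deg_c a$ is the least degree of a polynomial $f$ over $K$ with $a=f(c)$. A sequence $u_m$ converges uniformly to $u$ if for every $\varepsilon>0$, for all large $m$ and all $a\in A$, $|u(a)-u_m(a)|\le\varepsilon\deg_c a$ (with $|\infty-\infty|=0$); this does not depend on $c$. A countable family $C=\{(a_k,\alpha_k):k\in\mathbb{N}\}$ such that $\{a_k\}$ generates $A$ over $K$ almost finitely generates $u$ (over $K$) if the $K$-sub-valuations generated by $\{(a_k,\alpha_k):k<m\}$ (defined for $m$ large) converge uniformly to $u$ as $m\to\infty$; $u$ is almost finitely generated if it is so by some such countable family (equivalently, it is a uniform limit of $K$-sub-valuations generated by finitely many conditions). Duals. For $\eta\colon W(K)\to\mathbb{R}$ and $f\in K[W]_m$ homogeneous of degree $m$, $\eta^*(f)=\inf_{\xi\in W(K)}(vf(\xi)-m\eta(\xi))$, extended by $\eta^*(\sum f_m)=\min_m\eta^*(f_m)$. For $u\colon K[W]\to\mathbb{R}\cup\{\infty\}$ and $\xi\in W(K)$, $u^*(\xi)=\inf_f\bigl(\hat f(\xi)-\frac{u(f)}{\deg f}\bigr)$ over non-constant homogeneous $f$. Terms of the form $\infty-\infty$ (arising from $f=0$ in $K[W]$) are read as $\infty$ in these infima. The distance of sub-valuations is $d(u,w)=\sup_f\frac{|u(f)-w(f)|}{\deg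 f}$ over non-constant homogeneous $f$, with $|\infty-\infty|=0$. *)

theory Defs
  imports
    "HOL-Library.Poly_Mapping"
    "HOL-Analysis.Finite_Cartesian_Product"
    "HOL-Library.Extended_Real"
    "HOL-Algebra.QuotRing"
    "HOL-Algebra.Generated_Rings"
    "HOL-Algebra.Algebraic_Closure_Type"
begin

section \<open>Valuations\<close>

text \<open>
  The ground field is a type; extension fields and coordinate rings, which depend on
  data or are quantified over inside the statement, are ring records on carriers.
  \<^const>\<open>ring_of_type_algebra\<close> passes from a type to a record.
  All values lie in the extended reals. The value $-\infty$ is excluded explicitly, and the
  library conventions $\infty - x = \infty$ (also for $x = \infty$) and $\infty / r = \infty$
  (for $r > 0$) are the ones needed for the terms that come from $f = 0$.
\<close>

definition valuation :: "('a, 'b) ring_scheme \<Rightarrow> ('a \<Rightarrow> ereal) \<Rightarrow> bool" where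
  "valuation R v \<longleftrightarrow>
     (\<forall>a\<in>carrier R. v a \<noteq> -\<infinity>) \<and>
     (\<forall>a\<in>carrier R. v a = \<infinity> \<longleftrightarrow> a = \<zero>\<^bsub>R\<^esub>) \<and>
     (\<forall>a\<in>carrier R. \<forall>b\<in>carrier R. v (a \<otimes>\<^bsub>R\<^esub> b) = v a + v b) \<and>
     (\<forall>a\<in>carrier R. \<forall>b\<in>carrier R. v (a \<oplus>\<^bsub>R\<^esub> b) \<ge> min (v a) (v b))"

definition complete_valuation :: "('k::field \<Rightarrow> ereal) \<Rightarrow> bool" where
  "complete_valuation v \<longleftrightarrow>
     (\<forall>x :: nat \<Rightarrow> 'k.
        (\<forall>B::real. \<exists>N. \<forall>i\<ge>N. \<forall>j\<ge>N. v (x i - x j) \<ge> ereal B) \<longrightarrow>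
        (\<exists>l. \<forall>B::real. \<exists>N. \<forall>i\<ge>N. v (x i - l) \<ge> ereal B))"

text \<open>The distance on the extended reals, with $|\infty - \infty| = 0$.\<close>

definition ext_dist :: "ereal \<Rightarrow> ereal \<Rightarrow> ereal" where
  "ext_dist a b = (if a = b then 0 else \<bar>a - b\<bar>)"


section \<open>Sub-valuations on algebras\<close>

text \<open>A $K$-algebra is a ring record \<open>A\<close> with a structure map \<open>\<iota>\<close> from $K$ to \<open>A\<close>.\<close>

definition subvaluation :: "('a, 'b) ring_scheme \<Rightarrow> ('a \<Rightarrow> ereal) \<Rightarrow> bool" where
  "subvaluation A u \<longleftrightarrow>
     (\<forall>a\<in>carrier A. u a \<noteq> -\<infinity>) \<and>
     (\<forall>a\<in>carrier A. \<forall>b\<in>carrier A. u (a \<otimes>\<^bsub>A\<^esub> b) \<ge> u a + u b) \<and>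
     (\<forall>a\<in>carrier A. u (a \<otimes>\<^bsub>A\<^esub> a) = 2 * u a) \<and>
     (\<forall>a\<in>carrier A. \<forall>b\<in>carrier A. u (a \<oplus>\<^bsub>A\<^esub> b) \<ge> min (u a) (u b)) \<and>
     u \<zero>\<^bsub>A\<^esub> = \<infinity>"

definition K_subvaluation ::
    "('a, 'b) ring_scheme \<Rightarrow> ('k \<Rightarrow> 'a) \<Rightarrow> ('k \<Rightarrow> ereal) \<Rightarrow> ('a \<Rightarrow> ereal) \<Rightarrow> bool" where
  "K_subvaluation A \<iota> v u \<longleftrightarrow> subvaluation A u \<and> (\<forall>c. u (\<iota> c) \<ge> v c)"

definition reduced_subvaluation :: "('a, 'b) ring_scheme \<Rightarrow> ('a \<Rightarrow> ereal) \<Rightarrow> bool" where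
  "reduced_subvaluation A u \<longleftrightarrow> (\<forall>a\<in>carrier A. u a = \<infinity> \<longrightarrow> a = \<zero>\<^bsub>A\<^esub>)"

text \<open>\<open>G m\<close> is the homogeneous part of degree \<open>m\<close> of a graded ring.\<close>

definition homogeneous_subvaluation ::
    "('a, 'b) ring_scheme \<Rightarrow> (nat \<Rightarrow> 'a set) \<Rightarrow> ('a \<Rightarrow> ereal) \<Rightarrow> bool" where
  "homogeneous_subvaluation A G u \<longleftrightarrow>
     (\<forall>N a. (\<forall>m\<le>N. a m \<in> G m) \<longrightarrow>
        u (\<Oplus>\<^bsub>A\<^esub>m\<in>{..N}. a m) = (MIN m\<in>{..N}. u (a m)))"

definition generates_algebra :: "('a, 'b) ring_scheme \<Rightarrow> ('k \<Rightarrow> 'a) \<Rightarrow> 'a set \<Rightarrow> bool" where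
  "generates_algebra A \<iota> S \<longleftrightarrow>
     S \<subseteq> carrier A \<and> generate_ring A (range \<iota> \<union> S) = carrier A"

definition generated_subvaluation ::
    "('a, 'b) ring_scheme \<Rightarrow> ('k \<Rightarrow> 'a) \<Rightarrow> ('k \<Rightarrow> ereal) \<Rightarrow> ('a \<times> ereal) set
      \<Rightarrow> ('a \<Rightarrow> ereal) \<Rightarrow> bool" where
  "generated_subvaluation A \<iota> v C u \<longleftrightarrow>
     generates_algebra A \<iota> (fst ` C) \<and>
     K_subvaluation A \<iota> v u \<and> (\<forall>(a, \<alpha>)\<in>C. u a \<ge> \<alpha>) \<and>
     (\<forall>w. K_subvaluation A \<iota> v w \<and> (\<forall>(a, \<alpha>)\<in>C. w a \<ge> \<alpha>) \<longrightarrow> (\<forall>a\<in>carrier A. u a \<le> w a))"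

type_synonym ('i, 'k) mpoly = "('i \<Rightarrow>\<^sub>0 nat) \<Rightarrow>\<^sub>0 'k"

definition mdeg :: "('i \<Rightarrow>\<^sub>0 nat) \<Rightarrow> nat" where
  "mdeg \<alpha> = (\<Sum>i\<in>Poly_Mapping.keys \<alpha>. Poly_Mapping.lookup \<alpha> i)"

definition algebra_eval ::
    "('a, 'b) ring_scheme \<Rightarrow> ('k::field \<Rightarrow> 'a) \<Rightarrow> 'a list \<Rightarrow> (nat, 'k) mpoly \<Rightarrow> 'a" where
  "algebra_eval A \<iota> c f =
     (\<Oplus>\<^bsub>A\<^esub>\<alpha>\<in>Poly_Mapping.keys f. \<iota> (Poly_Mapping.lookup f \<alpha>) \<otimes>\<^bsub>A\<^esub> (\<Otimes>\<^bsub>A\<^esub>i\<in>Poly_Mapping.keys \<alpha>. (c ! i) [^]\<^bsub>A\<^esub> Poly_Mapping.lookup \<alpha> i))"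

definition tuple_degree ::
    "('a, 'b) ring_scheme \<Rightarrow> ('k::field \<Rightarrow> 'a) \<Rightarrow> 'a list \<Rightarrow> 'a \<Rightarrow> nat" where
  "tuple_degree A \<iota> c a =
     (LEAST d. \<exists>f. (\<forall>\<alpha>\<in>Poly_Mapping.keys f. Poly_Mapping.keys \<alpha> \<subseteq> {..<length c} \<and> mdeg \<alpha> \<le> d) \<and> algebra_eval A \<iota> c f = a)"

text \<open>The choice of the finite generating tuple \<open>c\<close> does not matter.\<close>

definition subvaluations_converge ::
    "('a, 'b) ring_scheme \<Rightarrow> ('k::field \<Rightarrow> 'a) \<Rightarrow> (nat \<Rightarrow> 'a \<Rightarrow> ereal) \<Rightarrow> ('a \<Rightarrow> ereal) \<Rightarrow> bool" where
  "subvaluations_converge A \<iota> us u \<longleftrightarrow>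
     (\<exists>c. generates_algebra A \<iota> (set c) \<and>
        (\<forall>\<epsilon>>0. \<forall>\<^sub>F m in sequentially. \<forall>a\<in>carrier A.
           ext_dist (u a) (us m a) \<le> ereal (\<epsilon> * real (tuple_degree A \<iota> c a))))"

definition almost_finitely_generates ::
    "('a, 'b) ring_scheme \<Rightarrow> ('k::field \<Rightarrow> 'a) \<Rightarrow> ('k \<Rightarrow> ereal) \<Rightarrow> (nat \<Rightarrow> 'a \<times> ereal)
      \<Rightarrow> ('a \<Rightarrow> ereal) \<Rightarrow> bool" where
  "almost_finitely_generates A \<iota> v C u \<longleftrightarrow>
     (\<forall>k. snd (C k) \<noteq> -\<infinity>) \<and> generates_algebra A \<iota> (range (\<lambda>k. fst (C k))) \<and>
     (\<exists>us. (\<forall>\<^sub>F m in sequentially. generated_subvaluation A \<iota> v (C ` {..<m}) (us m)) \<and>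
           subvaluations_converge A \<iota> us u)"

definition almost_finitely_generated ::
    "('a, 'b) ring_scheme \<Rightarrow> ('k::field \<Rightarrow> 'a) \<Rightarrow> ('k \<Rightarrow> ereal) \<Rightarrow> ('a \<Rightarrow> ereal) \<Rightarrow> bool" where
  "almost_finitely_generated A \<iota> v u \<longleftrightarrow> (\<exists>C. almost_finitely_generates A \<iota> v C u)"


section \<open>Projective space and coordinate rings\<close>

text \<open>
  The variables $X_0, \ldots, X_n$ are indexed by a finite type \<open>'n\<close> with $n + 1$ elements.
\<close>

definition proj_rel :: "'k::field ^ 'n \<Rightarrow> 'k ^ 'n \<Rightarrow> bool" where
  "proj_rel x y \<longleftrightarrow> x \<noteq> 0 \<and> (\<exists>c. c \<noteq> 0 \<and> y = c *s x)"

quotient_type (overloaded) ('k, 'n) proj = "'k::field ^ 'n" / partial: proj_rel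
proof (rule part_equivpI)
  show "\<exists>x::'k ^ 'n. proj_rel x x"
    by (rule exI[of _ "\<chi> i. 1"]) (auto simp: proj_rel_def vec_eq_iff intro: exI[of _ 1])
  show "symp (proj_rel :: 'k ^ 'n \<Rightarrow> _)"
  proof (rule sympI)
    fix x y :: "'k ^ 'n"
    assume "proj_rel x y"
    then obtain c where c: "x \<noteq> 0" "c \<noteq> 0" "y = c *s x"
      by (auto simp: proj_rel_def)
    have "x = inverse c *s y" "y \<noteq> 0"
      using c by (auto simp: vec_eq_iff)
    then show "proj_rel y x"
      using c by (auto simp: proj_rel_def intro: exI[of _ "inverse c"])
  qed
  show "transp (proj_rel :: 'k ^ 'n \<Rightarrow> _)"
  proof (rule transpI)
    fix x y z :: "'k ^ 'n"
    assume "proj_rel x y" "proj_rel y z"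
    then obtain c d where "x \<noteq> 0" "c \<noteq> 0" "d \<noteq> 0" "z = (d * c) *s x"
      by (auto simp: proj_rel_def vec_eq_iff mult.assoc)
    then show "proj_rel x z"
      by (auto simp: proj_rel_def intro: exI[of _ "d * c"])
  qed
qed

definition homogeneous :: "nat \<Rightarrow> ('i, 'k::zero) mpoly \<Rightarrow> bool" where
  "homogeneous m f \<longleftrightarrow> (\<forall>\<alpha>\<in>Poly_Mapping.keys f. mdeg \<alpha> = m)"

definition hom_component :: "nat \<Rightarrow> ('i, 'k::comm_monoid_add) mpoly \<Rightarrow> ('i, 'k) mpoly" where
  "hom_component m f = (\<Sum>\<alpha>\<in>{\<alpha>\<in>Poly_Mapping.keys f. mdeg \<alpha> = m}. Poly_Mapping.single \<alpha> (Poly_Mapping.lookup f \<alpha>))"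

definition monom_eval :: "('n \<Rightarrow>\<^sub>0 nat) \<Rightarrow> 'k::field ^ 'n \<Rightarrow> 'k" where
  "monom_eval \<alpha> x = (\<Prod>i\<in>Poly_Mapping.keys \<alpha>. (x $ i) ^ Poly_Mapping.lookup \<alpha> i)"

definition poly_eval :: "('n, 'k::field) mpoly \<Rightarrow> 'k ^ 'n \<Rightarrow> 'k" where
  "poly_eval f x = (\<Sum>\<alpha>\<in>Poly_Mapping.keys f. Poly_Mapping.lookup f \<alpha> * monom_eval \<alpha> x)"

text \<open>
  Points are evaluated at the representative \<^const>\<open>rep_proj\<close>; vanishing of a form, and the
  values of forms introduced below, do not depend on it.
\<close>

definition zariski_closed :: "('k::field, 'n::finite) proj set \<Rightarrow> bool" where
  "zariski_closed W \<longleftrightarrow>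
     (\<exists>S. (\<forall>f\<in>S. \<exists>m. homogeneous m f) \<and> W = {\<xi>. \<forall>f\<in>S. poly_eval f (rep_proj \<xi>) = 0})"

text \<open>
  The ideal generated by the forms that vanish on \<open>W\<close>, i.e. the polynomials all of whose
  homogeneous components do. For empty \<open>W\<close> this is the unit ideal.
\<close>

definition vanishing_ideal :: "('k::field, 'n::finite) proj set \<Rightarrow> ('n, 'k) mpoly set" where
  "vanishing_ideal W = {f. \<forall>m. \<forall>\<xi>\<in>W. poly_eval (hom_component m f) (rep_proj \<xi>) = 0}"

definition coord_ring :: "('k::field, 'n::finite) proj set \<Rightarrow> ('n, 'k) mpoly set ring" where
  "coord_ring W = ring_of_type_algebra Quot vanishing_ideal W"

definition coord_class ::
    "('k::field, 'n::finite) proj set \<Rightarrow> ('n, 'k) mpoly \<Rightarrow> ('n, 'k) mpoly set" where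
  "coord_class W f = vanishing_ideal W +>\<^bsub>ring_of_type_algebra\<^esub> f"

definition coord_const ::
    "('k::field, 'n::finite) proj set \<Rightarrow> 'k \<Rightarrow> ('n, 'k) mpoly set" where
  "coord_const W c = coord_class W (Poly_Mapping.single 0 c)"

definition coord_grade ::
    "('k::field, 'n::finite) proj set \<Rightarrow> nat \<Rightarrow> ('n, 'k) mpoly set set" where
  "coord_grade W m = coord_class W ` {f. homogeneous m f}"

definition reduced_homogeneous_subvaluation ::
    "('k::field \<Rightarrow> ereal) \<Rightarrow> ('k, 'n::finite) proj set \<Rightarrow> (('n, 'k) mpoly set \<Rightarrow> ereal) \<Rightarrow> bool" where
  "reduced_homogeneous_subvaluation v W u \<longleftrightarrow>
     K_subvaluation (coord_ring W) (coord_const W) v u \<and>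
     reduced_subvaluation (coord_ring W) u \<and>
     homogeneous_subvaluation (coord_ring W) (coord_grade W) u"


section \<open>Virtual divisors\<close>

definition tuple_val :: "('k \<Rightarrow> ereal) \<Rightarrow> 'k ^ 'n \<Rightarrow> ereal" where
  "tuple_val v x = (MIN i. v (x $ i))"

definition form_val ::
    "('k::field \<Rightarrow> ereal) \<Rightarrow> nat \<Rightarrow> ('n::finite, 'k) mpoly \<Rightarrow> ('k, 'n) proj \<Rightarrow> ereal" where
  "form_val v m f \<xi> =
     v (poly_eval f (rep_proj \<xi>)) - ereal (real m) * tuple_val v (rep_proj \<xi>)"

definition form_hat ::
    "('k::field \<Rightarrow> ereal) \<Rightarrow> nat \<Rightarrow> ('n::finite, 'k) mpoly \<Rightarrow> ('k, 'n) proj \<Rightarrow> ereal" where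
  "form_hat v m f \<xi> = form_val v m f \<xi> / ereal (real m)"

text \<open>
  The value at a $K$-rational tuple of the form of degree \<open>d\<close> over an extension \<open>L\<close> of $K$
  whose coefficient at the monomial \<open>\<alpha>\<close> is \<open>a \<alpha>\<close>.
\<close>

definition ext_form_eval ::
    "('l, 'b) ring_scheme \<Rightarrow> ('k::field \<Rightarrow> 'l) \<Rightarrow> nat \<Rightarrow> (('n::finite \<Rightarrow>\<^sub>0 nat) \<Rightarrow> 'l)
      \<Rightarrow> 'k ^ 'n \<Rightarrow> 'l" where
  "ext_form_eval L \<iota> d a x = (\<Oplus>\<^bsub>L\<^esub>\<alpha>\<in>{\<alpha>. mdeg \<alpha> = d}. a \<alpha> \<otimes>\<^bsub>L\<^esub> \<iota> (monom_eval \<alpha> x))"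

text \<open>
  Fields cannot be quantified over as types, so \<open>L\<close> ranges over the fields whose carrier is
  a subset of a type \<open>'l\<close>. Any \<open>'l\<close> into which $K$ injects is large enough: only the
  subfield generated over $K$ by the coefficients of the form matters, and over an infinite
  $K$ it has the cardinality of $K$.
\<close>

definition virtual_divisor_of_degree ::
    "'l itself \<Rightarrow> ('k::field \<Rightarrow> ereal) \<Rightarrow> ('k, 'n::finite) proj set \<Rightarrow> nat
      \<Rightarrow> (('k, 'n) proj \<Rightarrow> ereal) \<Rightarrow> bool" where
  "virtual_divisor_of_degree U v W d \<eta> \<longleftrightarrow>
     d \<ge> 1 \<and>
     (\<exists>(L :: 'l ring) w \<iota> a.
        field L \<and> valuation L w \<and>
        \<iota> \<in> ring_hom ring_of_type_algebra L \<and> (\<forall>c. w (\<iota> c) = v c) \<and>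
        (\<forall>\<alpha>. mdeg \<alpha> = d \<longrightarrow> a \<alpha> \<in> carrier L) \<and>
        (\<forall>\<xi>\<in>W. \<bar>\<eta> \<xi>\<bar> \<noteq> \<infinity> \<and>
           \<eta> \<xi> = (w (ext_form_eval L \<iota> d a (rep_proj \<xi>))
                    - ereal (real d) * tuple_val v (rep_proj \<xi>)) / ereal (real d)))"

definition ext_uniform_limit :: "'x set \<Rightarrow> (nat \<Rightarrow> 'x \<Rightarrow> ereal) \<Rightarrow> ('x \<Rightarrow> ereal) \<Rightarrow> bool" where
  "ext_uniform_limit S fs g \<longleftrightarrow>
     (\<forall>\<epsilon>>0. \<forall>\<^sub>F m in sequentially. \<forall>x\<in>S. ext_dist (fs m x) (g x) \<le> ereal \<epsilon>)"

definition virtual_divisor ::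
    "'l itself \<Rightarrow> ('k::field \<Rightarrow> ereal) \<Rightarrow> ('k, 'n::finite) proj set
      \<Rightarrow> (('k, 'n) proj \<Rightarrow> ereal) \<Rightarrow> bool" where
  "virtual_divisor U v W \<eta> \<longleftrightarrow>
     (\<forall>\<xi>\<in>W. \<bar>\<eta> \<xi>\<bar> \<noteq> \<infinity>) \<and>
     (\<exists>\<theta>. (\<forall>m. \<exists>d. virtual_divisor_of_degree U v W d (\<theta> m)) \<and> ext_uniform_limit W \<theta> \<eta>)"

text \<open>The supremum is taken in $[0, \infty]$, so that it is $0$ for empty \<open>W\<close>.\<close>

definition divisor_dist ::
    "('k::field, 'n::finite) proj set \<Rightarrow> (('k, 'n) proj \<Rightarrow> ereal) \<Rightarrow> (('k, 'n) proj \<Rightarrow> ereal)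
      \<Rightarrow> ereal" where
  "divisor_dist W \<eta> \<theta> = max 0 (SUP \<xi>\<in>W. ext_dist (\<eta> \<xi>) (\<theta> \<xi>))"

definition subvaluation_dist ::
    "('k::field, 'n::finite) proj set \<Rightarrow> (('n, 'k) mpoly set \<Rightarrow> ereal)
      \<Rightarrow> (('n, 'k) mpoly set \<Rightarrow> ereal) \<Rightarrow> ereal" where
  "subvaluation_dist W u w =
     (SUP (m, a)\<in>{(m, a). m \<ge> 1 \<and> a \<in> coord_grade W m}. ext_dist (u a) (w a) / ereal (real m))"


section \<open>Duals\<close>

text \<open>
  The dual of a function on \<open>W\<close> is computed from the components of any polynomial
  representing the given element of the coordinate ring, since two representatives have
  components that agree on \<open>W\<close>. Components that are zero contribute $\infty$.
\<close>

definition divisor_dual ::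
    "('k::field \<Rightarrow> ereal) \<Rightarrow> ('k, 'n::finite) proj set \<Rightarrow> (('k, 'n) proj \<Rightarrow> ereal)
      \<Rightarrow> ('n, 'k) mpoly set \<Rightarrow> ereal" where
  "divisor_dual v W \<eta> a =
     (let f = (SOME f. coord_class W f = a)
      in INF m. INF \<xi>\<in>W. form_val v m (hom_component m f) \<xi> - ereal (real m) * \<eta> \<xi>)"

definition subvaluation_dual ::
    "('k::field \<Rightarrow> ereal) \<Rightarrow> ('k, 'n::finite) proj set \<Rightarrow> (('n, 'k) mpoly set \<Rightarrow> ereal)
      \<Rightarrow> ('k, 'n) proj \<Rightarrow> ereal" where
  "subvaluation_dual v W u \<xi> =
     (INF (m, f)\<in>{(m, f). m \<ge> 1 \<and> homogeneous m f}.
        form_hat v m f \<xi> - u (coord_class W f) / ereal (real m))"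

end

theory Submission
  imports Defs "HOL-Computational_Algebra.Fraction_Field"
begin

text \<open>
  The heart of the matter is a maximum principle: the least $K$-sub-valuation on $K[W]$ with
  $u(f_k) \ge \gamma_k$ for $k < m$ is the dual of the function
  $\min_{k < m} (\hat f_k - \gamma_k / \deg f_k)$ on \<open>W\<close>. Every sub-valuation is an infimum of
  multiplicative semivaluations, and for a multiplicative one Noether normalization over the
  valuation ring reduces the claim to the Gauss valuation, whose value at a polynomial is
  attained at a generic integral point because the residue field is infinite. Both dualities are
  contractions, so almost finitely generated sub-valuations correspond to uniform limits of such
  minima.

  These limits are the virtual divisors. A minimum of forms over $K$ is the value of their generic
  combination over $K(T)$ with the Gauss valuation; conversely, as $K$ is complete, the space of
  forms has bases that are almost orthogonal for the valuation of the coefficients in \<open>L\<close>, so that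
  the value of a form over \<open>L\<close> is, up to \<open>\<epsilon>\<close>, a minimum of values of forms over $K$ plus constants.
\<close>

section \<open>Ultrametric functions and valuations\<close>

text \<open>Two obstacles shape the proof. First, when K[X] is finite over a polynomial subring
  K[h], a form f has an integral equation with coefficients of unknown value, whereas its bound at
  points controls its minimal polynomial, whose leading coefficient \<open>a\<close> is not known to
  be constant, since no unique factorization is invoked. Scaling \<open>a\<close> to Gauss value 0
  and playing the two equations against each other bounds the values of a^M * f^N below for fixed M
  and growing N, which suffices. Second, the value group is only dense in the reals and the forms
  have different degrees. Powers equalize the degrees at no cost, because sub-valuations are exact
  on powers; constants move thresholds to 0 up to an error that is sent to 0. Quotients K[X] / P are
  never formed: kernels are put inside the subrings, and equations are read modulo P. Finally, the
  dual of a function on \<open>W\<close> avoids the value -\<infinity> only if the function is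
  bounded above; that bound comes from the maximum principle as well, applied to a sub-valuation
  made of hypothetical bad points.\<close>

locale ultrametric =
  fixes w :: "'a::ab_group_add \<Rightarrow> ereal"
  assumes not_MInf: "w a \<noteq> -\<infinity>"
    and at_0: "w 0 = \<infinity>"
    and add_ge: "min (w a) (w b) \<le> w (a + b)"
begin

lemma ge_add: "c \<le> w a \<Longrightarrow> c \<le> w b \<Longrightarrow> c \<le> w (a + b)"
  using add_ge[of a b] by (auto simp: min_def split: if_splits)

lemma gr_add: "c < w a \<Longrightarrow> c < w b \<Longrightarrow> c < w (a + b)"
  using add_ge[of a b] by (auto simp: min_def split: if_splits)

lemma ge_sum: "(\<And>i. i \<in> A \<Longrightarrow> c \<le> w (f i)) \<Longrightarrow> c \<le> w (sum f A)"
  by (induction A rule: infinite_finite_induct) (auto simp: at_0 intro!: ge_add)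

lemma gr_sum: "c < \<infinity> \<Longrightarrow> (\<And>i. i \<in> A \<Longrightarrow> c < w (f i)) \<Longrightarrow> c < w (sum f A)"
  by (induction A rule: infinite_finite_induct) (auto simp: at_0 intro!: gr_add)

end

locale semivaluation = ultrametric w for w :: "'a::comm_ring_1 \<Rightarrow> ereal" +
  assumes mult: "w (a * b) = w a + w b"
    and at_1: "w 1 = 0"
begin

lemma minus [simp]: "w (- a) = w a"
proof -
  have "w (-1) + w (-1) = 0"
    using mult[of "-1" "-1"] at_1 by simp
  then have "w (-1) = 0"
    using not_MInf[of "-1"] by (cases "w (-1)") auto
  then show ?thesis
    using mult[of "-1" a] by simp
qed

lemma ge_diff: "c \<le> w a \<Longrightarrow> c \<le> w b \<Longrightarrow> c \<le> w (a - b)"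
  using ge_add[of c a "- b"] by simp

lemma eq_add:
  assumes "w a < w b"
  shows "w (a + b) = w a"
proof (rule antisym)
  show "w a \<le> w (a + b)"
    using assms by (intro ge_add) auto
  show "w (a + b) \<le> w a"
  proof (rule ccontr)
    assume "\<not> w (a + b) \<le> w a"
    then have "w a < w ((a + b) + (- b))"
      using assms by (subst gr_add) auto
    then show False by simp
  qed
qed

lemma eq_of_diff: "w a < w (b - a) \<Longrightarrow> w b = w a"
  using eq_add[of a "b - a"] by simp

lemma power: "w (a ^ n) = ereal (real n) * w a"
proof (induction n)
  case (Suc n)
  then show ?case
    using not_MInf[of a]
    by (cases "w a") (auto simp: mult algebra_simps)
qed (simp add: at_1 zero_ereal_def[symmetric])

lemma prod: "w (prod f A) = (\<Sum>i\<in>A. w (f i))"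
  by (induction A rule: infinite_finite_induct) (auto simp: at_1 mult)

lemma mult_ge_0: "0 \<le> w a \<Longrightarrow> 0 \<le> w b \<Longrightarrow> 0 \<le> w (a * b)"
  by (simp add: mult)

lemma ge_mult: "0 \<le> w a \<Longrightarrow> c \<le> w b \<Longrightarrow> c \<le> w (a * b)"
  using add_mono[of 0 "w a" c "w b"] by (simp add: mult)

lemma power_ge_0: "0 \<le> w a \<Longrightarrow> 0 \<le> w (a ^ n)"
  by (simp add: power)

end

locale valued_field = semivaluation v for v :: "'k::field \<Rightarrow> ereal" +
  assumes eq_0: "v a = \<infinity> \<Longrightarrow> a = 0"
begin

lemma eq_PInf_iff: "v a = \<infinity> \<longleftrightarrow> a = 0"
  using eq_0 at_0 by auto

lemma finite: "a \<noteq> 0 \<Longrightarrow> \<bar>v a\<bar> \<noteq> \<infinity>"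
  using eq_0[of a] not_MInf[of a] by auto

lemma finiteE:
  assumes "a \<noteq> 0" obtains r where "v a = ereal r"
  using finite[OF assms] by (cases "v a") auto

lemma inverse: "a \<noteq> 0 \<Longrightarrow> v (inverse a) = - v a"
  using mult[of a "inverse a"] at_1 not_MInf[of a] not_MInf[of "inverse a"]
  by (cases "v a"; cases "v (inverse a)") (auto simp: zero_ereal_def)

lemma divide: "b \<noteq> 0 \<Longrightarrow> v (a / b) = v a - v b"
  by (simp add: divide_inverse mult inverse minus_ereal_def)

end

section \<open>Points avoiding finitely many residue conditions, and density of the value
  group\<close>

locale closed_valued_field = valued_field v for v :: "'k::alg_closed_field \<Rightarrow> ereal" +
  assumes nontrivial: "\<exists>c. c \<noteq> 0 \<and> v c \<noteq> 0"
begin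

text \<open>The leading term strictly dominates: its coefficient is a unit, the others are integral,
  and the value of t ^ i falls as \<open>i\<close> grows.\<close>

lemma poly_eq_lead:
  fixes p :: "'k poly"
  assumes "v (lead_coeff p) = 0" "\<And>i. 0 \<le> v (coeff p i)" "v t < 0"
  shows "v (poly p t) = ereal (real (degree p)) * v t"
proof -
  let ?n = "degree p"
  obtain r where r: "v t = ereal r" "r < 0"
    using assms(3) not_MInf[of t] by (cases "v t") auto
  have top: "v (coeff p ?n * t ^ ?n) = ereal (real ?n) * v t"
    using assms(1) by (simp add: mult power)
  have "v (coeff p ?n * t ^ ?n) < v (\<Sum>i<?n. coeff p i * t ^ i)"
  proof (rule gr_sum)
    fix i assume "i \<in> {..<?n}"
    then have "ereal (real ?n * r) < ereal (real i * r)"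
      using r by simp
    also have "\<dots> \<le> v (coeff p i * t ^ i)"
      using add_mono[OF assms(2)[of i], of "ereal (real i * r)" "ereal (real i * r)"] r
      by (simp add: mult power)
    finally show "v (coeff p ?n * t ^ ?n) < v (coeff p i * t ^ i)"
      by (simp add: top r)
  qed (simp add: top r)
  then have "v (coeff p ?n * t ^ ?n + (\<Sum>i<?n. coeff p i * t ^ i)) = ereal (real ?n) * v t"
    using eq_add top by simp
  then show ?thesis
    by (simp add: poly_altdef lessThan_Suc_atMost[symmetric] add.commute)
qed

lemma poly_ge_0:
  assumes "\<And>i. 0 \<le> v (coeff p i)" "0 \<le> v t"
  shows "0 \<le> v (poly p t)"
  unfolding poly_altdef using assms by (intro ge_sum mult_ge_0 power_ge_0) auto

text \<open>A root of \<open>t * (\<Prod>p\<in>Q. p t) = 1\<close> is a unit whose residue is a root of none of the \<open>p\<close>.\<close>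

lemma unit_with_unit_values:
  fixes Q :: "'k poly set"
  assumes "finite Q" "\<And>p. p \<in> Q \<Longrightarrow> v (lead_coeff p) = 0" "\<And>p i. p \<in> Q \<Longrightarrow> 0 \<le> v (coeff p i)"
  obtains t where "v t = 0" "\<And>p. p \<in> Q \<Longrightarrow> v (poly p t) = 0"
proof -
  let ?P = "[:0, 1:] * (\<Prod>p\<in>Q. p)"
  have nz: "p \<noteq> 0" if "p \<in> Q" for p
    using assms(2)[OF that] at_0 by auto
  then have "(\<Prod>p\<in>Q. p) \<noteq> 0"
    using assms(1) by auto
  then have "degree ?P > 0"
    by (subst degree_mult_eq) auto
  then have "degree (?P - 1) > 0"
    by (metis degree_1 degree_add_eq_left diff_conv_add_uminus degree_minus)
  then obtain t where "poly (?P - 1) t = 0"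
    using alg_closed_imp_poly_has_root by blast
  then have t: "t * (\<Prod>p\<in>Q. poly p t) = 1"
    by (simp add: poly_prod)
  then have sum0: "v t + (\<Sum>p\<in>Q. v (poly p t)) = 0"
    using mult at_1 prod by metis
  \<comment> \<open>At a non-integral \<open>t\<close> all the factors have value at most 0 and
    \<open>t\<close> itself a negative one, so the product could not be 1.\<close>
  have t0: "0 \<le> v t"
  proof (rule ccontr)
    assume neg: "\<not> 0 \<le> v t"
    then have "v (poly p t) \<le> 0" if "p \<in> Q" for p
      using poly_eq_lead[of p t] assms(2,3)[OF that] by (cases "v t") (auto simp: mult_nonneg_nonpos)
    then have "(\<Sum>p\<in>Q. v (poly p t)) \<le> 0"
      by (intro sum_nonpos) auto
    then show False
      using sum0 neg by (cases "v t"; cases "(\<Sum>p\<in>Q. v (poly p t))") auto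
  qed
  have p0: "0 \<le> v (poly p t)" if "p \<in> Q" for p
    using poly_ge_0 assms(3) t0 that by blast
  have "(\<Sum>p\<in>Q. v (poly p t)) \<ge> 0"
    using p0 by (intro sum_nonneg) auto
  then have "v t = 0" "(\<Sum>p\<in>Q. v (poly p t)) = 0"
    using sum0 t0 by (cases "v t"; cases "(\<Sum>p\<in>Q. v (poly p t))"; auto)+
  then show ?thesis
    using that p0 sum_nonneg_eq_0_iff[OF assms(1), of "\<lambda>p. v (poly p t)"] by blast
qed

text \<open>Cutting each polynomial off above its last unit coefficient makes the leading
  coefficient a unit. The discarded coefficients have positive value, so at a unit \<open>t\<close>
  they cannot disturb a value 0.\<close>

lemma unit_with_unit_values':
  fixes Q :: "'k poly set"
  assumes "finite Q" "\<And>p. p \<in> Q \<Longrightarrow> \<exists>i. v (coeff p i) = 0" "\<And>p i. p \<in> Q \<Longrightarrow> 0 \<le> v (coeff p i)"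
  obtains t where "v t = 0" "\<And>p. p \<in> Q \<Longrightarrow> v (poly p t) = 0"
proof -
  define N where "N p = Max {i. v (coeff p i) = 0}" for p
  have fin: "finite {i. v (coeff p i) = 0}" for p
  proof (rule finite_subset)
    show "{i. v (coeff p i) = 0} \<subseteq> {..degree p}"
      using at_0 by (auto intro!: le_degree)
  qed simp
  have N: "v (coeff p (N p)) = 0" if "p \<in> Q" for p
    using Max_in[OF fin] assms(2)[OF that] unfolding N_def by blast
  have N': "v (coeff p i) > 0" if "p \<in> Q" "i > N p" for p i
    using Max_ge[OF fin, of i p] assms(3)[OF that(1), of i] that(2) unfolding N_def[symmetric]
    by (cases "v (coeff p i) = 0") auto
  let ?c = "\<lambda>p. poly_cutoff (Suc (N p)) p"
  have deg: "degree (?c p) = N p" if "p \<in> Q" for p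
    using N[OF that] at_0
    by (intro antisym degree_le le_degree) (auto simp: coeff_poly_cutoff)
  obtain t where t: "v t = 0" "\<And>p. p \<in> ?c ` Q \<Longrightarrow> v (poly p t) = 0"
  proof (rule unit_with_unit_values[of "?c ` Q"])
    fix p i assume "p \<in> ?c ` Q"
    then show "0 \<le> v (coeff p i)"
      using assms(3) at_0 by (auto simp: coeff_poly_cutoff)
  next
    fix p assume "p \<in> ?c ` Q"
    then show "v (lead_coeff p) = 0"
      using deg N by (auto simp: coeff_poly_cutoff)
  qed (use assms(1) in auto)
  have "v (poly p t) = 0" if p: "p \<in> Q" for p
  proof -
    have "0 < v (poly (p - ?c p) t)"
      unfolding poly_altdef
    proof (rule gr_sum)
      fix i
      have "0 < v (coeff (p - ?c p) i)"
        using N'[OF p, of i] at_0 by (auto simp: coeff_poly_cutoff)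
      then show "0 < v (coeff (p - ?c p) i * t ^ i)"
        using t(1) by (simp add: mult power)
    qed simp
    then have "v (poly (?c p) t) < v (poly p t - poly (?c p) t)"
      using t(2) p by simp
    then show ?thesis
      using eq_of_diff[of "poly (?c p) t" "poly p t"] t(2) p by simp
  qed
  then show ?thesis
    using that t(1) by blast
qed

text \<open>Roots make the value group divisible: an n-th root of an element of positive value has a
  value \<open>q\<close> smaller than \<open>b - a\<close>, and some integer multiple of
  \<open>q\<close> then falls into the interval.\<close>

lemma value_dense:
  fixes a b :: real
  assumes "a < b"
  obtains c where "c \<noteq> 0" "ereal a \<le> v c" "v c \<le> ereal b"
proof -
  obtain c0 where "c0 \<noteq> 0" "v c0 \<noteq> 0"
    using nontrivial by blast
  then obtain c r where c: "c \<noteq> 0" "v c = ereal r" "r > 0"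
  proof (cases "v c0 > 0")
    case True
    obtain r where "v c0 = ereal r" using finiteE[OF \<open>c0 \<noteq> 0\<close>] by blast
    then show ?thesis using that[of c0 r] True \<open>c0 \<noteq> 0\<close> by simp
  next
    case False
    obtain r where r: "v c0 = ereal r"
      using finiteE[OF \<open>c0 \<noteq> 0\<close>] by blast
    then have "v (inverse c0) = ereal (- r)" "- r > 0"
      using False \<open>v c0 \<noteq> 0\<close> inverse[OF \<open>c0 \<noteq> 0\<close>] by (auto simp: zero_ereal_def)
    then show ?thesis
      using that[of "inverse c0" "- r"] \<open>c0 \<noteq> 0\<close> by auto
  qed
  obtain n :: nat where n: "n > 0" "r / real n < b - a"
  proof -
    obtain n :: nat where "real n > r / (b - a)"
      using reals_Archimedean2 by blast
    moreover from this have "real n > 0"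
      using c(3) assms by (smt (verit) divide_pos_pos)
    moreover from calculation have "r < real n * (b - a)"
      using assms by (simp add: pos_divide_less_eq)
    ultimately show ?thesis
      using that[of n] by (simp add: pos_divide_less_eq mult.commute)
  qed
  obtain s where s: "s ^ n = c"
    using nth_root_exists[OF n(1)] by blast
  have "s \<noteq> 0"
    using s c(1) n(1) by auto
  then obtain q where q: "v s = ereal q"
    using finiteE by blast
  have qn: "q = r / real n"
    using power[of s n] n(1) unfolding s c(2) q by (simp add: eq_divide_eq mult.commute)
  define m where "m = \<lceil>a / q\<rceil>"
  have q0: "0 < q" "q < b - a"
    using n c(3) qn by auto
  have m: "a \<le> of_int m * q" "of_int m * q \<le> b"
  proof -
    have "a / q \<le> of_int m" "of_int m < a / q + 1"
      unfolding m_def by linarith+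
    then show "a \<le> of_int m * q"
      using q0(1) by (simp add: pos_divide_le_eq)
    have "of_int m * q < (a / q + 1) * q"
      using \<open>of_int m < a / q + 1\<close> q0 by (intro mult_strict_right_mono) auto
    also have "\<dots> = a + q"
      using q0(1) by (simp add: distrib_right)
    finally show "of_int m * q \<le> b"
      using q0(2) by simp
  qed
  show ?thesis
  proof (cases "m \<ge> 0")
    case True
    then have "v (s ^ nat m) = ereal (of_int m * q)"
      by (simp add: power q)
    then show ?thesis
      using that[of "s ^ nat m"] m \<open>s \<noteq> 0\<close> by auto
  next
    case False
    then have "v (inverse (s ^ nat (- m))) = ereal (of_int m * q)"
      using \<open>s \<noteq> 0\<close> by (subst inverse) (simp_all add: power q)
    then show ?thesis
      using that[of "inverse (s ^ nat (- m))"] m \<open>s \<noteq> 0\<close> by auto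
  qed
qed

end

section \<open>Finite ring extensions\<close>

definition is_subring :: "'a::comm_ring_1 set \<Rightarrow> bool" where
  "is_subring B \<longleftrightarrow> 1 \<in> B \<and> (\<forall>x\<in>B. - x \<in> B) \<and> (\<forall>x\<in>B. \<forall>y\<in>B. x + y \<in> B \<and> x * y \<in> B)"

definition is_ideal :: "'a::comm_ring_1 set \<Rightarrow> bool" where
  "is_ideal I \<longleftrightarrow> 0 \<in> I \<and> (\<forall>x\<in>I. \<forall>y\<in>I. x + y \<in> I) \<and> (\<forall>x\<in>I. \<forall>r. r * x \<in> I)"

lemma is_subring_D:
  assumes "is_subring B"
  shows "1 \<in> B" "0 \<in> B" "x \<in> B \<Longrightarrow> - x \<in> B" "x \<in> B \<Longrightarrow> y \<in> B \<Longrightarrow> x + y \<in> B"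
    "x \<in> B \<Longrightarrow> y \<in> B \<Longrightarrow> x * y \<in> B" "x \<in> B \<Longrightarrow> y \<in> B \<Longrightarrow> x - y \<in> B"
proof -
  show 1: "1 \<in> B" "x \<in> B \<Longrightarrow> - x \<in> B" "x \<in> B \<Longrightarrow> y \<in> B \<Longrightarrow> x + y \<in> B"
      "x \<in> B \<Longrightarrow> y \<in> B \<Longrightarrow> x * y \<in> B" for x y
    using assms by (auto simp: is_subring_def)
  show "0 \<in> B"
    using 1(3)[OF 1(1) 1(2)[OF 1(1)]] by simp
  show "x \<in> B \<Longrightarrow> y \<in> B \<Longrightarrow> x - y \<in> B"
    using 1(3)[OF _ 1(2), of x y] by simp
qed

lemma is_subring_sum: "is_subring B \<Longrightarrow> (\<And>i. i \<in> A \<Longrightarrow> f i \<in> B) \<Longrightarrow> sum f A \<in> B"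
  by (induction A rule: infinite_finite_induct) (auto intro: is_subring_D)

lemma is_subring_prod: "is_subring B \<Longrightarrow> (\<And>i. i \<in> A \<Longrightarrow> f i \<in> B) \<Longrightarrow> prod f A \<in> B"
  by (induction A rule: infinite_finite_induct) (auto intro: is_subring_D)

lemma is_subring_power: "is_subring B \<Longrightarrow> x \<in> B \<Longrightarrow> x ^ n \<in> B"
  by (induction n) (auto intro: is_subring_D)

lemma is_ideal_D:
  assumes "is_ideal I"
  shows "0 \<in> I" "x \<in> I \<Longrightarrow> y \<in> I \<Longrightarrow> x + y \<in> I" "x \<in> I \<Longrightarrow> r * x \<in> I"
    "x \<in> I \<Longrightarrow> x * r \<in> I" "x \<in> I \<Longrightarrow> - x \<in> I" "x \<in> I \<Longrightarrow> y \<in> I \<Longrightarrow> x - y \<in> I"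
proof -
  show 1: "0 \<in> I" "x \<in> I \<Longrightarrow> y \<in> I \<Longrightarrow> x + y \<in> I" "x \<in> I \<Longrightarrow> r * x \<in> I" for x y r
    using assms by (auto simp: is_ideal_def)
  show "x \<in> I \<Longrightarrow> x * r \<in> I"
    using 1(3)[of x r] by (simp add: mult.commute)
  show 2: "x \<in> I \<Longrightarrow> - x \<in> I" for x
    using 1(3)[of x "-1"] by simp
  show "x \<in> I \<Longrightarrow> y \<in> I \<Longrightarrow> x - y \<in> I"
    using 1(2)[OF _ 2, of x y] by simp
qed

lemma is_ideal_sum: "is_ideal B \<Longrightarrow> (\<And>i. i \<in> A \<Longrightarrow> f i \<in> B) \<Longrightarrow> sum f A \<in> B"
  by (induction A rule: infinite_finite_induct) (auto intro: is_ideal_D)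

inductive_set ring_gen :: "'a::comm_ring_1 set \<Rightarrow> 'a set" for A where
  base: "x \<in> A \<Longrightarrow> x \<in> ring_gen A"
| one: "1 \<in> ring_gen A"
| minus: "x \<in> ring_gen A \<Longrightarrow> - x \<in> ring_gen A"
| add: "x \<in> ring_gen A \<Longrightarrow> y \<in> ring_gen A \<Longrightarrow> x + y \<in> ring_gen A"
| mult: "x \<in> ring_gen A \<Longrightarrow> y \<in> ring_gen A \<Longrightarrow> x * y \<in> ring_gen A"

lemma is_subring_ring_gen: "is_subring (ring_gen A)"
  by (auto simp: is_subring_def intro: ring_gen.intros)

lemma ring_gen_least:
  assumes "is_subring B" "A \<subseteq> B" shows "ring_gen A \<subseteq> B"
proof
  fix x assume "x \<in> ring_gen A"
  then show "x \<in> B"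
    by induction (use assms in \<open>auto intro: is_subring_D\<close>)
qed

text \<open>The coefficients come from an arbitrary set \<open>B\<close>, because subrings, ideals
  and spans of powers all occur in this place.\<close>

inductive_set lin_span :: "'a::comm_ring_1 set \<Rightarrow> 'a set \<Rightarrow> 'a set" for B S where
  zero: "0 \<in> lin_span B S"
| step: "b \<in> B \<Longrightarrow> s \<in> S \<Longrightarrow> x \<in> lin_span B S \<Longrightarrow> b * s + x \<in> lin_span B S"

lemma lin_span_single: "b \<in> B \<Longrightarrow> s \<in> S \<Longrightarrow> b * s \<in> lin_span B S"
  using lin_span.step[OF _ _ lin_span.zero, of b B s S] by simp

lemma lin_span_add: "x \<in> lin_span B S \<Longrightarrow> y \<in> lin_span B S \<Longrightarrow> x + y \<in> lin_span B S"
  by (induction rule: lin_span.induct) (auto simp: add.assoc intro: lin_span.intros)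

lemma lin_span_sum: "(\<And>i. i \<in> A \<Longrightarrow> f i \<in> lin_span B S) \<Longrightarrow> sum f A \<in> lin_span B S"
  by (induction A rule: infinite_finite_induct) (auto intro: lin_span_add lin_span.zero)

lemma lin_span_mult:
  assumes "x \<in> lin_span B S" "y \<in> lin_span B' S'"
    and "\<And>b b' s s'. b \<in> B \<Longrightarrow> b' \<in> B' \<Longrightarrow> s \<in> S \<Longrightarrow> s' \<in> S' \<Longrightarrow> (b * b') * (s * s') \<in> lin_span C T"
  shows "x * y \<in> lin_span C T"
  using assms(1)
proof induction
  case (step b s x)
  have "b * s * y \<in> lin_span C T"
    using assms(2)
  proof induction
    case (step b' s' y)
    have "b * s * (b' * s' + y) = (b * b') * (s * s') + b * s * y"
      by (simp add: algebra_simps)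
    then show ?case
      using assms(3) step \<open>b \<in> B\<close> \<open>s \<in> S\<close> by (auto intro: lin_span_add)
  qed (auto intro: lin_span.zero)
  then show ?case
    using step by (auto simp: distrib_right intro: lin_span_add)
qed (auto intro: lin_span.zero)

lemma lin_span_scale:
  assumes "x \<in> lin_span B S" "\<And>b. b \<in> B \<Longrightarrow> c * b \<in> B'"
  shows "c * x \<in> lin_span B' S"
  using assms(1)
proof induction
  case (step b s x)
  have "c * (b * s + x) = (c * b) * s + c * x"
    by (simp add: algebra_simps)
  then show ?case
    using assms(2) step by (auto intro: lin_span.step)
qed (auto intro: lin_span.zero)

lemma lin_span_mono: "B \<subseteq> B' \<Longrightarrow> S \<subseteq> S' \<Longrightarrow> x \<in> lin_span B S \<Longrightarrow> x \<in> lin_span B' S'"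
  by (erule lin_span.induct) (auto intro: lin_span.intros)

lemma lin_span_coeffs:
  assumes "x \<in> lin_span B S" "finite S" "0 \<in> B" "\<And>b c. b \<in> B \<Longrightarrow> c \<in> B \<Longrightarrow> b + c \<in> B"
  obtains b where "\<And>s. b s \<in> B" "x = (\<Sum>s\<in>S. b s * s)"
proof -
  from assms(1) have "\<exists>b. (\<forall>s. b s \<in> B) \<and> x = (\<Sum>s\<in>S. b s * s)"
  proof induction
    case zero
    then show ?case using assms(3) by (intro exI[of _ "\<lambda>_. 0"]) auto
  next
    case (step c t x)
    then obtain b where b: "\<And>s. b s \<in> B" "x = (\<Sum>s\<in>S. b s * s)"
      by blast
    have "c * t + x = (\<Sum>s\<in>S. (if s = t then c * s else 0) + b s * s)"
      using step(2) assms(2) by (simp add: sum.distrib b(2))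
    also have "\<dots> = (\<Sum>s\<in>S. (if s = t then c + b s else b s) * s)"
      by (intro sum.cong) (auto simp: algebra_simps)
    finally show ?case
      using b(1) step(1) assms(4) by (intro exI[of _ "\<lambda>s. if s = t then c + b s else b s"]) auto
  qed
  then show ?thesis using that by blast
qed

text \<open>Coefficients are indexed by exponents and not by elements, since different powers of
  \<open>f\<close> may coincide.\<close>

lemma lin_span_powers_coeffs:
  assumes "x \<in> lin_span B {f ^ j |j. j < n}" "0 \<in> B" "\<And>b c. b \<in> B \<Longrightarrow> c \<in> B \<Longrightarrow> b + c \<in> B"
  obtains b where "\<And>j. b j \<in> B" "x = (\<Sum>j<n. b j * f ^ j)"
proof -
  from assms(1) have "\<exists>b. (\<forall>s. b s \<in> B) \<and> x = (\<Sum>j<n. b j * f ^ j)"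
  proof induction
    case zero
    then show ?case using assms(2) by (intro exI[of _ "\<lambda>_. 0"]) auto
  next
    case (step c t x)
    then obtain b i where b: "\<And>s. b s \<in> B" "x = (\<Sum>j<n. b j * f ^ j)" and i: "i < n" "t = f ^ i"
      by blast
    have "c * t + x = (\<Sum>j<n. (if j = i then c * f ^ j else 0) + b j * f ^ j)"
      using i by (simp add: sum.distrib b(2))
    also have "\<dots> = (\<Sum>j<n. (if j = i then c + b j else b j) * f ^ j)"
      by (intro sum.cong) (auto simp: algebra_simps)
    finally show ?case
      using b(1) step(1) assms(3) by (intro exI[of _ "\<lambda>s. if s = i then c + b s else b s"]) auto
  qed
  then show ?thesis using that by blast
qed

text \<open>
  Gaussian elimination without division: the pivots lie in \<open>U\<close>, the other entries in \<open>M\<close>.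
  The index \<open>d\<close> is a degree.
\<close>

lemma elimination:
  fixes U M :: "nat \<Rightarrow> 'a::comm_ring_1 set"
  assumes U1: "1 \<in> U 0" and UU: "\<And>x y d e. x \<in> U d \<Longrightarrow> y \<in> U e \<Longrightarrow> x * y \<in> U (d + e)"
    and UM: "\<And>x y d e. x \<in> U d \<Longrightarrow> y \<in> M e \<Longrightarrow> x * y \<in> M (d + e)"
    and MM: "\<And>x y d e. x \<in> M d \<Longrightarrow> y \<in> M e \<Longrightarrow> x * y \<in> M (d + e)"
    and diff: "\<And>x y d. x \<in> U d \<Longrightarrow> y \<in> M d \<Longrightarrow> x - y \<in> U d"
    and M0: "\<And>d. 0 \<in> M d" and Madd: "\<And>x y d. x \<in> M d \<Longrightarrow> y \<in> M d \<Longrightarrow> x + y \<in> M d"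
    and "finite S" "\<And>s. s \<in> S \<Longrightarrow> \<exists>u\<in>U d. u * s \<in> lin_span (M d) S"
  shows "\<exists>e. \<exists>u\<in>U e. \<forall>s\<in>S. u * s = 0"
  using assms(8,9)
proof (induction S arbitrary: d)
  case empty
  then show ?case using U1 by blast
next
  case (insert e S)
  have fin: "finite (insert e S)" using insert by auto
  obtain u where u: "u \<in> U d" "u * e \<in> lin_span (M d) (insert e S)"
    using insert.prems by blast
  obtain m where m: "\<And>s. m s \<in> M d" "u * e = (\<Sum>s\<in>insert e S. m s * s)"
    using lin_span_coeffs[OF u(2) fin M0 Madd] by blast
  \<comment> \<open>The relation for \<open>e\<close> is solved for \<open>e\<close>: moving its own
    coefficient to the left gives the pivot \<open>p\<close>.\<close>
  define p where "p = u - m e"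
  have p: "p \<in> U d" "p * e = (\<Sum>s\<in>S. m s * s)"
    using u(1) m diff insert.hyps by (auto simp: p_def algebra_simps)
  have "\<exists>u\<in>U (d + d). u * s \<in> lin_span (M (d + d)) S" if s: "s \<in> S" for s
  proof -
    obtain u' where u': "u' \<in> U d" "u' * s \<in> lin_span (M d) (insert e S)"
      using insert.prems s by blast
    obtain m' where m': "\<And>s. m' s \<in> M d" "u' * s = (\<Sum>s\<in>insert e S. m' s * s)"
      using lin_span_coeffs[OF u'(2) fin M0 Madd] by blast
    \<comment> \<open>Multiplying the relation for \<open>s\<close> by \<open>p\<close> lets the
      occurrence of \<open>e\<close> be replaced by elements of the smaller \<open>S\<close>, at the
      price of doubling the degree.\<close>
    have "p * u' * s = p * (m' e * e + (\<Sum>s\<in>S. m' s * s))"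
      using insert.hyps by (simp add: mult.assoc m'(2))
    also have "\<dots> = m' e * (p * e) + p * (\<Sum>s\<in>S. m' s * s)"
      by (simp add: algebra_simps)
    also have "\<dots> = (\<Sum>s\<in>S. (m' e * m s) * s) + (\<Sum>s\<in>S. (p * m' s) * s)"
      by (simp add: p(2) sum_distrib_left mult.assoc)
    also have "\<dots> \<in> lin_span (M (d + d)) S"
      using m(1) m'(1) MM UM p(1) by (intro lin_span_add lin_span_sum lin_span_single) auto
    finally show ?thesis
      using UU[OF p(1) u'(1)] by blast
  qed
  then obtain k w where w: "w \<in> U k" "\<forall>s\<in>S. w * s = 0"
    using insert.IH by blast
  \<comment> \<open>A multiplier that kills \<open>S\<close> also kills \<open>p * e\<close>, which
    is a combination of \<open>S\<close>.\<close>
  have "w * p * e = w * (\<Sum>s\<in>S. m s * s)"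
    by (simp add: mult.assoc p(2))
  also have "\<dots> = (\<Sum>s\<in>S. m s * (w * s))"
    by (simp add: sum_distrib_left mult.left_commute)
  finally have "w * p * e = (\<Sum>s\<in>S. m s * (w * s))" .
  then have "w * p * e = 0" using w(2) by simp
  moreover have "w * p * s = 0" if "s \<in> S" for s
    using w(2) that by (metis mult.assoc mult.commute mult_zero_right)
  ultimately show ?case
    using UU[OF w(1) p(1)] by blast
qed

section \<open>Integral elements, finite extensions and extended ideals\<close>

definition integral_over :: "'a::comm_ring_1 set \<Rightarrow> 'a \<Rightarrow> bool" where
  "integral_over B f \<longleftrightarrow> (\<exists>n. f ^ n \<in> lin_span B {f ^ j |j. j < n})"

text \<open>The upper ring is always the whole type, in the application K[X]; only the lower ring
  varies.\<close>

definition finite_over :: "'a::comm_ring_1 set \<Rightarrow> bool" where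
  "finite_over B \<longleftrightarrow> (\<exists>S. finite S \<and> lin_span B S = UNIV)"

lemma integral_over_mono: "B \<subseteq> C \<Longrightarrow> integral_over B f \<Longrightarrow> integral_over C f"
  using lin_span_mono[of B C] unfolding integral_over_def by blast

lemma integral_overI:
  assumes "f ^ n = (\<Sum>j<n. b j * f ^ j)" "\<And>j. j < n \<Longrightarrow> b j \<in> B"
  shows "integral_over B f"
  unfolding integral_over_def
  by (rule exI[of _ n], subst assms(1)) (use assms(2) in \<open>auto intro!: lin_span_sum lin_span_single\<close>)

lemma integral_overE:
  assumes "integral_over B f" "is_subring B"
  obtains n b where "f ^ n = (\<Sum>j<n. b j * f ^ j)" "\<And>j. b j \<in> B"
proof -
  obtain n where "f ^ n \<in> lin_span B {f ^ j |j. j < n}"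
    using assms(1) unfolding integral_over_def by blast
  then obtain b where "\<And>j. b j \<in> B" "f ^ n = (\<Sum>j<n. b j * f ^ j)"
    by (rule lin_span_powers_coeffs) (use is_subring_D[OF assms(2)] in auto)
  then show ?thesis
    using that by blast
qed

text \<open>The determinant trick without determinants: the pivots are monic polynomials of degree
  \<open>d\<close> in \<open>f\<close>, the other entries have degree below \<open>d\<close>.
  \<open>elimination\<close> yields a monic polynomial in \<open>f\<close> that kills all module
  generators, hence kills 1; this is the integral equation.\<close>

lemma finite_over_integral:
  assumes B: "is_subring B" "finite_over B"
  shows "integral_over B f"
proof -
  obtain S where S: "finite S" "lin_span B S = UNIV"
    using B(2) by (auto simp: finite_over_def)
  define M where "M d = lin_span B {f ^ j |j. j < d}" for d
  have MM: "x * y \<in> M (d + e)" if "x \<in> M d" "y \<in> M e" for x y d e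
    using that unfolding M_def
    by (rule lin_span_mult)
      (use B in \<open>auto simp: power_add[symmetric] intro!: lin_span_single is_subring_D\<close>)
  have PM: "f ^ d * y \<in> M (d + e)" if "y \<in> M e" for y d e
  proof -
    have "(1 * f ^ d) * y \<in> M (d + e)"
      unfolding M_def
      by (rule lin_span_mult[OF lin_span_single[of 1 B "f ^ d" "{f ^ d}"] that[unfolded M_def]])
        (use B in \<open>auto simp: power_add[symmetric] intro!: lin_span_single is_subring_D\<close>)
    then show ?thesis by simp
  qed
  have neg: "- x \<in> M d" if "x \<in> M d" for x d
    using lin_span_scale[of x B "{f ^ j |j. j < d}" "-1" B] that is_subring_D(3)[OF B(1)] unfolding M_def by simp
  define U where "U d = {u. u - f ^ d \<in> M d}" for d
  have add: "x + y \<in> M d" if "x \<in> M d" "y \<in> M d" for x y d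
    using that unfolding M_def by (rule lin_span_add)
  have "\<exists>e. \<exists>u\<in>U e. \<forall>s\<in>S. u * s = 0"
  proof (rule elimination[where U = U and M = M and d = 1])
    show "1 \<in> U 0" by (auto simp: U_def M_def intro: lin_span.zero)
    show "x * y \<in> U (d + e)" if "x \<in> U d" "y \<in> U e" for x y d e
    proof -
      have "x * y - f ^ (d + e) = (x - f ^ d) * (y - f ^ e) + f ^ d * (y - f ^ e) + f ^ e * (x - f ^ d)"
        by (simp add: algebra_simps power_add)
      also have "\<dots> \<in> M (d + e)"
        using that PM[of "x - f ^ d" d e] PM[of "y - f ^ e" e d] MM
        by (intro add) (auto simp: U_def ac_simps)
      finally show ?thesis by (simp add: U_def)
    qed
    show "x * y \<in> M (d + e)" if "x \<in> U d" "y \<in> M e" for x y d e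
    proof -
      have "x * y = (x - f ^ d) * y + f ^ d * y" by (simp add: algebra_simps)
      also have "\<dots> \<in> M (d + e)"
        using that PM MM by (intro add) (auto simp: U_def)
      finally show ?thesis .
    qed
    show "x - y \<in> U d" if "x \<in> U d" "y \<in> M d" for x y d
    proof -
      have "x - y - f ^ d = (x - f ^ d) + (- y)" by simp
      also have "\<dots> \<in> M d" using that neg by (intro add) (auto simp: U_def)
      finally show ?thesis by (simp add: U_def)
    qed
    \<comment> \<open>The first pivot is \<open>f\<close> itself; the entries lie in
      \<open>B\<close>, that is, they have degree 0 in \<open>f\<close>.\<close>
    show "\<exists>u\<in>U 1. u * s \<in> lin_span (M 1) S" if "s \<in> S" for s
    proof (intro bexI[of _ f])
      have "b \<in> M 1" if "b \<in> B" for b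
        using lin_span_single[of b B "f ^ 0" "{f ^ j |j. j < 1}"] that unfolding M_def by auto
      then show "f * s \<in> lin_span (M 1) S"
        using S(2) lin_span_mono[of B "M 1" S S "f * s"] by auto
      show "f \<in> U 1"
        by (auto simp: U_def M_def intro: lin_span.zero)
    qed
  qed (use MM add S in \<open>auto simp: M_def intro: lin_span.zero\<close>)
  then obtain e u where u: "u \<in> U e" "\<forall>s\<in>S. u * s = 0"
    by blast
  have "u * x = 0" if "x \<in> lin_span B S" for x
    using that by induction (use u(2) in \<open>auto simp: algebra_simps\<close>)
  then have "u * 1 = 0" using S(2) by blast
  then have "- (- (f ^ e)) \<in> M e"
    using u(1) neg by (auto simp: U_def simp del: minus_minus)
  then show ?thesis
    unfolding integral_over_def M_def by auto
qed

lemma span_of_ideal: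
  assumes "lin_span B S = UNIV" "\<And>m b. m \<in> M \<Longrightarrow> b \<in> B \<Longrightarrow> b * m \<in> M"
  shows "is_ideal (lin_span M S)" "M \<subseteq> lin_span M S"
proof -
  have *: "m * x \<in> lin_span M S" if "m \<in> M" for m x
    using lin_span_scale[of x B S m M] assms that by (auto simp: mult.commute)
  show "is_ideal (lin_span M S)"
    unfolding is_ideal_def
  proof (intro conjI ballI allI)
    fix x r assume "x \<in> lin_span M S"
    then show "r * x \<in> lin_span M S"
    proof induction
      case (step b s x)
      then show ?case using *[of b "s * r"] by (auto simp: algebra_simps intro: lin_span_add)
    qed (auto intro: lin_span.zero)
  qed (auto intro: lin_span.zero lin_span_add)
  show "M \<subseteq> lin_span M S"
    using *[of _ 1] by auto
qed

text \<open>Nakayama's argument: if 1 lay in the extended ideal, every generator would be an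
  \<open>M\<close>-combination of generators, and \<open>elimination\<close> with pivots in 1 +
  \<open>M\<close> would give such a pivot that kills the whole ring. It would be 0, so 1 would be
  in \<open>M\<close>. This is what later lifts points along finite extensions.\<close>

lemma extended_ideal_proper:
  assumes B: "is_subring B" "finite S" "lin_span B S = UNIV"
    and M: "0 \<in> M" "\<And>x y. x \<in> M \<Longrightarrow> y \<in> M \<Longrightarrow> x + y \<in> M"
      "\<And>m b. m \<in> M \<Longrightarrow> b \<in> B \<Longrightarrow> b * m \<in> M" "M \<subseteq> B" "1 \<notin> M"
  shows "1 \<notin> lin_span M S"
proof
  assume 1: "1 \<in> lin_span M S"
  have neg: "- m \<in> M" if "m \<in> M" for m
    using M(3)[OF that, of "-1"] is_subring_D(3)[OF B(1) is_subring_D(1)[OF B(1)]] by simp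
  have MM: "x * y \<in> M" if "x \<in> M" "y \<in> M" for x y
    using M(3)[OF that(2), of x] that M(4) by auto
  have "\<exists>e::nat. \<exists>u\<in>{u. 1 - u \<in> M}. \<forall>s\<in>S. u * s = 0"
  proof (rule elimination[where U = "\<lambda>_. {u. 1 - u \<in> M}" and M = "\<lambda>_. M" and d = 0])
    show "x * y \<in> {u. 1 - u \<in> M}" if "x \<in> {u. 1 - u \<in> M}" "y \<in> {u. 1 - u \<in> M}" for x y
    proof -
      have "1 - x * y = (1 - x) + (1 - y) + (- ((1 - x) * (1 - y)))"
        by (simp add: algebra_simps)
      also have "\<dots> \<in> M" using that neg MM by (intro M(2)) auto
      finally show ?thesis by simp
    qed
    show "x * y \<in> M" if "x \<in> {u. 1 - u \<in> M}" "y \<in> M" for x y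
    proof -
      have "x * y = y + (- ((1 - x) * y))" by (simp add: algebra_simps)
      also have "\<dots> \<in> M" using that neg MM by (intro M(2)) auto
      finally show ?thesis .
    qed
    show "x - y \<in> {u. 1 - u \<in> M}" if "x \<in> {u. 1 - u \<in> M}" "y \<in> M" for x y
      using M(2)[of "1 - x" y] that by (auto simp: algebra_simps)
    show "\<exists>u\<in>{u. 1 - u \<in> M}. u * s \<in> lin_span M S" if "s \<in> S" for s
      using is_ideal_D(3)[OF span_of_ideal(1)[OF B(3) M(3)] 1, of s] M(1)
      by (intro bexI[of _ 1]) auto
  qed (use M MM B(2) in auto)
  then obtain u where u: "1 - u \<in> M" "\<forall>s\<in>S. u * s = 0" by blast
  have "u * x = 0" if "x \<in> lin_span B S" for x
    using that by induction (use u(2) in \<open>auto simp: algebra_simps\<close>)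
  then have "u * 1 = 0" using B(3) by blast
  then show False using u(1) M(5) by simp
qed

lemma is_subring_adjoin:
  assumes "is_subring B"
  shows "is_subring (lin_span B (range (\<lambda>j. f ^ j)))" "B \<subseteq> lin_span B (range (\<lambda>j. f ^ j))"
    "f \<in> lin_span B (range (\<lambda>j. f ^ j))"
proof -
  let ?C = "lin_span B (range (\<lambda>j. f ^ j))"
  show B: "B \<subseteq> ?C"
    using lin_span_single[of _ B "f ^ 0" "range (\<lambda>j. f ^ j)", OF _ rangeI] by auto
  show "f \<in> ?C"
    using lin_span_single[of 1 B "f ^ 1" "range (\<lambda>j. f ^ j)", OF _ rangeI] is_subring_D(1)[OF assms] by auto
  show "is_subring ?C"
    unfolding is_subring_def
  proof (intro conjI ballI)
    fix x y assume x: "x \<in> ?C"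
    show "- x \<in> ?C"
      using lin_span_scale[OF x, of "-1" B] is_subring_D(3)[OF assms] by simp
    assume y: "y \<in> ?C"
    show "x + y \<in> ?C" using x y by (rule lin_span_add)
    show "x * y \<in> ?C"
      by (rule lin_span_mult[OF x y])
        (use is_subring_D(5)[OF assms] in \<open>auto simp: power_add[symmetric] intro!: lin_span_single\<close>)
  qed (use B is_subring_D(1)[OF assms] in auto)
qed

text \<open>The powers of \<open>f\<close> below the degree of its integral equation span B[f] over
  \<open>B\<close>; their products with module generators over B[f] span the whole ring over
  \<open>B\<close>.\<close>

lemma finite_over_adjoin:
  assumes B: "is_subring B" "integral_over B f" and fin: "finite_over (lin_span B (range (\<lambda>j. f ^ j)))"
  shows "finite_over B"
proof -
  obtain n where n: "f ^ n \<in> lin_span B {f ^ j |j. j < n}"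
    using B(2) by (auto simp: integral_over_def)
  let ?F = "{f ^ j |j. j < n}"
  have pow: "f ^ j \<in> lin_span B ?F" for j
  proof (induction j)
    case 0
    show ?case
    proof (cases "n = 0")
      case True
      then show ?thesis using n by simp
    next
      case False
      then show ?thesis
        using lin_span_single[of 1 B "f ^ 0" ?F] is_subring_D(1)[OF B(1)] by force
    qed
  next
    case (Suc j)
    have "(1 * f) * f ^ j \<in> lin_span B ?F"
    proof (rule lin_span_mult[OF lin_span_single[of 1 B f "{f}"] Suc])
      fix b b' s s' assume *: "b \<in> B" "b' \<in> B" "s \<in> {f}" "s' \<in> ?F"
      then obtain i where i: "i < n" "s * s' = f ^ Suc i" by auto
      show "b * b' * (s * s') \<in> lin_span B ?F"
      proof (cases "Suc i = n")
        case True
        then show ?thesis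
          using i lin_span_scale[OF n, of "b * b'" B] * B(1) by (auto intro: is_subring_D)
      next
        case False
        then have "s * s' \<in> ?F"
          using i by (auto intro!: exI[of _ "Suc i"])
        then show ?thesis using * B(1) by (auto intro!: lin_span_single is_subring_D)
      qed
    qed (use is_subring_D(1)[OF B(1)] in auto)
    then show ?case by simp
  qed
  let ?C = "lin_span B (range (\<lambda>j. f ^ j))"
  have C: "x \<in> lin_span B ?F" if "x \<in> ?C" for x
    using that
  proof induction
    case (step b s x)
    then obtain j where j: "s = f ^ j" by auto
    have "b * f ^ j \<in> lin_span B ?F"
      using lin_span_scale[OF pow] is_subring_D(5)[OF B(1) step(1)] by blast
    then show ?case
      using step j by (auto intro: lin_span_add)
  qed (auto intro: lin_span.zero)
  obtain S where S: "finite S" "lin_span ?C S = UNIV"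
    using fin by (auto simp: finite_over_def)
  let ?T = "(\<lambda>(a, s). a * s) ` (?F \<times> S)"
  have "finite ?F" by simp
  then have "finite ?T" using S(1) by blast
  moreover have "x \<in> lin_span B ?T" if "x \<in> lin_span ?C S" for x
    using that
  proof induction
    case (step c s x)
    have "c * (1 * s) \<in> lin_span B ?T"
    proof (rule lin_span_mult[OF C[OF step(1)] lin_span_single[of 1 B s "{s}"]])
      fix b b' t s' assume *: "b \<in> B" "b' \<in> B" "t \<in> ?F" "s' \<in> {s}"
      then have "t * s' \<in> ?T"
        using step(2) by (intro image_eqI[of _ _ "(t, s)"]) auto
      then show "b * b' * (t * s') \<in> lin_span B ?T"
        using * is_subring_D(5)[OF B(1)] by (intro lin_span_single) auto
    qed (use is_subring_D(1)[OF B(1)] in auto)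
    then show ?case
      using step by (auto intro: lin_span_add)
  qed (auto intro: lin_span.zero)
  ultimately show ?thesis
    using S(2) unfolding finite_over_def by blast
qed

text \<open>The last hypothesis expresses that \<open>B\<close> and \<open>F\<close> generate the
  ring; it passes to the larger base when one element of \<open>F\<close> is adjoined.\<close>

lemma finite_over_of_generators:
  assumes "finite F" "is_subring B" "\<And>f. f \<in> F \<Longrightarrow> integral_over B f"
    and "\<And>C. is_subring C \<Longrightarrow> B \<subseteq> C \<Longrightarrow> F \<subseteq> C \<Longrightarrow> C = UNIV"
  shows "finite_over B"
  using assms
proof (induction F arbitrary: B)
  case empty
  then have "B = UNIV" by blast
  then have "lin_span B {1} = UNIV"
    using lin_span_single[of _ B 1 "{1}"] by auto
  then show ?case unfolding finite_over_def by blast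
next
  case (insert f F)
  let ?C = "lin_span B (range (\<lambda>j. f ^ j))"
  note C = is_subring_adjoin[OF insert.prems(1), of f]
  have "finite_over ?C"
  proof (rule insert.IH)
    show "integral_over ?C g" if "g \<in> F" for g
      using insert.prems(2) that C(2) by (auto intro: integral_over_mono)
    show "D = UNIV" if "is_subring D" "?C \<subseteq> D" "F \<subseteq> D" for D
      using insert.prems(3)[of D] that C by auto
  qed (rule C)
  then show ?case
    using finite_over_adjoin insert.prems by blast
qed

section \<open>Polynomials\<close>

definition is_hom :: "('a::comm_ring_1 \<Rightarrow> 'b::comm_ring_1) \<Rightarrow> bool" where
  "is_hom \<phi> \<longleftrightarrow> \<phi> 1 = 1 \<and> (\<forall>a b. \<phi> (a + b) = \<phi> a + \<phi> b \<and> \<phi> (a * b) = \<phi> a * \<phi> b)"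

lemma is_hom_D:
  assumes "is_hom \<phi>"
  shows "\<phi> 1 = 1" "\<phi> (a + b) = \<phi> a + \<phi> b" "\<phi> (a * b) = \<phi> a * \<phi> b" "\<phi> 0 = 0" "\<phi> (- a) = - \<phi> a"
    "\<phi> (a - b) = \<phi> a - \<phi> b"
proof -
  show 1: "\<phi> 1 = 1" "\<phi> (a + b) = \<phi> a + \<phi> b" "\<phi> (a * b) = \<phi> a * \<phi> b" for a b
    using assms by (auto simp: is_hom_def)
  show 0: "\<phi> 0 = 0"
    using 1(2)[of 0 0] by simp
  show 2: "\<phi> (- a) = - \<phi> a" for a
    using 1(2)[of a "- a"] 0 by (simp add: add_eq_0_iff)
  show "\<phi> (a - b) = \<phi> a - \<phi> b"
    using 1(2)[of a "- b"] 2 by simp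
qed

lemma is_hom_sum: "is_hom \<phi> \<Longrightarrow> \<phi> (sum f A) = (\<Sum>i\<in>A. \<phi> (f i))"
  by (induction A rule: infinite_finite_induct) (auto simp: is_hom_D)

lemma is_hom_prod: "is_hom \<phi> \<Longrightarrow> \<phi> (prod f A) = (\<Prod>i\<in>A. \<phi> (f i))"
  by (induction A rule: infinite_finite_induct) (auto simp: is_hom_D)

lemma is_hom_power: "is_hom \<phi> \<Longrightarrow> \<phi> (x ^ n) = \<phi> x ^ n"
  by (induction n) (auto simp: is_hom_D)

lemma is_hom_id: "is_hom (\<lambda>x. x)"
  by (simp add: is_hom_def)

section \<open>Monomials and evaluation of polynomials\<close>

definition mon :: "('i \<Rightarrow> 'r::comm_ring_1) \<Rightarrow> ('i \<Rightarrow>\<^sub>0 nat) \<Rightarrow> 'r" where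
  "mon g \<alpha> = (\<Prod>i\<in>Poly_Mapping.keys \<alpha>. g i ^ Poly_Mapping.lookup \<alpha> i)"

lemma mon_superset:
  "finite A \<Longrightarrow> Poly_Mapping.keys \<alpha> \<subseteq> A \<Longrightarrow> mon g \<alpha> = (\<Prod>i\<in>A. g i ^ Poly_Mapping.lookup \<alpha> i)"
  unfolding mon_def by (rule prod.mono_neutral_left) (auto simp: in_keys_iff)

lemma mon_0 [simp]: "mon g 0 = 1"
  by (simp add: mon_def)

lemma mon_single [simp]: "mon g (Poly_Mapping.single i n) = g i ^ n"
  by (subst mon_superset[of "{i}"]) auto

lemma mon_add: "mon g (\<alpha> + \<beta>) = mon g \<alpha> * mon g \<beta>"
  by (subst (1 2 3) mon_superset[of "Poly_Mapping.keys \<alpha> \<union> Poly_Mapping.keys \<beta>"])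
    (use Poly_Mapping.keys_add[of \<alpha> \<beta>] in \<open>auto simp: lookup_add power_add prod.distrib\<close>)

lemma poly_mapping_sum_monomials:
  "(\<Sum>\<alpha>\<in>Poly_Mapping.keys p. Poly_Mapping.single \<alpha> (Poly_Mapping.lookup p \<alpha>)) = p"
proof (intro poly_mapping_eqI)
  fix \<beta>
  have "Poly_Mapping.lookup (\<Sum>\<alpha>\<in>Poly_Mapping.keys p. Poly_Mapping.single \<alpha> (Poly_Mapping.lookup p \<alpha>)) \<beta> =
      (\<Sum>\<alpha>\<in>Poly_Mapping.keys p. if \<alpha> = \<beta> then Poly_Mapping.lookup p \<alpha> else 0)"
    unfolding lookup_sum by (intro sum.cong) (auto simp: lookup_single when_def)
  then show "Poly_Mapping.lookup (\<Sum>\<alpha>\<in>Poly_Mapping.keys p. Poly_Mapping.single \<alpha> (Poly_Mapping.lookup p \<alpha>)) \<beta> =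
      Poly_Mapping.lookup p \<beta>"
    by (auto simp: in_keys_iff)
qed

lemma mpoly_induct [case_names zero add]:
  fixes p :: "('i, 'k::comm_ring_1) mpoly"
  assumes "P 0" "\<And>\<alpha> c p. P p \<Longrightarrow> P (Poly_Mapping.single \<alpha> c + p)"
  shows "P p"
proof -
  have "P (\<Sum>\<alpha>\<in>A. Poly_Mapping.single \<alpha> (Poly_Mapping.lookup p \<alpha>))" if "finite A" for A
    using that by induction (auto intro: assms)
  from this[of "Poly_Mapping.keys p"] show ?thesis
    by (simp add: poly_mapping_sum_monomials)
qed

text \<open>With the identity as coefficient map this is evaluation at a point, with
  \<open>Const\<close> it is substitution of polynomials for the variables.\<close>

definition peval :: "('k::comm_ring_1 \<Rightarrow> 'r::comm_ring_1) \<Rightarrow> ('i \<Rightarrow> 'r) \<Rightarrow> ('i, 'k) mpoly \<Rightarrow> 'r" where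
  "peval \<phi> g p = (\<Sum>\<alpha>\<in>Poly_Mapping.keys p. \<phi> (Poly_Mapping.lookup p \<alpha>) * mon g \<alpha>)"

lemma peval_superset:
  "\<phi> 0 = 0 \<Longrightarrow> finite A \<Longrightarrow> Poly_Mapping.keys p \<subseteq> A \<Longrightarrow>
    peval \<phi> g p = (\<Sum>\<alpha>\<in>A. \<phi> (Poly_Mapping.lookup p \<alpha>) * mon g \<alpha>)"
  unfolding peval_def by (rule sum.mono_neutral_left) (auto simp: in_keys_iff)

lemma peval_0 [simp]: "peval \<phi> g 0 = 0"
  by (simp add: peval_def)

lemma peval_single: "\<phi> 0 = 0 \<Longrightarrow> peval \<phi> g (Poly_Mapping.single \<alpha> c) = \<phi> c * mon g \<alpha>"
  by (subst peval_superset[of _ "{\<alpha>}"]) auto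

lemma peval_add:
  assumes "is_hom \<phi>"
  shows "peval \<phi> g (p + q) = peval \<phi> g p + peval \<phi> g q"
  by (subst (1 2 3) peval_superset[of \<phi> "Poly_Mapping.keys p \<union> Poly_Mapping.keys q"])
    (use Poly_Mapping.keys_add[of p q] is_hom_D[OF assms] in
      \<open>auto simp: lookup_add distrib_right sum.distrib\<close>)

lemma peval_mult:
  assumes "is_hom \<phi>"
  shows "peval \<phi> g (p * q) = peval \<phi> g p * peval \<phi> g q"
proof (induction p rule: mpoly_induct)
  case (add \<alpha> c p)
  have "peval \<phi> g (Poly_Mapping.single \<alpha> c * q) = peval \<phi> g (Poly_Mapping.single \<alpha> c) * peval \<phi> g q"
  proof (induction q rule: mpoly_induct)
    case (add \<beta> d q)
    then show ?case
      by (simp add: distrib_left peval_add[OF assms] mult_single peval_single is_hom_D[OF assms]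
          mon_add algebra_simps)
  qed simp
  then show ?case
    using add by (simp add: distrib_right peval_add[OF assms])
qed simp

lemma is_hom_peval:
  assumes "is_hom \<phi>" shows "is_hom (peval \<phi> g)"
  unfolding is_hom_def
  using peval_add[OF assms] peval_mult[OF assms] peval_single[of \<phi> g 0 1] is_hom_D[OF assms]
  by (auto simp: single_one)

lemma hom_mon: "is_hom \<psi> \<Longrightarrow> \<psi> (mon g \<alpha>) = mon (\<lambda>i. \<psi> (g i)) \<alpha>"
  by (simp add: mon_def is_hom_prod is_hom_power)

lemma hom_peval:
  "is_hom \<psi> \<Longrightarrow> \<psi> (peval \<phi> g p) = peval (\<lambda>c. \<psi> (\<phi> c)) (\<lambda>i. \<psi> (g i)) p"
  by (simp add: peval_def is_hom_sum is_hom_D hom_mon)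

lemma mon_cong: "(\<And>i. i \<in> Poly_Mapping.keys \<alpha> \<Longrightarrow> g i = h i) \<Longrightarrow> mon g \<alpha> = mon h \<alpha>"
  by (auto simp: mon_def intro!: prod.cong)

lemma peval_cong:
  "(\<And>\<alpha> i. \<alpha> \<in> Poly_Mapping.keys p \<Longrightarrow> i \<in> Poly_Mapping.keys \<alpha> \<Longrightarrow> g i = h i) \<Longrightarrow>
    peval \<phi> g p = peval \<phi> h p"
  by (auto simp: peval_def intro!: sum.cong arg_cong2[where f = "(*)"] mon_cong)

abbreviation Const :: "'k::comm_ring_1 \<Rightarrow> ('i, 'k) mpoly" where
  "Const c \<equiv> Poly_Mapping.single 0 c"

abbreviation Var :: "'i \<Rightarrow> ('i, 'k::comm_ring_1) mpoly" where
  "Var i \<equiv> Poly_Mapping.single (Poly_Mapping.single i (Suc 0)) 1"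

lemma is_hom_Const: "is_hom Const"
  by (auto simp: is_hom_def single_add mult_single single_one)

lemma mon_Var: "mon (Var :: 'i \<Rightarrow> ('i, 'k::comm_ring_1) mpoly) \<alpha> = Poly_Mapping.single \<alpha> 1"
proof -
  have pow: "(Var i :: ('i, 'k) mpoly) ^ n = Poly_Mapping.single (Poly_Mapping.single i n) 1" for i n
    by (induction n) (auto simp: mult_single single_add[symmetric] single_one)
  have "(\<Prod>i\<in>A. Poly_Mapping.single (Poly_Mapping.single i (Poly_Mapping.lookup \<alpha> i)) (1::'k)) =
      Poly_Mapping.single (\<Sum>i\<in>A. Poly_Mapping.single i (Poly_Mapping.lookup \<alpha> i)) 1" if "finite A" for A
    using that by induction (auto simp: mult_single single_one)
  from this[of "Poly_Mapping.keys \<alpha>"] show ?thesis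
    unfolding mon_def pow by (simp add: poly_mapping_sum_monomials)
qed

lemma peval_Var: "peval Const Var p = p"
  unfolding peval_def mon_Var by (simp add: mult_single poly_mapping_sum_monomials)

lemma poly_eval_altdef: "poly_eval f x = peval (\<lambda>c. c) (($) x) f"
  by (simp add: poly_eval_def peval_def monom_eval_def mon_def)

lemma is_hom_poly_eval: "is_hom (\<lambda>f. poly_eval f x)"
  unfolding poly_eval_altdef by (rule is_hom_peval[OF is_hom_id])

lemmas poly_eval_simps = is_hom_D[OF is_hom_poly_eval]

lemma poly_eval_Const [simp]: "poly_eval (Const c) x = c"
  by (simp add: poly_eval_altdef peval_single)

lemma poly_eval_Var [simp]: "poly_eval (Var i) x = x $ i"
  by (simp add: poly_eval_altdef peval_single)

subsection \<open>Homogeneous components\<close>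

lemma mdeg_superset:
  "finite A \<Longrightarrow> Poly_Mapping.keys \<alpha> \<subseteq> A \<Longrightarrow> mdeg \<alpha> = (\<Sum>i\<in>A. Poly_Mapping.lookup \<alpha> i)"
  unfolding mdeg_def by (rule sum.mono_neutral_left) (auto simp: in_keys_iff)

lemma mdeg_0 [simp]: "mdeg 0 = 0"
  by (simp add: mdeg_def)

lemma mdeg_add: "mdeg (\<alpha> + \<beta>) = mdeg \<alpha> + mdeg \<beta>"
  by (subst (1 2 3) mdeg_superset[of "Poly_Mapping.keys \<alpha> \<union> Poly_Mapping.keys \<beta>"])
    (use Poly_Mapping.keys_add[of \<alpha> \<beta>] in \<open>auto simp: lookup_add sum.distrib\<close>)

lemma mdeg_single [simp]: "mdeg (Poly_Mapping.single i n) = n"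
  by (subst mdeg_superset[of "{i}"]) auto

lemma lookup_hom_component:
  "Poly_Mapping.lookup (hom_component m f) \<alpha> = (if mdeg \<alpha> = m then Poly_Mapping.lookup f \<alpha> else 0)"
proof -
  have "Poly_Mapping.lookup (hom_component m f) \<alpha> =
      (\<Sum>\<beta>\<in>{\<beta> \<in> Poly_Mapping.keys f. mdeg \<beta> = m}. if \<beta> = \<alpha> then Poly_Mapping.lookup f \<beta> else 0)"
    unfolding hom_component_def lookup_sum
    by (intro sum.cong) (auto simp: lookup_single when_def)
  also have "\<dots> = (if mdeg \<alpha> = m then Poly_Mapping.lookup f \<alpha> else 0)"
    by (subst sum.delta) (auto simp: in_keys_iff)
  finally show ?thesis .
qed

lemma keys_hom_component:
  "Poly_Mapping.keys (hom_component m f) = {\<alpha> \<in> Poly_Mapping.keys f. mdeg \<alpha> = m}"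
  by (auto simp: in_keys_iff lookup_hom_component split: if_splits)

lemma homogeneous_hom_component [simp]: "homogeneous m (hom_component m f)"
  by (simp add: homogeneous_def keys_hom_component)

lemma hom_component_0 [simp]: "hom_component m 0 = 0"
  by (intro poly_mapping_eqI) (simp add: lookup_hom_component)

lemma hom_component_add: "hom_component m (f + g) = hom_component m f + hom_component m g"
  by (intro poly_mapping_eqI) (simp add: lookup_hom_component lookup_add)

lemma hom_component_diff:
  "hom_component m (f - g) = hom_component m f - hom_component m (g :: ('i, 'k::comm_ring_1) mpoly)"
  by (intro poly_mapping_eqI) (simp add: lookup_hom_component lookup_minus)

lemma hom_component_sum: "hom_component m (sum f A) = (\<Sum>i\<in>A. hom_component m (f i))"
  by (induction A rule: infinite_finite_induct) (auto simp: hom_component_add)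

lemma homogeneous_0 [simp]: "homogeneous m 0"
  by (simp add: homogeneous_def)

lemma hom_component_homogeneous:
  "homogeneous m f \<Longrightarrow> hom_component k f = (if k = m then f else 0)"
  by (intro poly_mapping_eqI)
    (auto simp: lookup_hom_component homogeneous_def in_keys_iff)

lemma homogeneous_iff: "homogeneous m f \<longleftrightarrow> hom_component m f = f"
  by (metis homogeneous_hom_component hom_component_homogeneous)

lemma homogeneous_single: "homogeneous (mdeg \<alpha>) (Poly_Mapping.single \<alpha> c)"
  by (auto simp: homogeneous_def)

lemma homogeneous_Const [simp]: "homogeneous 0 (Const c)"
  using homogeneous_single[of 0 c] by simp

lemma homogeneous_Var [simp]: "homogeneous (Suc 0) (Var i)"
  using homogeneous_single[of "Poly_Mapping.single i 1"] by simp

lemma homogeneous_add: "homogeneous m f \<Longrightarrow> homogeneous m g \<Longrightarrow> homogeneous m (f + (g :: ('i, 'k::comm_monoid_add) mpoly))"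
  by (simp add: homogeneous_iff hom_component_add)

lemma homogeneous_sum: "(\<And>i. i \<in> A \<Longrightarrow> homogeneous m (f i)) \<Longrightarrow> homogeneous m (sum f A :: ('i, 'k::comm_monoid_add) mpoly)"
  by (induction A rule: infinite_finite_induct) (auto intro: homogeneous_add)

lemma homogeneous_diff:
  "homogeneous m f \<Longrightarrow> homogeneous m (g :: ('i, 'k::comm_ring_1) mpoly) \<Longrightarrow> homogeneous m (f - g)"
  by (simp add: homogeneous_iff hom_component_diff)

lemma hom_component_single:
  "hom_component m (Poly_Mapping.single \<alpha> c) = (if mdeg \<alpha> = m then Poly_Mapping.single \<alpha> c else 0)"
  using homogeneous_single[of \<alpha> c] by (auto simp: hom_component_homogeneous)

lemma hom_component_mult:
  fixes f :: "('i, 'k::comm_ring_1) mpoly"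
  shows "hom_component m (f * g) = (\<Sum>i\<le>m. hom_component i f * hom_component (m - i) g)"
proof (induction f rule: mpoly_induct)
  case (add \<alpha> c f)
  have "hom_component m (Poly_Mapping.single \<alpha> c * g) =
      (\<Sum>i\<le>m. hom_component i (Poly_Mapping.single \<alpha> c) * hom_component (m - i) g)"
  proof (induction g rule: mpoly_induct)
    case (add \<beta> d g)
    have "(\<Sum>i\<le>m. hom_component i (Poly_Mapping.single \<alpha> c) * hom_component (m - i) (Poly_Mapping.single \<beta> d))
        = (\<Sum>i\<le>m. if i = mdeg \<alpha> then (if mdeg \<alpha> + mdeg \<beta> = m then Poly_Mapping.single (\<alpha> + \<beta>) (c * d) else 0) else 0)"
      by (intro sum.cong) (auto simp: hom_component_single mult_single)
    also have "\<dots> = hom_component m (Poly_Mapping.single \<alpha> c * Poly_Mapping.single \<beta> d)"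
      by (simp add: mult_single hom_component_single mdeg_add)
    finally show ?case
      using add by (simp add: distrib_left hom_component_add sum.distrib)
  qed simp
  then show ?case
    using add by (simp add: distrib_right hom_component_add sum.distrib)
qed simp

lemma homogeneous_mult:
  fixes f :: "('i, 'k::comm_ring_1) mpoly"
  assumes "homogeneous m f" "homogeneous k g"
  shows "homogeneous (m + k) (f * g)"
proof -
  have "hom_component (m + k) (f * g) = (\<Sum>i\<le>m + k. if i = m then f * g else 0)"
    unfolding hom_component_mult
    by (intro sum.cong) (auto simp: hom_component_homogeneous[OF assms(1)] hom_component_homogeneous[OF assms(2)])
  then show ?thesis by (simp add: homogeneous_iff)
qed

lemma homogeneous_power:
  fixes f :: "('i, 'k::comm_ring_1) mpoly"
  assumes "homogeneous m f" shows "homogeneous (n * m) (f ^ n)"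
proof (induction n)
  case 0
  then show ?case using homogeneous_Const[of 1] by (simp add: single_one)
next
  case (Suc n)
  then show ?case using homogeneous_mult[OF assms Suc] by simp
qed

lemma homogeneous_Const_mult:
  "homogeneous m f \<Longrightarrow> homogeneous m (Const (c :: 'k::comm_ring_1) * f)"
  using homogeneous_mult[OF homogeneous_Const] by fastforce

lemma homogeneous_prod:
  fixes f :: "'a \<Rightarrow> ('i, 'k::comm_ring_1) mpoly"
  assumes "\<And>i. i \<in> A \<Longrightarrow> homogeneous (d i) (f i)" shows "homogeneous (sum d A) (prod f A)"
  using assms
proof (induction A rule: infinite_finite_induct)
  case (insert x A)
  then show ?case by (auto intro!: homogeneous_mult)
qed (use homogeneous_Const[of 1] in \<open>auto simp: single_one\<close>)

lemma homogeneous_mon: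
  assumes "\<And>i. homogeneous D (g i)"
  shows "homogeneous (mdeg \<alpha> * D) (mon g \<alpha> :: ('i, 'k::comm_ring_1) mpoly)"
  unfolding mon_def mdeg_def sum_distrib_right
  by (intro homogeneous_prod homogeneous_power assms)

lemma hom_component_large:
  obtains N where "\<And>m. m > N \<Longrightarrow> hom_component m f = 0"
proof
  fix m assume "m > Max (insert 0 (mdeg ` Poly_Mapping.keys f))"
  then have "mdeg \<alpha> \<noteq> m" if "\<alpha> \<in> Poly_Mapping.keys f" for \<alpha>
    using that by auto
  then show "hom_component m f = 0"
    by (intro poly_mapping_eqI) (auto simp: lookup_hom_component in_keys_iff)
qed

lemma sum_hom_components:
  assumes "\<And>m. m > N \<Longrightarrow> hom_component m f = 0"
  shows "(\<Sum>m\<le>N. hom_component m f) = f"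
proof (intro poly_mapping_eqI)
  fix \<alpha>
  have "Poly_Mapping.lookup (\<Sum>m\<le>N. hom_component m f) \<alpha> = (\<Sum>m\<le>N. if m = mdeg \<alpha> then Poly_Mapping.lookup f \<alpha> else 0)"
    unfolding lookup_sum by (intro sum.cong) (auto simp: lookup_hom_component)
  also have "\<dots> = Poly_Mapping.lookup f \<alpha>"
  proof (cases "mdeg \<alpha> \<le> N")
    case False
    then have "Poly_Mapping.lookup (hom_component (mdeg \<alpha>) f) \<alpha> = 0"
      using assms by (simp add: not_le)
    then show ?thesis using False by (auto simp: lookup_hom_component)
  qed auto
  finally show "Poly_Mapping.lookup (\<Sum>m\<le>N. hom_component m f) \<alpha> = Poly_Mapping.lookup f \<alpha>" .
qed

lemma hom_component_of_sum:
  assumes "\<And>m. m \<in> A \<Longrightarrow> homogeneous m (a m)" "finite A"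
  shows "hom_component k (\<Sum>m\<in>A. a m) = (if k \<in> A then a k else 0)"
proof -
  have "hom_component k (\<Sum>m\<in>A. a m) = (\<Sum>m\<in>A. if m = k then a m else 0)"
    unfolding hom_component_sum
    by (intro sum.cong) (auto simp: hom_component_homogeneous[OF assms(1)])
  then show ?thesis using assms(2) by simp
qed

text \<open>Substituting forms of one common degree multiplies all degrees by \<open>D\<close>, and
  since \<open>D > 0\<close> different components stay apart. A component of a relation between the
  \<open>g i\<close> modulo a homogeneous ideal is thus a relation again.\<close>

lemma hom_component_peval:
  assumes "\<And>i. homogeneous D (g i)" "D > 0"
  shows "hom_component (e * D) (peval Const g p :: ('i, 'k::comm_ring_1) mpoly) = peval Const g (hom_component e p)"
proof (induction p rule: mpoly_induct)
  case (add \<alpha> c p)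
  have "hom_component (e * D) (Const c * mon g \<alpha>) = (if mdeg \<alpha> = e then Const c * mon g \<alpha> else 0)"
    using hom_component_homogeneous[OF homogeneous_Const_mult[OF homogeneous_mon[of D g \<alpha>]], of "e * D" c] assms
    by auto
  then show ?case
    using add by (simp add: peval_add[OF is_hom_Const] hom_component_add hom_component_single peval_single)
qed simp

lemma poly_eval_homogeneous:
  assumes "homogeneous m f"
  shows "poly_eval f (c *s x) = c ^ m * poly_eval f x"
proof -
  have "mon (($) (c *s x)) \<alpha> = c ^ mdeg \<alpha> * mon (($) x) \<alpha>" for \<alpha>
    by (simp add: mon_def mdeg_def power_mult_distrib prod.distrib power_sum)
  then show ?thesis
    using assms unfolding poly_eval_altdef peval_def sum_distrib_left
    by (intro sum.cong) (auto simp: homogeneous_def algebra_simps)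
qed

subsection \<open>Points of ideals\<close>

definition ueval :: "('a::comm_ring_1 \<Rightarrow> 'b::comm_ring_1) \<Rightarrow> 'b \<Rightarrow> 'a poly \<Rightarrow> 'b" where
  "ueval \<phi> z p = (\<Sum>i\<le>degree p. \<phi> (coeff p i) * z ^ i)"

lemma ueval_altdef:
  "\<phi> 0 = 0 \<Longrightarrow> degree p \<le> N \<Longrightarrow> ueval \<phi> z p = (\<Sum>i\<le>N. \<phi> (coeff p i) * z ^ i)"
  unfolding ueval_def by (rule sum.mono_neutral_left) (auto simp: coeff_eq_0)

lemma ueval_add:
  assumes "is_hom \<phi>"
  shows "ueval \<phi> z (p + q) = ueval \<phi> z p + ueval \<phi> z q"
proof -
  let ?N = "max (degree p) (degree q)"
  have "degree (p + q) \<le> ?N" by (rule degree_add_le_max)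
  then show ?thesis
    using ueval_altdef[of \<phi> _ ?N z] is_hom_D[OF assms] by (simp add: sum.distrib distrib_right)
qed

lemma ueval_smult:
  assumes "is_hom \<phi>"
  shows "ueval \<phi> z (smult c p) = \<phi> c * ueval \<phi> z p"
  using ueval_altdef[of \<phi> _ "degree p" z] is_hom_D[OF assms] degree_smult_le[of c p]
  by (simp add: sum_distrib_left mult.assoc)

lemma ueval_pCons:
  assumes "is_hom \<phi>"
  shows "ueval \<phi> z (pCons c p) = \<phi> c + z * ueval \<phi> z p"
proof -
  have "ueval \<phi> z (pCons c p) = (\<Sum>i\<le>Suc (degree p). \<phi> (coeff (pCons c p) i) * z ^ i)"
    by (rule ueval_altdef) (simp_all add: is_hom_D[OF assms] degree_pCons_le)
  then show ?thesis
    by (simp add: sum.atMost_Suc_shift ueval_def sum_distrib_left mult.left_commute del: sum.atMost_Suc)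
qed

lemma ueval_0 [simp]: "\<phi> 0 = 0 \<Longrightarrow> ueval \<phi> z 0 = 0"
  by (simp add: ueval_def)

lemma ueval_mult:
  assumes "is_hom \<phi>"
  shows "ueval \<phi> z (p * q) = ueval \<phi> z p * ueval \<phi> z q"
  by (induction p)
    (simp_all add: ueval_add[OF assms] ueval_smult[OF assms] ueval_pCons[OF assms] is_hom_D[OF assms] algebra_simps)

lemma is_hom_ueval: "is_hom \<phi> \<Longrightarrow> is_hom (ueval \<phi> z)"
  unfolding is_hom_def
  using ueval_pCons[of \<phi> z 1 0] by (auto simp: ueval_add ueval_mult is_hom_def[symmetric] is_hom_D one_pCons)

lemma ueval_monom: "is_hom \<phi> \<Longrightarrow> ueval \<phi> z (monom c n) = \<phi> c * z ^ n"
  by (induction n) (simp_all add: monom_0 monom_Suc ueval_pCons is_hom_D algebra_simps)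

text \<open>Split off a root, p = (X - a) * q. If adding \<open>z - Const a\<close> to
  \<open>J\<close> produced 1, multiplying that representation of 1 by q(z) would put q(z) into
  \<open>J\<close>, and \<open>q\<close> has smaller degree.\<close>

lemma proper_ideal_add_linear:
  fixes J :: "('i, 'k::alg_closed_field) mpoly set"
  assumes "is_ideal J" "1 \<notin> J" "p \<noteq> 0" "ueval Const z p \<in> J"
  shows "\<exists>a. \<exists>J'. is_ideal J' \<and> 1 \<notin> J' \<and> J \<subseteq> J' \<and> z - Const a \<in> J'"
  using assms(3,4)
proof (induction "degree p" arbitrary: p)
  case 0
  then obtain c where c: "p = [:c:]" "c \<noteq> 0"
    by (metis degree_eq_zeroE pCons_0_0)
  have "Const (inverse c) * Const c \<in> J"
    using 0(3) c by (intro is_ideal_D(3)[OF assms(1)]) (simp add: ueval_def)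
  then show ?case using c assms(2) by (simp add: mult_single single_one)
next
  case (Suc n)
  then obtain a where "poly p a = 0"
    using alg_closed_imp_poly_has_root[of p] by auto
  then obtain q where q: "p = [:-a, 1:] * q"
    by (auto simp: poly_eq_0_iff_dvd)
  then have "q \<noteq> 0" using Suc.prems by auto
  have ueval_linear: "ueval Const z [:-a, 1:] = z - Const a"
    by (simp add: ueval_pCons[OF is_hom_Const] is_hom_D[OF is_hom_Const])
  from \<open>q \<noteq> 0\<close> have deg: "degree q = n"
    using Suc(2) unfolding q by (subst (asm) degree_mult_eq) auto
  define J' where "J' = {j + r * (z - Const a) |j r. j \<in> J}"
  have "is_ideal J'"
    unfolding is_ideal_def
  proof (intro conjI ballI allI)
    show "0 \<in> J'" using is_ideal_D(1)[OF assms(1)] by (auto simp: J'_def intro!: exI[of _ 0])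
  next
    fix x y assume "x \<in> J'" "y \<in> J'"
    then obtain j r k s where "j \<in> J" "k \<in> J" "x = j + r * (z - Const a)" "y = k + s * (z - Const a)"
      by (auto simp: J'_def)
    then show "x + y \<in> J'"
      using is_ideal_D(2)[OF assms(1), of j k] unfolding J'_def
      by (intro CollectI exI[of _ "j + k"] exI[of _ "r + s"]) (simp add: distrib_right)
  next
    fix x t assume "x \<in> J'"
    then obtain j r where "j \<in> J" "x = j + r * (z - Const a)"
      by (auto simp: J'_def)
    then show "t * x \<in> J'"
      using is_ideal_D(3)[OF assms(1), of j t] unfolding J'_def
      by (intro CollectI exI[of _ "t * j"] exI[of _ "t * r"]) (simp add: distrib_left mult.assoc)
  qed
  moreover have "J \<subseteq> J'"
  proof
    fix j assume "j \<in> J"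
    then show "j \<in> J'"
      unfolding J'_def by (intro CollectI exI[of _ j] exI[of _ 0]) simp
  qed
  moreover have "z - Const a \<in> J'"
    using is_ideal_D(1)[OF assms(1)] unfolding J'_def by (intro CollectI exI[of _ 0] exI[of _ 1]) simp
  ultimately show ?case
  proof (cases "1 \<in> J'")
    case True
    then obtain j r where j: "j \<in> J" "1 = j + r * (z - Const a)" by (auto simp: J'_def)
    have "ueval Const z q * 1 = ueval Const z q * j + r * ((z - Const a) * ueval Const z q)"
      unfolding j(2) by (simp add: algebra_simps)
    also have "\<dots> \<in> J"
      using Suc.prems(2) j(1)
      unfolding q ueval_mult[OF is_hom_Const] ueval_linear
      by (rule is_ideal_D(2)[OF assms(1) is_ideal_D(3)[OF assms(1)] is_ideal_D(3)[OF assms(1)], rotated])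
    finally have "ueval Const z q \<in> J" by simp
    then show ?thesis using Suc(1) deg \<open>q \<noteq> 0\<close> by metis
  qed blast
qed

text \<open>A form of the Nullstellensatz in which every variable is already algebraic modulo
  \<open>J\<close>. Enlarging \<open>J\<close> one variable at a time makes each variable congruent
  to a constant, so every polynomial is congruent to its value at the resulting point; elements of
  \<open>J\<close> must have value 0 there, as no other constant lies in a proper ideal.\<close>

lemma proper_ideal_point:
  fixes J :: "('n::finite, 'k::alg_closed_field) mpoly set"
  assumes "is_ideal J" "1 \<notin> J" "\<And>i. \<exists>p. p \<noteq> 0 \<and> ueval Const (Var i) p \<in> J"
  obtains x where "\<And>p. p \<in> J \<Longrightarrow> poly_eval p x = 0"
proof -
  have "\<exists>x J'. is_ideal J' \<and> 1 \<notin> J' \<and> J \<subseteq> J' \<and> (\<forall>i\<in>F. Var i - Const (x i) \<in> J')"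
    if "finite F" for F :: "'n set"
    using that
  proof induction
    case empty
    then show ?case using assms by blast
  next
    case (insert i F)
    then obtain x J' where J': "is_ideal J'" "1 \<notin> J'" "J \<subseteq> J'" "\<forall>i\<in>F. Var i - Const (x i) \<in> J'"
      by blast
    obtain p where "p \<noteq> 0" "ueval Const (Var i) p \<in> J'" using assms(3) J'(3) by blast
    then obtain a J'' where J'': "is_ideal J''" "1 \<notin> J''" "J' \<subseteq> J''" "Var i - Const a \<in> J''"
      using proper_ideal_add_linear[OF J'(1,2)] by blast
    then show ?case
      using J'(3,4) insert.hyps by (intro exI[of _ "x(i := a)"] exI[of _ J'']) auto
  qed
  from this[of UNIV] obtain x J' where J': "is_ideal J'" "1 \<notin> J'" "J \<subseteq> J'"
      "\<And>i. Var i - Const (x i) \<in> J'" by auto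
  let ?x = "\<chi> i. x i"
  have cong_mult: "p * q - a * b \<in> J'" if "p - a \<in> J'" "q - b \<in> J'" for p q a b
  proof -
    have "p * q - a * b = q * (p - a) + a * (q - b)" by (simp add: algebra_simps)
    then show ?thesis using that J'(1) by (auto intro: is_ideal_D)
  qed
  have cong_pow: "Var i ^ n - Const (x i) ^ n \<in> J'" for i n
    by (induction n) (use J'(4) is_ideal_D(1)[OF J'(1)] in \<open>auto intro: cong_mult\<close>)
  have cong_prod: "(\<Prod>i\<in>A. Var i ^ e i) - (\<Prod>i\<in>A. Const (x i) ^ e i) \<in> J'" for A and e :: "'n \<Rightarrow> nat"
    by (induction A rule: infinite_finite_induct)
      (use is_ideal_D(1)[OF J'(1)] in \<open>auto intro!: cong_mult cong_pow\<close>)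
  have "p - Const (poly_eval p ?x) \<in> J'" for p
  proof -
    have "p - Const (poly_eval p ?x) = peval Const Var p - peval Const (\<lambda>i. Const (x i)) p"
      using hom_peval[OF is_hom_Const, of "\<lambda>c. c" "($) ?x" p] by (simp add: peval_Var poly_eval_altdef)
    also have "\<dots> = (\<Sum>\<alpha>\<in>Poly_Mapping.keys p. Const (Poly_Mapping.lookup p \<alpha>) * (mon Var \<alpha> - mon (\<lambda>i. Const (x i)) \<alpha>))"
      by (simp add: peval_def sum_subtractf right_diff_distrib)
    also have "\<dots> \<in> J'"
      using cong_prod unfolding mon_def by (intro is_ideal_sum[OF J'(1)] is_ideal_D(3)[OF J'(1)])
    finally show ?thesis .
  qed
  have "poly_eval p ?x = 0" if "p \<in> J" for p
  proof (rule ccontr)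
    let ?c = "poly_eval p ?x"
    assume c: "?c \<noteq> 0"
    have "p - (p - Const ?c) \<in> J'"
      using that J'(3) \<open>p - Const ?c \<in> J'\<close> by (subst is_ideal_D(6)[OF J'(1)]) auto
    then have "Const (inverse ?c) * Const ?c \<in> J'"
      by (intro is_ideal_D(3)[OF J'(1)]) simp
    then show False using c J'(2) by (simp add: mult_single single_one)
  qed
  then show ?thesis using that by blast
qed

section \<open>The Gauss valuation\<close>

definition mvars :: "('i, 'k::zero) mpoly \<Rightarrow> 'i set" where
  "mvars p = (\<Union>\<alpha>\<in>Poly_Mapping.keys p. Poly_Mapping.keys \<alpha>)"

lemma finite_mvars [simp]: "finite (mvars p)"
  by (simp add: mvars_def)

lemma peval_cong_mvars: "(\<And>i. i \<in> mvars p \<Longrightarrow> g i = h i) \<Longrightarrow> peval \<phi> g p = peval \<phi> h p"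
  by (rule peval_cong) (auto simp: mvars_def)

context closed_valued_field
begin

text \<open>Absent monomials contribute \<infinity>, so the infimum may run over all of them and the
  zero polynomial gets \<infinity>.\<close>

definition gauss :: "('i, 'k) mpoly \<Rightarrow> ereal" where
  "gauss p = (INF \<alpha>. v (Poly_Mapping.lookup p \<alpha>))"

lemma gauss_le: "gauss p \<le> v (Poly_Mapping.lookup p \<alpha>)"
  unfolding gauss_def by (rule INF_lower) simp

lemma gauss_ge: "(\<And>\<alpha>. c \<le> v (Poly_Mapping.lookup p \<alpha>)) \<Longrightarrow> c \<le> gauss p"
  unfolding gauss_def by (rule INF_greatest)

lemma gauss_0 [simp]: "gauss 0 = \<infinity>"
  by (simp add: gauss_def at_0)

lemma gauss_attained:
  assumes "p \<noteq> 0"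
  obtains \<alpha> where "Poly_Mapping.lookup p \<alpha> \<noteq> 0" "gauss p = v (Poly_Mapping.lookup p \<alpha>)"
proof -
  let ?V = "(\<lambda>\<alpha>. v (Poly_Mapping.lookup p \<alpha>)) ` Poly_Mapping.keys p"
  have "?V \<noteq> {}" using assms by simp
  then have "Min ?V \<in> ?V" by (intro Min_in) auto
  then obtain \<alpha> where \<alpha>: "\<alpha> \<in> Poly_Mapping.keys p" "Min ?V = v (Poly_Mapping.lookup p \<alpha>)"
    by auto
  have "Min ?V \<le> v (Poly_Mapping.lookup p \<beta>)" for \<beta>
    by (cases "\<beta> \<in> Poly_Mapping.keys p") (auto simp: in_keys_iff at_0)
  then have "gauss p = v (Poly_Mapping.lookup p \<alpha>)"
    using \<alpha> by (intro antisym gauss_le gauss_ge) auto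
  then show ?thesis using that \<alpha>(1) by (auto simp: in_keys_iff)
qed

lemma gauss_finite: "p \<noteq> 0 \<Longrightarrow> \<bar>gauss p\<bar> \<noteq> \<infinity>"
  by (metis gauss_attained finite)

lemma gauss_single: "gauss (Poly_Mapping.single \<alpha> c) = v c"
proof (cases "c = 0")
  case False
  then have "Poly_Mapping.single \<alpha> c \<noteq> 0"
    by (metis lookup_single_eq lookup_zero)
  from gauss_attained[OF this] obtain \<beta> where
    "Poly_Mapping.lookup (Poly_Mapping.single \<alpha> c) \<beta> \<noteq> 0"
    "gauss (Poly_Mapping.single \<alpha> c) = v (Poly_Mapping.lookup (Poly_Mapping.single \<alpha> c) \<beta>)" .
  then show ?thesis by (auto simp: lookup_single when_def split: if_splits)
qed (simp add: at_0)

lemma mon_ge_0: "(\<And>i. 0 \<le> v (z i)) \<Longrightarrow> 0 \<le> v (mon z \<alpha>)"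
  unfolding mon_def prod by (intro sum_nonneg power_ge_0)

lemma gauss_le_peval:
  assumes "\<And>i. 0 \<le> v (z i)"
  shows "gauss p \<le> v (peval (\<lambda>c. c) z p)"
  unfolding peval_def
  by (intro ge_sum, subst mult.commute, intro ge_mult mon_ge_0 assms gauss_le)

text \<open>The constant \<open>t\<close> is substituted for the variable \<open>i\<close>, and the
  result remains a polynomial in the other variables: updating the exponent to 0 erases
  \<open>i\<close>, and monomials that become equal are added up.\<close>

definition specialize :: "'i \<Rightarrow> 'k \<Rightarrow> ('i, 'k) mpoly \<Rightarrow> ('i, 'k) mpoly" where
  "specialize i t p = (\<Sum>\<alpha>\<in>Poly_Mapping.keys p.
     Poly_Mapping.single (Poly_Mapping.update i 0 \<alpha>) (Poly_Mapping.lookup p \<alpha> * t ^ Poly_Mapping.lookup \<alpha> i))"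

lemma update_0_add_single:
  "Poly_Mapping.update i 0 \<alpha> + Poly_Mapping.single i (Poly_Mapping.lookup \<alpha> i) = (\<alpha> :: 'i \<Rightarrow>\<^sub>0 nat)"
  by (intro poly_mapping_eqI) (auto simp: lookup_add lookup_update lookup_single when_def)

lemma keys_update_0: "Poly_Mapping.keys (Poly_Mapping.update i 0 \<alpha>) = Poly_Mapping.keys \<alpha> - {i}"
  by (auto simp: in_keys_iff lookup_update split: if_splits)

lemma peval_specialize:
  "peval (\<lambda>c. c) z (specialize i t p) = peval (\<lambda>c. c) (z(i := t)) p"
proof -
  have "mon (z(i := t)) \<alpha> = mon z (Poly_Mapping.update i 0 \<alpha>) * t ^ Poly_Mapping.lookup \<alpha> i" for \<alpha>
  proof -
    have "mon (z(i := t)) \<alpha> =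
        mon (z(i := t)) (Poly_Mapping.update i 0 \<alpha> + Poly_Mapping.single i (Poly_Mapping.lookup \<alpha> i))"
      by (simp only: update_0_add_single)
    also have "\<dots> = mon (z(i := t)) (Poly_Mapping.update i 0 \<alpha>) * t ^ Poly_Mapping.lookup \<alpha> i"
      by (simp add: mon_add)
    also have "mon (z(i := t)) (Poly_Mapping.update i 0 \<alpha>) = mon z (Poly_Mapping.update i 0 \<alpha>)"
      by (rule mon_cong) (auto simp: keys_update_0)
    finally show ?thesis .
  qed
  then show ?thesis
    unfolding specialize_def is_hom_sum[OF is_hom_peval[OF is_hom_id]]
    by (simp add: peval_single peval_def[of _ "z(i := t)"] algebra_simps)
qed

lemma mvars_specialize: "mvars (specialize i t p) \<subseteq> mvars p - {i}"
proof
  fix j assume "j \<in> mvars (specialize i t p)"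
  then obtain \<beta> where \<beta>: "\<beta> \<in> Poly_Mapping.keys (specialize i t p)" "j \<in> Poly_Mapping.keys \<beta>"
    by (auto simp: mvars_def)
  have "(\<Sum>\<alpha>\<in>Poly_Mapping.keys p. Poly_Mapping.lookup (Poly_Mapping.single (Poly_Mapping.update i 0 \<alpha>)
      (Poly_Mapping.lookup p \<alpha> * t ^ Poly_Mapping.lookup \<alpha> i)) \<beta>) \<noteq> 0"
    using \<beta>(1) by (simp add: in_keys_iff specialize_def lookup_sum)
  then obtain \<alpha> where "\<alpha> \<in> Poly_Mapping.keys p" "Poly_Mapping.lookup (Poly_Mapping.single (Poly_Mapping.update i 0 \<alpha>)
      (Poly_Mapping.lookup p \<alpha> * t ^ Poly_Mapping.lookup \<alpha> i)) \<beta> \<noteq> 0"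
    by (rule sum.not_neutral_contains_not_neutral)
  then have "\<alpha> \<in> Poly_Mapping.keys p" "\<beta> = Poly_Mapping.update i 0 \<alpha>"
    by (auto simp: lookup_single when_def split: if_splits)
  then show "j \<in> mvars p - {i}"
    using \<beta>(2) by (auto simp: mvars_def keys_update_0)
qed

text \<open>Each coefficient after specialization is a polynomial in \<open>t\<close>, whose
  coefficients are coefficients of \<open>p\<close>. The one that contains a coefficient of least
  value becomes integral with a unit coefficient after division, so
  \<open>unit_with_unit_values'\<close> supplies one unit \<open>t\<close> that serves all
  \<open>p\<close> at once.\<close>

lemma gauss_specialize:
  fixes Q :: "('i, 'k) mpoly set"
  assumes "finite Q" "0 \<notin> Q"
  shows "\<exists>t. v t = 0 \<and> (\<forall>p\<in>Q. gauss (specialize i t p) = gauss p)"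
proof -
  let ?r = "Poly_Mapping.update i (0::nat)"
  define s where "s p \<beta> = (\<Sum>\<alpha>\<in>{\<alpha>\<in>Poly_Mapping.keys p. ?r \<alpha> = \<beta>}.
      monom (Poly_Mapping.lookup p \<alpha>) (Poly_Mapping.lookup \<alpha> i))" for p :: "('i, 'k) mpoly" and \<beta>
  have lookup: "Poly_Mapping.lookup (specialize i t p) \<beta> = poly (s p \<beta>) t" for t p \<beta>
    unfolding specialize_def lookup_sum s_def poly_sum
    by (rule sym, rule sum.mono_neutral_cong_left)
      (auto simp: lookup_single when_def poly_monom)
  have coeff_s: "coeff (s p \<beta>) j = (\<Sum>\<alpha>\<in>{\<alpha>\<in>Poly_Mapping.keys p. ?r \<alpha> = \<beta>}.
      if Poly_Mapping.lookup \<alpha> i = j then Poly_Mapping.lookup p \<alpha> else 0)" for p \<beta> j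
    unfolding s_def coeff_sum by (intro sum.cong) auto
  have ge: "gauss p \<le> v (coeff (s p \<beta>) j)" for p \<beta> j
    unfolding coeff_s by (intro ge_sum) (auto simp: gauss_le at_0)
  have "\<exists>\<alpha>. Poly_Mapping.lookup p \<alpha> \<noteq> 0 \<and> gauss p = v (Poly_Mapping.lookup p \<alpha>)" if "p \<in> Q" for p
    using gauss_attained[of p] assms(2) that by blast
  then obtain A where A: "\<And>p. p \<in> Q \<Longrightarrow> Poly_Mapping.lookup p (A p) \<noteq> 0"
      "\<And>p. p \<in> Q \<Longrightarrow> gauss p = v (Poly_Mapping.lookup p (A p))"
    by metis
  \<comment> \<open>A monomial is determined by its exponent at \<open>i\<close> together with the
    rest, so only one monomial contributes here.\<close>
  have coeff_A: "coeff (s p (?r (A p))) (Poly_Mapping.lookup (A p) i) = Poly_Mapping.lookup p (A p)"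
    if "p \<in> Q" for p
  proof -
    have "coeff (s p (?r (A p))) (Poly_Mapping.lookup (A p) i) =
        (\<Sum>\<alpha>\<in>{\<alpha>\<in>Poly_Mapping.keys p. ?r \<alpha> = ?r (A p)}. if \<alpha> = A p then Poly_Mapping.lookup p \<alpha> else 0)"
      unfolding coeff_s
    proof (intro sum.cong refl)
      fix \<alpha> assume "\<alpha> \<in> {\<alpha>\<in>Poly_Mapping.keys p. ?r \<alpha> = ?r (A p)}"
      then have "Poly_Mapping.lookup \<alpha> i = Poly_Mapping.lookup (A p) i \<longleftrightarrow> \<alpha> = A p"
        by (metis (mono_tags, lifting) mem_Collect_eq update_0_add_single)
      then show "(if Poly_Mapping.lookup \<alpha> i = Poly_Mapping.lookup (A p) i then Poly_Mapping.lookup p \<alpha> else 0) =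
          (if \<alpha> = A p then Poly_Mapping.lookup p \<alpha> else 0)" by simp
    qed
    then show ?thesis using A(1)[OF that] by (auto simp: in_keys_iff)
  qed
  let ?S = "\<lambda>p. smult (inverse (Poly_Mapping.lookup p (A p))) (s p (?r (A p)))"
  obtain t where t: "v t = 0" "\<And>q. q \<in> ?S ` Q \<Longrightarrow> v (poly q t) = 0"
  proof (rule unit_with_unit_values'[of "?S ` Q"])
    fix q assume "q \<in> ?S ` Q"
    then obtain p where p: "p \<in> Q" "q = ?S p" by blast
    show "\<exists>j. v (coeff q j) = 0"
      using A(1)[OF p(1)] coeff_A[OF p(1)] p(2) at_1
      by (intro exI[of _ "Poly_Mapping.lookup (A p) i"]) simp
    show "0 \<le> v (coeff q j)" for j
    proof -
      obtain r where r: "v (Poly_Mapping.lookup p (A p)) = ereal r"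
        using finiteE[OF A(1)[OF p(1)]] .
      then have "ereal r \<le> v (coeff (s p (?r (A p))) j)"
        using ge[of p "?r (A p)" j] A(2)[OF p(1)] by simp
      then show ?thesis
        using inverse[OF A(1)[OF p(1)]] r p(2)
        by (cases "v (coeff (s p (?r (A p))) j)") (auto simp: mult)
    qed
  qed (use assms(1) in auto)
  have "gauss (specialize i t p) = gauss p" if p: "p \<in> Q" for p
  proof (rule antisym)
    have "v (poly (s p (?r (A p))) t) = gauss p"
    proof -
      obtain r where r: "v (Poly_Mapping.lookup p (A p)) = ereal r"
        using finiteE[OF A(1)[OF p]] .
      have "v (inverse (Poly_Mapping.lookup p (A p))) + v (poly (s p (?r (A p))) t) = 0"
        using t(2)[of "?S p"] p by (simp add: mult)
      then show ?thesis
        using inverse[OF A(1)[OF p]] r A(2)[OF p]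
        by (cases "v (poly (s p (?r (A p))) t)") auto
    qed
    then show "gauss (specialize i t p) \<le> gauss p"
      using gauss_le[of "specialize i t p" "?r (A p)"] by (simp add: lookup)
    show "gauss p \<le> gauss (specialize i t p)"
    proof (rule gauss_ge)
      fix \<beta>
      show "gauss p \<le> v (Poly_Mapping.lookup (specialize i t p) \<beta>)"
        unfolding lookup poly_altdef
        by (intro ge_sum, subst mult.commute, intro ge_mult power_ge_0 ge) (simp add: t(1))
    qed
  qed
  then show ?thesis using t(1) by blast
qed

text \<open>The variables are specialized one at a time, with no Gauss value changing, until only
  constants are left.\<close>

lemma generic_point:
  fixes Q :: "('i, 'k) mpoly set"
  assumes "finite Q" "0 \<notin> Q"
  obtains z where "\<And>i. v (z i) = 0" "\<And>p. p \<in> Q \<Longrightarrow> v (peval (\<lambda>c. c) z p) = gauss p"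
proof -
  have "\<exists>z. (\<forall>i. v (z i) = 0) \<and> (\<forall>p\<in>Q. v (peval (\<lambda>c. c) z p) = gauss p)"
    if "finite V" "finite Q" "0 \<notin> Q" "\<And>p. p \<in> Q \<Longrightarrow> mvars p \<subseteq> V" for V :: "'i set" and Q
    using that
  proof (induction V arbitrary: Q)
    case empty
    have "v (peval (\<lambda>c. c) (\<lambda>_. 1) p) = gauss p" if "p \<in> Q" for p
    proof -
      have "\<alpha> = 0" if "\<alpha> \<in> Poly_Mapping.keys p" for \<alpha>
        using empty.prems(3)[OF \<open>p \<in> Q\<close>] that by (auto simp: mvars_def)
      then have "p = Const (Poly_Mapping.lookup p 0)"
        by (intro poly_mapping_eqI) (auto simp: lookup_single when_def in_keys_iff)
      then show ?thesis
        by (metis gauss_single peval_single mon_0 mult.right_neutral)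
    qed
    then show ?case using at_1 by (intro exI[of _ "\<lambda>_. 1"]) auto
  next
    case (insert i V)
    obtain t where t: "v t = 0" "\<And>p. p \<in> Q \<Longrightarrow> gauss (specialize i t p) = gauss p"
      using gauss_specialize[OF insert.prems(1,2), of i] by blast
    have "\<exists>z. (\<forall>i. v (z i) = 0) \<and> (\<forall>p\<in>specialize i t ` Q. v (peval (\<lambda>c. c) z p) = gauss p)"
    proof (rule insert.IH)
      show "0 \<notin> specialize i t ` Q"
      proof
        assume "0 \<in> specialize i t ` Q"
        then obtain p where p: "p \<in> Q" "specialize i t p = 0" by auto
        then have "gauss p = \<infinity>" using t(2)[OF p(1)] by simp
        then show False using gauss_finite[of p] insert.prems(2) p(1) by auto
      qed
      show "mvars p \<subseteq> V" if "p \<in> specialize i t ` Q" for p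
        using that insert.prems(3) mvars_specialize[of i t] by blast
    qed (use insert in auto)
    then obtain z where "\<And>i. v (z i) = 0" "\<And>p. p \<in> Q \<Longrightarrow> v (peval (\<lambda>c. c) z (specialize i t p)) = gauss p"
      using t(2) by auto
    then have "\<forall>p\<in>Q. v (peval (\<lambda>c. c) (z(i := t)) p) = gauss p" "\<forall>j. v ((z(i := t)) j) = 0"
      using t(1) unfolding peval_specialize by (blast, simp)
    then show ?case by blast
  qed
  note * = this
  have "\<exists>z. (\<forall>i. v (z i) = 0) \<and> (\<forall>p\<in>Q. v (peval (\<lambda>c. c) z p) = gauss p)"
    by (rule *[of "\<Union>(mvars ` Q)"]) (use assms in auto)
  then show ?thesis
    using that by blast
qed

text \<open>Evaluation at a point that is generic for both factors and the product is multiplicative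
  and computes all three Gauss values.\<close>

lemma gauss_mult:
  fixes p q :: "('i, 'k) mpoly"
  shows "gauss (p * q) = gauss p + gauss q"
proof (cases "p = 0 \<or> q = 0")
  case True
  then show ?thesis
    using gauss_finite[of p] gauss_finite[of q] by (cases "p = 0"; cases "q = 0") auto
next
  case False
  \<comment> \<open>This first point serves only to show \<open>p * q\<close> nonzero, which
    \<open>generic_point\<close> demands of its polynomials.\<close>
  obtain z where z: "\<And>r. r \<in> {p, q} \<Longrightarrow> v (peval (\<lambda>c. c) z r) = gauss r"
    by (rule generic_point[of "{p, q}"]) (use False in auto)
  have "peval (\<lambda>c. c) z p \<noteq> 0" "peval (\<lambda>c. c) z q \<noteq> 0"
    using z[of p] z[of q] gauss_finite[of p] gauss_finite[of q] False by (auto simp: at_0)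
  then have "peval (\<lambda>c. c) z (p * q) \<noteq> 0"
    by (simp add: peval_mult[OF is_hom_id])
  then have nz: "p * q \<noteq> 0" by auto
  obtain z where z: "\<And>r. r \<in> {p, q, p * q} \<Longrightarrow> v (peval (\<lambda>c. c) z r) = gauss r"
    by (rule generic_point[of "{p, q, p * q}"]) (use False nz in auto)
  then have "gauss (p * q) = v (peval (\<lambda>c. c) z (p * q))" by simp
  also have "\<dots> = gauss p + gauss q"
    using z by (simp add: peval_mult[OF is_hom_id] mult)
  finally show ?thesis .
qed

sublocale gauss: semivaluation "gauss :: ('i, 'k) mpoly \<Rightarrow> ereal"
proof
  fix p q :: "('i, 'k) mpoly"
  show "gauss p \<noteq> -\<infinity>"
    using gauss_finite[of p] by (cases "p = 0") auto
  show "min (gauss p) (gauss q) \<le> gauss (p + q)"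
    by (intro gauss_ge) (auto simp: lookup_add min.coboundedI1 min.coboundedI2 gauss_le intro!: ge_add)
  show "gauss (1 :: ('i, 'k) mpoly) = 0"
    using gauss_single[of 0 1] at_1 by (simp add: single_one)
qed (simp_all add: gauss_mult)

end

section \<open>Noether normalization over the valuation ring\<close>

lemma finite_over_mono: "B \<subseteq> C \<Longrightarrow> finite_over B \<Longrightarrow> finite_over C"
  unfolding finite_over_def using lin_span_mono[of B C] by blast

locale graded_semivaluation = closed_valued_field v + w: semivaluation w
  for v :: "'k::alg_closed_field \<Rightarrow> ereal" and w :: "('n::finite, 'k) mpoly \<Rightarrow> ereal" +
  assumes w_Const: "w (Const c) = v c"
    and w_components: "w p = (INF m. w (hom_component m p))"
begin

text \<open>The kernel of \<open>w\<close>. It is a homogeneous ideal, and its zero set is the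
  variety on which \<open>w\<close> lives.\<close>

definition P :: "('n, 'k) mpoly set" where
  "P = {p. w p = \<infinity>}"

lemma P_ideal: "is_ideal P"
  unfolding is_ideal_def P_def
proof (intro conjI ballI allI CollectI)
  fix x y assume "x \<in> {p. w p = \<infinity>}" "y \<in> {p. w p = \<infinity>}"
  then show "w (x + y) = \<infinity>"
    using w.add_ge[of x y] by auto
next
  fix x r assume "x \<in> {p. w p = \<infinity>}"
  then show "w (r * x) = \<infinity>"
    using w.not_MInf[of r] by (simp add: w.mult)
qed (simp add: w.at_0)

lemma P_component: "p \<in> P \<Longrightarrow> hom_component m p \<in> P"
  unfolding P_def using w_components[of p] INF_lower[of m UNIV "\<lambda>m. w (hom_component m p)"] by auto

lemma Const_in_P: "Const c \<in> P \<longleftrightarrow> c = 0"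
  by (simp add: P_def w_Const eq_PInf_iff)

text \<open>Including \<open>P\<close> turns statements about the subring K[g] of K[X] / P into
  statements about a subring of K[X].\<close>

definition coeff_ring :: "(nat \<Rightarrow> ('n, 'k) mpoly) \<Rightarrow> ('n, 'k) mpoly set" where
  "coeff_ring g = ring_gen (range Const \<union> P \<union> range g)"

lemma coeff_ring: "is_subring (coeff_ring g)" "Const c \<in> coeff_ring g" "P \<subseteq> coeff_ring g" "g i \<in> coeff_ring g"
  by (auto simp: coeff_ring_def is_subring_ring_gen intro: ring_gen.base)

text \<open>
  The change of variables \<open>g i = g' i + z i * g l\<close> with a generic \<open>z\<close> makes an equation
  between the \<open>g i\<close> monic in \<open>g l\<close>, with coefficients integral over the valuation ring.
\<close>

lemma integral_equation:
  assumes z: "\<And>i. 0 \<le> v (z i)" "peval (\<lambda>c. c) z q = 1" "z l = 1"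
    and q: "homogeneous e q" "0 \<le> gauss q"
    and g': "\<And>i. g' i = g i - Const (z i) * g l"
  shows "peval Const g q - g l ^ e \<in>
    lin_span (ring_gen ({Const c |c. 0 \<le> v c} \<union> range g')) {(g l :: ('n, 'k) mpoly) ^ j |j. j < e}"
proof -
  let ?B = "ring_gen ({Const c |c. 0 \<le> v c} \<union> range g')"
  have B: "is_subring ?B" "\<And>c. 0 \<le> v c \<Longrightarrow> Const c \<in> ?B" "\<And>i. g' i \<in> ?B"
    by (auto intro: is_subring_ring_gen ring_gen.base)
  let ?M = "\<lambda>d. lin_span ?B {g l ^ j |j. j < d}"
  \<comment> \<open>\<open>T d c a\<close> says that \<open>a\<close> is a polynomial of degree
    \<open>d\<close> in \<open>g l\<close> with leading coefficient \<open>c\<close>, integral over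
    the valuation ring, and lower coefficients in \<open>?B\<close>.\<close>
  define T where "T d c a \<longleftrightarrow> 0 \<le> v c \<and> a - Const c * g l ^ d \<in> ?M d" for d c a
  have scale: "b * g l ^ d * y \<in> ?M (d + e)" if "y \<in> ?M e" "b \<in> ?B" for b y d e
    by (rule lin_span_mult[OF lin_span_single[of b ?B "g l ^ d" "{g l ^ d}"] that(1)])
      (use that B(1) in \<open>auto simp: power_add[symmetric] intro!: lin_span_single is_subring_D(5)[OF B(1)]\<close>)
  have T_mult: "T (d + e) (c * c') (a * b)" if "T d c a" "T e c' b" for d e c c' a b
  proof -
    have "a * b - Const (c * c') * g l ^ (d + e) = (a - Const c * g l ^ d) * (b - Const c' * g l ^ e)
        + Const c * g l ^ d * (b - Const c' * g l ^ e) + Const c' * g l ^ e * (a - Const c * g l ^ d)"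
      by (simp add: algebra_simps power_add is_hom_D[OF is_hom_Const])
    also have "\<dots> \<in> ?M (d + e)"
    proof (intro lin_span_add)
      show "(a - Const c * g l ^ d) * (b - Const c' * g l ^ e) \<in> ?M (d + e)"
        by (rule lin_span_mult[of _ ?B "{g l ^ j |j. j < d}" _ ?B "{g l ^ j |j. j < e}"])
          (use that B(1) in \<open>auto simp: T_def power_add[symmetric] intro!: lin_span_single is_subring_D(5)[OF B(1)]\<close>)
      show "Const c * g l ^ d * (b - Const c' * g l ^ e) \<in> ?M (d + e)"
        using that B(2) by (intro scale) (auto simp: T_def)
      show "Const c' * g l ^ e * (a - Const c * g l ^ d) \<in> ?M (d + e)"
        using that B(2) scale[of "a - Const c * g l ^ d" d "Const c'" e] by (auto simp: T_def add.commute)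
    qed
    finally show ?thesis
      using that by (auto simp: T_def mult)
  qed
  have T_1: "T 0 1 1"
    by (simp add: T_def at_1 single_one lin_span.zero)
  \<comment> \<open>This is the change of variables itself: \<open>g' i\<close> is the constant term
    and \<open>z i\<close> the leading coefficient.\<close>
  have T_g: "T 1 (z i) (g i)" for i
    using z(1) lin_span_single[of "g' i" ?B "g l ^ 0" "{g l ^ j |j. j < 1}"] B(3)
    unfolding T_def power_one_right g'[symmetric] by simp
  have T_pow: "T n (z i ^ n) (g i ^ n)" for i n
  proof (induction n)
    case (Suc n)
    then show ?case using T_mult[OF T_g Suc] by simp
  qed (use T_1 in simp)
  have T_prod: "T (\<Sum>i\<in>A. m i) (\<Prod>i\<in>A. z i ^ m i) (\<Prod>i\<in>A. g i ^ m i)" for A m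
    by (induction A rule: infinite_finite_induct) (auto simp: T_1 intro: T_mult T_pow)
  \<comment> \<open>The leading coefficient of the whole expression is q(z), which was arranged to
    be 1.\<close>
  have "peval Const g q - g l ^ e = peval Const g q - Const (peval (\<lambda>c. c) z q) * g l ^ e"
    using z(2) by (simp add: single_one)
  also have "\<dots> = (\<Sum>\<alpha>\<in>Poly_Mapping.keys q.
      Const (Poly_Mapping.lookup q \<alpha>) * (mon g \<alpha> - Const (mon z \<alpha>) * g l ^ e))"
    by (simp add: peval_def sum_subtractf right_diff_distrib is_hom_sum[OF is_hom_Const]
        is_hom_D(3)[OF is_hom_Const] sum_distrib_right mult.assoc)
  also have "\<dots> \<in> ?M e"
  proof (rule lin_span_sum)
    fix \<alpha> assume \<alpha>: "\<alpha> \<in> Poly_Mapping.keys q"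
    have "T (mdeg \<alpha>) (mon z \<alpha>) (mon g \<alpha>)"
      unfolding mdeg_def mon_def by (rule T_prod)
    then have "mon g \<alpha> - Const (mon z \<alpha>) * g l ^ e \<in> ?M e"
      using q(1) \<alpha> by (auto simp: T_def homogeneous_def)
    moreover have "Const (Poly_Mapping.lookup q \<alpha>) \<in> ?B"
      using q(2) gauss_le[of q \<alpha>] by (intro B(2)) auto
    ultimately show "Const (Poly_Mapping.lookup q \<alpha>) * (mon g \<alpha> - Const (mon z \<alpha>) * g l ^ e) \<in> ?M e"
      using scale[of "mon g \<alpha> - Const (mon z \<alpha>) * g l ^ e" e _ 0] by auto
  qed
  finally show ?thesis .
qed

text \<open>A generic point gives \<open>q\<close> its Gauss value. Dividing the point by its unit
  coordinate at \<open>l\<close> makes that coordinate 1 and changes the value of the form by a unit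
  only; then \<open>a\<close> is the inverse of q(z), so that scaling by it keeps the coefficients
  integral.\<close>

lemma normalize_form:
  fixes q :: "(nat, 'k) mpoly"
  assumes "homogeneous e q" "q \<noteq> 0" "mvars q \<subseteq> {..l}"
  shows "\<exists>z a. (\<forall>i. 0 \<le> v (z i)) \<and> z l = 1 \<and> (\<forall>i>l. z i = 0) \<and>
    peval (\<lambda>c. c) z (Const a * q) = 1 \<and> 0 \<le> gauss (Const a * q)"
proof -
  obtain y where y: "\<And>i. v (y i) = 0" "\<And>p. p \<in> {q} \<Longrightarrow> v (peval (\<lambda>c. c) y p) = gauss p"
    by (rule generic_point[of "{q}"]) (use assms(2) in auto)
  \<comment> \<open>Vanishing beyond \<open>l\<close> ensures that the variables \<open>g i\<close>
    with \<open>i > l\<close>, which are already 0, stay 0.\<close>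
  define z where "z i = (if i \<le> l then y i / y l else 0)" for i
  have yl: "y l \<noteq> 0" using y(1)[of l] at_0 by auto
  have z: "0 \<le> v (z i)" for i
    using y(1) divide[OF yl] by (simp add: z_def at_0)
  have "peval (\<lambda>c. c) y q = peval (\<lambda>c. c) (\<lambda>i. y l * z i) q"
    by (rule peval_cong_mvars) (use assms(3) yl in \<open>auto simp: z_def\<close>)
  also have "\<dots> = y l ^ e * peval (\<lambda>c. c) z q"
    unfolding peval_def sum_distrib_left
  proof (rule sum.cong[OF refl])
    fix \<alpha> assume "\<alpha> \<in> Poly_Mapping.keys q"
    then have "e = mdeg \<alpha>" using assms(1) by (auto simp: homogeneous_def)
    then show "Poly_Mapping.lookup q \<alpha> * mon (\<lambda>i. y l * z i) \<alpha> = y l ^ e * (Poly_Mapping.lookup q \<alpha> * mon z \<alpha>)"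
      by (simp add: mon_def mdeg_def power_mult_distrib prod.distrib power_sum)
  qed
  finally have v: "v (peval (\<lambda>c. c) z q) = gauss q"
    using y by (simp add: mult power)
  define a where "a = inverse (peval (\<lambda>c. c) z q)"
  have nz: "peval (\<lambda>c. c) z q \<noteq> 0"
    using v gauss_finite[OF assms(2)] at_0 by auto
  have "peval (\<lambda>c. c) z (Const a * q) = 1"
    using nz by (simp add: peval_mult[OF is_hom_id] peval_single a_def)
  moreover have "0 \<le> gauss (Const a * q)"
    using inverse[OF nz] finiteE[OF nz] v unfolding gauss.mult gauss_single a_def[symmetric]
    by (cases "gauss q") auto
  ultimately show ?thesis
    using z yl by (intro exI[of _ z] exI[of _ a]) (auto simp: z_def)
qed

text \<open>In an integral equation with lower part \<open>s\<close>, a root of negative value would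
  make the top term smaller in value than anything in \<open>s\<close>.\<close>

lemma root_integral:
  assumes "t ^ e + s = 0" "e > 0" "v t < 0 \<Longrightarrow> ereal (real (e - 1)) * v t \<le> v s"
  shows "0 \<le> v t"
proof (rule ccontr)
  assume "\<not> 0 \<le> v t"
  then obtain r where r: "v t = ereal r" "r < 0"
    using not_MInf[of t] by (cases "v t") auto
  have "v s = v (t ^ e)"
    using assms(1) minus[of s] by (simp add: add_eq_0_iff2)
  then have "ereal (real (e - 1)) * ereal r \<le> ereal (real e) * ereal r"
    using assms(3) r by (simp add: power del: times_ereal.simps)
  then have "real (e - 1) * r \<le> real e * r" by simp
  moreover have "real e * r < real (e - 1) * r"
    using r(2) assms(2) by (intro mult_strict_right_mono_neg) auto
  ultimately show False by linarith
qed

text \<open>Besides finiteness and independence modulo \<open>P\<close>, the last conjunct records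
  that all changes of variables happen over the valuation ring: at zeros of \<open>P\<close>,
  integral values of the \<open>h i\<close> force integral values of the original
  \<open>g i\<close>. The induction is on the number of variables not yet eliminated.\<close>

lemma noether_normalization:
  assumes "D > 0" "\<And>i. homogeneous D (g i)" "\<And>i. 0 \<le> w (g i)" "\<And>i. i \<ge> m \<Longrightarrow> g i = 0"
    and "finite_over (coeff_ring g)"
  shows "\<exists>r h. (\<forall>i. 0 \<le> w (h i)) \<and> (\<forall>i\<ge>r. h i = 0) \<and> finite_over (coeff_ring h) \<and>
    (\<forall>p. mvars p \<subseteq> {..<r} \<longrightarrow> peval Const h p \<in> P \<longrightarrow> p = 0) \<and>
    (\<forall>x. (\<forall>p\<in>P. poly_eval p x = 0) \<longrightarrow> (\<forall>i. 0 \<le> v (poly_eval (h i) x)) \<longrightarrow> (\<forall>i. 0 \<le> v (poly_eval (g i) x)))"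
  using assms
proof (induction m arbitrary: g)
  case 0
  have "p = 0" if "mvars p \<subseteq> {..<0}" "peval Const g p \<in> P" for p
  proof -
    have "\<alpha> = 0" if "\<alpha> \<in> Poly_Mapping.keys p" for \<alpha>
      using \<open>mvars p \<subseteq> {..<0}\<close> that by (auto simp: mvars_def)
    then have p: "p = Const (Poly_Mapping.lookup p 0)"
      by (intro poly_mapping_eqI) (auto simp: lookup_single when_def in_keys_iff)
    have "peval Const g p = Const (Poly_Mapping.lookup p 0)"
      by (subst p) (simp add: peval_single)
    then show ?thesis using that(2) p by (simp add: Const_in_P)
  qed
  then show ?case using 0 by (intro exI[of _ 0] exI[of _ g]) blast
next
  case (Suc l)
  show ?case
  proof (cases "\<forall>p. mvars p \<subseteq> {..<Suc l} \<longrightarrow> peval Const g p \<in> P \<longrightarrow> p = 0")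
    case True
    then show ?thesis using Suc.prems by (intro exI[of _ "Suc l"] exI[of _ g]) blast
  next
    case False
    then obtain p where p: "mvars p \<subseteq> {..<Suc l}" "peval Const g p \<in> P" "p \<noteq> 0" by blast
    \<comment> \<open>The relation may be replaced by a nonzero homogeneous component, because
      \<open>P\<close> is homogeneous and all \<open>g i\<close> have degree
      \<open>D\<close>.\<close>
    have "\<exists>e. hom_component e p \<noteq> 0"
    proof (rule ccontr)
      assume *: "\<nexists>e. hom_component e p \<noteq> 0"
      then have "(\<Sum>m\<le>0. hom_component m p) = p" by (intro sum_hom_components) auto
      then show False using * p(3) by auto
    qed
    then obtain e where e: "hom_component e p \<noteq> 0" by blast
    have "mvars (hom_component e p) \<subseteq> {..l}"
      using p(1) by (auto simp: mvars_def keys_hom_component)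
    then obtain z a where z: "\<And>i. 0 \<le> v (z i)" "z l = 1" "\<And>i. i > l \<Longrightarrow> z i = 0"
        "peval (\<lambda>c. c) z (Const a * hom_component e p) = 1" "0 \<le> gauss (Const a * hom_component e p)"
      using normalize_form[OF homogeneous_hom_component e] by blast
    let ?q = "Const a * hom_component e p"
    have qP: "peval Const g ?q \<in> P"
      using P_component[OF p(2), of "e * D"] hom_component_peval[OF Suc.prems(2,1), where e = e and p = p]
      by (simp add: peval_mult[OF is_hom_Const] is_ideal_D(3)[OF P_ideal])
    define G where "G = g l"
    define g' where "g' i = g i - Const (z i) * g l" for i
    let ?B = "ring_gen ({Const c |c. 0 \<le> v c} \<union> range g')"
    define s where "s = peval Const g ?q - G ^ e"
    have s: "s \<in> lin_span ?B {G ^ j |j. j < e}"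
      unfolding s_def G_def
      by (rule integral_equation[OF z(1,4,2) homogeneous_Const_mult[OF homogeneous_hom_component] z(5) g'_def])
    have eqP: "G ^ e + s \<in> P" using qP by (simp add: s_def)
    \<comment> \<open>In degree 0 the relation would put 1 into \<open>P\<close>.\<close>
    have e0: "e > 0"
    proof (rule ccontr)
      assume "\<not> e > 0"
      then have "s = 0" using s by (auto elim: lin_span.cases)
      then show False
        using eqP \<open>\<not> e > 0\<close> Const_in_P[of 1] by (simp add: single_one)
    qed
    have BB: "?B \<subseteq> coeff_ring g'"
      using coeff_ring[where g = g'] by (intro ring_gen_least) auto
    have G: "integral_over (coeff_ring g') G"
      unfolding integral_over_def
    proof
      \<comment> \<open>The equation holds only modulo \<open>P\<close>; its error enters as a
        constant coefficient, which is allowed because \<open>P\<close> lies in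
        \<open>coeff_ring g'\<close>.\<close>
      have "G ^ e = (G ^ e + s) * G ^ 0 + (-1) * s" by simp
      also have "\<dots> \<in> lin_span (coeff_ring g') {G ^ j |j. j < e}"
      proof (rule lin_span_add[OF lin_span_single])
        show "(-1) * s \<in> lin_span (coeff_ring g') {G ^ j |j. j < e}"
          using lin_span_mono[OF BB subset_refl s]
          by (rule lin_span_scale) (use is_subring_D(3)[OF coeff_ring(1)] in simp)
      qed (use eqP coeff_ring(3) e0 in \<open>auto intro!: exI[of _ 0]\<close>)
      finally show "G ^ e \<in> lin_span (coeff_ring g') {G ^ j |j. j < e}" .
    qed
    have g_eq: "g i = g' i + Const (z i) * G" for i
      by (simp add: g'_def G_def)
    have fin: "finite_over (coeff_ring g')"
    proof (rule finite_over_adjoin[OF coeff_ring(1) G])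
      let ?C = "lin_span (coeff_ring g') (range (\<lambda>j. G ^ j))"
      note C = is_subring_adjoin[OF coeff_ring(1)[where g = g'], of G]
      have "coeff_ring g \<subseteq> ?C"
        unfolding coeff_ring_def[of g]
      proof (rule ring_gen_least[OF C(1)])
        have "g i \<in> ?C" for i
          unfolding g_eq using C(2,3) coeff_ring[where g = g']
          by (intro is_subring_D(4)[OF C(1)] is_subring_D(5)[OF C(1)]) auto
        then show "range Const \<union> P \<union> range g \<subseteq> ?C"
          using C(2) coeff_ring[where g = g'] by auto
      qed
      then show "finite_over ?C" using Suc.prems(5) finite_over_mono by blast
    qed
    have IH: "\<exists>r h. (\<forall>i. 0 \<le> w (h i)) \<and> (\<forall>i\<ge>r. h i = 0) \<and> finite_over (coeff_ring h) \<and>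
      (\<forall>p. mvars p \<subseteq> {..<r} \<longrightarrow> peval Const h p \<in> P \<longrightarrow> p = 0) \<and>
      (\<forall>x. (\<forall>p\<in>P. poly_eval p x = 0) \<longrightarrow> (\<forall>i. 0 \<le> v (poly_eval (h i) x)) \<longrightarrow>
        (\<forall>i. 0 \<le> v (poly_eval (g' i) x)))"
    proof (rule Suc.IH[OF \<open>D > 0\<close> _ _ _ fin])
      show "homogeneous D (g' i)" for i
        unfolding g'_def by (intro homogeneous_diff homogeneous_Const_mult Suc.prems(2))
      show "0 \<le> w (g' i)" for i
        unfolding g'_def by (intro w.ge_diff w.mult_ge_0) (simp_all add: Suc.prems(3) w_Const z(1))
      \<comment> \<open>For \<open>i = l\<close> this is the choice \<open>z l = 1\<close>; so one
        variable fewer remains.\<close>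
      show "g' i = 0" if "i \<ge> l" for i
        using that Suc.prems(4) z(2,3) by (cases "i = l") (auto simp: g'_def single_one)
    qed
    have gx: "0 \<le> v (poly_eval (g i) x)"
      if x: "\<forall>p\<in>P. poly_eval p x = 0" and g'x: "\<forall>i. 0 \<le> v (poly_eval (g' i) x)" for x i
    proof -
      note ev = is_hom_D[OF is_hom_poly_eval[of x]] is_hom_power[OF is_hom_poly_eval[of x]]
      have Bx: "0 \<le> v (poly_eval b x)" if "b \<in> ?B" for b
        using that
        by induction (auto simp: ev g'x at_1 intro: ge_add mult_ge_0)
      \<comment> \<open>At a zero of \<open>P\<close> the relation becomes an integral equation for
        the value of \<open>G\<close>, with integral coefficients.\<close>
      have Gx: "0 \<le> v (poly_eval G x)"
      proof (rule root_integral)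
        show "poly_eval G x ^ e + poly_eval s x = 0"
          using x eqP by (metis ev(2,7))
        assume neg: "v (poly_eval G x) < 0"
        then obtain r where r: "v (poly_eval G x) = ereal r" "r < 0"
          using not_MInf[of "poly_eval G x"] by (cases "v (poly_eval G x)") auto
        show "ereal (real (e - 1)) * v (poly_eval G x) \<le> v (poly_eval s x)"
          using s
        proof induction
          case (step b t y)
          then obtain j where j: "j < e" "t = G ^ j" by auto
          then have "real (e - 1) * r \<le> real j * r"
            using r(2) by (intro mult_right_mono_neg) auto
          then have "ereal (real (e - 1)) * v (poly_eval G x) \<le> v (poly_eval t x)"
            using j r by (simp add: ev power)
          then show ?case
            unfolding ev by (intro ge_add ge_mult step Bx)
        qed (simp add: ev at_0)
      qed (rule e0)
      show ?thesis
        unfolding g_eq ev using g'x Gx z(1) by (intro ge_add mult_ge_0) auto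
    qed
    from IH obtain r h where rh: "\<forall>i. 0 \<le> w (h i)" "\<forall>i\<ge>r. h i = 0" "finite_over (coeff_ring h)"
      "\<forall>p. mvars p \<subseteq> {..<r} \<longrightarrow> peval Const h p \<in> P \<longrightarrow> p = 0"
      "\<forall>x. (\<forall>p\<in>P. poly_eval p x = 0) \<longrightarrow> (\<forall>i. 0 \<le> v (poly_eval (h i) x)) \<longrightarrow> (\<forall>i. 0 \<le> v (poly_eval (g' i) x))"
      by (elim exE conjE)
    have "\<forall>x. (\<forall>p\<in>P. poly_eval p x = 0) \<longrightarrow> (\<forall>i. 0 \<le> v (poly_eval (h i) x)) \<longrightarrow> (\<forall>i. 0 \<le> v (poly_eval (g i) x))"
      by (intro allI impI gx) (simp_all add: rh(5))
    with rh(1-4) show ?thesis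
      by (intro exI[of _ r] exI[of _ h] conjI)
  qed
qed

end

section \<open>The maximum principle for multiplicative semivaluations\<close>

lemma mvars_add: "mvars (p + q) \<subseteq> mvars p \<union> mvars (q :: ('i, 'k::comm_ring_1) mpoly)"
  unfolding mvars_def using Poly_Mapping.keys_add[of p q] by blast

lemma mvars_mult: "mvars (p * q) \<subseteq> mvars p \<union> mvars (q :: ('i, 'k::comm_ring_1) mpoly)"
proof
  fix i assume "i \<in> mvars (p * q)"
  then obtain \<gamma> where "\<gamma> \<in> Poly_Mapping.keys (p * q)" "i \<in> Poly_Mapping.keys \<gamma>"
    by (auto simp: mvars_def)
  moreover from this obtain \<alpha> \<beta> where "\<alpha> \<in> Poly_Mapping.keys p" "\<beta> \<in> Poly_Mapping.keys q" "\<gamma> = \<alpha> + \<beta>"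
    using keys_mult[of p q] by blast
  ultimately show "i \<in> mvars p \<union> mvars q"
    using Poly_Mapping.keys_add[of \<alpha> \<beta>] unfolding mvars_def by blast
qed

lemma mvars_single: "mvars (Poly_Mapping.single \<alpha> c) \<subseteq> Poly_Mapping.keys \<alpha>"
  by (simp add: mvars_def)

lemma is_subring_mvars: "is_subring {p :: ('i, 'k::comm_ring_1) mpoly. mvars p \<subseteq> V}"
proof -
  have "mvars (1 :: ('i, 'k) mpoly) \<subseteq> V"
    using mvars_single[of "0 :: 'i \<Rightarrow>\<^sub>0 nat" "1::'k"] by (simp add: single_one)
  moreover have "mvars (- p) = mvars p" for p :: "('i, 'k) mpoly"
    by (simp add: mvars_def)
  moreover have "mvars (p + q) \<subseteq> V" "mvars (p * q) \<subseteq> V"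
    if "mvars p \<subseteq> V" "mvars q \<subseteq> V" for p q :: "('i, 'k) mpoly"
    using mvars_add[of p q] mvars_mult[of p q] that by blast+
  ultimately show ?thesis
    unfolding is_subring_def by simp
qed

lemma smult_sum_right: "smult c (sum f A) = (\<Sum>i\<in>A. smult c (f i))"
  by (induction A rule: infinite_finite_induct) (simp_all add: smult_add_right)

context closed_valued_field
begin

text \<open>The coefficients divided by the leading one are symmetric functions of the roots, up to
  sign, hence integral; the induction splits off one root at a time.\<close>

lemma lead_le_coeff:
  fixes p :: "'k poly"
  assumes "p \<noteq> 0" "\<And>t. poly p t = 0 \<Longrightarrow> 0 \<le> v t"
  shows "v (lead_coeff p) \<le> v (coeff p i)"
  using assms
proof (induction "degree p" arbitrary: p i)
  case 0
  then obtain c where "p = [:c:]" by (metis degree_eq_zeroE)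
  then show ?case by (cases i) (auto simp: at_0)
next
  case (Suc n)
  then obtain a where a: "poly p a = 0"
    using alg_closed_imp_poly_has_root[of p] by auto
  then obtain q where q: "p = [:-a, 1:] * q"
    by (auto simp: poly_eq_0_iff_dvd)
  have q0: "q \<noteq> 0" using Suc.prems(1) q by auto
  then have deg: "degree q = n"
    using Suc(2) unfolding q by (subst (asm) degree_mult_eq) auto
  have IH: "v (lead_coeff q) \<le> v (coeff q j)" for j
    using Suc(1)[of q j] deg q0 Suc.prems(2) unfolding q by auto
  have lead: "lead_coeff p = lead_coeff q"
    unfolding q lead_coeff_mult by simp
  have "coeff p i = coeff (pCons 0 q) i - a * coeff q i"
    unfolding q by simp
  moreover have "v (lead_coeff q) \<le> v (coeff (pCons 0 q) i)"
    using IH by (cases i) (auto simp: at_0)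
  ultimately show ?case
    unfolding lead using ge_mult[of a] IH Suc.prems(2)[OF a] by (auto intro!: ge_diff)
qed

end

context graded_semivaluation
begin

lemma w_ge_mod_P: "x - y \<in> P \<Longrightarrow> c \<le> w y \<Longrightarrow> c \<le> w x"
  using w.ge_add[of c "x - y" y] by (simp add: P_def)

lemma gauss_le_w_peval:
  assumes "\<And>i. 0 \<le> w (h i)"
  shows "gauss p \<le> w (peval Const h p)"
proof -
  have "0 \<le> w (mon h \<alpha>)" for \<alpha>
    unfolding mon_def w.prod by (intro sum_nonneg w.power_ge_0 assms)
  then have "gauss p \<le> w (mon h \<alpha> * Const (Poly_Mapping.lookup p \<alpha>))" for \<alpha>
    using gauss_le[of p \<alpha>] by (intro w.ge_mult) (simp_all add: w_Const)
  then show ?thesis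
    unfolding peval_def by (intro w.ge_sum) (simp add: mult.commute)
qed

text \<open>
  \<open>Rel\<close> is the kernel of $K[h_1, \ldots, h_r][T] \to K[X] / P$, $T \mapsto f$, and \<open>q\<close> is an element
  of minimal degree.
\<close>

lemma point_bound:
  assumes h: "\<And>i. 0 \<le> w (h i)" "\<And>i. i \<ge> r \<Longrightarrow> h i = 0"
    and fin: "finite_over (coeff_ring h)"
    and indep: "\<And>p. mvars p \<subseteq> {..<r} \<Longrightarrow> peval Const h p \<in> P \<Longrightarrow> p = 0"
    and bound: "\<And>x. (\<And>p. p \<in> P \<Longrightarrow> poly_eval p x = 0) \<Longrightarrow> (\<And>i. 0 \<le> v (poly_eval (h i) x)) \<Longrightarrow>
       0 \<le> v (poly_eval f x)"
  shows "0 \<le> w f"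
proof -
  \<comment> \<open>\<open>V\<close> holds the polynomials in the first \<open>r\<close> variables,
    \<open>H\<close> substitutes the \<open>h i\<close> in them, and \<open>E\<close> moreover
    substitutes \<open>f\<close> for T.\<close>
  define V where "V = {p :: (nat, 'k) mpoly. mvars p \<subseteq> {..<r}}"
  define H where "H = peval Const h"
  define E where "E = ueval H f"
  have V: "is_subring V" unfolding V_def by (rule is_subring_mvars)
  note V = V is_subring_D[OF V]
  have VC: "Const c \<in> V" for c
    using mvars_single[of "0 :: nat \<Rightarrow>\<^sub>0 nat" c] by (simp add: V_def)
  have V_Var: "Var i \<in> V" if "i < r" for i
    using mvars_single[of "Poly_Mapping.single i (Suc 0)" "1::'k"] that by (auto simp: V_def split: if_splits)
  have H: "is_hom H" unfolding H_def by (rule is_hom_peval[OF is_hom_Const])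
  note H = H is_hom_D[OF H]
  have E: "is_hom E" unfolding E_def by (rule is_hom_ueval[OF H(1)])
  note E = E is_hom_D[OF E]
  have E_smult: "E (smult c s) = H c * E s" for c s
    unfolding E_def by (rule ueval_smult[OF H(1)])
  have E_pCons: "E (pCons c s) = H c + f * E s" for c s
    unfolding E_def by (rule ueval_pCons[OF H(1)])
  have E_monom: "E (monom c n) = H c * f ^ n" for c n
    unfolding E_def by (rule ueval_monom[OF H(1)])
  define VT where "VT = {s. \<forall>i. coeff s i \<in> V}"
  have VT: "is_subring VT"
    unfolding is_subring_def VT_def
    by (auto simp: coeff_mult intro!: V is_subring_sum[OF V(1)])
  note VT = VT is_subring_D[OF VT]
  have VT_monom: "monom c n \<in> VT" if "c \<in> V" for c n
    using that V by (simp add: VT_def)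
  have VT_smult: "smult c s \<in> VT" if "c \<in> V" "s \<in> VT" for c s
    using that V by (simp add: VT_def)
  have VT_pCons: "pCons c s \<in> VT" if "c \<in> V" "s \<in> VT" for c s
    using that by (auto simp: VT_def coeff_pCons split: nat.split)
  define Rel where "Rel = {s \<in> VT. E s \<in> P}"
  note PI = is_ideal_D[OF P_ideal]
  have Rel_add: "s + t \<in> Rel" if "s \<in> Rel" "t \<in> Rel" for s t
    using that VT PI by (simp add: Rel_def E)
  have Rel_diff: "s - t \<in> Rel" if "s \<in> Rel" "t \<in> Rel" for s t
    using that VT PI by (simp add: Rel_def E)
  have Rel_mult: "t * s \<in> Rel" if "s \<in> Rel" "t \<in> VT" for s t
    using that VT PI by (simp add: Rel_def E)
  have Rel_smult: "smult c s \<in> Rel" if "s \<in> Rel" "c \<in> V" for s c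
    using that VT_smult PI by (simp add: Rel_def E_smult)
  have Rel_0: "0 \<in> Rel"
    using VT PI by (simp add: Rel_def E)
  have Rel_sum: "sum g A \<in> Rel" if "\<And>j. j \<in> A \<Longrightarrow> g j \<in> Rel" for A :: "nat set" and g
    using that by (induction A rule: infinite_finite_induct) (auto intro: Rel_add Rel_0)
  have coeff_ring_elem: "\<exists>\<beta>\<in>V. b - H \<beta> \<in> P" if "b \<in> coeff_ring h" for b
    using that unfolding coeff_ring_def
  proof induction
    case (base x)
    then consider c where "x = Const c" | "x \<in> P" | i where "x = h i" by auto
    then show ?case
    proof cases
      case 1
      then show ?thesis using VC PI(1) by (intro bexI[of _ "Const c"]) (auto simp: H_def peval_single)
    next
      case 2
      then show ?thesis using V(3) by (intro bexI[of _ 0]) (auto simp: H)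
    next
      case 3
      show ?thesis
      proof (cases "i < r")
        case True
        then show ?thesis using 3 PI(1) V_Var
          by (intro bexI[of _ "Var i"]) (auto simp: H_def peval_single single_one)
      next
        case False
        then show ?thesis using 3 PI(1) V(3) h(2) by (intro bexI[of _ 0]) (auto simp: H)
      qed
    qed
  next
    case one
    then show ?case using V(2) PI(1) by (intro bexI[of _ 1]) (auto simp: H)
  next
    case (minus x)
    then obtain \<beta> where "\<beta> \<in> V" "x - H \<beta> \<in> P" by blast
    then show ?case using V(4) PI(5)[of "x - H \<beta>"] by (intro bexI[of _ "- \<beta>"]) (auto simp: H)
  next
    case (add x y)
    then obtain \<beta> \<gamma> where *: "\<beta> \<in> V" "x - H \<beta> \<in> P" "\<gamma> \<in> V" "y - H \<gamma> \<in> P" by blast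
    then show ?case using V(5) PI(2)[OF *(2,4)] by (intro bexI[of _ "\<beta> + \<gamma>"]) (auto simp: H algebra_simps)
  next
    case (mult x y)
    then obtain \<beta> \<gamma> where *: "\<beta> \<in> V" "x - H \<beta> \<in> P" "\<gamma> \<in> V" "y - H \<gamma> \<in> P" by blast
    have "x * y - H (\<beta> * \<gamma>) = y * (x - H \<beta>) + H \<beta> * (y - H \<gamma>)"
      by (simp add: H algebra_simps)
    also have "\<dots> \<in> P" using * PI by blast
    finally show ?case using * V(6) by blast
  qed
  \<comment> \<open>A monic element of \<open>Rel\<close>: the integral equation of \<open>f\<close>
    with its coefficients lifted to \<open>V\<close>. Nothing is known about their values.\<close>
  obtain M s0 where s0: "s0 \<in> VT" "monom 1 M - s0 \<in> Rel" "\<And>i. i \<ge> M \<Longrightarrow> coeff s0 i = 0"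
  proof -
    obtain M b where b: "f ^ M = (\<Sum>j<M. b j * f ^ j)" "\<And>j. b j \<in> coeff_ring h"
      using integral_overE[OF finite_over_integral[OF coeff_ring(1) fin] coeff_ring(1)] by metis
    have "\<forall>j. \<exists>\<beta>. \<beta> \<in> V \<and> b j - H \<beta> \<in> P"
      using coeff_ring_elem b(2) by blast
    from choice[OF this] obtain \<beta> where \<beta>: "\<And>j. \<beta> j \<in> V" "\<And>j. b j - H (\<beta> j) \<in> P"
      by blast
    let ?s = "\<Sum>j<M. monom (\<beta> j) j"
    have s: "?s \<in> VT" using VT_monom \<beta>(1) by (intro is_subring_sum[OF VT(1)]) auto
    have "E (monom 1 M - ?s) = (\<Sum>j<M. (b j - H (\<beta> j)) * f ^ j)"
      by (simp add: E is_hom_sum[OF E(1)] E_monom H b(1) sum_subtractf left_diff_distrib)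
    also have "\<dots> \<in> P" using \<beta>(2) PI by (intro is_ideal_sum[OF P_ideal]) blast
    finally have "monom 1 M - ?s \<in> Rel"
      using s VT_monom[OF V(2)] VT(7) by (auto simp: Rel_def)
    moreover have "coeff ?s i = 0" if "i \<ge> M" for i
      using that by (auto simp: coeff_sum intro!: sum.neutral)
    ultimately show ?thesis using that s by blast
  qed
  have "\<exists>s. s \<in> Rel \<and> s \<noteq> 0"
  proof (intro exI conjI)
    show "monom 1 M - s0 \<noteq> 0"
      using s0(3)[of M] by (auto dest!: arg_cong[where f = "\<lambda>p. coeff p M"])
  qed (rule s0)
  then obtain q0 where q0: "q0 \<in> Rel" "q0 \<noteq> 0" "\<And>s. s \<in> Rel \<Longrightarrow> s \<noteq> 0 \<Longrightarrow> degree q0 \<le> degree s"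
    using ex_has_least_nat[of "\<lambda>s. s \<in> Rel \<and> s \<noteq> 0" _ degree] by metis
  \<comment> \<open>Scaling by a constant gives the leading coefficient Gauss value 0; it may still
    be a nonconstant polynomial.\<close>
  obtain q where q: "q \<in> Rel" "q \<noteq> 0" "\<And>s. s \<in> Rel \<Longrightarrow> s \<noteq> 0 \<Longrightarrow> degree q \<le> degree s" "gauss (lead_coeff q) = 0"
  proof -
    have "lead_coeff q0 \<noteq> 0" using q0(2) by simp
    then obtain \<alpha> where \<alpha>: "Poly_Mapping.lookup (lead_coeff q0) \<alpha> \<noteq> 0"
        "gauss (lead_coeff q0) = v (Poly_Mapping.lookup (lead_coeff q0) \<alpha>)"
      by (rule gauss_attained)
    define c where "c = inverse (Poly_Mapping.lookup (lead_coeff q0) \<alpha>)"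
    have "gauss (Const c * lead_coeff q0) = v c + v (Poly_Mapping.lookup (lead_coeff q0) \<alpha>)"
      by (simp add: gauss.mult gauss_single \<alpha>(2))
    also have "\<dots> = 0" using \<alpha>(1) at_1 by (simp add: mult[symmetric] c_def)
    finally have g: "gauss (Const c * lead_coeff q0) = 0" .
    then have nz: "Const c * lead_coeff q0 \<noteq> 0" by auto
    have deg: "degree (smult (Const c) q0) = degree q0"
      using nz degree_smult_le[of "Const c" q0] by (intro antisym le_degree) auto
    have "smult (Const c) q0 \<noteq> 0" using nz by (metis coeff_smult coeff_0)
    then show ?thesis
      using that[of "smult (Const c) q0"] Rel_smult[OF q0(1) VC] q0(3) deg g by simp
  qed
  define n where "n = degree q"
  define a where "a = lead_coeff q"
  have a: "a \<in> V" "a \<noteq> 0" "gauss a = 0" "coeff q n = a"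
    using q by (auto simp: a_def n_def Rel_def VT_def)
  have min: "s = 0" if "s \<in> Rel" "\<And>i. i \<ge> n \<Longrightarrow> coeff s i = 0" for s
  proof (rule ccontr)
    assume "s \<noteq> 0"
    then have "degree s \<ge> n" using q(3) that(1) by (simp add: n_def)
    then show False using that(2) \<open>s \<noteq> 0\<close> leading_coeff_0_iff by blast
  qed
  have n0: "n > 0"
  proof (rule ccontr)
    assume "\<not> n > 0"
    then obtain c where "q = [:c:]" by (auto simp: n_def elim: degree_eq_zeroE)
    then have "q = [:a:]" by (simp add: a_def)
    then have "H a \<in> P" using q(1) by (simp add: Rel_def E_pCons E)
    then show False using indep[of a] a by (simp add: V_def H_def)
  qed
  \<comment> \<open>A specialization \<open>y\<close> of the \<open>h i\<close> together with a root
    \<open>\<tau>\<close> of the specialized \<open>q\<close> is realized at a zero of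
    \<open>P\<close>. Evaluation at (y, \<tau>) factors through the subring \<open>B\<close>
    generated by the \<open>h i\<close>, \<open>f\<close> and \<open>P\<close>; its kernel
    \<open>M\<close> extends to a proper ideal of K[X] because K[X] is finite over \<open>B\<close>,
    and that ideal has a point.\<close>
  have point: "\<exists>x. (\<forall>p\<in>P. poly_eval p x = 0) \<and> (\<forall>i<r. poly_eval (h i) x = y i) \<and> poly_eval f x = \<tau>"
    if E'q: "ueval (peval (\<lambda>c. c) y) \<tau> q = 0" and ay: "peval (\<lambda>c. c) y a \<noteq> 0" for y \<tau>
  proof -
    define E' where "E' = ueval (peval (\<lambda>c. c) y) \<tau>"
    have Y: "is_hom (peval (\<lambda>c. c) y)" by (rule is_hom_peval[OF is_hom_id])
    have E': "is_hom E'" unfolding E'_def by (rule is_hom_ueval[OF Y])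
    note E' = E' is_hom_D[OF E']
    \<comment> \<open>Pseudo-division by \<open>q\<close>: multiplication by \<open>a\<close>, which
      does not vanish at \<open>y\<close>, allows the degree to be lowered within
      \<open>Rel\<close>, and below degree \<open>n\<close> only 0 is left.\<close>
    have vanish: "E' s = 0" if "s \<in> Rel" for s
      using that
    proof (induction "degree s" arbitrary: s rule: less_induct)
      case less
      show ?case
      proof (cases "degree s < n")
        case True
        then have "s = 0" using less.prems by (intro min) (auto intro: coeff_eq_0)
        then show ?thesis by (simp add: E')
      next
        case False
        define k where "k = degree s"
        define t where "t = smult a s - monom (lead_coeff s) (k - n) * q"
        have t_Rel: "t \<in> Rel"
          unfolding t_def using less.prems a(1) q(1)
          by (intro Rel_diff Rel_smult Rel_mult VT_monom) (auto simp: Rel_def VT_def)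
        have "degree (monom (lead_coeff s) (k - n) * q) \<le> (k - n) + n"
          using degree_mult_le[of "monom (lead_coeff s) (k - n)" q] degree_monom_le[of "lead_coeff s" "k - n"]
          by (simp add: n_def)
        then have "degree t \<le> k"
          unfolding t_def using False degree_smult_le[of a s] by (intro degree_diff_le) (auto simp: k_def)
        moreover have "coeff t k = 0"
        proof -
          have "coeff (monom (lead_coeff s) (k - n) * q) k = lead_coeff s * a"
            using False a(4) by (subst coeff_monom_mult) (simp add: k_def)
          then show ?thesis by (simp add: t_def k_def mult.commute)
        qed
        moreover have "k > 0" using False n0 by (simp add: k_def)
        ultimately have "degree t < k"
          by (metis coeff_0_degree_minus_1 degree_0 diff_less le_neq_implies_less leading_coeff_0_iff zero_less_one)
        then have "E' t = 0" using less(1)[of t] t_Rel by (simp add: k_def)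
        then have "peval (\<lambda>c. c) y a * E' s = 0"
          using E'q by (simp add: t_def E' E'_def ueval_smult[OF Y] ueval_mult[OF Y] is_hom_D[OF is_hom_ueval[OF Y]])
        then show ?thesis using ay by simp
      qed
    qed
    define B where "B = {E s + p |s p. s \<in> VT \<and> p \<in> P}"
    define M where "M = {E s + p |s p. s \<in> VT \<and> p \<in> P \<and> E' s = 0}"
    have BI: "E s + p \<in> B" if "s \<in> VT" "p \<in> P" for s p using that by (auto simp: B_def)
    have MI: "E s + p \<in> M" if "s \<in> VT" "p \<in> P" "E' s = 0" for s p using that by (auto simp: M_def)
    have mult_eq: "(E s + p) * (E t + u) = E (s * t) + ((E s + p) * u + E t * p)" for s t p u
      by (simp add: E algebra_simps)
    have add_eq: "(E s + p) + (E t + u) = E (s + t) + (p + u)" for s t p u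
      by (simp add: E)
    have B: "is_subring B"
      unfolding is_subring_def
    proof (intro conjI ballI)
      show "1 \<in> B" using BI[of 1 0] VT PI(1) by (simp add: E)
      fix x assume "x \<in> B"
      then obtain s p where x: "x = E s + p" "s \<in> VT" "p \<in> P" by (auto simp: B_def)
      have "- x = E (- s) + (- p)" using x by (simp add: E)
      then show "- x \<in> B" using x VT(4) PI(5) BI by metis
      fix y assume "y \<in> B"
      then obtain t u where y: "y = E t + u" "t \<in> VT" "u \<in> P" by (auto simp: B_def)
      show "x + y \<in> B" unfolding x(1) y(1) add_eq using x y VT PI by (intro BI) auto
      show "x * y \<in> B" unfolding x(1) y(1) mult_eq using x y VT PI by (intro BI) auto
    qed
    have B_f: "coeff_ring h \<subseteq> B"
    proof
      fix b assume "b \<in> coeff_ring h"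
      then obtain \<beta> where "\<beta> \<in> V" "b - H \<beta> \<in> P" using coeff_ring_elem by blast
      then have "E [:\<beta>:] + (b - H \<beta>) \<in> B" using VT_pCons VT(3) by (intro BI) auto
      then show "b \<in> B" by (simp add: E_pCons E)
    qed
    have fin_B: "finite_over B" using finite_over_mono[OF B_f fin] .
    then obtain S where S: "finite S" "lin_span B S = UNIV" by (auto simp: finite_over_def)
    have M_mult: "b * m \<in> M" if m: "m \<in> M" and b: "b \<in> B" for m b
    proof -
      obtain s p where b: "b = E s + p" "s \<in> VT" "p \<in> P" using b by (auto simp: B_def)
      obtain t u where m: "m = E t + u" "t \<in> VT" "u \<in> P" "E' t = 0" using m by (auto simp: M_def)
      show ?thesis unfolding b(1) m(1) mult_eq using m b VT PI by (intro MI) (auto simp: E')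
    qed
    define J where "J = lin_span M S"
    have J: "is_ideal J" "M \<subseteq> J"
      unfolding J_def using span_of_ideal[OF S(2) M_mult] by auto
    have "1 \<notin> J"
      unfolding J_def
    proof (rule extended_ideal_proper[OF B S _ _ M_mult])
      show "0 \<in> M" using MI[of 0 0] VT PI(1) by (simp add: E E')
      show "M \<subseteq> B" by (auto simp: M_def B_def)
      show "x + y \<in> M" if "x \<in> M" "y \<in> M" for x y
      proof -
        obtain s p where x: "x = E s + p" "s \<in> VT" "p \<in> P" "E' s = 0" using \<open>x \<in> M\<close> by (auto simp: M_def)
        obtain t u where y: "y = E t + u" "t \<in> VT" "u \<in> P" "E' t = 0" using \<open>y \<in> M\<close> by (auto simp: M_def)
        show ?thesis unfolding x(1) y(1) add_eq using x y VT PI by (intro MI) (auto simp: E')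
      qed
      \<comment> \<open>If 1 = E s + p, then 1 - s is in \<open>Rel\<close>, and
        \<open>vanish\<close> gives E' s = 1.\<close>
      show "1 \<notin> M"
      proof
        assume "1 \<in> M"
        then obtain s p where s: "1 = E s + p" "s \<in> VT" "p \<in> P" "E' s = 0" by (auto simp: M_def)
        then have "E (1 - s) = p" by (simp add: E diff_eq_eq add.commute)
        then have "1 - s \<in> Rel" using s VT by (auto simp: Rel_def)
        from vanish[OF this] show False using s(4) by (simp add: E')
      qed
    qed
    \<comment> \<open>Every element of \<open>B\<close> is a constant modulo \<open>M\<close>, so an
      integral equation over \<open>B\<close> becomes an equation over K modulo
      \<open>J\<close>.\<close>
    have "\<exists>p. p \<noteq> 0 \<and> ueval Const (Var i) p \<in> J" for i
    proof -
      let ?g = "Var i :: ('n, 'k) mpoly"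
      obtain e b where b: "?g ^ e = (\<Sum>j<e. b j * ?g ^ j)" "\<And>j. b j \<in> B"
        using integral_overE[OF finite_over_integral[OF B fin_B] B, of ?g] by metis
      have "\<exists>c. x - Const c \<in> M" if x: "x \<in> B" for x
      proof -
        obtain s p where s: "x = E s + p" "s \<in> VT" "p \<in> P" using x by (auto simp: B_def)
        have C: "[:Const (E' s):] \<in> VT" using VT_pCons VC VT(3) by blast
        have "E (s - [:Const (E' s):]) + p \<in> M"
          using s C VT by (intro MI) (auto simp: E' E'_def ueval_pCons[OF Y] peval_single is_hom_D[OF is_hom_ueval[OF Y]] is_hom_D[OF Y])
        then show ?thesis
          using s by (intro exI[of _ "E' s"]) (simp add: E E_pCons H_def peval_single algebra_simps)
      qed
      then have "\<forall>j. \<exists>c. b j - Const c \<in> M" using b(2) by blast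
      from choice[OF this] obtain c where c: "\<And>j. b j - Const (c j) \<in> M" by blast
      let ?p = "monom 1 e - (\<Sum>j<e. monom (c j) j)"
      have "coeff ?p e = 1"
        by (auto simp: coeff_sum intro!: sum.neutral)
      then have "?p \<noteq> 0" by (metis coeff_0 zero_neq_one)
      moreover have "ueval Const ?g ?p = (\<Sum>j<e. (b j - Const (c j)) * ?g ^ j)"
        using b(1) by (simp add: is_hom_D[OF is_hom_ueval[OF is_hom_Const]] is_hom_sum[OF is_hom_ueval[OF is_hom_Const]]
            ueval_monom[OF is_hom_Const] single_one sum_subtractf left_diff_distrib)
      moreover have "\<dots> \<in> J" using c J by (intro is_ideal_sum[OF J(1)] is_ideal_D(4)[OF J(1)]) auto
      ultimately show ?thesis by metis
    qed
    then obtain x where x: "\<And>p. p \<in> J \<Longrightarrow> poly_eval p x = 0"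
      using proper_ideal_point[OF J(1) \<open>1 \<notin> J\<close>] by blast
    have "p \<in> J" if "p \<in> P" for p
      using MI[of 0 p] that VT J(2) by (auto simp: E E')
    moreover have "h i - Const (y i) \<in> J" if "i < r" for i
    proof -
      have "E [:Var i - Const (y i):] + 0 \<in> M"
      proof (intro MI PI VT_pCons V VT VC V_Var that)
        show "E' [:Var i - Const (y i):] = 0"
          by (simp add: E'_def ueval_pCons[OF Y] is_hom_D[OF Y] peval_single is_hom_D[OF is_hom_ueval[OF Y]])
      qed
      then show ?thesis
        using J(2) by (auto simp: E_pCons E H) (auto simp: H_def peval_single single_one)
    qed
    moreover have "f - Const \<tau> \<in> J"
    proof -
      have "E [:- Const \<tau>, 1:] + 0 \<in> M"
      proof (intro MI PI VT_pCons V VT VC)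
        show "E' [:- Const \<tau>, 1:] = 0"
          by (simp add: E'_def ueval_pCons[OF Y] is_hom_D[OF Y] peval_single is_hom_D[OF is_hom_ueval[OF Y]])
      qed
      then show ?thesis
        using J(2) by (auto simp: E_pCons E H) (auto simp: H_def peval_single single_one)
    qed
    ultimately show ?thesis
      using x[of "f - Const \<tau>"] x[of "h i - Const (y i)" for i] x
      by (intro exI[of _ x]) (auto simp: poly_eval_simps)
  qed
  \<comment> \<open>At a \<open>y\<close> generic for all coefficients of \<open>q\<close>, the
    roots of the specialized polynomial are values of \<open>f\<close> at admissible points, hence
    integral. So the leading coefficient, of value 0, has the least value among the
    coefficients.\<close>
  have coeff_q: "0 \<le> gauss (coeff q i)" for i
  proof -
    let ?Q = "coeff q ` {..n} - {0}"
    obtain y where y: "\<And>i. v (y i) = 0" "\<And>p. p \<in> ?Q \<Longrightarrow> v (peval (\<lambda>c. c) y p) = gauss p"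
      by (rule generic_point[of ?Q]) auto
    have Y: "is_hom (peval (\<lambda>c. c) y)" by (rule is_hom_peval[OF is_hom_id])
    have yq: "v (peval (\<lambda>c. c) y (coeff q i)) = gauss (coeff q i)" for i
      using y(2)[of "coeff q i"] coeff_eq_0[of q i] by (cases "i \<le> n"; cases "coeff q i = 0") (auto simp: at_0 n_def)
    have ya: "peval (\<lambda>c. c) y a \<noteq> 0"
      using yq[of n] a(3,4) at_0 by auto
    define p where "p = map_poly (peval (\<lambda>c. c) y) q"
    have cp: "coeff p i = peval (\<lambda>c. c) y (coeff q i)" for i
      by (simp add: p_def coeff_map_poly)
    have deg: "degree p = n"
      using ya a(4) by (intro antisym le_degree degree_le) (auto simp: cp n_def coeff_eq_0)
    have "v (lead_coeff p) \<le> v (coeff p i)"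
    proof (rule lead_le_coeff)
      show "p \<noteq> 0" using ya a(4) cp[of n] by auto
      fix \<tau> assume "poly p \<tau> = 0"
      then have "ueval (peval (\<lambda>c. c) y) \<tau> q = 0"
        by (simp add: poly_altdef ueval_def deg cp n_def)
      then obtain x where x: "\<And>p. p \<in> P \<Longrightarrow> poly_eval p x = 0" "\<And>i. i < r \<Longrightarrow> poly_eval (h i) x = y i"
          "poly_eval f x = \<tau>"
        using point ya by blast
      have "0 \<le> v (poly_eval (h i) x)" for i
        using x(2)[of i] h(2)[of i] y(1) by (cases "i < r") (auto simp: poly_eval_simps at_0)
      then show "0 \<le> v \<tau>" using bound x by blast
    qed
    then show ?thesis using yq[of n] yq[of i] a(3,4) by (simp add: deg cp)
  qed
  have gauss_1: "gauss (1 :: (nat, 'k) mpoly) = 0" by (rule gauss.at_1)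
  have q_VT: "q \<in> VT" using q(1) by (simp add: Rel_def)
  \<comment> \<open>Pseudo-division of T^N by \<open>q\<close>: the remainder keeps integral
    coefficients by \<open>coeff_q\<close>, but the power of \<open>a\<close> grows with
    \<open>N\<close>.\<close>
  have "\<exists>s\<in>VT. (\<forall>i\<ge>n. coeff s i = 0) \<and> (\<forall>i. 0 \<le> gauss (coeff s i)) \<and> smult (a ^ N) (monom 1 N) - s \<in> Rel" for N
  proof (induction N)
    case 0
    show ?case
      using VT Rel_0 n0 gauss_1 by (intro bexI[of _ 1]) (auto simp: one_pCons monom_0 coeff_pCons split: nat.split)
  next
    case (Suc N)
    then obtain s where s: "s \<in> VT" "\<And>i. i \<ge> n \<Longrightarrow> coeff s i = 0" "\<And>i. 0 \<le> gauss (coeff s i)"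
        "smult (a ^ N) (monom 1 N) - s \<in> Rel" by blast
    define c where "c = coeff s (n - 1)"
    have c: "c \<in> V" "0 \<le> gauss c" using s by (auto simp: c_def VT_def)
    let ?s = "smult a (pCons 0 s) - smult c q"
    have "?s \<in> VT" by (intro VT(7) VT_smult VT_pCons V(3) a(1) s(1) c(1) q_VT)
    moreover have "coeff ?s i = 0" if "i \<ge> n" for i
    proof (cases "i = n")
      case True
      then show ?thesis using n0 a(4) by (cases n) (auto simp: c_def mult.commute)
    next
      case False
      then show ?thesis using that s(2) coeff_eq_0[of q i] n0 by (cases i) (auto simp: n_def)
    qed
    moreover have "0 \<le> gauss (coeff ?s i)" for i
    proof -
      have "0 \<le> gauss (coeff (pCons 0 s) i)" using s(3) by (cases i) auto
      then show ?thesis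
        using coeff_q[of i] c(2) a(3) by (simp only: coeff_diff coeff_smult) (intro gauss.ge_diff gauss.mult_ge_0, auto)
    qed
    moreover have "smult (a ^ Suc N) (monom 1 (Suc N)) - ?s =
        smult a ([:0, 1:] * (smult (a ^ N) (monom 1 N) - s)) + smult c q"
      by (simp add: monom_Suc smult_diff_right)
    moreover have "[:0, 1:] \<in> VT" by (intro VT_pCons VT V)
    ultimately show ?case
      using Rel_add[OF Rel_smult[OF Rel_mult[OF s(4)] a(1)] Rel_smult[OF q(1) c(1)]] by metis
  qed
  then obtain \<sigma> where \<sigma>: "\<And>N. \<sigma> N \<in> VT" "\<And>N i. i \<ge> n \<Longrightarrow> coeff (\<sigma> N) i = 0"
      "\<And>N i. 0 \<le> gauss (coeff (\<sigma> N) i)" "\<And>N. smult (a ^ N) (monom 1 N) - \<sigma> N \<in> Rel"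
    by metis
  have V_pow: "a ^ k \<in> V" for k using is_subring_power[OF V(1) a(1)] .
  \<comment> \<open>Division by the monic relation needs no power of \<open>a\<close>, but it loses
    control of the values and leaves degree below \<open>M\<close> instead of
    \<open>n\<close>.\<close>
  have reduce: "\<exists>d\<in>VT. (\<forall>i\<ge>M. coeff d i = 0) \<and> monom 1 N - d \<in> Rel" for N
  proof (induction N)
    case 0
    show ?case
    proof (cases "M = 0")
      case True
      then have "s0 = 0" using s0(3) by (intro poly_eqI) auto
      then have "monom 1 0 - 0 \<in> Rel" using s0(2) True by simp
      then show ?thesis using VT(3) by (intro bexI[of _ 0]) auto
    next
      case False
      then show ?thesis
        using Rel_0 VT_monom[OF V(2), of 0] by (intro bexI[of _ "monom 1 0"]) auto
    qed
  next
    case (Suc N)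
    then obtain d where d: "d \<in> VT" "\<And>i. i \<ge> M \<Longrightarrow> coeff d i = 0" "monom 1 N - d \<in> Rel" by blast
    define c where "c = coeff (pCons 0 d) M"
    have cV: "c \<in> V" using VT_pCons[OF V(3) d(1)] by (simp add: c_def VT_def)
    let ?d = "pCons 0 d - smult c (monom 1 M - s0)"
    have dM: "coeff (pCons 0 d) i = 0" if "i > M" for i using that d(2) by (cases i) auto
    have "?d \<in> VT"
      by (intro VT(7) VT_smult VT_pCons VT_monom V d(1) cV s0(1))
    moreover have "coeff ?d i = 0" if "i \<ge> M" for i
      using that s0(3) dM[of i] by (cases "i = M") (auto simp: c_def)
    moreover have "monom 1 (Suc N) - ?d = [:0, 1:] * (monom 1 N - d) + smult c (monom 1 M - s0)"
      by (simp add: monom_Suc)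
    moreover have "[:0, 1:] \<in> VT" by (intro VT_pCons VT V)
    ultimately show ?case
      using Rel_add[OF Rel_mult[OF d(3)] Rel_smult[OF s0(2) cV]] by metis
  qed
  \<comment> \<open>Combining the two divisions gives integral remainders of degree below
    \<open>n\<close> with the fixed power a^M.\<close>
  have bounded: "\<exists>e. (\<forall>i\<ge>n. coeff e i = 0) \<and> (\<forall>i. 0 \<le> gauss (coeff e i)) \<and> smult (a ^ M) (monom 1 N) - e \<in> Rel" for N
  proof -
    obtain d where d: "d \<in> VT" "\<And>i. i \<ge> M \<Longrightarrow> coeff d i = 0" "monom 1 N - d \<in> Rel" using reduce by blast
    define e where "e = (\<Sum>j<M. smult (coeff d j * a ^ (M - j)) (\<sigma> j))"
    have dV: "coeff d j * a ^ (M - j) \<in> V" for j using d(1) V_pow V by (simp add: VT_def)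
    have d_eq: "d = (\<Sum>j<M. smult (coeff d j) (monom 1 j))"
    proof (rule poly_eqI)
      fix i
      have "coeff (\<Sum>j<M. smult (coeff d j) (monom 1 j)) i = (\<Sum>j<M. if j = i then coeff d j else 0)"
        unfolding coeff_sum by (intro sum.cong) auto
      then show "coeff d i = coeff (\<Sum>j<M. smult (coeff d j) (monom 1 j)) i"
        using d(2)[of i] by auto
    qed
    have "smult (a ^ M) d - e = (\<Sum>j<M. smult (coeff d j * a ^ (M - j)) (smult (a ^ j) (monom 1 j) - \<sigma> j))"
    proof -
      have "smult (a ^ M) d = (\<Sum>j<M. smult (coeff d j * a ^ (M - j)) (smult (a ^ j) (monom 1 j)))"
        by (subst d_eq) (auto simp: smult_sum_right mult_ac power_add[symmetric] intro!: sum.cong)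
      then show ?thesis by (simp add: e_def sum_subtractf smult_diff_right)
    qed
    also have "\<dots> \<in> Rel"
      by (rule Rel_sum) (intro Rel_smult \<sigma>(4) dV)
    finally have "smult (a ^ M) d - e \<in> Rel" .
    moreover have "smult (a ^ M) (monom 1 N) - e = smult (a ^ M) (monom 1 N - d) + (smult (a ^ M) d - e)"
      by (simp add: smult_diff_right)
    ultimately have eR: "smult (a ^ M) (monom 1 N) - e \<in> Rel"
      using Rel_add Rel_smult[OF d(3) V_pow] by metis
    have en: "coeff e i = 0" if "i \<ge> n" for i
      using \<sigma>(2)[OF that] by (simp add: e_def coeff_sum)
    \<comment> \<open>Both are remainders of a^(M+N) * T^N of degree below \<open>n\<close>, so
      minimality of \<open>q\<close> makes them equal; as \<open>a\<close> has Gauss value 0,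
      \<open>e\<close> inherits the integrality of \<open>\<sigma> N\<close>.\<close>
    have "smult (a ^ N) e - smult (a ^ M) (\<sigma> N) =
       smult (a ^ M) (smult (a ^ N) (monom 1 N) - \<sigma> N) - smult (a ^ N) (smult (a ^ M) (monom 1 N) - e)"
      by (simp add: smult_diff_right mult.commute)
    also have "\<dots> \<in> Rel" using Rel_diff Rel_smult V_pow \<sigma>(4) eR by blast
    finally have "smult (a ^ N) e - smult (a ^ M) (\<sigma> N) = 0"
      using en \<sigma>(2) by (intro min) auto
    then have "a ^ N * coeff e i = a ^ M * coeff (\<sigma> N) i" for i
      by (metis coeff_smult eq_iff_diff_eq_0)
    then have "gauss (a ^ N) + gauss (coeff e i) = gauss (a ^ M) + gauss (coeff (\<sigma> N) i)" for i
      by (metis gauss.mult)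
    then have "gauss (coeff e i) = gauss (coeff (\<sigma> N) i)" for i
      by (simp add: gauss.power a(3))
    then show ?thesis using en \<sigma>(3) eR by metis
  qed
  show ?thesis
  proof (rule ccontr)
    assume "\<not> 0 \<le> w f"
    then obtain \<rho> where \<rho>: "w f = ereal \<rho>" "\<rho> < 0"
      using w.not_MInf[of f] by (cases "w f") auto
    have "H a \<notin> P" using indep[of a] a by (auto simp: V_def H_def)
    then obtain A where A: "w (H a) = ereal A"
      using w.not_MInf[of "H a"] by (cases "w (H a)") (auto simp: P_def)
    \<comment> \<open>The lower bound for \<open>E e\<close> does not depend on \<open>N\<close>,
      because its degree in \<open>f\<close> is below \<open>n\<close>; the value of H a ^ M * f ^ N
      falls linearly in \<open>N\<close>.\<close>
    have le: "real n * \<rho> \<le> real M * A + real N * \<rho>" for N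
    proof -
      obtain e where e: "\<And>i. i \<ge> n \<Longrightarrow> coeff e i = 0" "\<And>i. 0 \<le> gauss (coeff e i)"
          "smult (a ^ M) (monom 1 N) - e \<in> Rel" using bounded by blast
      have "H a ^ M * f ^ N - E e \<in> P"
        using e(3) by (simp add: Rel_def E E_smult E_monom H is_hom_power[OF H(1)])
      moreover have "ereal (real n * \<rho>) \<le> w (E e)"
        unfolding E_def ueval_def
      proof (rule w.ge_sum)
        fix i
        show "ereal (real n * \<rho>) \<le> w (H (coeff e i) * f ^ i)"
        proof (cases "i \<ge> n")
          case False
          then have "real n * \<rho> \<le> real i * \<rho>" using \<rho>(2) by (intro mult_right_mono_neg) auto
          then have "ereal (real n * \<rho>) \<le> w (f ^ i)" using \<rho>(1) by (simp add: w.power)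
          moreover have "0 \<le> w (H (coeff e i))"
            using gauss_le_w_peval[OF h(1), of "coeff e i"] e(2) unfolding H_def by (rule order_trans[rotated])
          ultimately show ?thesis by (intro w.ge_mult)
        qed (simp add: e(1) H w.at_0)
      qed
      ultimately have "ereal (real n * \<rho>) \<le> w (H a ^ M * f ^ N)"
        by (rule w_ge_mod_P)
      then show ?thesis by (simp add: w.mult w.power A \<rho>(1))
    qed
    obtain N where "real M * A - real n * \<rho> < real N * (- \<rho>)"
      using reals_Archimedean3[of "- \<rho>"] \<rho>(2) by auto
    then show False using le[of N] by simp
  qed
qed

end

section \<open>The maximum principle for sub-valuations\<close>

lemma ereal_2_mult: "2 * (x :: ereal) = x + x"
proof -
  have "(2 :: ereal) = ereal 2" by simp
  then show ?thesis by (cases x) auto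
qed

context closed_valued_field
begin

text \<open>Sub-valuations on K[W] are treated as functions on K[X] that take the value \<infinity>
  on the vanishing ideal.\<close>

definition subval :: "(('n, 'k) mpoly \<Rightarrow> ereal) \<Rightarrow> bool" where
  "subval u \<longleftrightarrow> (\<forall>p. u p \<noteq> -\<infinity>) \<and> (\<forall>p q. u p + u q \<le> u (p * q)) \<and> (\<forall>p. u (p * p) = 2 * u p) \<and>
     (\<forall>p q. min (u p) (u q) \<le> u (p + q)) \<and> u 0 = \<infinity> \<and> (\<forall>c. v c \<le> u (Const c))"

lemma subval_D:
  assumes "subval u"
  shows "u p \<noteq> -\<infinity>" "u p + u q \<le> u (p * q)" "u (p * p) = 2 * u p" "min (u p) (u q) \<le> u (p + q)"
    "u 0 = \<infinity>" "v c \<le> u (Const c)"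
  using assms by (auto simp: subval_def)

lemma subval_ge_sum:
  assumes "subval u" "\<And>i. i \<in> A \<Longrightarrow> c \<le> u (f i)"
  shows "c \<le> u (sum f A)"
proof -
  interpret ultrametric u by unfold_locales (use subval_D[OF assms(1)] in auto)
  show ?thesis using assms(2) by (rule ge_sum)
qed

text \<open>Applying submultiplicativity also to the inverse of \<open>c\<close> turns the
  inequality around.\<close>

lemma subval_Const_mult:
  assumes u: "subval u" and c: "c \<noteq> 0"
  shows "u (Const c * p) = v c + u p"
proof (rule antisym)
  obtain r where r: "v c = ereal r" using finiteE[OF c] .
  show "v c + u p \<le> u (Const c * p)"
    using add_mono[OF subval_D(6)[OF u, of c] order_refl, of "u p"] subval_D(2)[OF u] order_trans by blast
  have "v (inverse c) + u (Const c * p) \<le> u (Const (inverse c)) + u (Const c * p)"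
    by (intro add_mono subval_D(6)[OF u] order_refl)
  also have "\<dots> \<le> u (Const (inverse c) * (Const c * p))"
    by (rule subval_D(2)[OF u])
  also have "Const (inverse c) * (Const c * p) = p"
    using c by (simp add: mult.assoc[symmetric] mult_single single_one)
  finally show "u (Const c * p) \<le> v c + u p"
    using inverse[OF c] r by (cases "u (Const c * p)"; cases "u p") auto
qed

lemma subval_power_ge:
  assumes u: "subval u"
  shows "ereal (real (Suc k)) * u p \<le> u (p ^ Suc k)"
proof (induction k)
  case (Suc k)
  have "ereal (real (Suc (Suc k))) * u p = u p + ereal (real (Suc k)) * u p"
    using subval_D(1)[OF u, of p] by (cases "u p") (auto simp: algebra_simps)
  also have "\<dots> \<le> u p + u (p ^ Suc k)" using Suc by (intro add_left_mono)
  also have "\<dots> \<le> u (p * p ^ Suc k)" by (rule subval_D(2)[OF u])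
  finally show ?case by simp
qed simp

text \<open>Exactness on squares gives powers of two; any other power is squeezed by completing it
  to a power of two with a complementary factor.\<close>

lemma subval_power:
  assumes u: "subval u" and k: "k > 0"
  shows "u (p ^ k) = ereal (real k) * u p"
proof (rule antisym)
  show "ereal (real k) * u p \<le> u (p ^ k)"
    using subval_power_ge[OF u, of "k - 1" p] k by simp
  show "u (p ^ k) \<le> ereal (real k) * u p"
  proof (cases "u p = \<infinity>")
    case False
    then obtain r where r: "u p = ereal r" using subval_D(1)[OF u, of p] by (cases "u p") auto
    have pow2: "u (p ^ (2 ^ j)) = ereal (real (2 ^ j)) * u p" for j
    proof (induction j)
      case (Suc j)
      have "p ^ (2 ^ Suc j) = p ^ (2 ^ j) * p ^ (2 ^ j)" by (simp add: power_add[symmetric] mult_2)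
      then show ?case using Suc subval_D(3)[OF u, of "p ^ (2 ^ j)"] by (simp add: r)
    qed simp
    obtain j where j: "k < 2 ^ j" using less_exp by blast
    obtain l where l: "2 ^ j = k + Suc l" using j less_iff_Suc_add by auto
    have "u (p ^ k) + ereal (real (Suc l)) * u p \<le> u (p ^ k) + u (p ^ Suc l)"
      by (intro add_left_mono subval_power_ge u)
    also have "\<dots> \<le> u (p ^ k * p ^ Suc l)" by (rule subval_D(2)[OF u])
    also have "p ^ k * p ^ Suc l = p ^ (2 ^ j)" by (simp only: l power_add)
    also have "u (p ^ (2 ^ j)) = ereal (real k + real (Suc l)) * u p"
      using pow2[of j] by (simp only: l of_nat_add)
    finally show ?thesis
      using r subval_D(1)[OF u, of "p ^ k"] by (cases "u (p ^ k)") (auto simp: algebra_simps)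
  qed (use k in simp)
qed

text \<open>The axioms survive a directed supremum already if each holds after passing to a later
  index. This is used for localizations, for chains in Zorn's lemma and for eventual infima.\<close>

lemma subval_SUP:
  fixes \<Phi> :: "'i \<Rightarrow> ('n, 'k) mpoly \<Rightarrow> ereal"
  assumes "I \<noteq> {}" and "\<And>i a. i \<in> I \<Longrightarrow> \<Phi> i a \<noteq> -\<infinity>"
    and mult: "\<And>i j a b. i \<in> I \<Longrightarrow> j \<in> I \<Longrightarrow> \<exists>k\<in>I. \<Phi> i a + \<Phi> j b \<le> \<Phi> k (a * b)"
    and add: "\<And>i j a b. i \<in> I \<Longrightarrow> j \<in> I \<Longrightarrow> \<exists>k\<in>I. min (\<Phi> i a) (\<Phi> j b) \<le> \<Phi> k (a + b)"
    and sq: "\<And>i a. i \<in> I \<Longrightarrow> \<exists>k\<in>I. \<Phi> i (a * a) \<le> 2 * \<Phi> k a"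
    and zero: "\<exists>i\<in>I. \<Phi> i 0 = \<infinity>" and const: "\<And>c. \<exists>i\<in>I. v c \<le> \<Phi> i (Const c)"
  shows "subval (\<lambda>a. SUP i\<in>I. \<Phi> i a)"
proof -
  let ?s = "\<lambda>a. SUP i\<in>I. \<Phi> i a"
  have le: "x \<le> ?s a" if "\<exists>k\<in>I. x \<le> \<Phi> k a" for x a
    using that by (meson SUP_upper2)
  have M: "?s a + ?s b \<le> ?s (a * b)" for a b
  proof -
    have bM: "?s b \<noteq> -\<infinity>"
      using assms(1,2) le[of _ b] by (metis all_not_in_conv ereal_infty_less_eq(2) order_refl)
    have "\<Phi> i a + ?s b \<le> ?s (a * b)" if i: "i \<in> I" for i
    proof -
      have "\<Phi> i a + ?s b = (SUP j\<in>I. \<Phi> i a + \<Phi> j b)"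
        using SUP_ereal_add_right[OF assms(1) assms(2)[OF i]] by simp
      also have "\<dots> \<le> ?s (a * b)"
        using mult[OF i] by (intro SUP_least le) auto
      finally show ?thesis .
    qed
    then have "(SUP i\<in>I. \<Phi> i a + ?s b) \<le> ?s (a * b)" by (intro SUP_least)
    then show ?thesis using SUP_ereal_add_left[OF assms(1) bM] by simp
  qed
  show ?thesis
    unfolding subval_def
  proof (intro conjI allI M)
    show "?s p \<noteq> -\<infinity>" for p
      using assms(1,2) le[of _ p] by (metis all_not_in_conv ereal_infty_less_eq(2) order_refl)
    show "?s (p * p) = 2 * ?s p" for p
    proof (rule antisym)
      show "2 * ?s p \<le> ?s (p * p)" unfolding ereal_2_mult by (rule M)
      show "?s (p * p) \<le> 2 * ?s p"
      proof (rule SUP_least)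
        fix i assume "i \<in> I"
        then obtain k where k: "k \<in> I" "\<Phi> i (p * p) \<le> 2 * \<Phi> k p" using sq by blast
        note k(2)
        also have "2 * \<Phi> k p \<le> 2 * ?s p"
          unfolding ereal_2_mult using k(1) by (intro add_mono SUP_upper)
        finally show "\<Phi> i (p * p) \<le> 2 * ?s p" .
      qed
    qed
    show "min (?s p) (?s q) \<le> ?s (p + q)" for p q
    proof (rule ccontr)
      assume "\<not> ?thesis"
      then have "?s (p + q) < ?s p" "?s (p + q) < ?s q" by (simp_all add: min_le_iff_disj not_le)
      then obtain i j where ij: "i \<in> I" "?s (p + q) < \<Phi> i p" "j \<in> I" "?s (p + q) < \<Phi> j q"
        unfolding less_SUP_iff by blast
      then obtain k where "k \<in> I" "min (\<Phi> i p) (\<Phi> j q) \<le> \<Phi> k (p + q)" using add by blast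
      then have "min (\<Phi> i p) (\<Phi> j q) \<le> ?s (p + q)" by (intro le) blast
      then show False using ij by (auto simp: min_def split: if_splits)
    qed
    show "?s 0 = \<infinity>" using zero le[of \<infinity> 0] by auto
    show "v c \<le> ?s (Const c)" for c using const[of c] by (rule le)
  qed
qed

text \<open>By submultiplicativity \<open>\<phi> j\<close> grows with \<open>j\<close>, so the
  supremum is a limit. Shifting \<open>j\<close> by one turns multiplication by \<open>g\<close>
  into addition of \<gamma>, and an \<open>f\<close> that was multiplicative before remains
  so.\<close>

lemma subval_localization:
  fixes u :: "('n, 'k) mpoly \<Rightarrow> ereal"
  assumes u: "subval u" and g: "u g = ereal \<gamma>"
  defines "\<phi> \<equiv> \<lambda>j a. u (a * g ^ j) - ereal (real j * \<gamma>)"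
  defines "l \<equiv> \<lambda>a. SUP j. \<phi> j a"
  shows "subval l" "u a \<le> l a" "l (a * g) = l a + ereal \<gamma>" "\<And>f \<delta>. (\<And>a. u (a * f) = u a + ereal \<delta>) \<Longrightarrow> l (a * f) = l a + ereal \<delta>"
proof -
  have nM: "\<phi> j a \<noteq> -\<infinity>" for j a
    using subval_D(1)[OF u, of "a * g ^ j"] unfolding \<phi>_def by (cases "u (a * g ^ j)") auto
  have mono1: "\<phi> j a \<le> \<phi> (Suc j) a" for j a
  proof -
    have "u (a * g ^ j) + ereal \<gamma> \<le> u (a * g ^ Suc j)"
      using subval_D(2)[OF u, of "a * g ^ j" g] g by (simp add: algebra_simps)
    then show ?thesis
      unfolding \<phi>_def by (cases "u (a * g ^ j)"; cases "u (a * g ^ Suc j)") (auto simp: algebra_simps)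
  qed
  have mono: "\<phi> i a \<le> \<phi> j a" if "i \<le> j" for i j a
    using that mono1 by (rule lift_Suc_mono_le[rotated])
  show "subval l"
    unfolding l_def
  proof (rule subval_SUP)
    fix i j a b
    show "\<exists>k\<in>UNIV. \<phi> i a + \<phi> j b \<le> \<phi> k (a * b)"
    proof
      have "u (a * g ^ i) + u (b * g ^ j) \<le> u (a * b * g ^ (i + j))"
        using subval_D(2)[OF u, of "a * g ^ i" "b * g ^ j"] by (simp add: power_add ac_simps)
      then show "\<phi> i a + \<phi> j b \<le> \<phi> (i + j) (a * b)"
        unfolding \<phi>_def
        by (cases "u (a * g ^ i)"; cases "u (b * g ^ j)"; cases "u (a * b * g ^ (i + j))")
           (use subval_D(1)[OF u] in \<open>auto simp: algebra_simps\<close>)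
    qed simp
    show "\<exists>k\<in>UNIV. min (\<phi> i a) (\<phi> j b) \<le> \<phi> k (a + b)"
    proof
      let ?k = "max i j"
      have "min (\<phi> i a) (\<phi> j b) \<le> min (\<phi> ?k a) (\<phi> ?k b)"
        using mono[of i ?k a] mono[of j ?k b] by (auto simp: min_def)
      also have "\<dots> \<le> \<phi> ?k (a + b)"
        using subval_D(4)[OF u, of "a * g ^ ?k" "b * g ^ ?k"] unfolding \<phi>_def distrib_right
        by (cases "u (a * g ^ ?k)"; cases "u (b * g ^ ?k)"; cases "u (a * g ^ ?k + b * g ^ ?k)")
           (auto simp: min_def split: if_splits)
      finally show "min (\<phi> i a) (\<phi> j b) \<le> \<phi> ?k (a + b)" .
    qed simp
    show "\<exists>k\<in>UNIV. \<phi> i (a * a) \<le> 2 * \<phi> k a"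
    proof
      have le: "\<phi> i (a * a) \<le> \<phi> (i + i) (a * a)" by (rule mono) simp
      have eq: "a * a * g ^ (i + i) = (a * g ^ i) * (a * g ^ i)" by (simp add: power_add ac_simps)
      have "\<phi> (i + i) (a * a) = 2 * \<phi> i a"
        unfolding \<phi>_def eq subval_D(3)[OF u] ereal_2_mult
        by (cases "u (a * g ^ i)") (auto simp: algebra_simps)
      then show "\<phi> i (a * a) \<le> 2 * \<phi> i a" using le by simp
    qed simp
    show "\<exists>i\<in>UNIV. v c \<le> \<phi> i (Const c)" for c
      using subval_D(6)[OF u, of c] by (intro bexI[of _ 0]) (auto simp: \<phi>_def zero_ereal_def[symmetric])
  qed (use nM subval_D(5)[OF u] in \<open>auto simp: \<phi>_def\<close>)
  show "u a \<le> l a"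
    unfolding l_def by (rule SUP_upper2[of 0]) (auto simp: \<phi>_def zero_ereal_def[symmetric])
  have add_const: "(SUP j. \<phi> j a + ereal \<delta>) = l a + ereal \<delta>" for \<delta>
    unfolding l_def by (rule SUP_ereal_add_left) auto
  show "l (a * g) = l a + ereal \<gamma>"
  proof -
    have "\<phi> j (a * g) = \<phi> (Suc j) a + ereal \<gamma>" for j
      unfolding \<phi>_def by (cases "u (a * g ^ Suc j)") (auto simp: algebra_simps)
    then have "l (a * g) = (SUP j. \<phi> (Suc j) a + ereal \<gamma>)" by (simp add: l_def)
    also have "\<dots> = (SUP j. \<phi> j a + ereal \<gamma>)"
      by (rule antisym; rule SUP_mono) (auto intro: add_right_mono mono1)
    finally show ?thesis by (simp add: add_const)
  qed
  show "l (a * f) = l a + ereal \<delta>" if "\<And>a. u (a * f) = u a + ereal \<delta>" for f \<delta>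
  proof -
    have "\<phi> j (a * f) = \<phi> j a + ereal \<delta>" for j
    proof -
      have "u (a * f * g ^ j) = u (a * g ^ j) + ereal \<delta>"
        using that[of "a * g ^ j"] by (simp add: ac_simps)
      then show ?thesis unfolding \<phi>_def by (cases "u (a * g ^ j)") auto
    qed
    then show ?thesis using add_const by (simp add: l_def)
  qed
qed

text \<open>
  Berkovich's argument: a maximal sub-valuation above \<open>u\<close> for which \<open>f\<close> is multiplicative
  coincides with its localizations, hence is multiplicative.
\<close>

lemma exists_multiplicative:
  assumes u: "subval u" and f: "u f = ereal \<delta>"
  obtains w where "semivaluation w" "\<And>c. w (Const c) = v c" "\<And>p. u p \<le> w p" "w f = u f"
proof -
  \<comment> \<open>The value of \<open>f\<close> is fixed throughout the set, so that a lower bound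
    for the maximal element at \<open>f\<close> is a lower bound for \<open>u f\<close>.\<close>
  define W where "W = {w. subval w \<and> u \<le> w \<and> (\<forall>a. w (a * f) = w a + ereal \<delta>) \<and> w f = ereal \<delta>}"
  note L = subval_localization[OF u f]
  \<comment> \<open>Localizing at \<open>f\<close> itself starts the set; the value at
    \<open>f\<close> does not change, since \<open>u\<close> is exact on powers.\<close>
  let ?w0 = "\<lambda>a. SUP j. u (a * f ^ j) - ereal (real j * \<delta>)"
  have "u (f * f ^ j) - ereal (real j * \<delta>) = ereal \<delta>" for j
    using subval_power[OF u, of "Suc j" f] f by (simp add: algebra_simps)
  then have w0: "?w0 \<in> W"
    using L(1-3) by (simp add: W_def le_fun_def)
  have "\<exists>m\<in>W. \<forall>a\<in>W. m \<le> a \<longrightarrow> a = m"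
  proof (rule predicate_Zorn)
    show "partial_order_on W (relation_of (\<le>) W)"
      by (rule partial_order_on_relation_ofI) auto
    fix C assume C: "C \<in> Chains (relation_of (\<le>) W)"
    then have CW: "C \<subseteq> W" and chain: "\<And>a b. a \<in> C \<Longrightarrow> b \<in> C \<Longrightarrow> a \<le> b \<or> b \<le> a"
      by (auto simp: Chains_def relation_of_def)
    show "\<exists>m\<in>W. \<forall>a\<in>C. a \<le> m"
    proof (cases "C = {}")
      case True
      then show ?thesis using w0 by blast
    next
      case False
      let ?s = "\<lambda>a. SUP w\<in>C. w a"
      have sub: "subval w" if "w \<in> C" for w using that CW by (auto simp: W_def)
      have "subval ?s"
      proof (rule subval_SUP[OF False])
        fix i j a b assume ij: "i \<in> C" "j \<in> C"
        have big: "\<exists>k\<in>C. i \<le> k \<and> j \<le> k" using chain[OF ij] ij by auto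
        then obtain k where k: "k \<in> C" "i \<le> k" "j \<le> k" by blast
        have "i a + j b \<le> k a + k b" using k by (intro add_mono) (auto simp: le_fun_def)
        also have "\<dots> \<le> k (a * b)" by (rule subval_D(2)[OF sub[OF k(1)]])
        finally show "\<exists>k\<in>C. i a + j b \<le> k (a * b)" using k(1) by blast
        have "min (i a) (j b) \<le> min (k a) (k b)" using k by (intro min.mono) (auto simp: le_fun_def)
        also have "\<dots> \<le> k (a + b)" by (rule subval_D(4)[OF sub[OF k(1)]])
        finally show "\<exists>k\<in>C. min (i a) (j b) \<le> k (a + b)" using k(1) by blast
      next
        fix i a assume "i \<in> C"
        then show "\<exists>k\<in>C. i (a * a) \<le> 2 * k a" using subval_D(3)[OF sub] by fastforce
        from \<open>i \<in> C\<close> show "i a \<noteq> -\<infinity>" using subval_D(1)[OF sub] by blast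
      next
        show "\<exists>i\<in>C. i 0 = \<infinity>" using False subval_D(5)[OF sub] by blast
        show "\<exists>i\<in>C. v c \<le> i (Const c)" for c using False subval_D(6)[OF sub] by blast
      qed
      moreover have "u \<le> ?s"
        unfolding le_fun_def
      proof
        fix p obtain w where "w \<in> C" using False by blast
        then show "u p \<le> ?s p" using CW by (intro SUP_upper2[of w]) (auto simp: W_def le_fun_def)
      qed
      moreover have "?s (a * f) = ?s a + ereal \<delta>" for a
      proof -
        have "?s (a * f) = (SUP w\<in>C. w a + ereal \<delta>)"
          by (rule SUP_cong) (use CW in \<open>auto simp: W_def\<close>)
        then show ?thesis using SUP_ereal_add_left[OF False, of "ereal \<delta>" "\<lambda>w. w a"] by simp
      qed
      moreover have "?s f = ereal \<delta>"
      proof -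
        have "?s f = (SUP w\<in>C. ereal \<delta>)"
          by (rule SUP_cong) (use CW in \<open>auto simp: W_def\<close>)
        then show ?thesis using False by simp
      qed
      ultimately have "?s \<in> W" by (simp add: W_def)
      then show ?thesis by (intro bexI[of _ ?s]) (auto simp: le_fun_def intro: SUP_upper)
    qed
  qed
  then obtain w where w: "subval w" "u \<le> w" "\<And>a. w (a * f) = w a + ereal \<delta>" "w f = ereal \<delta>"
      and max: "\<And>a. a \<in> W \<Longrightarrow> w \<le> a \<Longrightarrow> a = w" by (auto simp: W_def)
  have mult: "w (a * g) = w a + w g" for a g
  proof (cases "w g")
    case (real \<gamma>)
    note L = subval_localization[OF w(1) real]
    let ?l = "\<lambda>a. SUP j. w (a * g ^ j) - ereal (real j * \<gamma>)"
    \<comment> \<open>As \<open>f\<close> is multiplicative for \<open>w\<close>, it separates from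
      g ^ j, and \<open>w\<close> is exact on the powers of \<open>g\<close>.\<close>
    have "?l f = ereal \<delta>"
    proof -
      have "w (f * g ^ j) - ereal (real j * \<gamma>) = ereal \<delta>" for j
      proof (cases "j = 0")
        case False
        have "w (f * g ^ j) = w (g ^ j) + ereal \<delta>" using w(3)[of "g ^ j"] by (simp add: mult.commute)
        also have "w (g ^ j) = ereal (real j * \<gamma>)" using subval_power[OF w(1), of j g] False real by simp
        finally show ?thesis by simp
      qed (simp add: w(4))
      then show ?thesis by simp
    qed
    then have "?l \<in> W"
      using L(1) L(4)[OF w(3)] order_trans[OF w(2)[unfolded le_fun_def, rule_format] L(2)]
      by (simp add: W_def le_fun_def)
    moreover have "w \<le> ?l"
      unfolding le_fun_def by (intro allI L(2))
    ultimately have "?l = w" by (rule max)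
    from fun_cong[OF this, of "a * g"] fun_cong[OF this, of a] show ?thesis
      using L(3)[of a] real by simp
  next
    case PInf
    then show ?thesis using subval_D(2)[OF w(1), of a g] subval_D(1)[OF w(1), of a] by (cases "w a") auto
  qed (use subval_D(1)[OF w(1), of g] in simp)
  have "w 1 + ereal \<delta> = ereal \<delta>" using w(3)[of 1] w(4) by simp
  then have w1: "w 1 = 0" by (cases "w 1") (auto simp: zero_ereal_def)
  interpret wv: semivaluation w
    by unfold_locales (use subval_D[OF w(1)] mult w1 in auto)
  have "w (Const c) = v c" for c
  proof (cases "c = 0")
    case False
    have "w (Const c) = v c + w 1"
      using subval_Const_mult[OF w(1) False, of 1] by simp
    then show ?thesis by (simp add: w1)
  qed (simp add: at_0 wv.at_0)
  then show ?thesis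
    using that[of w] wv.semivaluation_axioms w(2,4) f by (simp add: le_fun_def)
qed

text \<open>As in Gauss's lemma, the product of the first components that attain the two minima
  cannot be cancelled by the other products of its degree. The function may vary with the degree
  because points of \<open>W\<close> later give values shifted by a multiple of the degree.\<close>

lemma semivaluation_INF_components:
  fixes w0 :: "nat \<Rightarrow> ('n, 'k) mpoly \<Rightarrow> ereal"
  assumes um: "\<And>m. ultrametric (w0 m)" and minus: "\<And>m a. w0 m (- a) = w0 m a"
    and w0_mult: "\<And>i j a b. homogeneous i a \<Longrightarrow> homogeneous j b \<Longrightarrow> w0 (i + j) (a * b) = w0 i a + w0 j b"
    and w0_1: "w0 0 1 = 0"
  shows "semivaluation (\<lambda>p. INF m. w0 m (hom_component m p))"
proof -
  let ?W = "\<lambda>p. INF m. w0 m (hom_component m p)"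
  note at_0 = ultrametric.at_0[OF um] and not_MInf = ultrametric.not_MInf[OF um]
  have lower: "?W p \<le> w0 m (hom_component m p)" for m p by (rule INF_lower) simp
  have attained: "\<exists>m. w0 m (hom_component m p) = ?W p" for p
  proof -
    obtain N where N: "\<And>m. m > N \<Longrightarrow> hom_component m p = 0" using hom_component_large[of p] by blast
    let ?A = "(\<lambda>m. w0 m (hom_component m p)) ` {..N}"
    have "Min ?A \<in> ?A" by (intro Min_in) auto
    moreover have "Min ?A = ?W p"
    proof (rule antisym)
      show "Min ?A \<le> ?W p"
      proof (rule INF_greatest)
        fix m show "Min ?A \<le> w0 m (hom_component m p)"
          using N[of m] by (cases "m \<le> N") (auto simp: at_0)
      qed
    qed (use \<open>Min ?A \<in> ?A\<close> lower in auto)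
    ultimately show ?thesis by auto
  qed
  show ?thesis
  proof
    show "?W p \<noteq> -\<infinity>" for p using attained[of p] not_MInf by metis
    show "?W 0 = \<infinity>" by (simp add: at_0)
    show "min (?W a) (?W b) \<le> ?W (a + b)" for a b
    proof (rule INF_greatest)
      fix m
      show "min (?W a) (?W b) \<le> w0 m (hom_component m (a + b))"
        unfolding hom_component_add
        by (rule ultrametric.ge_add[OF um]) (auto intro: min.coboundedI1 min.coboundedI2 lower)
    qed
    show "?W 1 = 0"
    proof (rule antisym)
      have 1: "hom_component m (1 :: ('n, 'k) mpoly) = (if m = 0 then 1 else 0)" for m
      proof -
        have "homogeneous 0 (Const 1 :: ('n, 'k) mpoly)" by (rule homogeneous_Const)
        then have "homogeneous 0 (1 :: ('n, 'k) mpoly)" by (simp add: single_one)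
        then show ?thesis by (simp add: hom_component_homogeneous)
      qed
      show "?W 1 \<le> 0" using lower[of 1 0] by (simp add: 1 w0_1)
      show "0 \<le> ?W 1" by (rule INF_greatest) (simp add: 1 w0_1 at_0)
    qed
    show "?W (p * q) = ?W p + ?W q" for p q
    proof (rule antisym)
      have terms: "w0 m (hom_component k p * hom_component (m - k) q) =
          w0 k (hom_component k p) + w0 (m - k) (hom_component (m - k) q)" if "k \<le> m" for k m
        using w0_mult[of k "hom_component k p" "m - k" "hom_component (m - k) q"] that by simp
      show "?W p + ?W q \<le> ?W (p * q)"
        unfolding hom_component_mult
        by (intro INF_greatest ultrametric.ge_sum[OF um]) (auto simp: terms intro!: add_mono lower)
      show "?W (p * q) \<le> ?W p + ?W q"
      proof (cases "?W p = \<infinity> \<or> ?W q = \<infinity>")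
        case True
        then show ?thesis using attained[of p] attained[of q] not_MInf by (metis ereal_plus_eq_PInfty top_greatest top_ereal_def)
      next
        case False
        define i where "i = (LEAST m. w0 m (hom_component m p) = ?W p)"
        define j where "j = (LEAST m. w0 m (hom_component m q) = ?W q)"
        have i: "w0 i (hom_component i p) = ?W p"
          unfolding i_def by (rule LeastI_ex[OF attained])
        have i_less: "?W p < w0 k (hom_component k p)" if "k < i" for k
          by (rule le_neq_trans[OF lower not_sym]) (rule not_less_Least[OF that[unfolded i_def]])
        have j: "w0 j (hom_component j q) = ?W q"
          unfolding j_def by (rule LeastI_ex[OF attained])
        have j_less: "?W q < w0 k (hom_component k q)" if "k < j" for k
          by (rule le_neq_trans[OF lower not_sym]) (rule not_less_Least[OF that[unfolded j_def]])
        obtain P Q where PQ: "?W p = ereal P" "?W q = ereal Q"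
          using False attained[of p] attained[of q] not_MInf by (metis ereal_cases)
        let ?m = "i + j"
        let ?t = "\<lambda>k. hom_component k p * hom_component (?m - k) q"
        \<comment> \<open>In every other product of this total degree one factor comes strictly
          before its first minimum, so \<open>R\<close> has larger value.\<close>
        define R where "R = (\<Sum>k\<in>{..?m} - {i}. ?t k)"
        have R: "ereal (P + Q) < w0 ?m R"
          unfolding R_def
        proof (rule ultrametric.gr_sum[OF um])
          fix k assume k: "k \<in> {..?m} - {i}"
          have *: "ereal (P + Q) < a + b" if "ereal P \<le> a" "ereal Q \<le> b" "ereal P < a \<or> ereal Q < b" for a b
            using that by (cases a; cases b) auto
          have "?W p < w0 k (hom_component k p) \<or> ?W q < w0 (?m - k) (hom_component (?m - k) q)"
          proof (cases "k < i")
            case False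
            then have "?m - k < j" using k by auto
            then show ?thesis using j_less by blast
          qed (use i_less in blast)
          then show "ereal (P + Q) < w0 ?m (?t k)"
            using k lower[of p k] lower[of q "?m - k"] by (subst terms) (auto simp: PQ intro: *)
        qed simp
        have "hom_component ?m (p * q) = ?t i + R"
          unfolding hom_component_mult R_def by (subst sum.remove[of _ i]) auto
        moreover have ti: "w0 ?m (?t i) = ereal (P + Q)"
          using i j PQ by (subst terms) auto
        moreover have "w0 ?m (?t i + R) \<le> ereal (P + Q)"
        proof (rule ccontr)
          assume "\<not> ?thesis"
          then have "ereal (P + Q) < w0 ?m ((?t i + R) + (- R))"
            using R minus by (subst ultrametric.gr_add[OF um]) (auto simp: not_le)
          then show False using ti by simp
        qed
        ultimately show ?thesis using lower[of "p * q" ?m] PQ by simp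
      qed
    qed
  qed
qed

text \<open>This makes the kernel homogeneous, as the normalization requires, and does not change
  the value of any form.\<close>

lemma graded_semivaluation_INF:
  fixes w :: "('n::finite, 'k) mpoly \<Rightarrow> ereal"
  assumes "semivaluation w" "\<And>c. w (Const c) = v c"
  shows "graded_semivaluation v (\<lambda>p. INF m. w (hom_component m p))"
proof -
  interpret w: semivaluation w by fact
  let ?W = "\<lambda>p. INF m. w (hom_component m p)"
  have "semivaluation ?W"
    by (rule semivaluation_INF_components) (simp_all add: w.ultrametric_axioms w.mult w.at_1)
  then interpret W: semivaluation ?W .
  have hom: "?W p = w p" if "homogeneous d p" for d p
  proof (rule antisym)
    show "?W p \<le> w p"
      by (rule INF_lower2[of d]) (simp_all add: hom_component_homogeneous[OF that])
    show "w p \<le> ?W p"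
      by (rule INF_greatest) (simp add: hom_component_homogeneous[OF that] w.at_0)
  qed
  show ?thesis
    by unfold_locales (use assms(2) hom in \<open>auto simp: hom[OF homogeneous_Const] hom[OF homogeneous_hom_component]\<close>)
qed

text \<open>A multiplicative \<open>w\<close> above \<open>u\<close> with the same value at
  \<open>F\<close> reduces the claim to \<open>point_bound\<close>. The \<open>f k\<close> generate
  K[X] over \<open>S\<close>, whose elements die under \<open>w\<close>; being roots of constant
  multiples of the \<open>g k\<close>, they are integral over the ring of the \<open>g k\<close>, so
  K[X] is finite over it.\<close>

lemma subval_bound_normalized:
  fixes u :: "('n::finite, 'k) mpoly \<Rightarrow> ereal" and f g :: "nat \<Rightarrow> ('n, 'k) mpoly"
  assumes u: "subval u" and D: "D > 0" and g: "\<And>k. k < m \<Longrightarrow> homogeneous D (g k)" "\<And>k. k < m \<Longrightarrow> 0 \<le> u (g k)"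
    and f: "\<And>k. k < m \<Longrightarrow> \<exists>N>0. \<exists>c. c \<noteq> 0 \<and> g k = Const c * f k ^ N"
    and S: "\<And>s i. s \<in> S \<Longrightarrow> u (hom_component i s) = \<infinity>"
    and gen: "\<And>C. is_subring C \<Longrightarrow> range Const \<subseteq> C \<Longrightarrow> S \<subseteq> C \<Longrightarrow> f ` {..<m} \<subseteq> C \<Longrightarrow> C = UNIV"
    and F: "homogeneous d F"
    and bound: "\<And>x. (\<And>s. s \<in> S \<Longrightarrow> poly_eval s x = 0) \<Longrightarrow> (\<And>k. k < m \<Longrightarrow> 0 \<le> v (poly_eval (g k) x)) \<Longrightarrow>
      0 \<le> v (poly_eval F x)"
  shows "0 \<le> u F"
proof (rule ccontr)
  assume neg: "\<not> 0 \<le> u F"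
  then obtain \<delta> where \<delta>: "u F = ereal \<delta>" using subval_D(1)[OF u, of F] by (cases "u F") auto
  obtain w where w: "semivaluation w" "\<And>c. w (Const c) = v c" "\<And>p. u p \<le> w p" "w F = u F"
    using exists_multiplicative[OF u \<delta>] by blast
  define W where "W p = (INF m. w (hom_component m p))" for p
  interpret w: semivaluation w by fact
  interpret W: graded_semivaluation v W
    unfolding W_def using w(1,2) by (rule graded_semivaluation_INF)
  have hom: "W p = w p" if "homogeneous d p" for d p
  proof (rule antisym)
    show "W p \<le> w p" unfolding W_def
      by (rule INF_lower2[of d]) (simp_all add: hom_component_homogeneous[OF that])
    show "w p \<le> W p" unfolding W_def
      by (rule INF_greatest) (simp add: hom_component_homogeneous[OF that] w.at_0)
  qed
  have SP: "S \<subseteq> W.P"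
  proof
    fix s assume "s \<in> S"
    then have "w (hom_component i s) = \<infinity>" for i
      using S[of s i] w(3)[of "hom_component i s"] by simp
    then show "s \<in> W.P" by (simp add: W.P_def W_def)
  qed
  define g' where "g' i = (if i < m then g i else 0)" for i
  have "finite_over (W.coeff_ring g')"
  proof (rule finite_over_of_generators[of "f ` {..<m}"])
    show "integral_over (W.coeff_ring g') h" if h_in: "h \<in> f ` {..<m}" for h
    proof -
      obtain k where k: "k < m" "h = f k" using h_in by blast
      obtain N c where N: "N > 0" "c \<noteq> 0" "g k = Const c * f k ^ N" using f[OF k(1)] by blast
      have "Const (inverse c) * g' k = h ^ N"
        using N k by (simp add: g'_def mult.assoc[symmetric] mult_single single_one)
      moreover have "Const (inverse c) * g' k \<in> W.coeff_ring g'"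
        using W.coeff_ring by (intro is_subring_D(5)) auto
      ultimately have hN: "h ^ N \<in> W.coeff_ring g'" by simp
      \<comment> \<open>The integral equation has h ^ N as its only coefficient, in position
        0.\<close>
      have "(\<Sum>j<N. (if j = 0 then h ^ N else 0) * h ^ j) = (\<Sum>j<N. if j = 0 then h ^ N else 0)"
        by (intro sum.cong) auto
      then show ?thesis
        using N(1) hN is_subring_D(2)[OF W.coeff_ring(1)]
        by (intro integral_overI[of h N "\<lambda>j. if j = 0 then h ^ N else 0"]) auto
    qed
    show "C = UNIV" if "is_subring C" "W.coeff_ring g' \<subseteq> C" "f ` {..<m} \<subseteq> C" for C
      using that W.coeff_ring(2)[where g = g'] order_trans[OF SP order_trans[OF W.coeff_ring(3) that(2)]]
      by (intro gen) auto
  qed (simp_all add: W.coeff_ring)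
  then have "\<exists>r h. (\<forall>i. 0 \<le> W (h i)) \<and> (\<forall>i\<ge>r. h i = 0) \<and> finite_over (W.coeff_ring h) \<and>
    (\<forall>p. mvars p \<subseteq> {..<r} \<longrightarrow> peval Const h p \<in> W.P \<longrightarrow> p = 0) \<and>
    (\<forall>x. (\<forall>p\<in>W.P. poly_eval p x = 0) \<longrightarrow> (\<forall>i. 0 \<le> v (poly_eval (h i) x)) \<longrightarrow> (\<forall>i. 0 \<le> v (poly_eval (g' i) x)))"
  proof (rule W.noether_normalization[rotated -1, where D = D and m = m])
    show "homogeneous D (g' i)" for i using g(1) by (simp add: g'_def)
    show "0 \<le> W (g' i)" for i
      using g hom[of D "g i"] order_trans[OF g(2)[of i] w(3)[of "g i"]] by (auto simp: g'_def W.w.at_0)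
  qed (use D in \<open>auto simp: g'_def\<close>)
  then obtain r h where h: "\<forall>i. 0 \<le> W (h i)" "\<forall>i\<ge>r. h i = 0" "finite_over (W.coeff_ring h)"
    "\<forall>p. mvars p \<subseteq> {..<r} \<longrightarrow> peval Const h p \<in> W.P \<longrightarrow> p = 0"
    "\<forall>x. (\<forall>p\<in>W.P. poly_eval p x = 0) \<longrightarrow> (\<forall>i. 0 \<le> v (poly_eval (h i) x)) \<longrightarrow> (\<forall>i. 0 \<le> v (poly_eval (g' i) x))"
    by (elim exE conjE)
  have "0 \<le> W F"
  proof (rule W.point_bound[of h r])
    fix x assume x: "\<And>p. p \<in> W.P \<Longrightarrow> poly_eval p x = 0" "\<And>i. 0 \<le> v (poly_eval (h i) x)"
    show "0 \<le> v (poly_eval F x)"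
    proof (rule bound)
      show "poly_eval s x = 0" if "s \<in> S" for s using that SP x(1) by blast
      show "0 \<le> v (poly_eval (g k) x)" if "k < m" for k
        using h(5) x that by (metis g'_def)
    qed
  qed (use h(1-4) in auto)
  then show False using neg hom[OF F] w(4) by simp
qed

text \<open>The parameter \<open>t\<close> leaves room for rescaling the affine point
  \<open>x\<close>: it shifts every threshold in proportion to its degree. Powers and constants
  reduce this to common degree and thresholds 0, with a slack forced by a value group that is only
  dense.\<close>

lemma subval_bound:
  fixes u :: "('n::finite, 'k) mpoly \<Rightarrow> ereal" and f :: "nat \<Rightarrow> ('n, 'k) mpoly"
  assumes u: "subval u" and f: "\<And>k. k < m \<Longrightarrow> d k > 0" "\<And>k. k < m \<Longrightarrow> homogeneous (d k) (f k)"
      "\<And>k. k < m \<Longrightarrow> ereal (\<gamma> k) \<le> u (f k)"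
    and S: "\<And>s i. s \<in> S \<Longrightarrow> u (hom_component i s) = \<infinity>"
    and gen: "\<And>C. is_subring C \<Longrightarrow> range Const \<subseteq> C \<Longrightarrow> S \<subseteq> C \<Longrightarrow> f ` {..<m} \<subseteq> C \<Longrightarrow> C = UNIV"
    and F: "homogeneous e F" "e > 0"
    and bound: "\<And>x t. (\<And>s. s \<in> S \<Longrightarrow> poly_eval s x = 0) \<Longrightarrow>
      (\<And>k. k < m \<Longrightarrow> ereal (\<gamma> k + real (d k) * t) \<le> v (poly_eval (f k) x)) \<Longrightarrow>
      ereal (\<alpha> + real e * t) \<le> v (poly_eval F x)"
  shows "ereal \<alpha> \<le> u F"
proof (rule ccontr)
  assume "\<not> ereal \<alpha> \<le> u F"
  then obtain \<delta> where \<delta>: "u F = ereal \<delta>" "\<delta> < \<alpha>" using subval_D(1)[OF u, of F] by (cases "u F") auto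
  \<comment> \<open>A common multiple of all degrees; \<open>N k\<close> and \<open>M\<close> are
    the powers that raise the forms to it.\<close>
  define D where "D = e * (\<Prod>k<m. d k)"
  define N where "N k = D div d k" for k
  define M where "M = D div e"
  have D0: "D > 0" unfolding D_def using F(2) f(1) by (auto intro!: mult_pos_pos prod_pos)
  have N: "N k * d k = D" "N k > 0" if "k < m" for k
  proof -
    have "d k dvd D" unfolding D_def using that by (intro dvd_mult dvd_prodI) auto
    then show "N k * d k = D" by (simp add: N_def)
    then show "N k > 0" using D0 by (cases "N k") auto
  qed
  have M: "M * e = D" "M > 0"
    using D0 F(2) by (auto simp: M_def D_def intro!: Nat.gr0I)
  \<comment> \<open>One third of the gap: one part for the choice of the \<open>c k\<close>, one for
    the choice of \<open>a\<close>, and one left over for the contradiction.\<close>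
  define \<epsilon> where "\<epsilon> = real M * (\<alpha> - \<delta>) / 3"
  have \<epsilon>: "\<epsilon> > 0" using \<delta>(2) M(2) by (simp add: \<epsilon>_def)
  have "\<exists>c. c \<noteq> 0 \<and> ereal (- \<gamma> k * real (N k)) \<le> v c \<and> v c \<le> ereal (- \<gamma> k * real (N k) + \<epsilon>)" for k
    using value_dense[of "- \<gamma> k * real (N k)" "- \<gamma> k * real (N k) + \<epsilon>"] \<epsilon> by (smt (verit))
  then obtain c where c: "\<And>k. c k \<noteq> 0" "\<And>k. ereal (- \<gamma> k * real (N k)) \<le> v (c k)"
      "\<And>k. v (c k) \<le> ereal (- \<gamma> k * real (N k) + \<epsilon>)" by metis
  obtain a where a: "a \<noteq> 0" "ereal (- \<alpha> * real M + \<epsilon>) \<le> v a" "v a \<le> ereal (- \<alpha> * real M + 2 * \<epsilon>)"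
    using value_dense[of "- \<alpha> * real M + \<epsilon>" "- \<alpha> * real M + 2 * \<epsilon>"] \<epsilon> by (smt (verit))
  obtain a' where a': "v a = ereal a'" using finiteE[OF a(1)] .
  have "0 \<le> u (Const a * F ^ M)"
  proof (rule subval_bound_normalized[OF u D0, of m "\<lambda>k. Const (c k) * f k ^ N k" f S])
    show "homogeneous D (Const (c k) * f k ^ N k)" if "k < m" for k
      using homogeneous_Const_mult[OF homogeneous_power[OF f(2)[OF that], of "N k"], of "c k"] N(1)[OF that] by simp
    show "0 \<le> u (Const (c k) * f k ^ N k)" if "k < m" for k
    proof -
      obtain r where r: "v (c k) = ereal r" using finiteE[OF c(1)] .
      have "0 \<le> v (c k) + ereal (real (N k)) * u (f k)"
      proof (cases "u (f k)")
        case (real s)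
        then have "real (N k) * \<gamma> k \<le> real (N k) * s"
          using f(3)[OF that] by (intro mult_left_mono) auto
        then show ?thesis using c(2)[of k] by (simp add: r real mult.commute)
      next
        case PInf
        then show ?thesis using N(2)[OF that] by (simp add: r)
      qed (use subval_D(1)[OF u, of "f k"] in simp)
      then show ?thesis
        unfolding subval_Const_mult[OF u c(1)] subval_power[OF u N(2)[OF that]] .
    qed
    show "homogeneous D (Const a * F ^ M)"
      using homogeneous_Const_mult[OF homogeneous_power[OF F(1), of M], of a] M(1) by simp
    fix x assume x: "\<And>s. s \<in> S \<Longrightarrow> poly_eval s x = 0" "\<And>k. k < m \<Longrightarrow> 0 \<le> v (poly_eval (Const (c k) * f k ^ N k) x)"
    \<comment> \<open>Choosing \<open>c k\<close> may have raised its value by \<epsilon>, which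
      costs the forms at most \<open>- real (d k) * t\<close>. The lower bound on the value of
      \<open>a\<close> contains an extra \<epsilon> to make up for this.\<close>
    define t where "t = - \<epsilon> / real D"
    have "ereal (\<alpha> + real e * t) \<le> v (poly_eval F x)"
    proof (rule bound)
      fix k assume k: "k < m"
      obtain r where r: "v (c k) = ereal r" using finiteE[OF c(1)] .
      have "0 \<le> v (c k) + ereal (real (N k)) * v (poly_eval (f k) x)"
        using x(2)[OF k] by (simp add: poly_eval_simps is_hom_power[OF is_hom_poly_eval] mult power)
      moreover have "\<gamma> k + real (d k) * t \<le> s" if "0 \<le> r + real (N k) * s" for s
      proof -
        have "real (d k) * t * real (N k) = - \<epsilon>"
          using N(1)[OF k] D0 unfolding t_def by (simp add: field_simps of_nat_mult[symmetric] del: of_nat_mult)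
        then have "(\<gamma> k + real (d k) * t) * real (N k) \<le> s * real (N k)"
          using that c(3)[of k] r by (simp add: algebra_simps)
        then show ?thesis using N(2)[OF k] by simp
      qed
      ultimately show "ereal (\<gamma> k + real (d k) * t) \<le> v (poly_eval (f k) x)"
        using r not_MInf[of "poly_eval (f k) x"] by (cases "v (poly_eval (f k) x)") auto
    qed (rule x(1))
    moreover have "0 \<le> a' + real M * s" if "\<alpha> + real e * t \<le> s" for s
    proof -
      have "real M * (real e * t) = - \<epsilon>"
        using M(1) D0 unfolding t_def by (simp add: field_simps of_nat_mult[symmetric] del: of_nat_mult)
      moreover have "real M * (\<alpha> + real e * t) \<le> real M * s" using that by (intro mult_left_mono) auto
      ultimately show ?thesis using a(2) a' by (simp add: algebra_simps)
    qed
    ultimately show "0 \<le> v (poly_eval (Const a * F ^ M) x)"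
      using a' not_MInf[of "poly_eval F x"] M(2)
      by (cases "v (poly_eval F x)") (auto simp: poly_eval_simps is_hom_power[OF is_hom_poly_eval] mult power)
  qed (use N(2) c(1) S gen in \<open>auto\<close>)
  then have "0 \<le> a' + real M * \<delta>"
    unfolding subval_Const_mult[OF u a(1)] subval_power[OF u M(2)] \<delta> a' by simp
  moreover have "real M * (\<alpha> - \<delta>) = 3 * \<epsilon>" by (simp add: \<epsilon>_def)
  ultimately show False using a(3) a' \<epsilon> by (simp add: algebra_simps)
qed

end

section \<open>Almost orthogonal bases\<close>

lemma finite_mdeg: "finite {\<alpha> :: 'n::finite \<Rightarrow>\<^sub>0 nat. mdeg \<alpha> = d}"
proof (rule finite_imageD)
  have "Poly_Mapping.lookup \<alpha> i \<le> mdeg \<alpha>" for \<alpha> :: "'n \<Rightarrow>\<^sub>0 nat" and i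
    using member_le_sum[of i UNIV "Poly_Mapping.lookup \<alpha>"] by (subst mdeg_superset[of UNIV]) auto
  then have "Poly_Mapping.lookup ` {\<alpha> :: 'n \<Rightarrow>\<^sub>0 nat. mdeg \<alpha> = d} \<subseteq> (UNIV \<rightarrow>\<^sub>E {..d})"
    by (auto simp: PiE_UNIV_domain)
  then show "finite (Poly_Mapping.lookup ` {\<alpha> :: 'n \<Rightarrow>\<^sub>0 nat. mdeg \<alpha> = d})"
    by (rule finite_subset) (intro finite_PiE; simp)
  show "inj_on Poly_Mapping.lookup {\<alpha> :: 'n \<Rightarrow>\<^sub>0 nat. mdeg \<alpha> = d}"
    by (intro inj_onI) (simp only: Poly_Mapping.lookup_inject)
qed

definition lin_functional :: "(('i, 'k::comm_ring_1) mpoly \<Rightarrow> 'k) \<Rightarrow> bool" where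
  "lin_functional f \<longleftrightarrow> (\<forall>p q. f (p + q) = f p + f q) \<and> (\<forall>c p. f (Const c * p) = c * f p)"

lemma lin_functional_D:
  assumes "lin_functional f"
  shows "f (p + q) = f p + f q" "f (Const c * p) = c * f p" "f 0 = 0" "f (p - q) = f p - f q"
proof -
  show 1: "f (p + q) = f p + f q" "f (Const c * p) = c * f p" for p q c
    using assms by (auto simp: lin_functional_def)
  show "f 0 = 0" using 1(2)[of 0 0] by simp
  show "f (p - q) = f p - f q" using 1(1)[of "p - q" q] by simp
qed

lemma lookup_Const_mult: "Poly_Mapping.lookup (Const c * p) \<alpha> = c * Poly_Mapping.lookup p \<alpha>"
  for p :: "('i, 'k::comm_ring_1) mpoly"
proof (induction p rule: mpoly_induct)
  case (add \<beta> d p)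
  then show ?case
    by (simp add: distrib_left mult_single lookup_add lookup_single when_def)
qed simp

lemma lin_functional_coeff: "lin_functional (\<lambda>p. Poly_Mapping.lookup p \<beta>)"
  by (simp add: lin_functional_def lookup_add lookup_Const_mult)

locale complete_valued_field = closed_valued_field v for v :: "'k::alg_closed_field \<Rightarrow> ereal" +
  assumes complete: "complete_valuation v"

locale vector_seminorm = complete_valued_field v + N: ultrametric N
  for v :: "'k::alg_closed_field \<Rightarrow> ereal" and N :: "('i, 'k) mpoly \<Rightarrow> ereal" +
  assumes N_scale: "c \<noteq> 0 \<Longrightarrow> N (Const c * p) = v c + N p"
begin

lemma N_minus: "N (- p) = N p"
proof -
  have "v (-1) = 0" using minus[of 1] at_1 by simp
  moreover have "Const (-1) * p = - p" by (simp add: single_uminus single_one)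
  ultimately show ?thesis using N_scale[of "-1" p] by simp
qed

lemma N_ge_diff: "c \<le> N a \<Longrightarrow> c \<le> N b \<Longrightarrow> c \<le> N (a - b)"
  using N.ge_add[of c a "- b"] by (simp add: N_minus)

lemma N_eq_mod_kernel:
  assumes "N (a - b) = \<infinity>" shows "N a = N b"
proof (rule antisym)
  show "N a \<le> N b" using N_ge_diff[of "N a" a "a - b"] assms by simp
  show "N b \<le> N a" using N.ge_add[of "N b" "a - b" b] assms by simp
qed

lemma N_scale_ge: "v c + N p \<le> N (Const c * p)"
  using N_scale[of c p] N.at_0 by (cases "c = 0") auto

text \<open>The \<open>b i\<close> represent a basis of the span of the monomials in
  \<open>J\<close> modulo the kernel of \<open>N\<close>, with coordinates
  \<open>\<Lambda> i\<close>. The last clause says that cancellation raises the value of a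
  combination by at most \<epsilon> above each term; the opposite bound is the ultrametric
  inequality.\<close>

definition almost_orthogonal :: "(('i \<Rightarrow>\<^sub>0 nat) set) \<Rightarrow> real \<Rightarrow> nat \<Rightarrow> (nat \<Rightarrow> ('i, 'k) mpoly) \<Rightarrow>
    (nat \<Rightarrow> ('i, 'k) mpoly \<Rightarrow> 'k) \<Rightarrow> bool" where
  "almost_orthogonal J \<epsilon> r b \<Lambda> \<longleftrightarrow>
     (\<forall>i. lin_functional (\<Lambda> i)) \<and> (\<forall>i<r. Poly_Mapping.keys (b i) \<subseteq> J \<and> \<bar>N (b i)\<bar> \<noteq> \<infinity>) \<and>
     (\<forall>p. Poly_Mapping.keys p \<subseteq> J \<longrightarrow> N (p - (\<Sum>i<r. Const (\<Lambda> i p) * b i)) = \<infinity>) \<and>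
     (\<forall>c. \<forall>i<r. N (\<Sum>i<r. Const (c i) * b i) \<le> v (c i) + N (b i) + ereal \<epsilon>)"

lemma keys_lincomb:
  fixes b :: "nat \<Rightarrow> ('i, 'k) mpoly"
  assumes "\<And>i. i < r \<Longrightarrow> Poly_Mapping.keys (b i) \<subseteq> J"
  shows "Poly_Mapping.keys (\<Sum>i<r. Const (c i) * b i) \<subseteq> J"
proof
  fix \<alpha> assume "\<alpha> \<in> Poly_Mapping.keys (\<Sum>i<r. Const (c i) * b i)"
  then have "(\<Sum>i<r. c i * Poly_Mapping.lookup (b i) \<alpha>) \<noteq> 0"
    by (simp add: in_keys_iff lookup_sum lookup_Const_mult)
  then obtain i where "i \<in> {..<r}" "c i * Poly_Mapping.lookup (b i) \<alpha> \<noteq> 0"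
    by (rule sum.not_neutral_contains_not_neutral)
  then have "i < r" "\<alpha> \<in> Poly_Mapping.keys (b i)" by (auto simp: in_keys_iff)
  then show "\<alpha> \<in> J" using assms by blast
qed

text \<open>This is where completeness enters: finite-dimensional subspaces are closed.\<close>

lemma best_approximation:
  assumes ao: "almost_orthogonal J \<epsilon> r b \<Lambda>"
    and y: "\<And>n::nat. Poly_Mapping.keys (y n) \<subseteq> J" "\<And>n. ereal (real n) \<le> N (e - y n)"
  shows "\<exists>z. Poly_Mapping.keys z \<subseteq> J \<and> N (e - z) = \<infinity>"
proof -
  note lin = ao[unfolded almost_orthogonal_def, THEN conjunct1, rule_format]
  note b = ao[unfolded almost_orthogonal_def, THEN conjunct2, THEN conjunct1, rule_format]
  note ker = ao[unfolded almost_orthogonal_def, THEN conjunct2, THEN conjunct2, THEN conjunct1, rule_format]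
  note orth = ao[unfolded almost_orthogonal_def, THEN conjunct2, THEN conjunct2, THEN conjunct2, rule_format]
  have "\<exists>t. \<forall>B::real. \<exists>M. \<forall>n\<ge>M. ereal B \<le> v (\<Lambda> i (y n) - t)" if i: "i < r" for i
  proof -
    obtain \<beta> where \<beta>: "N (b i) = ereal \<beta>" using b[OF i] by (cases "N (b i)") auto
    \<comment> \<open>Almost orthogonality bounds each coordinate of a difference by the value of
      that difference, so the coordinates of the approximations are Cauchy.\<close>
    have "\<forall>B::real. \<exists>M. \<forall>n\<ge>M. \<forall>m\<ge>M. ereal B \<le> v (\<Lambda> i (y n) - \<Lambda> i (y m))"
    proof
      fix B :: real
      obtain M :: nat where M: "B + \<beta> + \<epsilon> \<le> real M" using real_arch_simple by blast
      show "\<exists>M. \<forall>n\<ge>M. \<forall>m\<ge>M. ereal B \<le> v (\<Lambda> i (y n) - \<Lambda> i (y m))"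
      proof (intro exI allI impI)
        fix n m assume nm: "n \<ge> M" "m \<ge> M"
        let ?p = "y n - y m"
        have "ereal (real M) \<le> N (e - y n)" "ereal (real M) \<le> N (e - y m)"
          by (rule order_trans[OF _ y(2)], use nm in simp)+
        then have "ereal (real M) \<le> N ((e - y m) - (e - y n))"
          by (rule N_ge_diff[rotated])
        then have "ereal (real M) \<le> N ?p" by simp
        also have "Poly_Mapping.keys ?p \<subseteq> J"
          using keys_diff[of "y n" "y m"] y(1) by blast
        from N_eq_mod_kernel[OF ker[OF this]] have "N ?p = N (\<Sum>i<r. Const (\<Lambda> i ?p) * b i)" .
        also have "\<dots> \<le> v (\<Lambda> i ?p) + N (b i) + ereal \<epsilon>" by (rule orth[OF i])
        finally show "ereal B \<le> v (\<Lambda> i (y n) - \<Lambda> i (y m))"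
          using M \<beta> by (cases "v (\<Lambda> i ?p)") (auto simp: lin_functional_D[OF lin])
      qed
    qed
    then show ?thesis
      by (rule mp[OF spec[OF complete[unfolded complete_valuation_def]]])
  qed
  then obtain t where t: "\<And>i B. i < r \<Longrightarrow> \<exists>M. \<forall>n\<ge>M. ereal B \<le> v (\<Lambda> i (y n) - t i)" by metis
  let ?z = "\<Sum>i<r. Const (t i) * b i"
  have "ereal B \<le> N (e - ?z)" for B
  proof -
    have "\<exists>M. \<forall>n\<ge>M. ereal B \<le> v (\<Lambda> i (y n) - t i) + N (b i)" if i: "i < r" for i
    proof -
      obtain \<beta> where \<beta>: "N (b i) = ereal \<beta>" using b[OF i] by (cases "N (b i)") auto
      obtain M where M: "\<And>n. n \<ge> M \<Longrightarrow> ereal (B - \<beta>) \<le> v (\<Lambda> i (y n) - t i)" using t[OF i] by blast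
      have "ereal B \<le> v (\<Lambda> i (y n) - t i) + N (b i)" if "n \<ge> M" for n
        using M[OF that] \<beta> by (cases "v (\<Lambda> i (y n) - t i)") auto
      then show ?thesis by blast
    qed
    then obtain M where M: "\<And>i n. i < r \<Longrightarrow> n \<ge> M i \<Longrightarrow> ereal B \<le> v (\<Lambda> i (y n) - t i) + N (b i)" by metis
    obtain M' :: nat where M': "B \<le> real M'" using real_arch_simple by blast
    define n where "n = M' + (\<Sum>i<r. M i)"
    have n: "n \<ge> M i" if "i < r" for i
      using member_le_sum[of i "{..<r}" M] that by (simp add: n_def)
    have "e - ?z = (e - y n) + ((y n - (\<Sum>i<r. Const (\<Lambda> i (y n)) * b i)) + (\<Sum>i<r. Const (\<Lambda> i (y n) - t i) * b i))"
      by (simp add: single_diff left_diff_distrib sum_subtractf)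
    also have "ereal B \<le> N \<dots>"
    proof (intro N.ge_add N.ge_sum)
      have "M' \<le> n" by (simp add: n_def)
      then have "ereal B \<le> ereal (real n)" using M' by simp
      then show "ereal B \<le> N (e - y n)" using y(2) by (rule order_trans)
      show "ereal B \<le> N (y n - (\<Sum>i<r. Const (\<Lambda> i (y n)) * b i))" using ker[OF y(1)] by simp
      show "ereal B \<le> N (Const (\<Lambda> i (y n) - t i) * b i)" if "i \<in> {..<r}" for i
        using M[of i n] n that N_scale_ge by (auto intro: order_trans)
    qed
    finally show ?thesis .
  qed
  then have "N (e - ?z) = \<infinity>" by (metis ereal_top)
  then show ?thesis using keys_lincomb[of r b J t] b by blast
qed

text \<open>Gram-Schmidt with an error: the new monomial \<open>e\<close> is replaced by
  \<open>e - y\<close>, with \<open>y\<close> in the old span nearly best possible. If there is no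
  finite best value, \<open>e\<close> is dependent modulo the kernel by
  \<open>best_approximation\<close>, and no vector is added.\<close>

lemma exists_almost_orthogonal:
  assumes "finite J" "\<epsilon> > 0"
  shows "\<exists>r b \<Lambda>. almost_orthogonal J \<epsilon> r b \<Lambda>"
  using assms
proof (induction J arbitrary: \<epsilon>)
  case empty
  have "almost_orthogonal {} \<epsilon> 0 b (\<lambda>_ _. 0)" for b
    by (simp add: almost_orthogonal_def lin_functional_def N.at_0)
  then show ?case by blast
next
  case (insert \<beta> J)
  have \<epsilon>: "\<epsilon> / 2 > 0" using insert.prems by simp
  obtain r b \<Lambda> where ao: "almost_orthogonal J (\<epsilon> / 2) r b \<Lambda>" using insert.IH[OF \<epsilon>] by blast
  note lin = ao[unfolded almost_orthogonal_def, THEN conjunct1, rule_format]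
  note b = ao[unfolded almost_orthogonal_def, THEN conjunct2, THEN conjunct1, rule_format]
  note ker = ao[unfolded almost_orthogonal_def, THEN conjunct2, THEN conjunct2, THEN conjunct1, rule_format]
  note orth = ao[unfolded almost_orthogonal_def, THEN conjunct2, THEN conjunct2, THEN conjunct2, rule_format]
  define e where "e = Poly_Mapping.single \<beta> (1::'k)"
  \<comment> \<open>Removing the multiple of \<open>e - y\<close> that carries the monomial
    \<open>\<beta>\<close> leaves a polynomial supported in \<open>J\<close>, to which the old
    coordinates apply.\<close>
  define res where "res y p = p - Const (Poly_Mapping.lookup p \<beta>) * (e - y)" for y p
  have res_keys: "Poly_Mapping.keys (res y p) \<subseteq> J"
    if y: "Poly_Mapping.keys y \<subseteq> J" and p: "Poly_Mapping.keys p \<subseteq> insert \<beta> J" for y p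
  proof
    fix \<alpha> assume "\<alpha> \<in> Poly_Mapping.keys (res y p)"
    then have ne: "Poly_Mapping.lookup p \<alpha> - Poly_Mapping.lookup p \<beta> * (Poly_Mapping.lookup e \<alpha> - Poly_Mapping.lookup y \<alpha>) \<noteq> 0"
      by (simp add: in_keys_iff res_def lookup_minus lookup_Const_mult)
    show "\<alpha> \<in> J"
    proof (rule ccontr)
      assume "\<alpha> \<notin> J"
      then have "Poly_Mapping.lookup y \<alpha> = 0" "\<alpha> \<noteq> \<beta> \<Longrightarrow> Poly_Mapping.lookup p \<alpha> = 0"
        using y p by (auto simp: in_keys_iff subset_iff)
      then show False
        using ne by (cases "\<alpha> = \<beta>") (auto simp: e_def lookup_single when_def)
    qed
  qed
  have lin_res: "lin_functional (\<lambda>p. \<Lambda> i (res y p))" for i y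
  proof -
    have "res y (p + q) = res y p + res y q" for p q
      by (simp add: res_def lookup_add single_add distrib_right)
    moreover have "res y (Const c * p) = Const c * res y p" for c p
      unfolding res_def lookup_Const_mult is_hom_D(3)[OF is_hom_Const] by (simp only: right_diff_distrib mult.assoc)
    ultimately show ?thesis
      by (simp add: lin_functional_def lin_functional_D[OF lin])
  qed
  have ker_res: "N (p - (Const (Poly_Mapping.lookup p \<beta>) * (e - y) + (\<Sum>i<r. Const (\<Lambda> i (res y p)) * b i))) = \<infinity>"
    if "Poly_Mapping.keys y \<subseteq> J" "Poly_Mapping.keys p \<subseteq> insert \<beta> J" for y p
    using ker[OF res_keys[OF that]] by (simp add: res_def diff_diff_eq)
  define \<rho> where "\<rho> = (SUP y\<in>{y. Poly_Mapping.keys y \<subseteq> J}. N (e - y))"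
  have N_le: "N (e - y) \<le> \<rho>" if "Poly_Mapping.keys y \<subseteq> J" for y
    unfolding \<rho>_def using that by (intro SUP_upper) auto
  show ?case
  proof (cases "\<rho> = \<infinity>")
    case True
    have "\<exists>y. Poly_Mapping.keys y \<subseteq> J \<and> ereal (real n) \<le> N (e - y)" for n
    proof -
      have "ereal (real n) < \<rho>" using True by simp
      then show ?thesis unfolding \<rho>_def less_SUP_iff by (auto intro: less_imp_le)
    qed
    then obtain y where y: "\<And>n. Poly_Mapping.keys (y n) \<subseteq> J" "\<And>n. ereal (real n) \<le> N (e - y n)" by metis
    obtain z where z: "Poly_Mapping.keys z \<subseteq> J" "N (e - z) = \<infinity>"
      using best_approximation[OF ao y] by blast
    have "N (p - (\<Sum>i<r. Const (\<Lambda> i (res z p)) * b i)) = \<infinity>" if p: "Poly_Mapping.keys p \<subseteq> insert \<beta> J" for p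
    proof -
      let ?c = "Const (Poly_Mapping.lookup p \<beta>) * (e - z)" and ?s = "\<Sum>i<r. Const (\<Lambda> i (res z p)) * b i"
      have "p - ?s = (p - (?c + ?s)) + ?c" by simp
      moreover have "N ?c = \<infinity>"
        using N_scale_ge[of "Poly_Mapping.lookup p \<beta>" "e - z"] z(2) not_MInf by simp
      ultimately show ?thesis
        using N.ge_add[of \<infinity> "p - (?c + ?s)" ?c] ker_res[OF z(1) p] by simp
    qed
    moreover have "N (\<Sum>i<r. Const (c i) * b i) \<le> v (c i) + N (b i) + ereal \<epsilon>" if "i < r" for c i
      using orth[OF that, of c] by (rule order_trans) (use \<epsilon> in \<open>intro add_left_mono, simp\<close>)
    moreover have "Poly_Mapping.keys (b i) \<subseteq> insert \<beta> J" if "i < r" for i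
      using b[OF that] by blast
    ultimately have "almost_orthogonal (insert \<beta> J) \<epsilon> r b (\<lambda>i p. \<Lambda> i (res z p))"
      using lin_res b unfolding almost_orthogonal_def by simp
    then show ?thesis by blast
  next
    case False
    have "N (e - 0) \<le> \<rho>" by (rule N_le) simp
    then obtain \<rho>' where \<rho>': "\<rho> = ereal \<rho>'"
      using False N.not_MInf[of "e - 0"] by (cases \<rho>) auto
    have "ereal (\<rho>' - \<epsilon> / 2) < \<rho>" using \<rho>' \<epsilon> by simp
    then obtain y where y: "Poly_Mapping.keys y \<subseteq> J" "ereal (\<rho>' - \<epsilon> / 2) < N (e - y)"
      unfolding \<rho>_def less_SUP_iff by auto
    obtain \<nu> where \<nu>: "N (e - y) = ereal \<nu>" "\<rho>' - \<epsilon> / 2 < \<nu>"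
      using y N_le[OF y(1)] \<rho>' by (cases "N (e - y)") auto
    define b' where "b' i = (if i < r then b i else e - y)" for i
    define \<Lambda>' where "\<Lambda>' i p = (if i < r then \<Lambda> i (res y p) else Poly_Mapping.lookup p \<beta>)" for i p
    have sum: "(\<Sum>i<Suc r. Const (c i) * b' i) = (\<Sum>i<r. Const (c i) * b i) + Const (c r) * (e - y)" for c
      by (simp add: b'_def)
    have "almost_orthogonal (insert \<beta> J) \<epsilon> (Suc r) b' \<Lambda>'"
      unfolding almost_orthogonal_def
    proof (intro conjI allI impI)
      show "lin_functional (\<Lambda>' i)" for i
      proof -
        have "\<Lambda>' i = (if i < r then (\<lambda>p. \<Lambda> i (res y p)) else (\<lambda>p. Poly_Mapping.lookup p \<beta>))"
          by (auto simp: \<Lambda>'_def)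
        then show ?thesis using lin_res[of i y] by (simp add: lin_functional_coeff)
      qed
      show "Poly_Mapping.keys (b' i) \<subseteq> insert \<beta> J" for i
        using b[of i] y(1) keys_diff[of e y] by (cases "i < r") (auto simp: b'_def e_def split: if_splits)
      show "\<bar>N (b' i)\<bar> \<noteq> \<infinity>" for i
        using b[of i] \<nu> by (simp add: b'_def)
      show "N (p - (\<Sum>i<Suc r. Const (\<Lambda>' i p) * b' i)) = \<infinity>" if "Poly_Mapping.keys p \<subseteq> insert \<beta> J" for p
        using ker_res[OF y(1) that] unfolding sum by (simp add: \<Lambda>'_def add.commute)
      show "N (\<Sum>i<Suc r. Const (c i) * b' i) \<le> v (c i) + N (b' i) + ereal \<epsilon>" if i: "i < Suc r" for c i
      proof -
        define z where "z = (\<Sum>i<r. Const (c i) * b i)"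
        have z_i: "N z \<le> v (c i) + N (b i) + ereal (\<epsilon> / 2)" if "i < r" for i
          unfolding z_def using that by (rule orth)
        have z_keys: "Poly_Mapping.keys z \<subseteq> J" unfolding z_def using b by (intro keys_lincomb) auto
        show ?thesis
        proof (cases "c r = 0")
          case True
          show ?thesis
          proof (cases "i < r")
            case True
            have "v (c i) + N (b i) + ereal (\<epsilon> / 2) \<le> v (c i) + N (b i) + ereal \<epsilon>"
              using \<epsilon> by (intro add_left_mono) simp
            then show ?thesis
              using z_i[OF True] \<open>c r = 0\<close> True unfolding sum z_def by (auto simp: b'_def)
          next
            case False
            then have "i = r" using i by simp
            then show ?thesis using \<open>c r = 0\<close> at_0 N.not_MInf[of "b' r"] by simp
          qed
        next
          case False
          obtain l where l: "v (c r) = ereal l" using finiteE[OF False] .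
          let ?q = "Const (c r) * (e - y) + z"
          \<comment> \<open>Up to the scalar \<open>c r\<close> this is \<open>e\<close> minus
            something supported in \<open>J\<close>, so \<open>\<rho>\<close> bounds its value, and
            \<open>e - y\<close> comes within \<epsilon> / 2 of that bound.\<close>
          have "?q = Const (c r) * (e - (y - Const (inverse (c r)) * z))"
            using False by (simp add: algebra_simps mult.assoc[symmetric] mult_single single_one)
          moreover have "Poly_Mapping.keys (y - Const (inverse (c r)) * z) \<subseteq> J"
            using keys_diff[of y "Const (inverse (c r)) * z"] y(1) z_keys
            by (auto simp: in_keys_iff lookup_Const_mult subset_iff)
          ultimately have q_le: "N ?q \<le> ereal (l + \<rho>')"
            using N_scale[OF False] N_le l \<rho>' by (metis add_left_mono plus_ereal.simps(1))
          have Nl: "N (Const (c r) * (e - y)) = ereal (l + \<nu>)" using N_scale[OF False] l \<nu> by simp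
          show ?thesis
          proof (cases "i < r")
            case True
            \<comment> \<open>Hence \<open>z\<close> loses at most \<epsilon> / 2 against
              \<open>?q\<close>, and the old basis loses the other half.\<close>
            have "N ?q - ereal (\<epsilon> / 2) \<le> N z"
            proof -
              have "N ?q - ereal (\<epsilon> / 2) \<le> N (?q - Const (c r) * (e - y))"
              proof (rule N_ge_diff)
                show "N ?q - ereal (\<epsilon> / 2) \<le> N ?q" using \<epsilon> by (cases "N ?q") auto
                show "N ?q - ereal (\<epsilon> / 2) \<le> N (Const (c r) * (e - y))"
                  using q_le Nl \<nu>(2) by (cases "N ?q") auto
              qed
              then show ?thesis by simp
            qed
            also note z_i[OF True]
            finally show ?thesis
              using True b[of i] not_MInf[of "c i"] unfolding sum z_def[symmetric]
              by (cases "N ?q"; cases "v (c i)"; cases "N (b i)") (auto simp: b'_def add.commute)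
          next
            case False
            then have "i = r" using i by simp
            then show ?thesis
              using q_le l \<nu> \<epsilon> unfolding sum z_def[symmetric] by (cases "N ?q") (auto simp: b'_def add.commute)
          qed
        qed
      qed
    qed
    then show ?thesis by blast
  qed
qed

end

context complete_valued_field
begin

text \<open>The form over \<open>L\<close> is a linear functional \<open>s\<close> on coefficient
  vectors over K, and its value at \<open>x\<close> is \<open>s\<close> at the vector
  \<open>l x\<close> of monomial values. Along an almost orthogonal basis for the seminorm w(s(p)),
  the coordinates of \<open>l x\<close> depend on \<open>x\<close> as forms over K; the constants
  are the values of the basis vectors.\<close>

lemma ext_form_approx:
  fixes L :: "('l, 'b) ring_scheme" and a :: "('n::finite \<Rightarrow>\<^sub>0 nat) \<Rightarrow> 'l"
  assumes L: "field L" "valuation L w" and \<iota>: "\<iota> \<in> ring_hom ring_of_type_algebra L" "\<And>c. w (\<iota> c) = v c"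
    and a: "\<And>\<alpha>. mdeg \<alpha> = d \<Longrightarrow> a \<alpha> \<in> carrier L" and \<epsilon>: "\<epsilon> > 0"
  obtains r F c where "\<And>i. homogeneous d (F i)"
    "\<And>x. (INF i\<in>{..<r::nat}. v (poly_eval (F i) x) + ereal (c i)) \<le> w (ext_form_eval L \<iota> d a x)"
    "\<And>x. w (ext_form_eval L \<iota> d a x) \<le> (INF i\<in>{..<r}. v (poly_eval (F i) x) + ereal (c i)) + ereal \<epsilon>"
proof -
  interpret L: field L by fact
  let ?J = "{\<alpha> :: 'n \<Rightarrow>\<^sub>0 nat. mdeg \<alpha> = d}"
  have \<iota>_closed: "\<iota> x \<in> carrier L" for x
    using \<iota>(1) by (auto simp: ring_hom_def ring_of_type_algebra_def)
  have \<iota>_add: "\<iota> (x + y) = \<iota> x \<oplus>\<^bsub>L\<^esub> \<iota> y" and \<iota>_mult: "\<iota> (x * y) = \<iota> x \<otimes>\<^bsub>L\<^esub> \<iota> y" for x y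
    using \<iota>(1) by (auto simp: ring_hom_def ring_of_type_algebra_def)
  define s where "s p = (\<Oplus>\<^bsub>L\<^esub>\<alpha>\<in>?J. a \<alpha> \<otimes>\<^bsub>L\<^esub> \<iota> (Poly_Mapping.lookup p \<alpha>))" for p
  have s_closed: "s p \<in> carrier L" for p
    unfolding s_def by (intro L.finsum_closed) (auto simp: \<iota>_closed a)
  have \<iota>_0: "\<iota> 0 = \<zero>\<^bsub>L\<^esub>"
    using \<iota>_add[of 0 0] \<iota>_closed[of 0] by (metis L.add.r_cancel_one' add.right_neutral)
  have s_add: "s (p + q) = s p \<oplus>\<^bsub>L\<^esub> s q" for p q
  proof -
    have "s (p + q) = (\<Oplus>\<^bsub>L\<^esub>\<alpha>\<in>?J. a \<alpha> \<otimes>\<^bsub>L\<^esub> \<iota> (Poly_Mapping.lookup p \<alpha>) \<oplus>\<^bsub>L\<^esub> a \<alpha> \<otimes>\<^bsub>L\<^esub> \<iota> (Poly_Mapping.lookup q \<alpha>))"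
      unfolding s_def lookup_add \<iota>_add by (intro L.finsum_cong') (auto simp: \<iota>_closed a L.r_distr)
    also have "\<dots> = s p \<oplus>\<^bsub>L\<^esub> s q"
      unfolding s_def by (intro L.finsum_addf) (auto simp: \<iota>_closed a)
    finally show ?thesis .
  qed
  have s_scale: "s (Const c * p) = \<iota> c \<otimes>\<^bsub>L\<^esub> s p" for c p
    unfolding s_def lookup_Const_mult \<iota>_mult
    by (subst L.finsum_rdistr) (auto simp: \<iota>_closed a L.m_lcomm finite_mdeg intro!: L.finsum_cong')
  have s_0: "s 0 = \<zero>\<^bsub>L\<^esub>"
    unfolding s_def by (rule L.add.finprod_one_eqI) (simp add: \<iota>_0 a)
  have w: "\<And>x. x \<in> carrier L \<Longrightarrow> w x \<noteq> -\<infinity>" "\<And>x. x \<in> carrier L \<Longrightarrow> w x = \<infinity> \<longleftrightarrow> x = \<zero>\<^bsub>L\<^esub>"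
    "\<And>x y. x \<in> carrier L \<Longrightarrow> y \<in> carrier L \<Longrightarrow> w (x \<otimes>\<^bsub>L\<^esub> y) = w x + w y"
    "\<And>x y. x \<in> carrier L \<Longrightarrow> y \<in> carrier L \<Longrightarrow> min (w x) (w y) \<le> w (x \<oplus>\<^bsub>L\<^esub> y)"
    using L(2) by (auto simp: valuation_def)
  interpret N: vector_seminorm v "\<lambda>p. w (s p)"
  proof unfold_locales
    show "w (s (Const c * p)) = v c + w (s p)" for c p
      using w(3)[OF \<iota>_closed s_closed] by (simp add: s_scale \<iota>(2))
  qed (use w s_closed s_add s_0 in auto)
  obtain r b \<Lambda> where ao: "N.almost_orthogonal ?J \<epsilon> r b \<Lambda>"
    using N.exists_almost_orthogonal[OF finite_mdeg \<epsilon>] by blast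
  note lin = ao[unfolded N.almost_orthogonal_def, THEN conjunct1, rule_format]
  note b = ao[unfolded N.almost_orthogonal_def, THEN conjunct2, THEN conjunct1, rule_format]
  note ker = ao[unfolded N.almost_orthogonal_def, THEN conjunct2, THEN conjunct2, THEN conjunct1, rule_format]
  note orth = ao[unfolded N.almost_orthogonal_def, THEN conjunct2, THEN conjunct2, THEN conjunct2, rule_format]
  \<comment> \<open>The coefficients of \<open>F i\<close> are the coordinates of the monomials, so
    that evaluating \<open>F i\<close> at \<open>x\<close> yields coordinate \<open>i\<close> of
    \<open>l x\<close>.\<close>
  define F where "F i = (\<Sum>\<alpha>\<in>?J. Poly_Mapping.single \<alpha> (\<Lambda> i (Poly_Mapping.single \<alpha> 1)))" for i
  define c where "c i = real_of_ereal (w (s (b i)))" for i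
  have c: "w (s (b i)) = ereal (c i)" if "i < r" for i
    using b[OF that] by (auto simp: c_def ereal_real')
  define l where "l x = (\<Sum>\<alpha>\<in>?J. Poly_Mapping.single \<alpha> (monom_eval \<alpha> x))" for x :: "'k ^ 'n"
  have lookup_l: "Poly_Mapping.lookup (l x) \<alpha> = (if mdeg \<alpha> = d then monom_eval \<alpha> x else 0)" for x \<alpha>
  proof -
    have "Poly_Mapping.lookup (l x) \<alpha> = (\<Sum>\<beta>\<in>?J. if \<beta> = \<alpha> then monom_eval \<beta> x else 0)"
      unfolding l_def lookup_sum by (intro sum.cong) (auto simp: lookup_single when_def)
    then show ?thesis by (simp add: finite_mdeg)
  qed
  have s_l: "s (l x) = ext_form_eval L \<iota> d a x" for x
    unfolding s_def ext_form_eval_def by (intro L.finsum_cong') (auto simp: lookup_l a \<iota>_closed)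
  have \<Lambda>_l: "\<Lambda> i (l x) = poly_eval (F i) x" for i x
  proof -
    have lin_sum: "\<Lambda> i (\<Sum>\<alpha>\<in>A. g \<alpha>) = (\<Sum>\<alpha>\<in>A. \<Lambda> i (g \<alpha>))" for A g
      by (induction A rule: infinite_finite_induct) (simp_all add: lin_functional_D[OF lin])
    have "Poly_Mapping.single \<alpha> y = Const y * Poly_Mapping.single \<alpha> 1" for \<alpha> :: "'n \<Rightarrow>\<^sub>0 nat" and y :: 'k
      by (simp add: mult_single)
    then have sc: "\<Lambda> i (Poly_Mapping.single \<alpha> y) = y * \<Lambda> i (Poly_Mapping.single \<alpha> 1)" for \<alpha> y
      by (metis lin_functional_D(2)[OF lin])
    have "\<Lambda> i (l x) = (\<Sum>\<alpha>\<in>?J. monom_eval \<alpha> x * \<Lambda> i (Poly_Mapping.single \<alpha> 1))"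
      unfolding l_def lin_sum by (intro sum.cong refl sc)
    also have "\<dots> = poly_eval (F i) x"
      unfolding F_def is_hom_sum[OF is_hom_poly_eval]
      by (intro sum.cong) (auto simp: poly_eval_altdef peval_single monom_eval_def mon_def mult.commute)
    finally show ?thesis .
  qed
  have l_keys: "Poly_Mapping.keys (l x) \<subseteq> ?J" for x
    by (auto simp: in_keys_iff lookup_l split: if_splits)
  have eq: "w (s (l x)) = w (s (\<Sum>i<r. Const (poly_eval (F i) x) * b i))" for x
    using N.N_eq_mod_kernel[OF ker[OF l_keys]] by (simp add: \<Lambda>_l)
  show ?thesis
  proof (rule that[of F c r])
    show "homogeneous d (F i)" for i
      unfolding F_def by (intro homogeneous_sum) (use homogeneous_single in blast)
    fix x
    show "(INF i\<in>{..<r}. v (poly_eval (F i) x) + ereal (c i)) \<le> w (ext_form_eval L \<iota> d a x)"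
      unfolding s_l[symmetric] eq
    proof (rule N.N.ge_sum)
      fix i assume i: "i \<in> {..<r}"
      then have "(INF i\<in>{..<r}. v (poly_eval (F i) x) + ereal (c i)) \<le> v (poly_eval (F i) x) + w (s (b i))"
        using c by (intro INF_lower2[of i]) auto
      also have "\<dots> \<le> w (s (Const (poly_eval (F i) x) * b i))" by (rule N.N_scale_ge)
      finally show "(INF i\<in>{..<r}. v (poly_eval (F i) x) + ereal (c i)) \<le> w (s (Const (poly_eval (F i) x) * b i))" .
    qed
    have "w (s (l x)) - ereal \<epsilon> \<le> (INF i\<in>{..<r}. v (poly_eval (F i) x) + ereal (c i))"
    proof (rule INF_greatest)
      fix i assume i: "i \<in> {..<r}"
      have "w (s (l x)) \<le> v (poly_eval (F i) x) + w (s (b i)) + ereal \<epsilon>"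
        unfolding eq using orth[of i "\<lambda>i. poly_eval (F i) x"] i by simp
      then show "w (s (l x)) - ereal \<epsilon> \<le> v (poly_eval (F i) x) + ereal (c i)"
        using c[of i] i by (simp add: ereal_minus_le)
    qed
    then show "w (ext_form_eval L \<iota> d a x) \<le> (INF i\<in>{..<r}. v (poly_eval (F i) x) + ereal (c i)) + ereal \<epsilon>"
      unfolding s_l by (simp add: ereal_minus_le)
  qed
qed

end

section \<open>Minima of forms as virtual divisors\<close>

text \<open>The length is coded along with the folded pairs, because folding alone is injective only
  on lists of equal length.\<close>

lemma infinite_inj_list:
  assumes "infinite (UNIV :: 'a set)"
  shows "\<exists>e :: 'a list \<Rightarrow> 'a. inj e"
proof -
  obtain p :: "'a \<times> 'a \<Rightarrow> 'a" where p: "inj p"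
    using card_of_Times_same_infinite[OF assms]
      card_of_ordIso[of "UNIV \<times> UNIV :: ('a \<times> 'a) set" "UNIV :: 'a set"] unfolding bij_betw_def UNIV_Times_UNIV by blast
  obtain l :: "nat \<Rightarrow> 'a" where l: "inj l"
    using infinite_countable_subset[OF assms] by auto
  define e where "e = rec_list (undefined :: 'a) (\<lambda>x _ r. p (x, r))"
  have e_inj: "xs = ys" if "length xs = length ys" "e xs = e ys" for xs ys
    using that
    by (induction xs ys rule: list_induct2) (auto simp: e_def dest: injD[OF p])
  have "inj (\<lambda>xs. p (l (length xs), e xs))"
    by (rule injI) (auto dest!: injD[OF p] injD[OF l] e_inj)
  then show ?thesis by blast
qed

text \<open>The field K(T) has to be carried by a subset of \<open>'l\<close>, and K is what injects
  into \<open>'l\<close>; a fraction is coded by the coefficients of a chosen numerator and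
  denominator.\<close>

lemma inj_poly_fract:
  assumes "infinite (UNIV :: 'k::field set)"
  shows "\<exists>j :: 'k poly fract \<Rightarrow> 'k. inj j"
proof -
  obtain e :: "'k list \<Rightarrow> 'k" where e: "inj e" using infinite_inj_list[OF assms] by blast
  have "\<exists>ab. x = Fract (fst ab) (snd ab)" for x :: "'k poly fract"
    by (cases x) auto
  then obtain r :: "'k poly fract \<Rightarrow> 'k poly \<times> 'k poly" where r: "\<And>x. x = Fract (fst (r x)) (snd (r x))"
    by metis
  have "inj (\<lambda>x. e [e (coeffs (fst (r x))), e (coeffs (snd (r x)))])"
  proof (rule injI)
    fix x y assume "e [e (coeffs (fst (r x))), e (coeffs (snd (r x)))] = e [e (coeffs (fst (r y))), e (coeffs (snd (r y)))]"
    then have "fst (r x) = fst (r y)" "snd (r x) = snd (r y)"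
      by (auto dest!: injD[OF e] simp: coeffs_eq_iff)
    then show "x = y" using r by metis
  qed
  then show ?thesis by blast
qed

section \<open>The Gauss valuation on K(T) and generic combinations\<close>

context closed_valued_field
begin

lemma infinite_field: "infinite (UNIV :: 'k set)"
proof -
  obtain c where "c \<noteq> 0" "v c \<noteq> 0" using nontrivial by blast
  then obtain r where r: "v c = ereal r" "r \<noteq> 0" using finite[of c] by (cases "v c") auto
  have "inj (\<lambda>n. c ^ n)"
  proof (rule injI)
    fix m n assume "c ^ m = c ^ n"
    then have "v (c ^ m) = v (c ^ n)" by simp
    then show "m = n" using r by (simp add: power)
  qed
  then have "infinite (range (\<lambda>n::nat. c ^ n))" by (rule range_inj_infinite)
  then show ?thesis by (rule infinite_super[rotated]) simp
qed

text \<open>Borrowing from the multivariate \<open>gauss\<close> through one variable yields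
  multiplicativity without a second argument.\<close>

definition ugauss :: "'k poly \<Rightarrow> ereal" where
  "ugauss p = gauss (ueval Const (Var (0::nat)) p)"

lemma ueval_monomials:
  "(\<Sum>i\<in>A. Const (y i) * Var (0::nat) ^ i) = (\<Sum>i\<in>A. Poly_Mapping.single (Poly_Mapping.single (0::nat) i) (y i :: 'k))"
proof (rule sum.cong[OF refl])
  fix i
  have "(Var (0::nat) :: (nat, 'k) mpoly) ^ i = Poly_Mapping.single (Poly_Mapping.single (0::nat) i) 1"
    by (induction i) (auto simp: mult_single single_add[symmetric] single_one)
  then show "Const (y i) * Var (0::nat) ^ i = Poly_Mapping.single (Poly_Mapping.single (0::nat) i) (y i)"
    by (simp add: mult_single)
qed

lemma lookup_monomials:
  fixes A :: "nat set"
  assumes "finite A"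
  shows "Poly_Mapping.lookup (\<Sum>i\<in>A. Poly_Mapping.single (Poly_Mapping.single (0::nat) i) (y i :: 'k)) (Poly_Mapping.single 0 k) =
    (if k \<in> A then y k else 0)"
proof -
  have inj: "Poly_Mapping.single (0::nat) i = Poly_Mapping.single 0 k \<longleftrightarrow> i = k" for i k :: nat
    by (metis lookup_single_eq)
  have "Poly_Mapping.lookup (\<Sum>i\<in>A. Poly_Mapping.single (Poly_Mapping.single (0::nat) i) (y i :: 'k)) (Poly_Mapping.single 0 k) =
      (\<Sum>i\<in>A. if i = k then y i else 0)"
    unfolding lookup_sum by (intro sum.cong refl) (simp only: lookup_single when_def inj)
  then show ?thesis using assms by simp
qed

lemma ugauss_sum_monom:
  assumes "finite A"
  shows "ugauss (\<Sum>k\<in>A. monom (y k) k) = (INF k\<in>A. v (y k))"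
proof -
  have eq: "ueval Const (Var (0::nat)) (\<Sum>k\<in>A. monom (y k) k) = (\<Sum>i\<in>A. Poly_Mapping.single (Poly_Mapping.single (0::nat) i) (y i))"
    by (simp add: is_hom_sum[OF is_hom_ueval[OF is_hom_Const]] ueval_monom[OF is_hom_Const] ueval_monomials)
  show ?thesis
    unfolding ugauss_def eq
  proof (rule antisym)
    show "gauss (\<Sum>i\<in>A. Poly_Mapping.single (Poly_Mapping.single (0::nat) i) (y i)) \<le> (INF k\<in>A. v (y k))"
    proof (rule INF_greatest)
      fix k assume "k \<in> A"
      then show "gauss (\<Sum>i\<in>A. Poly_Mapping.single (Poly_Mapping.single (0::nat) i) (y i)) \<le> v (y k)"
        using gauss_le[of "\<Sum>i\<in>A. Poly_Mapping.single (Poly_Mapping.single (0::nat) i) (y i)" "Poly_Mapping.single 0 k"]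
        by (simp add: lookup_monomials[OF assms])
    qed
    show "(INF k\<in>A. v (y k)) \<le> gauss (\<Sum>i\<in>A. Poly_Mapping.single (Poly_Mapping.single (0::nat) i) (y i))"
      by (intro gauss.ge_sum) (auto simp: gauss_single intro: INF_lower)
  qed
qed

lemma ugauss_const: "ugauss [:c:] = v c"
  using ugauss_sum_monom[of "{0}" "\<lambda>_. c"] by (simp add: monom_0)

lemma ugauss_0_iff: "ugauss p = \<infinity> \<longleftrightarrow> p = 0"
proof
  assume "ugauss p = \<infinity>"
  then have "ueval Const (Var (0::nat)) p = 0"
    unfolding ugauss_def using gauss_finite by force
  then have 0: "(\<Sum>i\<le>degree p. Poly_Mapping.single (Poly_Mapping.single (0::nat) i) (coeff p i)) = 0"
    by (simp add: ueval_def ueval_monomials)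
  have "coeff p (degree p) = 0"
    using lookup_monomials[of "{..degree p}" "coeff p" "degree p"] unfolding 0 by simp
  then show "p = 0" by simp
qed (simp add: ugauss_def)

lemma ugauss_semivaluation: "semivaluation ugauss"
proof -
  note h = is_hom_D[OF is_hom_ueval[OF is_hom_Const, of "Var (0::nat)"]]
  show ?thesis
    by unfold_locales (auto simp: ugauss_def h gauss.at_1 gauss.mult gauss.not_MInf gauss.add_ge)
qed

definition fract_val :: "'k poly fract \<Rightarrow> ereal" where
  "fract_val x = (let (p, q) = (SOME (p, q). q \<noteq> 0 \<and> x = Fract p q) in ugauss p - ugauss q)"

lemma fract_val_Fract:
  assumes "q \<noteq> 0"
  shows "fract_val (Fract p q) = ugauss p - ugauss q"
proof -
  interpret G: semivaluation ugauss by (rule ugauss_semivaluation)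
  define pq where "pq = (SOME pq. snd pq \<noteq> 0 \<and> Fract p q = Fract (fst pq) (snd pq))"
  have "snd pq \<noteq> 0 \<and> Fract p q = Fract (fst pq) (snd pq)"
    unfolding pq_def by (rule someI[of _ "(p, q)"]) (use assms in auto)
  then have pq: "snd pq \<noteq> 0" "p * snd pq = fst pq * q"
    using assms by (auto simp: eq_fract)
  have "ugauss p + ugauss (snd pq) = ugauss (fst pq) + ugauss q"
    using pq(2) by (metis G.mult)
  moreover have "\<bar>ugauss q\<bar> \<noteq> \<infinity>" "\<bar>ugauss (snd pq)\<bar> \<noteq> \<infinity>"
    using assms pq(1) ugauss_0_iff G.not_MInf by (auto simp: ereal_infinity_cases)
  ultimately have "ugauss (fst pq) - ugauss (snd pq) = ugauss p - ugauss q"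
    using G.not_MInf[of p] G.not_MInf[of "fst pq"]
    by (cases "ugauss p"; cases "ugauss q"; cases "ugauss (snd pq)"; cases "ugauss (fst pq)") auto
  then show ?thesis
    unfolding fract_val_def Let_def by (simp add: case_prod_unfold pq_def)
qed

lemma fract_val:
  shows "fract_val x \<noteq> -\<infinity>" "fract_val x = \<infinity> \<longleftrightarrow> x = 0" "fract_val (x * y) = fract_val x + fract_val y"
    "min (fract_val x) (fract_val y) \<le> fract_val (x + y)"
proof -
  interpret G: semivaluation ugauss by (rule ugauss_semivaluation)
  obtain p q where x: "x = Fract p q" "q \<noteq> 0" by (cases x)
  obtain p' q' where y: "y = Fract p' q'" "q' \<noteq> 0" by (cases y)
  obtain Q Q' where Q: "ugauss q = ereal Q" "ugauss q' = ereal Q'"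
    using x y ugauss_0_iff[of q] ugauss_0_iff[of q'] G.not_MInf[of q] G.not_MInf[of q'] by (metis ereal_cases)
  show "fract_val x \<noteq> -\<infinity>"
    using G.not_MInf[of p] Q by (cases "ugauss p") (auto simp: x fract_val_Fract)
  have "fract_val x = \<infinity> \<longleftrightarrow> ugauss p = \<infinity>"
    using Q by (cases "ugauss p") (auto simp: x fract_val_Fract)
  then show "fract_val x = \<infinity> \<longleftrightarrow> x = 0"
    using x by (simp add: ugauss_0_iff Zero_fract_def eq_fract)
  show "fract_val (x * y) = fract_val x + fract_val y"
    using Q x(2) y(2) G.not_MInf[of p] G.not_MInf[of p']
    by (cases "ugauss p"; cases "ugauss p'") (auto simp: x(1) y(1) fract_val_Fract G.mult)
  have "min (ugauss p + ereal Q') (ugauss p' + ereal Q) \<le> ugauss (p * q' + p' * q)"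
    using G.add_ge[of "p * q'" "p' * q"] by (simp add: G.mult Q)
  then show "min (fract_val x) (fract_val y) \<le> fract_val (x + y)"
    using Q x(2) y(2) G.not_MInf[of p] G.not_MInf[of p']
    by (cases "ugauss p"; cases "ugauss p'"; cases "ugauss (p * q' + p' * q)")
       (auto simp: x(1) y(1) fract_val_Fract G.mult min_def split: if_splits)
qed

text \<open>The coefficient sum of f_k * T^k turns the values of the \<open>f k\<close> at a point
  into the coefficients of a polynomial in T, and its Gauss value is their minimum.\<close>

lemma min_of_forms_virtual:
  fixes W :: "('k, 'n::finite) proj set" and U :: "'l itself"
  assumes inj: "\<exists>j :: 'k \<Rightarrow> 'l. inj j" and D: "D \<ge> 1"
    and f: "\<And>k. k < (m::nat) \<Longrightarrow> homogeneous D (f k)"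
    and \<eta>: "\<And>\<xi>. \<xi> \<in> W \<Longrightarrow> \<bar>\<eta> \<xi>\<bar> \<noteq> \<infinity>"
      "\<And>\<xi>. \<xi> \<in> W \<Longrightarrow> \<eta> \<xi> = ((INF k\<in>{..<m}. v (poly_eval (f k) (rep_proj \<xi>))) - ereal (real D) * tuple_val v (rep_proj \<xi>)) / ereal (real D)"
  shows "virtual_divisor_of_degree U v W D \<eta>"
proof -
  obtain j1 :: "'k \<Rightarrow> 'l" where j1: "inj j1" using inj by blast
  obtain j2 :: "'k poly fract \<Rightarrow> 'k" where j2: "inj j2" using inj_poly_fract[OF infinite_field] by blast
  define J where "J x = j1 (j2 x)" for x
  have J: "inj J" using inj_compose[OF j1 j2] by (simp add: J_def[abs_def] comp_def)
  define Ji where "Ji = inv_into UNIV J"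
  have IJ [simp]: "Ji (J x) = x" for x unfolding Ji_def using J by simp
  \<comment> \<open>K(T) transported along the injection \<open>J\<close>, so that its carrier is a
    subset of \<open>'l\<close>.\<close>
  define L where "L = \<lparr>carrier = range J, monoid.mult = (\<lambda>x y. J (Ji x * Ji y)), one = J 1,
    zero = J 0, add = (\<lambda>x y. J (Ji x + Ji y))\<rparr>"
  have L: "carrier L = range J" "J x \<otimes>\<^bsub>L\<^esub> J y = J (x * y)" "\<one>\<^bsub>L\<^esub> = J 1" "\<zero>\<^bsub>L\<^esub> = J 0" "J x \<oplus>\<^bsub>L\<^esub> J y = J (x + y)" for x y
    by (simp_all add: L_def)
  have "J \<in> ring_iso (ring_of_type_algebra :: 'k poly fract ring) L"
    unfolding ring_iso_def ring_hom_def using J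
    by (auto simp: L ring_of_type_algebra_def bij_betw_def)
  then have "field (L \<lparr>zero := J \<zero>\<^bsub>(ring_of_type_algebra :: 'k poly fract ring)\<^esub>\<rparr>)"
    by (rule field.ring_iso_imp_img_field[OF field_from_type_algebra])
  then have L_field: "field L"
    by (simp add: L_def ring_of_type_algebra_def)
  interpret L: field L by fact
  define w where "w x = fract_val (Ji x)" for x
  have w: "valuation L w"
    unfolding valuation_def w_def using fract_val by (auto simp: L inj_eq[OF J])
  define \<iota> where "\<iota> c = J (Fract [:c:] 1)" for c
  have \<iota>: "\<iota> \<in> ring_hom ring_of_type_algebra L"
    unfolding ring_hom_def \<iota>_def
    by (auto simp: L ring_of_type_algebra_def One_fract_def one_pCons mult.commute)
  have \<iota>_v: "w (\<iota> c) = v c" for c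
    using ugauss_const[of 1] by (simp add: w_def \<iota>_def fract_val_Fract ugauss_const at_1 one_pCons)
  define a where "a \<alpha> = J (Fract (\<Sum>k<m. monom (Poly_Mapping.lookup (f k) \<alpha>) k) 1)" for \<alpha>
  have finsum_J: "(\<Oplus>\<^bsub>L\<^esub>\<alpha>\<in>A. J (g \<alpha>)) = J (\<Sum>\<alpha>\<in>A. g \<alpha>)" if "finite A" for A :: "('n \<Rightarrow>\<^sub>0 nat) set" and g
    using that by induction (auto simp: L)
  have Fract_sum: "(\<Sum>\<alpha>\<in>A. Fract (g \<alpha>) 1) = Fract (\<Sum>\<alpha>\<in>A. g \<alpha>) (1 :: 'k poly)" for A :: "('n \<Rightarrow>\<^sub>0 nat) set" and g
    by (induction A rule: infinite_finite_induct) (auto simp: Zero_fract_def)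
  have eval: "w (ext_form_eval L \<iota> D a x) = (INF k\<in>{..<m}. v (poly_eval (f k) x))" for x :: "'k ^ 'n"
  proof -
    let ?S = "{\<alpha> :: 'n \<Rightarrow>\<^sub>0 nat. mdeg \<alpha> = D}"
    have "ext_form_eval L \<iota> D a x = J (Fract (\<Sum>\<alpha>\<in>?S. (\<Sum>k<m. monom (Poly_Mapping.lookup (f k) \<alpha>) k) * [:monom_eval \<alpha> x:]) 1)"
      unfolding ext_form_eval_def a_def \<iota>_def L(2) mult_fract by (simp add: finsum_J[OF finite_mdeg] Fract_sum)
    also have "(\<Sum>\<alpha>\<in>?S. (\<Sum>k<m. monom (Poly_Mapping.lookup (f k) \<alpha>) k) * [:monom_eval \<alpha> x:]) =
        (\<Sum>k<m. monom (poly_eval (f k) x) k)"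
    proof -
      have "(\<Sum>\<alpha>\<in>?S. (\<Sum>k<m. monom (Poly_Mapping.lookup (f k) \<alpha>) k) * [:monom_eval \<alpha> x:]) =
          (\<Sum>\<alpha>\<in>?S. \<Sum>k<m. monom (Poly_Mapping.lookup (f k) \<alpha> * monom_eval \<alpha> x) k)"
        by (simp add: smult_sum_right smult_monom mult.commute)
      also have "\<dots> = (\<Sum>k<m. \<Sum>\<alpha>\<in>?S. monom (Poly_Mapping.lookup (f k) \<alpha> * monom_eval \<alpha> x) k)"
        by (rule sum.swap)
      also have "\<dots> = (\<Sum>k<m. monom (poly_eval (f k) x) k)"
      proof (rule sum.cong[OF refl])
        fix k assume "k \<in> {..<m}"
        then have "Poly_Mapping.keys (f k) \<subseteq> ?S" using f by (auto simp: homogeneous_def)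
        then have "poly_eval (f k) x = (\<Sum>\<alpha>\<in>?S. Poly_Mapping.lookup (f k) \<alpha> * monom_eval \<alpha> x)"
          unfolding poly_eval_def
          by (rule sum.mono_neutral_left[OF finite_mdeg]) (auto simp: in_keys_iff)
        then show "(\<Sum>\<alpha>\<in>?S. monom (Poly_Mapping.lookup (f k) \<alpha> * monom_eval \<alpha> x) k) = monom (poly_eval (f k) x) k"
          by (simp add: monom_sum)
      qed
      finally show ?thesis .
    qed
    finally have "w (ext_form_eval L \<iota> D a x) = ugauss (\<Sum>k<m. monom (poly_eval (f k) x) k) - ugauss 1"
      by (simp add: w_def fract_val_Fract)
    also have "ugauss 1 = 0" using ugauss_const[of 1] by (simp add: at_1 one_pCons)
    finally show ?thesis by (simp add: ugauss_sum_monom)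
  qed
  have "(\<forall>\<alpha>. mdeg \<alpha> = D \<longrightarrow> a \<alpha> \<in> carrier L)" by (simp add: a_def L)
  then show ?thesis
    unfolding virtual_divisor_of_degree_def
    using D L_field w \<iota> \<iota>_v \<eta> eval by (intro conjI exI[of _ L] exI[of _ w] exI[of _ \<iota>] exI[of _ a]) auto
qed

end

section \<open>The coordinate ring\<close>

lemma rep_proj_nonzero: "rep_proj \<xi> \<noteq> 0"
  using Quotient3_rep_reflp[OF Quotient3_proj, of \<xi>] by (simp add: proj_rel_def)

lemma rep_abs_proj:
  assumes "x \<noteq> 0"
  obtains c where "c \<noteq> 0" "rep_proj (abs_proj x) = c *s x"
proof -
  have "proj_rel x x" using assms by (auto simp: proj_rel_def intro!: exI[of _ 1])
  then have "proj_rel (rep_proj (abs_proj x)) x"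
    by (rule Quotient3_rep_abs[OF Quotient3_proj])
  then obtain c where c: "c \<noteq> 0" "x = c *s rep_proj (abs_proj x)" by (auto simp: proj_rel_def)
  then have "inverse c *s x = rep_proj (abs_proj x)"
    by (subst c(2)) (simp add: vec_eq_iff)
  then show ?thesis using that[of "inverse c"] c(1) by simp
qed

section \<open>The degree filtration of K[X]\<close>

definition deg_le :: "nat \<Rightarrow> ('i, 'k::comm_ring_1) mpoly \<Rightarrow> bool" where
  "deg_le t f \<longleftrightarrow> (\<forall>m>t. hom_component m f = 0)"

lemma deg_le_iff: "deg_le t f \<longleftrightarrow> (\<forall>\<alpha>\<in>Poly_Mapping.keys f. mdeg \<alpha> \<le> t)"
proof
  assume d: "deg_le t f"
  show "\<forall>\<alpha>\<in>Poly_Mapping.keys f. mdeg \<alpha> \<le> t"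
  proof (rule ballI, rule ccontr)
    fix \<alpha> assume "\<alpha> \<in> Poly_Mapping.keys f" "\<not> mdeg \<alpha> \<le> t"
    then have "Poly_Mapping.lookup (hom_component (mdeg \<alpha>) f) \<alpha> \<noteq> 0"
      by (simp add: lookup_hom_component in_keys_iff)
    then show False using d \<open>\<not> mdeg \<alpha> \<le> t\<close> by (simp add: deg_le_def)
  qed
next
  assume *: "\<forall>\<alpha>\<in>Poly_Mapping.keys f. mdeg \<alpha> \<le> t"
  show "deg_le t f"
    unfolding deg_le_def
  proof (intro allI impI poly_mapping_eqI)
    fix m \<alpha> assume "m > t"
    then show "Poly_Mapping.lookup (hom_component m f) \<alpha> = Poly_Mapping.lookup 0 \<alpha>"
      using bspec[OF *, of \<alpha>] by (cases "Poly_Mapping.lookup f \<alpha> = 0") (auto simp: lookup_hom_component in_keys_iff)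
  qed
qed

lemma deg_le_mono: "deg_le s f \<Longrightarrow> s \<le> t \<Longrightarrow> deg_le t f"
  by (simp add: deg_le_def)

lemma deg_le_Const [simp]: "deg_le t (Const c)"
  by (simp add: deg_le_def hom_component_single)

lemma deg_le_sum: "(\<And>i. i \<in> A \<Longrightarrow> deg_le t (f i)) \<Longrightarrow> deg_le t (sum f A)"
  by (auto simp: deg_le_def hom_component_sum)

lemma deg_le_mult:
  assumes "deg_le s f" "deg_le t g" shows "deg_le (s + t) (f * g)"
  unfolding deg_le_def hom_component_mult
proof (intro allI impI sum.neutral ballI)
  fix m i assume "m > s + t" "i \<in> {..m}"
  then have "i > s \<or> m - i > t" by auto
  then show "hom_component i f * hom_component (m - i) g = 0"
    using assms by (auto simp: deg_le_def)
qed

lemma deg_le_power: "deg_le t f \<Longrightarrow> deg_le (n * t) (f ^ n)"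
  using deg_le_Const[of 0 1] by (induction n) (auto simp: single_one intro: deg_le_mult)

lemma deg_le_prod: "(\<And>i. i \<in> A \<Longrightarrow> deg_le (d i) (f i)) \<Longrightarrow> deg_le (sum d A) (prod f A)"
  using deg_le_Const[of 0 1]
  by (induction A rule: infinite_finite_induct) (auto simp: single_one intro: deg_le_mult)

lemma deg_le_peval:
  assumes "\<And>i. deg_le M (g i)" "deg_le d p"
  shows "deg_le (M * d) (peval Const g p)"
  unfolding peval_def
proof (rule deg_le_sum)
  fix \<alpha> assume "\<alpha> \<in> Poly_Mapping.keys p"
  then have "mdeg \<alpha> \<le> d" using assms(2) by (simp add: deg_le_iff)
  have "deg_le (\<Sum>i\<in>Poly_Mapping.keys \<alpha>. Poly_Mapping.lookup \<alpha> i * M) (mon g \<alpha>)"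
    unfolding mon_def by (intro deg_le_prod deg_le_power assms)
  moreover have "(\<Sum>i\<in>Poly_Mapping.keys \<alpha>. Poly_Mapping.lookup \<alpha> i * M) = mdeg \<alpha> * M"
    by (simp add: mdeg_def sum_distrib_right)
  ultimately have "deg_le (0 + mdeg \<alpha> * M) (Const (Poly_Mapping.lookup p \<alpha>) * mon g \<alpha>)"
    by (intro deg_le_mult) auto
  then show "deg_le (M * d) (Const (Poly_Mapping.lookup p \<alpha>) * mon g \<alpha>)"
    by (rule deg_le_mono) (use \<open>mdeg \<alpha> \<le> d\<close> in \<open>simp add: mult.commute\<close>)
qed

lemma deg_le_homogeneous: "homogeneous d f \<Longrightarrow> deg_le d f"
  by (simp add: deg_le_def hom_component_homogeneous)

section \<open>K[W] by representatives in K[X]\<close>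

context
  fixes W :: "('k::field, 'n::finite) proj set"
begin

lemma is_ideal_vanishing: "is_ideal (vanishing_ideal W)"
  unfolding is_ideal_def
proof (intro conjI ballI allI)
  fix x r assume "x \<in> vanishing_ideal W"
  then show "r * x \<in> vanishing_ideal W"
    by (auto simp: vanishing_ideal_def hom_component_mult poly_eval_simps is_hom_sum[OF is_hom_poly_eval] intro!: sum.neutral)
qed (auto simp: vanishing_ideal_def hom_component_add poly_eval_simps)

lemmas vanishing = is_ideal_D[OF is_ideal_vanishing]

lemma vanishing_component: "p \<in> vanishing_ideal W \<Longrightarrow> hom_component m p \<in> vanishing_ideal W"
  by (auto simp: vanishing_ideal_def hom_component_homogeneous[OF homogeneous_hom_component] poly_eval_simps)

lemma vanishing_homogeneous:
  "homogeneous d p \<Longrightarrow> p \<in> vanishing_ideal W \<longleftrightarrow> (\<forall>\<xi>\<in>W. poly_eval p (rep_proj \<xi>) = 0)"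
  by (auto simp: vanishing_ideal_def hom_component_homogeneous poly_eval_simps)

lemma coord_class_altdef: "coord_class W f = (\<lambda>i. i + f) ` vanishing_ideal W"
  by (auto simp: coord_class_def a_r_coset_def' ring_of_type_algebra_def)

lemma coord_class_eq_iff: "coord_class W f = coord_class W g \<longleftrightarrow> f - g \<in> vanishing_ideal W"
proof
  assume eq: "coord_class W f = coord_class W g"
  have "0 + f \<in> coord_class W f" unfolding coord_class_altdef using vanishing(1) by blast
  then have "f \<in> coord_class W g" by (simp add: eq)
  then obtain i where "i \<in> vanishing_ideal W" "f = i + g" by (auto simp: coord_class_altdef)
  then show "f - g \<in> vanishing_ideal W" by simp
next
  have *: "coord_class W f \<subseteq> coord_class W g" if "f - g \<in> vanishing_ideal W" for f g
  proof
    fix x assume "x \<in> coord_class W f"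
    then obtain i where "i \<in> vanishing_ideal W" "x = i + f" by (auto simp: coord_class_altdef)
    then have "x = (i + (f - g)) + g" "i + (f - g) \<in> vanishing_ideal W" using that vanishing(2) by auto
    then show "x \<in> coord_class W g" unfolding coord_class_altdef by blast
  qed
  assume "f - g \<in> vanishing_ideal W"
  moreover from this have "g - f \<in> vanishing_ideal W" using vanishing(5)[of "f - g"] by simp
  ultimately show "coord_class W f = coord_class W g" using * by blast
qed

lemma ideal_vanishing: "ideal (vanishing_ideal W) ring_of_type_algebra"
proof (rule idealI)
  show "ring (ring_of_type_algebra :: ('n, 'k) mpoly ring)" by (rule ring_from_type_algebra)
  interpret R: ring "ring_of_type_algebra :: ('n, 'k) mpoly ring" by (rule ring_from_type_algebra)
  have neg: "\<ominus>\<^bsub>ring_of_type_algebra\<^esub> x = - x" for x :: "('n, 'k) mpoly"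
    by (rule R.minus_equality) (auto simp: ring_of_type_algebra_def)
  show "subgroup (vanishing_ideal W) (add_monoid ring_of_type_algebra)"
    by (rule R.add.subgroupI)
      (use vanishing neg[unfolded a_inv_def] neg[unfolded ring_of_type_algebra_def] in \<open>auto simp: ring_of_type_algebra_def\<close>)
qed (use vanishing in \<open>auto simp: ring_of_type_algebra_def\<close>)

lemma cring_coord_ring: "cring (coord_ring W)"
  unfolding coord_ring_def
  by (rule ideal.quotient_is_cring[OF ideal_vanishing cring_from_type_algebra])

interpretation A: cring "coord_ring W" by (rule cring_coord_ring)

lemma coord_class_hom: "coord_class W \<in> ring_hom ring_of_type_algebra (coord_ring W)"
  using ideal.rcos_ring_hom[OF ideal_vanishing] unfolding coord_ring_def coord_class_def[abs_def] .

lemma carrier_coord_ring: "carrier (coord_ring W) = range (coord_class W)"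
  by (auto simp: coord_ring_def FactRing_def A_RCOSETS_def' coord_class_def ring_of_type_algebra_def)

lemma coord_class_closed [simp]: "coord_class W f \<in> carrier (coord_ring W)"
  by (simp add: carrier_coord_ring)

lemma coord_class_add: "coord_class W f \<oplus>\<^bsub>coord_ring W\<^esub> coord_class W g = coord_class W (f + g)"
  and coord_class_mult: "coord_class W f \<otimes>\<^bsub>coord_ring W\<^esub> coord_class W g = coord_class W (f * g)"
  and coord_class_1: "\<one>\<^bsub>coord_ring W\<^esub> = coord_class W 1"
  using coord_class_hom by (auto simp: ring_hom_def ring_of_type_algebra_def)

lemma coord_class_0: "\<zero>\<^bsub>coord_ring W\<^esub> = coord_class W 0"
  using A.r_zero[of "coord_class W 0"] coord_class_add[of 0 0]
  by (metis A.add.r_cancel_one' add.right_neutral coord_class_closed)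

lemma coord_class_uminus: "\<ominus>\<^bsub>coord_ring W\<^esub> coord_class W f = coord_class W (- f)"
  by (rule A.minus_equality) (simp_all add: coord_class_add coord_class_0)

lemma coord_class_power: "coord_class W f [^]\<^bsub>coord_ring W\<^esub> (n::nat) = coord_class W (f ^ n)"
  by (induction n) (simp_all add: coord_class_1 coord_class_mult mult.commute)

lemma coord_class_finsum:
  "finite S \<Longrightarrow> (\<Oplus>\<^bsub>coord_ring W\<^esub>i\<in>S. coord_class W (f i)) = coord_class W (\<Sum>i\<in>S. f i)"
  by (induction S rule: finite_induct) (simp_all add: coord_class_0 coord_class_add)

lemma coord_class_finprod:
  "finite S \<Longrightarrow> (\<Otimes>\<^bsub>coord_ring W\<^esub>i\<in>S. coord_class W (f i)) = coord_class W (\<Prod>i\<in>S. f i)"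
  by (induction S rule: finite_induct) (simp_all add: coord_class_1 coord_class_mult)

lemma coord_class_vanishing: "f \<in> vanishing_ideal W \<Longrightarrow> coord_class W f = coord_class W 0"
  by (simp add: coord_class_eq_iff)

lemma algebra_eval_coord_ring:
  assumes c: "\<And>i. i < length cs \<Longrightarrow> cs ! i = coord_class W (g i)" and f: "mvars f \<subseteq> {..<length cs}"
  shows "algebra_eval (coord_ring W) (coord_const W) cs f = coord_class W (peval Const g f)"
proof -
  have "(\<Otimes>\<^bsub>coord_ring W\<^esub>i\<in>Poly_Mapping.keys \<alpha>. (cs ! i) [^]\<^bsub>coord_ring W\<^esub> Poly_Mapping.lookup \<alpha> i) = coord_class W (mon g \<alpha>)"
    if "\<alpha> \<in> Poly_Mapping.keys f" for \<alpha>
  proof -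
    have "(\<Otimes>\<^bsub>coord_ring W\<^esub>i\<in>Poly_Mapping.keys \<alpha>. (cs ! i) [^]\<^bsub>coord_ring W\<^esub> Poly_Mapping.lookup \<alpha> i) =
       (\<Otimes>\<^bsub>coord_ring W\<^esub>i\<in>Poly_Mapping.keys \<alpha>. coord_class W (g i ^ Poly_Mapping.lookup \<alpha> i))"
      using that f c by (intro A.finprod_cong') (auto simp: mvars_def coord_class_power)
    then show ?thesis by (simp add: coord_class_finprod mon_def)
  qed
  then have "algebra_eval (coord_ring W) (coord_const W) cs f =
      (\<Oplus>\<^bsub>coord_ring W\<^esub>\<alpha>\<in>Poly_Mapping.keys f. coord_class W (Const (Poly_Mapping.lookup f \<alpha>) * mon g \<alpha>))"
    unfolding algebra_eval_def by (intro A.finsum_cong') (auto simp: coord_const_def coord_class_mult)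
  then show ?thesis by (simp add: coord_class_finsum peval_def)
qed

text \<open>Counting the vanishing ideal among the generators turns generation of K[W] into
  generation of K[X], which is what the finiteness lemmas use.\<close>

lemma generates_algebra_iff:
  "generates_algebra (coord_ring W) (coord_const W) (coord_class W ` F) \<longleftrightarrow>
    (\<forall>C. is_subring C \<longrightarrow> range Const \<subseteq> C \<longrightarrow> vanishing_ideal W \<subseteq> C \<longrightarrow> F \<subseteq> C \<longrightarrow> C = UNIV)"
proof -
  let ?G = "generate_ring (coord_ring W) (range (coord_const W) \<union> coord_class W ` F)"
  show ?thesis
  proof
    assume gen: "generates_algebra (coord_ring W) (coord_const W) (coord_class W ` F)"
    show "\<forall>C. is_subring C \<longrightarrow> range Const \<subseteq> C \<longrightarrow> vanishing_ideal W \<subseteq> C \<longrightarrow> F \<subseteq> C \<longrightarrow> C = UNIV"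
    proof (intro allI impI)
      fix C :: "('n, 'k) mpoly set"
      assume C: "is_subring C" "range Const \<subseteq> C" "vanishing_ideal W \<subseteq> C" "F \<subseteq> C"
      have G: "a \<in> coord_class W ` C" if "a \<in> ?G" for a
        using that
      proof induction
        case one
        then show ?case using is_subring_D(1)[OF C(1)] by (simp add: coord_class_1)
      next
        case (incl h)
        then show ?case using C(2,4) by (auto simp: coord_const_def)
      next
        case (a_inv h)
        then show ?case using is_subring_D(3)[OF C(1)] by (auto simp: coord_class_uminus)
      next
        case (eng_add h1 h2)
        then show ?case using is_subring_D(4)[OF C(1)] by (auto simp: coord_class_add)
      next
        case (eng_mult h1 h2)
        then show ?case using is_subring_D(5)[OF C(1)] by (auto simp: coord_class_mult)
      qed
      have "p \<in> C" for p
      proof -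
        have "coord_class W p \<in> ?G" using gen by (simp add: generates_algebra_def)
        then obtain q where "q \<in> C" "coord_class W p = coord_class W q" using G by blast
        then have "q + (p - q) \<in> C" using C(3) by (intro is_subring_D(4)[OF C(1)]) (auto simp: coord_class_eq_iff)
        then show ?thesis by simp
      qed
      then show "C = UNIV" by blast
    qed
  next
    assume *: "\<forall>C. is_subring C \<longrightarrow> range Const \<subseteq> C \<longrightarrow> vanishing_ideal W \<subseteq> C \<longrightarrow> F \<subseteq> C \<longrightarrow> C = UNIV"
    have sub: "range (coord_const W) \<union> coord_class W ` F \<subseteq> carrier (coord_ring W)"
      by (auto simp: coord_const_def)
    let ?C = "{p. coord_class W p \<in> ?G}"
    have "is_subring ?C"
      unfolding is_subring_def
      using generate_ring.one[of "coord_ring W"] generate_ring.a_inv[of _ "coord_ring W"]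
        generate_ring.eng_add[of _ "coord_ring W"] generate_ring.eng_mult[of _ "coord_ring W"]
      by (auto simp: coord_class_1[symmetric] coord_class_uminus[symmetric] coord_class_add[symmetric] coord_class_mult[symmetric])
    moreover have "Const c \<in> ?C" for c
      by (auto simp: coord_const_def[symmetric] intro!: generate_ring.incl)
    moreover have "p \<in> ?C" if "p \<in> vanishing_ideal W" for p
      using \<open>\<And>c. Const c \<in> ?C\<close>[of 0] that by (simp add: coord_class_vanishing)
    moreover have "F \<subseteq> ?C"
      by (auto intro!: generate_ring.incl)
    ultimately have "?C = UNIV" using * by blast
    then have "carrier (coord_ring W) \<subseteq> ?G" by (auto simp: carrier_coord_ring)
    moreover have "?G \<subseteq> carrier (coord_ring W)"
      using A.generate_ring_in_carrier[OF sub] by blast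
    ultimately show "generates_algebra (coord_ring W) (coord_const W) (coord_class W ` F)"
      using sub by (auto simp: generates_algebra_def)
  qed
qed

section \<open>Generating tuples and the degree they define\<close>

lemma generating_tuple_eval:
  assumes gen: "generates_algebra (coord_ring W) (coord_const W) (set cs)"
    and c: "\<And>i. i < length cs \<Longrightarrow> cs ! i = coord_class W (g i)"
  shows "\<exists>f. mvars f \<subseteq> {..<length cs} \<and> coord_class W p = coord_class W (peval Const g f)"
proof -
  let ?V = "{f :: (nat, 'k) mpoly. mvars f \<subseteq> {..<length cs}}"
  let ?C = "{p. \<exists>f\<in>?V. p - peval Const g f \<in> vanishing_ideal W}"
  have V: "is_subring ?V" by (rule is_subring_mvars)
  note E = is_hom_D[OF is_hom_peval[OF is_hom_Const, of g]]
  have "set cs = coord_class W ` g ` {..<length cs}"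
    using c by (force simp: set_conv_nth)
  then have *: "\<And>C. is_subring C \<Longrightarrow> range Const \<subseteq> C \<Longrightarrow> vanishing_ideal W \<subseteq> C \<Longrightarrow> g ` {..<length cs} \<subseteq> C \<Longrightarrow> C = UNIV"
    using gen generates_algebra_iff[of "g ` {..<length cs}"] by simp
  have "?C = UNIV"
  proof (rule *)
    show "is_subring ?C"
      unfolding is_subring_def
    proof (intro conjI ballI)
      show "1 \<in> ?C" using is_subring_D(1)[OF V] vanishing(1) E by (intro CollectI bexI[of _ 1]) auto
      fix x assume "x \<in> ?C"
      then obtain f where f: "f \<in> ?V" "x - peval Const g f \<in> vanishing_ideal W" by blast
      have "- x - peval Const g (- f) = - (x - peval Const g f)" by (simp add: E)
      then show "- x \<in> ?C"
        using is_subring_D(3)[OF V f(1)] vanishing(5)[OF f(2)] by (intro CollectI bexI[of _ "- f"]) (simp_all only: mem_Collect_eq)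
      fix y assume "y \<in> ?C"
      then obtain h where h: "h \<in> ?V" "y - peval Const g h \<in> vanishing_ideal W" by blast
      have "x + y - peval Const g (f + h) = (x - peval Const g f) + (y - peval Const g h)" by (simp add: E)
      then show "x + y \<in> ?C"
        using is_subring_D(4)[OF V f(1) h(1)] vanishing(2)[OF f(2) h(2)]
        by (intro CollectI bexI[of _ "f + h"]) (simp_all only: mem_Collect_eq)
      have "x * y - peval Const g (f * h) = y * (x - peval Const g f) + peval Const g f * (y - peval Const g h)"
        by (simp add: E algebra_simps)
      then have "x * y - peval Const g (f * h) \<in> vanishing_ideal W"
        using vanishing(2)[OF vanishing(3)[OF f(2)] vanishing(3)[OF h(2)]] by simp
      then show "x * y \<in> ?C" using is_subring_D(5)[OF V f(1) h(1)] by blast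
    qed
    show "range Const \<subseteq> ?C"
    proof
      fix x :: "('n, 'k) mpoly" assume "x \<in> range Const"
      then obtain a where "x = Const a" by blast
      then show "x \<in> ?C" using vanishing(1) mvars_single[of "0 :: nat \<Rightarrow>\<^sub>0 nat" a]
        by (intro CollectI bexI[of _ "Const a"]) (auto simp: peval_single)
    qed
    show "vanishing_ideal W \<subseteq> ?C"
      using is_subring_D(2)[OF V] by (intro subsetI CollectI bexI[of _ 0]) (auto simp: E)
    show "g ` {..<length cs} \<subseteq> ?C"
    proof
      fix x assume "x \<in> g ` {..<length cs}"
      then obtain i where "i < length cs" "x = g i" by blast
      then show "x \<in> ?C" using vanishing(1) mvars_single[of "Poly_Mapping.single i (Suc 0)" "1::'k"]
        by (intro CollectI bexI[of _ "Var i"]) (auto simp: peval_single single_one split: if_splits)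
    qed
  qed
  then have "p \<in> ?C" by blast
  then show ?thesis by (auto simp: coord_class_eq_iff)
qed

lemma tuple_degree_attained:
  assumes gen: "generates_algebra (coord_ring W) (coord_const W) (set cs)"
    and c: "\<And>i. i < length cs \<Longrightarrow> cs ! i = coord_class W (g i)"
  obtains f where "mvars f \<subseteq> {..<length cs}" "deg_le (tuple_degree (coord_ring W) (coord_const W) cs (coord_class W p)) f"
    "coord_class W (peval Const g f) = coord_class W p"
proof -
  let ?Q = "\<lambda>d. \<exists>f. (\<forall>\<alpha>\<in>Poly_Mapping.keys f. Poly_Mapping.keys \<alpha> \<subseteq> {..<length cs} \<and> mdeg \<alpha> \<le> d) \<and>
    algebra_eval (coord_ring W) (coord_const W) cs f = coord_class W p"
  obtain f where f: "mvars f \<subseteq> {..<length cs}" "coord_class W p = coord_class W (peval Const g f)"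
    using generating_tuple_eval[OF gen c] by blast
  obtain N where "\<And>m. m > N \<Longrightarrow> hom_component m f = 0" using hom_component_large by blast
  then have "deg_le N f" by (simp add: deg_le_def)
  then have "?Q N"
    using f by (intro exI[of _ f]) (auto simp: deg_le_iff algebra_eval_coord_ring[OF c] mvars_def)
  then have "?Q (LEAST d. ?Q d)" by (rule LeastI)
  then obtain f' where f': "\<forall>\<alpha>\<in>Poly_Mapping.keys f'. Poly_Mapping.keys \<alpha> \<subseteq> {..<length cs} \<and> mdeg \<alpha> \<le> (LEAST d. ?Q d)"
    "algebra_eval (coord_ring W) (coord_const W) cs f' = coord_class W p" by blast
  then have "mvars f' \<subseteq> {..<length cs}" by (auto simp: mvars_def)
  then show ?thesis
    using that[of f'] f' algebra_eval_coord_ring[OF c, of f'] by (auto simp: deg_le_iff tuple_degree_def)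
qed

lemma tuple_degree_le:
  assumes c: "\<And>i. i < length cs \<Longrightarrow> cs ! i = coord_class W (g i)"
    and f: "mvars f \<subseteq> {..<length cs}" "deg_le d f" "coord_class W (peval Const g f) = coord_class W p"
  shows "tuple_degree (coord_ring W) (coord_const W) cs (coord_class W p) \<le> d"
  unfolding tuple_degree_def
  by (rule Least_le, rule exI[of _ f])
    (use f in \<open>auto simp: deg_le_iff algebra_eval_coord_ring[OF c] mvars_def\<close>)

text \<open>Uniform convergence measures errors by the degree in an arbitrary tuple, duality by the
  degree of a form. Writing each variable as a polynomial of degree at most \<open>M\<close> in the
  tuple compares the two, without an additive constant.\<close>

lemma tuple_degree_form_bound:
  assumes gen: "generates_algebra (coord_ring W) (coord_const W) (set cs)"
  obtains M where "\<And>d q. homogeneous d q \<Longrightarrow> tuple_degree (coord_ring W) (coord_const W) cs (coord_class W q) \<le> M * d"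
proof -
  have "\<exists>g. \<forall>i<length cs. cs ! i = coord_class W (g i)"
  proof -
    have "\<forall>i. \<exists>p. i < length cs \<longrightarrow> cs ! i = coord_class W p"
      using gen unfolding generates_algebra_def carrier_coord_ring by (metis imageE nth_mem subsetD)
    then show ?thesis by metis
  qed
  then obtain g where c: "\<And>i. i < length cs \<Longrightarrow> cs ! i = coord_class W (g i)" by blast
  have "\<forall>i. \<exists>f. mvars f \<subseteq> {..<length cs} \<and> coord_class W (Var i) = coord_class W (peval Const g f)"
    using generating_tuple_eval[OF gen c] by blast
  then obtain h where h: "\<And>i. mvars (h i) \<subseteq> {..<length cs}" "\<And>i. coord_class W (Var i) = coord_class W (peval Const g (h i))"
    by metis
  have "\<forall>i. \<exists>N. deg_le N (h i)"
    using hom_component_large unfolding deg_le_def by metis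
  then obtain N where N: "\<And>i. deg_le (N i) (h i)" by metis
  define M where "M = Max (range N)"
  have M: "deg_le M (h i)" for i
    using N[of i] by (rule deg_le_mono) (simp add: M_def)
  have "tuple_degree (coord_ring W) (coord_const W) cs (coord_class W q) \<le> M * d" if q: "homogeneous d q" for d q
  proof (rule tuple_degree_le[OF c, where f = "peval Const h q"])
    show "deg_le (M * d) (peval Const h q)"
      by (intro deg_le_peval M deg_le_homogeneous q)
    have V: "is_subring {f :: (nat, 'k) mpoly. mvars f \<subseteq> {..<length cs}}" by (rule is_subring_mvars)
    have "peval Const h q \<in> {f. mvars f \<subseteq> {..<length cs}}"
      unfolding peval_def mon_def
      by (intro is_subring_sum[OF V] is_subring_D(5)[OF V] is_subring_prod[OF V] is_subring_power[OF V])
        (use h(1) mvars_single[of "0 :: nat \<Rightarrow>\<^sub>0 nat"] in auto)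
    then show "mvars (peval Const h q) \<subseteq> {..<length cs}" by simp
    have "peval Const (\<lambda>i. peval Const g (h i)) q - peval Const Var q \<in> vanishing_ideal W"
    proof -
      let ?a = "\<lambda>i. peval Const g (h i)"
      have i: "?a i - Var i \<in> vanishing_ideal W" for i
        using h(2)[of i, symmetric] by (simp add: coord_class_eq_iff)
      have cong_mult: "p * q - a * b \<in> vanishing_ideal W" if "p - a \<in> vanishing_ideal W" "q - b \<in> vanishing_ideal W" for p q a b
      proof -
        have "p * q - a * b = q * (p - a) + a * (q - b)" by (simp add: algebra_simps)
        then show ?thesis using vanishing(2)[OF vanishing(3)[OF that(1)] vanishing(3)[OF that(2)]] by simp
      qed
      have pow: "?a i ^ n - Var i ^ n \<in> vanishing_ideal W" for i n
        by (induction n) (use i vanishing(1) in \<open>auto intro!: cong_mult\<close>)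
      have prod: "(\<Prod>i\<in>S. ?a i ^ e i) - (\<Prod>i\<in>S. Var i ^ e i) \<in> vanishing_ideal W" for S and e :: "'n \<Rightarrow> nat"
        by (induction S rule: infinite_finite_induct) (use vanishing(1) in \<open>auto intro!: cong_mult pow\<close>)
      have "peval Const ?a q - peval Const Var q =
          (\<Sum>\<alpha>\<in>Poly_Mapping.keys q. Const (Poly_Mapping.lookup q \<alpha>) * (mon ?a \<alpha> - mon Var \<alpha>))"
        by (simp add: peval_def sum_subtractf right_diff_distrib)
      also have "\<dots> \<in> vanishing_ideal W"
        unfolding mon_def by (intro is_ideal_sum[OF is_ideal_vanishing] vanishing(3) prod)
      finally show ?thesis .
    qed
    moreover have "peval Const g (peval Const h q) = peval Const (\<lambda>i. peval Const g (h i)) q"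
      using hom_peval[OF is_hom_peval[OF is_hom_Const], of g Const h q] by (simp add: peval_single)
    ultimately show "coord_class W (peval Const g (peval Const h q)) = coord_class W q"
      by (simp add: coord_class_eq_iff peval_Var)
  qed
  then show ?thesis using that by blast
qed

end

section \<open>Duality for forms\<close>

lemma ereal_le_by_reals: "(\<And>\<alpha>. ereal \<alpha> \<le> x \<Longrightarrow> ereal \<alpha> \<le> y) \<Longrightarrow> x \<le> y"
  by (cases x) (auto simp: ereal_top)

lemma INF_attained_of_eventually_PInf:
  fixes g :: "nat \<Rightarrow> ereal"
  assumes "\<And>m. m > N \<Longrightarrow> g m = \<infinity>"
  shows "\<exists>m\<le>N. (INF m. g m) = g m"
proof -
  have "Min (g ` {..N}) \<in> g ` {..N}" by (intro Min_in) auto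
  then obtain m where "m \<in> {..N}" and m: "Min (g ` {..N}) = g m" by blast
  have "(INF m. g m) = Min (g ` {..N})"
  proof (rule antisym)
    show "(INF m. g m) \<le> Min (g ` {..N})"
      using \<open>Min (g ` {..N}) \<in> g ` {..N}\<close> by (auto intro: INF_lower2)
    show "Min (g ` {..N}) \<le> (INF m. g m)"
    proof (rule INF_greatest)
      fix m show "Min (g ` {..N}) \<le> g m" using assms[of m] by (cases "m \<le> N") auto
    qed
  qed
  then show ?thesis using m \<open>m \<in> {..N}\<close> by auto
qed

lemma INF_PInf [simp]: "(INF x\<in>S. (\<infinity> :: ereal)) = \<infinity>"
  by (simp flip: top_ereal_def)

lemma INF_eq_PInf_iff: "(INF x\<in>S. f x) = (\<infinity> :: ereal) \<longleftrightarrow> (\<forall>x\<in>S. f x = \<infinity>)"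
  by (simp flip: top_ereal_def)

lemma INF_2_mult: "(INF x\<in>S. 2 * f x) \<le> 2 * (INF x\<in>S. (f x :: ereal))"
proof (rule ereal_le_by_reals)
  fix \<alpha> assume \<alpha>: "ereal \<alpha> \<le> (INF x\<in>S. 2 * f x)"
  have "ereal (\<alpha> / 2) \<le> f x" if "x \<in> S" for x
    using order_trans[OF \<alpha> INF_lower[OF that]] by (cases "f x") auto
  then have "ereal (\<alpha> / 2) \<le> (INF x\<in>S. f x)" by (rule INF_greatest)
  then show "ereal \<alpha> \<le> 2 * (INF x\<in>S. f x)"
    by (cases "INF x\<in>S. f x") auto
qed

context closed_valued_field
begin

text \<open>An infimum loses multiplicativity but keeps the value of squares, because doubling
  commutes with infima.\<close>

lemma subval_INF:
  fixes w :: "'x \<Rightarrow> ('n, 'k) mpoly \<Rightarrow> ereal"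
  assumes w: "\<And>x. x \<in> S \<Longrightarrow> semivaluation (w x)" "\<And>x c. x \<in> S \<Longrightarrow> w x (Const c) = v c"
    and nM: "\<And>p. (INF x\<in>S. w x p) \<noteq> -\<infinity>"
  shows "subval (\<lambda>p. INF x\<in>S. w x p)"
  unfolding subval_def
proof (intro conjI allI)
  note mult = semivaluation.mult[OF w(1)] and um = semivaluation.axioms(1)[OF w(1)]
  let ?u = "\<lambda>p. INF x\<in>S. w x p"
  show "?u p \<noteq> -\<infinity>" for p by (rule nM)
  show M: "?u p + ?u q \<le> ?u (p * q)" for p q
    by (rule INF_greatest) (auto simp: mult intro!: add_mono INF_lower)
  show "?u (p * p) = 2 * ?u p" for p
  proof (rule antisym)
    have "?u (p * p) = (INF x\<in>S. 2 * w x p)" by (rule INF_cong) (simp_all only: mult ereal_2_mult)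
    also have "\<dots> \<le> 2 * ?u p" by (rule INF_2_mult)
    finally show "?u (p * p) \<le> 2 * ?u p" .
    show "2 * ?u p \<le> ?u (p * p)" unfolding ereal_2_mult by (rule M)
  qed
  show "min (?u p) (?u q) \<le> ?u (p + q)" for p q
  proof (rule INF_greatest)
    fix x assume x: "x \<in> S"
    show "min (?u p) (?u q) \<le> w x (p + q)"
      by (rule ultrametric.ge_add[OF um[OF x]])
        (auto intro: min.coboundedI1 min.coboundedI2 INF_lower x)
  qed
  show "?u 0 = \<infinity>"
  proof -
    have "?u 0 = (INF x\<in>S. \<infinity>)" by (rule INF_cong) (auto simp: ultrametric.at_0[OF um])
    then show ?thesis by simp
  qed
  show "v c \<le> ?u (Const c)" for c
    by (rule INF_greatest) (simp add: w(2))
qed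

section \<open>Values of forms at projective points\<close>

lemma tuple_val_le: "tuple_val v x \<le> v (x $ i)" for x :: "'k ^ 'n::finite"
  unfolding tuple_val_def by (rule Min_le) auto

lemma tuple_val_attained:
  fixes x :: "'k ^ 'n::finite"
  obtains i where "tuple_val v x = v (x $ i)"
proof -
  have "tuple_val v x \<in> range (\<lambda>i. v (x $ i))"
    unfolding tuple_val_def by (rule Min_in) auto
  then show ?thesis using that by auto
qed

lemma tuple_val_finite:
  fixes x :: "'k ^ 'n::finite"
  assumes "x \<noteq> 0" obtains t where "tuple_val v x = ereal t"
proof -
  obtain i where "x $ i \<noteq> 0" using assms by (auto simp: vec_eq_iff)
  then obtain r where "v (x $ i) = ereal r" using finiteE by blast
  moreover obtain j where "tuple_val v x = v (x $ j)" using tuple_val_attained[of x] .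
  ultimately have "tuple_val v x \<noteq> \<infinity>" "tuple_val v x \<noteq> -\<infinity>"
    using tuple_val_le[of x i] not_MInf[of "x $ j"] by auto
  then show ?thesis using that by (cases "tuple_val v x") auto
qed

lemma tuple_val_scale:
  fixes x :: "'k ^ 'n::finite"
  shows "tuple_val v (c *s x) = v c + tuple_val v x"
proof (rule antisym)
  obtain i where "tuple_val v x = v (x $ i)" using tuple_val_attained[of x] .
  then show "tuple_val v (c *s x) \<le> v c + tuple_val v x"
    using tuple_val_le[of "c *s x" i] by (simp add: mult)
  obtain j where "tuple_val v (c *s x) = v ((c *s x) $ j)" using tuple_val_attained[of "c *s x"] .
  then show "v c + tuple_val v x \<le> tuple_val v (c *s x)"
    using tuple_val_le[of x j] by (simp add: mult add_left_mono)
qed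

lemma form_val_abs:
  fixes x :: "'k ^ 'n::finite"
  assumes "x \<noteq> 0" "homogeneous m f"
  shows "form_val v m f (abs_proj x) = v (poly_eval f x) - ereal (real m) * tuple_val v x"
proof -
  obtain c where c: "c \<noteq> 0" "rep_proj (abs_proj x) = c *s x" using rep_abs_proj[OF assms(1)] .
  obtain t where t: "tuple_val v x = ereal t" using tuple_val_finite[OF assms(1)] .
  obtain r where r: "v c = ereal r" using finiteE[OF c(1)] .
  show ?thesis
    unfolding form_val_def c(2) poly_eval_homogeneous[OF assms(2)] tuple_val_scale mult power r t
    by (cases "v (poly_eval f x)") (auto simp: algebra_simps)
qed

lemma rep_val_finite:
  obtains t where "tuple_val v (rep_proj \<xi> :: 'k ^ 'n::finite) = ereal t"
  using tuple_val_finite[OF rep_proj_nonzero] .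

lemma form_val_not_MInf: "form_val v m f (\<xi> :: ('k, 'n::finite) proj) \<noteq> -\<infinity>"
proof -
  obtain t where "tuple_val v (rep_proj \<xi>) = ereal t" by (rule rep_val_finite)
  then show ?thesis
    using not_MInf[of "poly_eval f (rep_proj \<xi>)"] unfolding form_val_def
    by (cases "v (poly_eval f (rep_proj \<xi>))") auto
qed

lemma form_val_PInf_iff: "form_val v m f (\<xi> :: ('k, 'n::finite) proj) = \<infinity> \<longleftrightarrow> poly_eval f (rep_proj \<xi>) = 0"
proof -
  obtain t where "tuple_val v (rep_proj \<xi>) = ereal t" by (rule rep_val_finite)
  then show ?thesis
    using eq_PInf_iff[of "poly_eval f (rep_proj \<xi>)"] unfolding form_val_def
    by (cases "v (poly_eval f (rep_proj \<xi>))") auto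
qed

text \<open>Dividing a representative by a coordinate of least value makes all coordinates integral,
  and \<open>form_val\<close> is the value at that normalized representative.\<close>

lemma gauss_le_form_val:
  fixes \<xi> :: "('k, 'n::finite) proj"
  assumes "homogeneous m f"
  shows "gauss f \<le> form_val v m f \<xi>"
proof -
  let ?x = "rep_proj \<xi>"
  obtain t where t: "tuple_val v ?x = ereal t" by (rule rep_val_finite)
  obtain i where i: "tuple_val v ?x = v (?x $ i)" using tuple_val_attained[of ?x] .
  have nz: "?x $ i \<noteq> 0" using i t at_0 by auto
  let ?c = "inverse (?x $ i)"
  have vi: "v (?x $ i) = ereal t" using i t by simp
    then have vc: "v ?c = ereal (- t)" using inverse[OF nz] by simp
  have "0 \<le> v ((?c *s ?x) $ j)" for j
    using tuple_val_le[of ?x j] vc t by (cases "v (?x $ j)") (auto simp: mult)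
  then have "gauss f \<le> v (poly_eval f (?c *s ?x))"
    unfolding poly_eval_altdef by (rule gauss_le_peval)
  also have "\<dots> = form_val v m f \<xi>"
    unfolding poly_eval_homogeneous[OF assms] form_val_def mult power vc t
    by (cases "v (poly_eval f ?x)") auto
  finally show ?thesis .
qed

lemma form_hat_minus_ge:
  assumes "m \<ge> (1::nat)" "b \<le> (form_val v m f \<xi> - ereal (real m) * ereal h) + ereal (e * real m)"
  shows "ereal (h - e) \<le> form_hat v m f (\<xi> :: ('k, 'n::finite) proj) - b / ereal (real m)"
proof (cases "form_val v m f \<xi>")
  case (real a)
  show ?thesis
  proof (cases b)
    case (real c)
    then have "c \<le> a - real m * h + e * real m" using assms(2) \<open>form_val v m f \<xi> = ereal a\<close> by simp
    then have "(h - e) * real m \<le> a - c" by (simp add: algebra_simps)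
    then have "h - e \<le> (a - c) / real m" using assms(1) by (simp add: pos_le_divide_eq)
    then show ?thesis using real \<open>form_val v m f \<xi> = ereal a\<close> assms(1) unfolding form_hat_def by (simp add: diff_divide_distrib)
  next
    case PInf
    then show ?thesis using assms(2) real by simp
  next
    case MInf
    then show ?thesis using real assms(1) unfolding form_hat_def by simp
  qed
next
  case PInf
  then show ?thesis using assms(1) unfolding form_hat_def by simp
qed (use form_val_not_MInf in blast)

lemma form_val_minus_ge:
  assumes "m \<ge> (1::nat)" "b \<noteq> -\<infinity>" "ereal h \<le> form_hat v m f (\<xi> :: ('k, 'n::finite) proj) - b / ereal (real m)"
    "b = \<infinity> \<Longrightarrow> form_val v m f \<xi> = \<infinity>"
  shows "b \<le> form_val v m f \<xi> - ereal (real m) * ereal h"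
proof (cases "form_val v m f \<xi>")
  case (real a)
  show ?thesis
  proof (cases b)
    case (real c)
    then have "h \<le> (a - c) / real m"
      using assms(1,3) \<open>form_val v m f \<xi> = ereal a\<close> unfolding form_hat_def by (simp add: diff_divide_distrib)
    then have "h * real m \<le> a - c" using assms(1) by (simp add: pos_le_divide_eq)
    then show ?thesis using real \<open>form_val v m f \<xi> = ereal a\<close> by (simp add: algebra_simps)
  qed (use assms real in auto)
qed (use form_val_not_MInf in auto)

end

text \<open>This is \<open>divisor_dual\<close> computed on polynomials, before classes and the
  choice of representatives enter.\<close>

definition poly_dual :: "('k::field \<Rightarrow> ereal) \<Rightarrow> ('k, 'n::finite) proj set \<Rightarrow> (('k, 'n) proj \<Rightarrow> ereal) \<Rightarrow>
    ('n, 'k) mpoly \<Rightarrow> ereal" where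
  "poly_dual v W \<eta> p = (INF m. INF \<xi>\<in>W. form_val v m (hom_component m p) \<xi> - ereal (real m) * \<eta> \<xi>)"

definition min_hat :: "('k::field \<Rightarrow> ereal) \<Rightarrow> nat \<Rightarrow> (nat \<Rightarrow> nat) \<Rightarrow> (nat \<Rightarrow> ('n::finite, 'k) mpoly) \<Rightarrow> (nat \<Rightarrow> ereal)
    \<Rightarrow> ('k, 'n) proj \<Rightarrow> ereal" where
  "min_hat v m d f \<gamma> \<xi> = (INF k\<in>{..<m}. form_hat v (d k) (f k) \<xi> - \<gamma> k / ereal (real (d k)))"

locale projective_variety = complete_valued_field v for v :: "'k::alg_closed_field \<Rightarrow> ereal" +
  fixes W :: "('k, 'n::finite) proj set"
  assumes closed: "zariski_closed W"
begin

abbreviation I_W :: "('n, 'k) mpoly set" where "I_W \<equiv> vanishing_ideal W"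
abbreviation pdual where "pdual \<equiv> poly_dual v W"
abbreviation mhat where "mhat \<equiv> min_hat v"

lemmas vI = vanishing[where W = W]

text \<open>Here Zariski closedness is used: the forms that cut out \<open>W\<close> belong to its
  vanishing ideal.\<close>

lemma abs_proj_in_W:
  assumes "x \<noteq> 0" "\<And>s. s \<in> I_W \<Longrightarrow> poly_eval s x = 0"
  shows "abs_proj x \<in> W"
proof -
  obtain S where S: "\<And>f. f \<in> S \<Longrightarrow> \<exists>m. homogeneous m f" "W = {\<xi>. \<forall>f\<in>S. poly_eval f (rep_proj \<xi>) = 0}"
    using closed unfolding zariski_closed_def by blast
  obtain c where c: "rep_proj (abs_proj x) = c *s x" using rep_abs_proj[OF assms(1)] by blast
  have "poly_eval f (rep_proj (abs_proj x)) = 0" if f: "f \<in> S" for f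
  proof -
    obtain m where m: "homogeneous m f" using S(1)[OF f] by blast
    then have "f \<in> I_W" using vanishing_homogeneous[OF m, of W] S(2) f by blast
    then show ?thesis using assms(2) by (simp add: c poly_eval_homogeneous[OF m])
  qed
  then show ?thesis using S(2) by blast
qed

text \<open>The components vanish separately, so any multiple of the representative is a zero, the
  origin included.\<close>

lemma vanishing_poly_eval:
  assumes "p \<in> I_W" "\<xi> \<in> W"
  shows "poly_eval p (c *s rep_proj \<xi>) = 0"
proof -
  obtain N where "\<And>m. m > N \<Longrightarrow> hom_component m p = 0" using hom_component_large by blast
  then have p: "p = (\<Sum>m\<le>N. hom_component m p)" by (simp add: sum_hom_components)
  have "poly_eval (hom_component m p) (c *s rep_proj \<xi>) = 0" for m
    using assms by (simp add: poly_eval_homogeneous[OF homogeneous_hom_component] vanishing_ideal_def)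
  then show ?thesis by (subst p) (simp add: is_hom_sum[OF is_hom_poly_eval])
qed

section \<open>The dual of a function on \<open>W\<close>\<close>

lemma pdual_homogeneous:
  assumes \<eta>: "\<And>\<xi>. \<xi> \<in> W \<Longrightarrow> \<bar>\<eta> \<xi>\<bar> \<noteq> \<infinity>" and q: "homogeneous d q"
  shows "pdual \<eta> q = (INF \<xi>\<in>W. form_val v d q \<xi> - ereal (real d) * \<eta> \<xi>)"
proof -
  let ?g = "\<lambda>m. INF \<xi>\<in>W. form_val v m (hom_component m q) \<xi> - ereal (real m) * \<eta> \<xi>"
  have "?g m = \<infinity>" if "m \<noteq> d" for m
  proof -
    have "?g m = (INF \<xi>\<in>W. \<infinity>)"
    proof (rule INF_cong)
      fix \<xi> assume "\<xi> \<in> W"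
      have "form_val v m (hom_component m q) \<xi> = \<infinity>"
        using that q by (simp add: form_val_PInf_iff hom_component_homogeneous poly_eval_simps)
      then show "form_val v m (hom_component m q) \<xi> - ereal (real m) * \<eta> \<xi> = \<infinity>"
        using \<eta>[OF \<open>\<xi> \<in> W\<close>] by (cases "\<eta> \<xi>") auto
    qed simp
    then show ?thesis by simp
  qed
  then have le: "?g d \<le> ?g m" for m by (cases "m = d") auto
  have "pdual \<eta> q = ?g d"
    unfolding poly_dual_def by (intro antisym INF_lower[of d] INF_greatest le) simp
  then show ?thesis using q by (simp add: hom_component_homogeneous)
qed

lemma pdual_components:
  assumes \<eta>: "\<And>\<xi>. \<xi> \<in> W \<Longrightarrow> \<bar>\<eta> \<xi>\<bar> \<noteq> \<infinity>"
  shows "pdual \<eta> p = (INF m. pdual \<eta> (hom_component m p))"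
  by (subst poly_dual_def) (simp add: pdual_homogeneous[OF \<eta> homogeneous_hom_component])

lemma pdual_PInf_iff:
  assumes \<eta>: "\<And>\<xi>. \<xi> \<in> W \<Longrightarrow> \<bar>\<eta> \<xi>\<bar> \<noteq> \<infinity>"
  shows "pdual \<eta> p = \<infinity> \<longleftrightarrow> p \<in> I_W"
proof -
  have "form_val v m f \<xi> - ereal (real m) * \<eta> \<xi> = \<infinity> \<longleftrightarrow> poly_eval f (rep_proj \<xi>) = 0" if "\<xi> \<in> W" for m f \<xi>
    using \<eta>[OF that] form_val_PInf_iff[of m f \<xi>] by (cases "\<eta> \<xi>"; cases "form_val v m f \<xi>") auto
  then show ?thesis
    unfolding poly_dual_def vanishing_ideal_def by (auto simp: INF_eq_PInf_iff)
qed

lemma pdual_eq_mod: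
  assumes "p - q \<in> I_W" shows "pdual \<eta> p = pdual \<eta> q"
proof -
  have "form_val v m (hom_component m p) \<xi> = form_val v m (hom_component m q) \<xi>" if "\<xi> \<in> W" for m \<xi>
    using assms that by (simp add: form_val_def vanishing_ideal_def hom_component_diff poly_eval_simps)
  then show ?thesis unfolding poly_dual_def by (auto intro!: INF_cong)
qed

text \<open>Each point gives a homogeneous semivaluation: the degree m component at the
  representative, its value shifted by m times \<open>\<tau> \<xi>\<close>. Exchanging infima, the
  dual is the infimum of these over \<open>W\<close>.\<close>

lemma pdual_subval:
  assumes \<eta>: "\<And>\<xi>. \<xi> \<in> W \<Longrightarrow> \<bar>\<eta> \<xi>\<bar> \<noteq> \<infinity>" and B: "\<And>\<xi>. \<xi> \<in> W \<Longrightarrow> \<eta> \<xi> \<le> ereal B"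
  shows "subval (pdual \<eta>)"
proof -
  have "\<forall>\<xi>. \<exists>t. \<xi> \<in> W \<longrightarrow> tuple_val v (rep_proj \<xi>) + \<eta> \<xi> = ereal t"
  proof
    fix \<xi> :: "('k, 'n) proj"
    obtain t where "tuple_val v (rep_proj \<xi>) = ereal t" by (rule rep_val_finite)
    then show "\<exists>t. \<xi> \<in> W \<longrightarrow> tuple_val v (rep_proj \<xi>) + \<eta> \<xi> = ereal t" using \<eta>[of \<xi>] by (cases "\<eta> \<xi>") auto
  qed
  then obtain \<tau> where \<tau>: "\<And>\<xi>. \<xi> \<in> W \<Longrightarrow> tuple_val v (rep_proj \<xi>) + \<eta> \<xi> = ereal (\<tau> \<xi>)" by metis
  define w0 where "w0 \<xi> m q = v (poly_eval q (rep_proj \<xi>)) - ereal (real m * \<tau> \<xi>)" for \<xi> m q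
  have w0: "form_val v m q \<xi> - ereal (real m) * \<eta> \<xi> = w0 \<xi> m q" if \<xi>: "\<xi> \<in> W" for m q \<xi>
  proof -
    obtain t where "tuple_val v (rep_proj \<xi>) = ereal t" by (rule rep_val_finite)
    moreover obtain e where "\<eta> \<xi> = ereal e" using \<eta>[OF \<xi>] by (cases "\<eta> \<xi>") auto
    moreover from calculation have "\<tau> \<xi> = t + e" using \<tau>[OF \<xi>] by simp
    ultimately show ?thesis unfolding w0_def form_val_def
      by (cases "v (poly_eval q (rep_proj \<xi>))") (auto simp: algebra_simps)
  qed
  define w where "w \<xi> p = (INF m. w0 \<xi> m (hom_component m p))" for \<xi> p
  have um: "ultrametric (w0 \<xi> m)" for \<xi> m
  proof
    show "w0 \<xi> m a \<noteq> -\<infinity>" for a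
      using not_MInf[of "poly_eval a (rep_proj \<xi>)"] unfolding w0_def by (cases "v (poly_eval a (rep_proj \<xi>))") auto
    show "w0 \<xi> m 0 = \<infinity>" by (simp add: w0_def poly_eval_simps at_0)
    show "min (w0 \<xi> m a) (w0 \<xi> m b) \<le> w0 \<xi> m (a + b)" for a b
      using add_ge[of "poly_eval a (rep_proj \<xi>)" "poly_eval b (rep_proj \<xi>)"] unfolding w0_def poly_eval_simps
      by (cases "v (poly_eval a (rep_proj \<xi>))"; cases "v (poly_eval b (rep_proj \<xi>))";
          cases "v (poly_eval a (rep_proj \<xi>) + poly_eval b (rep_proj \<xi>))") (auto simp: min_def split: if_splits)
  qed
  have semi: "semivaluation (w \<xi>)" for \<xi>
    unfolding w_def[abs_def]
  proof (rule semivaluation_INF_components[OF um])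
    show "w0 \<xi> m (- a) = w0 \<xi> m a" for m a by (simp add: w0_def poly_eval_simps)
    show "w0 \<xi> (i + j) (a * b) = w0 \<xi> i a + w0 \<xi> j b" for i j a b
      using not_MInf[of "poly_eval a (rep_proj \<xi>)"] not_MInf[of "poly_eval b (rep_proj \<xi>)"]
      unfolding w0_def poly_eval_simps mult
      by (cases "v (poly_eval a (rep_proj \<xi>))"; cases "v (poly_eval b (rep_proj \<xi>))") (auto simp: algebra_simps)
    show "w0 \<xi> 0 1 = 0" by (simp add: w0_def poly_eval_simps at_1)
  qed
  have eq: "pdual \<eta> p = (INF \<xi>\<in>W. w \<xi> p)" for p
  proof -
    have "pdual \<eta> p = (INF m. INF \<xi>\<in>W. w0 \<xi> m (hom_component m p))"
      unfolding poly_dual_def by (intro INF_cong refl w0)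
    also have "\<dots> = (INF \<xi>\<in>W. w \<xi> p)"
      unfolding w_def by (rule INF_commute)
    finally show ?thesis .
  qed
  have w_Const: "w \<xi> (Const c) = v c" for \<xi> c
  proof (rule antisym)
    show "w \<xi> (Const c) \<le> v c"
      unfolding w_def by (rule INF_lower2[of 0]) (auto simp: hom_component_single w0_def zero_ereal_def[symmetric])
    show "v c \<le> w \<xi> (Const c)"
      unfolding w_def by (rule INF_greatest)
        (auto simp: hom_component_single w0_def zero_ereal_def[symmetric] poly_eval_simps at_0)
  qed
  \<comment> \<open>The Gauss value of a component minus its degree times \<open>B\<close> bounds
    below uniformly in \<xi>; only finitely many components matter.\<close>
  have "pdual \<eta> p \<noteq> -\<infinity>" for p
  proof -
    obtain N where N: "\<And>m. m > N \<Longrightarrow> hom_component m p = 0" using hom_component_large by blast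
    define g where "g m = gauss (hom_component m p) - ereal (real m * B)" for m
    obtain m where m: "(INF m. g m) = g m"
      using INF_attained_of_eventually_PInf[of N g] N by (auto simp: g_def)
    have "(INF m. g m) \<le> pdual \<eta> p"
      unfolding poly_dual_def
    proof (rule INF_mono)
      fix m :: nat
      have "g m \<le> form_val v m (hom_component m p) \<xi> - ereal (real m) * \<eta> \<xi>" if \<xi>: "\<xi> \<in> W" for \<xi>
      proof -
        obtain e where e: "\<eta> \<xi> = ereal e" "e \<le> B" using \<eta>[OF \<xi>] B[OF \<xi>] by (cases "\<eta> \<xi>") auto
        have "real m * e \<le> real m * B" using e(2) by (intro mult_left_mono) auto
        then show ?thesis
          using gauss_le_form_val[OF homogeneous_hom_component, of m p \<xi>] gauss.not_MInf[of "hom_component m p"] e(1) unfolding g_def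
          by (cases "gauss (hom_component m p)"; cases "form_val v m (hom_component m p) \<xi>") auto
      qed
      then show "\<exists>n\<in>UNIV. g n \<le> (INF \<xi>\<in>W. form_val v m (hom_component m p) \<xi> - ereal (real m) * \<eta> \<xi>)"
        by (intro bexI[of _ m] INF_greatest) auto
    qed
    moreover have "g m \<noteq> -\<infinity>"
      using gauss.not_MInf[of "hom_component m p"] unfolding g_def by (cases "gauss (hom_component m p)") auto
    ultimately show ?thesis using m by auto
  qed
  then have "subval (\<lambda>p. INF \<xi>\<in>W. w \<xi> p)"
    using eq by (intro subval_INF semi w_Const) auto
  then show ?thesis unfolding eq[symmetric] .
qed

text \<open>One half of the contraction property: an error in the function is multiplied by the
  degree of the form.\<close>

lemma pdual_mono:
  assumes \<eta>: "\<And>\<xi>. \<xi> \<in> W \<Longrightarrow> \<bar>\<eta> \<xi>\<bar> \<noteq> \<infinity>" and \<theta>: "\<And>\<xi>. \<xi> \<in> W \<Longrightarrow> \<bar>\<theta> \<xi>\<bar> \<noteq> \<infinity>"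
    and le: "\<And>\<xi>. \<xi> \<in> W \<Longrightarrow> \<theta> \<xi> \<le> \<eta> \<xi> + ereal e" and q: "homogeneous d q"
  shows "pdual \<eta> q \<le> pdual \<theta> q + ereal (e * real d)"
proof -
  have eqs: "pdual \<theta> q = (INF \<xi>\<in>W. form_val v d q \<xi> - ereal (real d) * \<theta> \<xi>)"
    "pdual \<eta> q = (INF \<xi>\<in>W. form_val v d q \<xi> - ereal (real d) * \<eta> \<xi>)"
    by (rule pdual_homogeneous[OF _ q], rule \<theta> \<eta>, assumption)+
  have "pdual \<eta> q - ereal (e * real d) \<le> pdual \<theta> q"
    unfolding eqs(1)
  proof (rule INF_greatest)
    fix \<xi> assume \<xi>: "\<xi> \<in> W"
    have "pdual \<eta> q \<le> form_val v d q \<xi> - ereal (real d) * \<eta> \<xi>"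
      unfolding eqs(2) by (rule INF_lower[OF \<xi>])
    moreover obtain a b where ab: "\<eta> \<xi> = ereal a" "\<theta> \<xi> = ereal b" "b \<le> a + e"
      using \<eta>[OF \<xi>] \<theta>[OF \<xi>] le[OF \<xi>] by (cases "\<eta> \<xi>"; cases "\<theta> \<xi>") auto
    moreover have "real d * b \<le> real d * (a + e)" using ab(3) by (intro mult_left_mono) auto
    ultimately show "pdual \<eta> q - ereal (e * real d) \<le> form_val v d q \<xi> - ereal (real d) * \<theta> \<xi>"
      by (cases "pdual \<eta> q"; cases "form_val v d q \<xi>") (auto simp: algebra_simps)
  qed
  then show ?thesis by (cases "pdual \<eta> q"; cases "pdual \<theta> q") auto
qed

lemma pdual_Const:
  assumes "W \<noteq> {}" and \<eta>: "\<And>\<xi>. \<xi> \<in> W \<Longrightarrow> \<bar>\<eta> \<xi>\<bar> \<noteq> \<infinity>"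
  shows "pdual \<eta> (Const c) = v c"
proof -
  have "pdual \<eta> (Const c) = (INF \<xi>\<in>W. form_val v 0 (Const c) \<xi> - ereal (real 0) * \<eta> \<xi>)"
    by (rule pdual_homogeneous) (simp_all add: \<eta>)
  also have "\<dots> = (INF \<xi>\<in>W. v c)"
    by (rule INF_cong) (auto simp: form_val_def zero_ereal_def[symmetric])
  finally have "pdual \<eta> (Const c) = (INF \<xi>\<in>W. v c)" .
  then show ?thesis using assms(1) by simp
qed

text \<open>Boundedness is the maximum principle applied to the empty variety cut out by the \<open>f k\<close>.\<close>

lemma forms_bounded_above:
  assumes f: "\<And>k. k < m \<Longrightarrow> homogeneous (d k) (f k)"
    and nz: "\<And>\<xi>. \<xi> \<in> W \<Longrightarrow> \<exists>k<m. poly_eval (f k) (rep_proj \<xi>) \<noteq> 0"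
  shows "\<exists>B::real. \<forall>\<xi>\<in>W. \<exists>k<m. form_val v (d k) (f k) \<xi> \<le> ereal B"
proof (rule ccontr)
  assume "\<not> ?thesis"
  then have unb: "\<exists>\<xi>\<in>W. \<forall>k<m. ereal B < form_val v (d k) (f k) \<xi>" for B
    by (auto simp: not_le)
  \<comment> \<open>Bad points, represented by integral vectors with a unit coordinate, at which all
    the forms have value at least \<open>b\<close>.\<close>
  define S where "S b = {x. (\<forall>i. 0 \<le> v (x $ i)) \<and> (\<exists>i. v (x $ i) = 0) \<and> (\<forall>p\<in>I_W. poly_eval p x = 0) \<and>
      (\<forall>k<m. ereal (real b) \<le> v (poly_eval (f k) x))}" for b :: nat
  have S_ne: "S b \<noteq> {}" for b
  proof -
    obtain \<xi> where \<xi>: "\<xi> \<in> W" "\<And>k. k < m \<Longrightarrow> ereal (real b) < form_val v (d k) (f k) \<xi>" using unb by blast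
    let ?x = "rep_proj \<xi>"
    obtain t where t: "tuple_val v ?x = ereal t" by (rule rep_val_finite)
    obtain i where i: "tuple_val v ?x = v (?x $ i)" using tuple_val_attained[of ?x] .
    have nz: "?x $ i \<noteq> 0" using i t at_0 by auto
    let ?c = "inverse (?x $ i)"
    have vi: "v (?x $ i) = ereal t" using i t by simp
    then have vc: "v ?c = ereal (- t)" using inverse[OF nz] by simp
    have "0 \<le> v ((?c *s ?x) $ j)" for j
      using tuple_val_le[of ?x j] vc t by (cases "v (?x $ j)") (auto simp: mult)
    moreover have "v ((?c *s ?x) $ i) = 0" using vc vi by (simp add: mult)
    moreover have "poly_eval p (?c *s ?x) = 0" if "p \<in> I_W" for p
      using vanishing_poly_eval[OF that \<xi>(1)] .
    moreover have "ereal (real b) \<le> v (poly_eval (f k) (?c *s ?x))" if "k < m" for k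
    proof -
      have "v (poly_eval (f k) (?c *s ?x)) = form_val v (d k) (f k) \<xi>"
        unfolding poly_eval_homogeneous[OF f[OF that]] form_val_def mult power vc t
        by (cases "v (poly_eval (f k) ?x)") auto
      then show ?thesis using \<xi>(2)[OF that] by simp
    qed
    ultimately have "?c *s ?x \<in> S b" unfolding S_def by blast
    then show ?thesis by blast
  qed
  have S_anti: "S b \<subseteq> S a" if "a \<le> b" for a b
    using that unfolding S_def by (auto intro: order_trans[rotated])
  define \<Phi> where "\<Phi> b p = (INF x\<in>S b. v (poly_eval p x))" for b and p :: "('n, 'k) mpoly"
  have \<Phi>_mono: "\<Phi> a p \<le> \<Phi> b p" if "a \<le> b" for a b p
    unfolding \<Phi>_def by (rule INF_superset_mono[OF S_anti[OF that]]) simp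
  \<comment> \<open>The eventual infimum over worse and worse points; it sends every
    \<open>f k\<close> to \<infinity>.\<close>
  define u where "u p = (SUP b\<in>UNIV. \<Phi> b p)" for p
  have u: "subval u"
    unfolding u_def[abs_def]
  proof (rule subval_SUP)
    show "\<Phi> b a \<noteq> -\<infinity>" for b a
    proof -
      have "gauss a \<le> \<Phi> b a"
        unfolding \<Phi>_def
      proof (rule INF_greatest)
        fix x assume "x \<in> S b"
        then show "gauss a \<le> v (poly_eval a x)"
          unfolding poly_eval_altdef by (intro gauss_le_peval) (simp add: S_def)
      qed
      then show ?thesis using gauss.not_MInf[of a] by auto
    qed
    fix i j :: nat and a b
    let ?k = "max i j"
    have "\<Phi> i a + \<Phi> j b \<le> \<Phi> ?k a + \<Phi> ?k b" by (intro add_mono \<Phi>_mono) auto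
    also have "\<dots> \<le> \<Phi> ?k (a * b)"
      unfolding \<Phi>_def by (rule INF_greatest) (auto simp: poly_eval_simps mult intro!: add_mono INF_lower)
    finally show "\<exists>k\<in>UNIV. \<Phi> i a + \<Phi> j b \<le> \<Phi> k (a * b)" by blast
    have "min (\<Phi> i a) (\<Phi> j b) \<le> min (\<Phi> ?k a) (\<Phi> ?k b)" by (intro min.mono \<Phi>_mono) auto
    also have "\<dots> \<le> \<Phi> ?k (a + b)"
      unfolding \<Phi>_def
    proof (rule INF_greatest)
      fix x assume x: "x \<in> S ?k"
      show "min (INF x\<in>S ?k. v (poly_eval a x)) (INF x\<in>S ?k. v (poly_eval b x)) \<le> v (poly_eval (a + b) x)"
        unfolding poly_eval_simps by (rule ge_add) (auto intro: min.coboundedI1 min.coboundedI2 INF_lower x)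
    qed
    finally show "\<exists>k\<in>UNIV. min (\<Phi> i a) (\<Phi> j b) \<le> \<Phi> k (a + b)" by blast
    have "\<Phi> i (a * a) = (INF x\<in>S i. 2 * v (poly_eval a x))"
      unfolding \<Phi>_def by (simp only: poly_eval_simps mult ereal_2_mult)
    also have "\<dots> \<le> 2 * \<Phi> i a" unfolding \<Phi>_def by (rule INF_2_mult)
    finally show "\<exists>k\<in>UNIV. \<Phi> i (a * a) \<le> 2 * \<Phi> k a" by blast
  next
    show "\<exists>i\<in>UNIV. \<Phi> i 0 = \<infinity>" by (auto simp: \<Phi>_def poly_eval_simps at_0 top_ereal_def[symmetric])
    show "\<exists>i\<in>UNIV. v c \<le> \<Phi> i (Const c)" for c by (auto simp: \<Phi>_def intro: INF_greatest)
  qed simp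
  have u_f: "u (f k) = \<infinity>" if "k < m" for k
  proof -
    have "ereal B \<le> u (f k)" for B
    proof -
      obtain b :: nat where "B \<le> real b" using real_arch_simple by blast
      moreover have "ereal (real b) \<le> \<Phi> b (f k)"
        unfolding \<Phi>_def by (rule INF_greatest) (use that in \<open>simp add: S_def\<close>)
      moreover have "\<Phi> b (f k) \<le> u (f k)" unfolding u_def by (rule SUP_upper) simp
      ultimately show ?thesis by (meson ereal_less_eq(3) order_trans)
    qed
    then show ?thesis by (metis ereal_top)
  qed
  have u_I: "u p = \<infinity>" if "p \<in> I_W" for p
  proof -
    have "\<Phi> 0 p = (INF x\<in>S 0. \<infinity>)"
      unfolding \<Phi>_def by (rule INF_cong) (use that in \<open>auto simp: S_def at_0\<close>)
    then have "\<Phi> 0 p = \<infinity>" by simp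
    moreover have "\<Phi> 0 p \<le> u p" unfolding u_def by (rule SUP_upper) simp
    ultimately show ?thesis by simp
  qed
  have u_Var: "0 \<le> u (Var i)" for i
  proof -
    have "0 \<le> \<Phi> 0 (Var i)" unfolding \<Phi>_def by (rule INF_greatest) (simp add: S_def)
    also have "\<dots> \<le> u (Var i)" unfolding u_def by (rule SUP_upper) simp
    finally show ?thesis .
  qed
  obtain e :: "nat \<Rightarrow> 'n" where e: "e ` {..<CARD('n)} = UNIV"
    using ex_bij_betw_nat_finite[of "UNIV :: 'n set"] by (auto simp: bij_betw_def atLeast0LessThan)
  \<comment> \<open>Only the origin can be a common zero of \<open>I_W\<close> and the
    \<open>f k\<close>, so the pointwise test imposes no restriction and the value of a variable can
    be pushed above 0.\<close>
  have u1: "ereal 1 \<le> u (Var i)" for i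
  proof (rule subval_bound[OF u, of "CARD('n)" "\<lambda>_. 1" "\<lambda>k. Var (e k)" "\<lambda>_. 0" "I_W \<union> f ` {..<m}" 1])
    show "u (hom_component j s) = \<infinity>" if "s \<in> I_W \<union> f ` {..<m}" for s j
      using that
    proof
      assume "s \<in> f ` {..<m}"
      then obtain k where "k < m" "s = f k" by blast
      then show ?thesis using u_f subval_D(5)[OF u] by (simp add: hom_component_homogeneous[OF f])
    qed (use u_I vanishing_component in blast)
    show "C = UNIV" if C: "is_subring C" "range Const \<subseteq> C" "(\<lambda>k. Var (e k)) ` {..<CARD('n)} \<subseteq> C" for C :: "('n, 'k) mpoly set"
    proof -
      have "Var i \<in> C" for i
      proof -
        have "i \<in> e ` {..<CARD('n)}" using e by simp
        then show ?thesis using C(3) by blast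
      qed
      then have "peval Const Var p \<in> C" for p
        unfolding peval_def mon_def using C(2)
        by (intro is_subring_sum[OF C(1)] is_subring_D(5)[OF C(1)] is_subring_prod[OF C(1)] is_subring_power[OF C(1)]) auto
      then show ?thesis by (auto simp: peval_Var)
    qed
    fix x t assume x: "\<And>s. s \<in> I_W \<union> f ` {..<m} \<Longrightarrow> poly_eval s x = 0"
    have "x = 0"
    proof (rule ccontr)
      assume x0: "x \<noteq> 0"
      then have "abs_proj x \<in> W" using x by (intro abs_proj_in_W) auto
      then obtain k where k: "k < m" "poly_eval (f k) (rep_proj (abs_proj x)) \<noteq> 0" using nz by blast
      obtain c where "rep_proj (abs_proj x) = c *s x" using rep_abs_proj[OF x0] by blast
      then show False using k x[of "f k"] by (simp add: poly_eval_homogeneous[OF f])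
    qed
    then show "ereal (1 + real 1 * t) \<le> v (poly_eval (Var i) x)" by (simp add: at_0)
  qed (use u_Var in \<open>auto simp: zero_ereal_def[symmetric]\<close>)
  have "\<exists>b. ereal (1/2) < \<Phi> b (Var i)" for i
  proof -
    have "ereal (1/2) < u (Var i)" using u1[of i] by (rule less_le_trans[rotated]) simp
    then show ?thesis unfolding u_def less_SUP_iff by blast
  qed
  then obtain b where b: "\<And>i. ereal (1/2) < \<Phi> (b i) (Var i)" by metis
  \<comment> \<open>There are finitely many variables, so they all have value above 1/2 from one
    stage on; but a point of \<open>S c\<close> has a unit coordinate.\<close>
  define c where "c = Max (range b)"
  have c: "ereal (1/2) < \<Phi> c (Var i)" for i
    using b[of i] \<Phi>_mono[of "b i" c "Var i"] by (simp add: c_def)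
  obtain x where x: "x \<in> S c" using S_ne by blast
  then obtain i where "v (x $ i) = 0" by (auto simp: S_def)
  moreover have "\<Phi> c (Var i) \<le> v (poly_eval (Var i) x)" unfolding \<Phi>_def by (rule INF_lower[OF x])
  ultimately have "\<Phi> c (Var i) \<le> ereal 0" by (simp add: zero_ereal_def)
  from less_le_trans[OF c[of i] this] show False by simp
qed

end

lemma ext_dist_D:
  assumes "ext_dist a b \<le> ereal \<delta>"
  shows "a \<le> b + ereal \<delta>" "b \<le> a + ereal \<delta>"
  using assms by (cases a; cases b; auto simp: ext_dist_def zero_ereal_def split: if_splits)+

lemma ext_dist_I:
  assumes "a \<le> b + ereal \<delta>" "b \<le> a + ereal \<delta>" "0 \<le> \<delta>"
  shows "ext_dist a b \<le> ereal \<delta>"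
  using assms by (cases a; cases b) (auto simp: ext_dist_def zero_ereal_def)

lemma ereal_le_by_epsilon:
  assumes "\<And>\<epsilon>. \<epsilon> > 0 \<Longrightarrow> x \<le> y + ereal (\<epsilon> * real d)"
  shows "x \<le> y"
proof (rule ereal_le_epsilon)
  fix e :: ereal assume e: "0 < e"
  show "x \<le> y + e"
  proof (cases e)
    case (real r)
    then have r: "0 < r" using e by simp
    \<comment> \<open>The summand 1 admits degree 0.\<close>
    have "x \<le> y + ereal (r / (real d + 1) * real d)"
      using r by (intro assms) simp
    also have "\<dots> \<le> y + e"
    proof (intro add_left_mono)
      have "r * real d \<le> r * (real d + 1)" using r by (intro mult_left_mono) auto
      then show "ereal (r / (real d + 1) * real d) \<le> e" unfolding real by (simp add: pos_divide_le_eq)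
    qed
    finally show ?thesis .
  next
    case PInf
    then show ?thesis using assms[of 1] by (cases y) auto
  qed (use e in auto)
qed

context projective_variety
begin

section \<open>Finitely many homogeneous conditions and their minimum\<close>

definition generating :: "('n, 'k) mpoly set \<Rightarrow> bool" where
  "generating F \<longleftrightarrow> (\<forall>C. is_subring C \<longrightarrow> range Const \<subseteq> C \<longrightarrow> I_W \<subseteq> C \<longrightarrow> F \<subseteq> C \<longrightarrow> C = UNIV)"

definition conditions :: "nat \<Rightarrow> (nat \<Rightarrow> nat) \<Rightarrow> (nat \<Rightarrow> ('n, 'k) mpoly) \<Rightarrow> (nat \<Rightarrow> ereal) \<Rightarrow> bool" where
  "conditions m d f \<gamma> \<longleftrightarrow> (\<forall>k<m. d k \<ge> 1 \<and> homogeneous (d k) (f k) \<and> \<gamma> k \<noteq> -\<infinity> \<and> (\<gamma> k = \<infinity> \<longrightarrow> f k \<in> I_W)) \<and>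
     generating (f ` {..<m})"

lemma conditions_D:
  assumes "conditions m d f \<gamma>"
  shows "k < m \<Longrightarrow> d k \<ge> 1" "k < m \<Longrightarrow> homogeneous (d k) (f k)" "k < m \<Longrightarrow> \<gamma> k \<noteq> -\<infinity>"
    "k < m \<Longrightarrow> \<gamma> k = \<infinity> \<Longrightarrow> f k \<in> I_W" "generating (f ` {..<m})"
  using assms by (auto simp: conditions_def)

text \<open>If all \<open>f k\<close> vanished at \<xi>, the polynomials with equal values at the
  representative and at the origin would form a subring containing all generators, so every
  coordinate would be 0.\<close>

lemma generating_nonvanishing:
  assumes f: "\<And>k. k < m \<Longrightarrow> d k \<ge> (1::nat) \<and> homogeneous (d k) (f k)" and gen: "generating (f ` {..<m})" and \<xi>: "\<xi> \<in> W"
  shows "\<exists>k<m. poly_eval (f k) (rep_proj \<xi>) \<noteq> 0"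
proof (rule ccontr)
  assume *: "\<not> ?thesis"
  let ?x = "rep_proj \<xi>"
  let ?C = "{p. poly_eval p (1 *s ?x) = poly_eval p (0 *s ?x)}"
  have "is_subring ?C" by (auto simp: is_subring_def poly_eval_simps)
  moreover have "range Const \<subseteq> ?C" by auto
  moreover have "I_W \<subseteq> ?C" using vanishing_poly_eval[OF _ \<xi>, of _ 0] vanishing_poly_eval[OF _ \<xi>, of _ 1] by auto
  moreover have "f ` {..<m} \<subseteq> ?C"
  proof
    fix q assume "q \<in> f ` {..<m}"
    then obtain k where k: "k < m" "q = f k" by blast
    then show "q \<in> ?C"
      using * f[OF k(1)] poly_eval_homogeneous[of "d k" "f k" 0 ?x] by auto
  qed
  ultimately have C: "?C = UNIV" using gen unfolding generating_def by blast
  have "?x $ i = 0" for i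
  proof -
    have "Var i \<in> ?C" using C by blast
    then show ?thesis by simp
  qed
  then show False using rep_proj_nonzero[of \<xi>] by (simp add: vec_eq_iff)
qed

lemma term_PInf:
  assumes "conditions m d f \<gamma>" "k < m" "\<gamma> k = \<infinity>" "\<xi> \<in> W"
  shows "form_val v (d k) (f k) \<xi> = \<infinity>"
  using conditions_D(2,4)[OF assms(1,2)] assms(3,4) vanishing_homogeneous
  by (auto simp: form_val_PInf_iff)

lemma term_not_MInf:
  assumes "conditions m d f \<gamma>" "k < m" "\<xi> \<in> W"
  shows "form_hat v (d k) (f k) \<xi> - \<gamma> k / ereal (real (d k)) \<noteq> -\<infinity>"
  using term_PInf[OF assms(1,2) _ assms(3)] conditions_D(1,3)[OF assms(1,2)] form_val_not_MInf[of "d k" "f k" \<xi>]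
  unfolding form_hat_def by (cases "\<gamma> k"; cases "form_val v (d k) (f k) \<xi>") auto

lemma mhat_attained:
  assumes "conditions m d f \<gamma>" "\<xi> \<in> W"
  shows "\<exists>k<m. mhat m d f \<gamma> \<xi> = form_hat v (d k) (f k) \<xi> - \<gamma> k / ereal (real (d k))"
proof -
  have "{..<m} \<noteq> {}"
    using generating_nonvanishing[of m d f, OF _ conditions_D(5)[OF assms(1)] assms(2)] conditions_D(1,2)[OF assms(1)] by auto
  then have "Min ((\<lambda>k. form_hat v (d k) (f k) \<xi> - \<gamma> k / ereal (real (d k))) ` {..<m}) \<in>
      (\<lambda>k. form_hat v (d k) (f k) \<xi> - \<gamma> k / ereal (real (d k))) ` {..<m}"
    by (intro Min_in) auto
  moreover have "mhat m d f \<gamma> \<xi> = Min ((\<lambda>k. form_hat v (d k) (f k) \<xi> - \<gamma> k / ereal (real (d k))) ` {..<m})"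
    unfolding min_hat_def using \<open>{..<m} \<noteq> {}\<close> by (subst cInf_eq_Min) auto
  ultimately show ?thesis by auto
qed

lemma mhat_upper:
  assumes c: "conditions m d f \<gamma>"
  shows "\<exists>B. \<forall>\<xi>\<in>W. mhat m d f \<gamma> \<xi> \<le> ereal B"
proof -
  have "\<exists>B::real. \<forall>\<xi>\<in>W. \<exists>k<m. form_val v (d k) (f k) \<xi> \<le> ereal B"
  proof (rule forms_bounded_above)
    show "\<exists>k<m. poly_eval (f k) (rep_proj \<xi>) \<noteq> 0" if "\<xi> \<in> W" for \<xi>
      using conditions_D(1,2)[OF c] by (intro generating_nonvanishing[where d = d, OF _ conditions_D(5)[OF c] that]) auto
  qed (rule conditions_D(2)[OF c])
  then obtain B :: real where B: "\<And>\<xi>. \<xi> \<in> W \<Longrightarrow> \<exists>k<m. form_val v (d k) (f k) \<xi> \<le> ereal B" by blast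
  define r where "r k = real_of_ereal (\<gamma> k)" for k
  define G where "G = (\<Sum>k<m. \<bar>r k\<bar>)"
  have "mhat m d f \<gamma> \<xi> \<le> ereal (\<bar>B\<bar> + G)" if \<xi>: "\<xi> \<in> W" for \<xi>
  proof -
    obtain k where k: "k < m" "form_val v (d k) (f k) \<xi> \<le> ereal B" using B[OF \<xi>] by blast
    then have "\<gamma> k \<noteq> \<infinity>" using term_PInf[OF c k(1) _ \<xi>] by auto
    then obtain g where g: "\<gamma> k = ereal g" using conditions_D(3)[OF c k(1)] by (cases "\<gamma> k") auto
    obtain a where a: "form_val v (d k) (f k) \<xi> = ereal a" "a \<le> B"
      using k(2) form_val_not_MInf[of "d k" "f k" \<xi>] by (cases "form_val v (d k) (f k) \<xi>") auto
    have d: "d k \<ge> 1" by (rule conditions_D(1)[OF c k(1)])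
    have "\<bar>g\<bar> \<le> G"
      using member_le_sum[of k "{..<m}" "\<lambda>k. \<bar>r k\<bar>"] k(1) g by (simp add: G_def r_def[of k])
    then have "a - g \<le> \<bar>B\<bar> + G" using a(2) by linarith
    moreover have "(\<bar>B\<bar> + G) \<le> (\<bar>B\<bar> + G) * real (d k)"
      using d \<open>\<bar>g\<bar> \<le> G\<close> mult_left_mono[of 1 "real (d k)" "\<bar>B\<bar> + G"] by simp
    ultimately have "(a - g) / real (d k) \<le> \<bar>B\<bar> + G" using d by (simp add: pos_divide_le_eq)
    then have "form_hat v (d k) (f k) \<xi> - \<gamma> k / ereal (real (d k)) \<le> ereal (\<bar>B\<bar> + G)"
      using d by (simp add: form_hat_def a g diff_divide_distrib)
    then show ?thesis unfolding min_hat_def using k(1) by (intro INF_lower2[of k]) auto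
  qed
  then show ?thesis by blast
qed

lemma mhat_finite:
  assumes c: "conditions m d f \<gamma>" and \<xi>: "\<xi> \<in> W"
  shows "\<bar>mhat m d f \<gamma> \<xi>\<bar> \<noteq> \<infinity>"
proof -
  obtain k where "k < m" "mhat m d f \<gamma> \<xi> = form_hat v (d k) (f k) \<xi> - \<gamma> k / ereal (real (d k))"
    using mhat_attained[OF c \<xi>] by blast
  then have "mhat m d f \<gamma> \<xi> \<noteq> -\<infinity>" using term_not_MInf[OF c _ \<xi>] by auto
  then show ?thesis using mhat_upper[OF c] \<xi> by auto
qed

lemma mhat_subval:
  assumes "conditions m d f \<gamma>" shows "subval (pdual (mhat m d f \<gamma>))"
proof -
  obtain B where "\<forall>\<xi>\<in>W. mhat m d f \<gamma> \<xi> \<le> ereal B" using mhat_upper[OF assms] by blast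
  then show ?thesis by (intro pdual_subval[where B = B] mhat_finite[OF assms]) auto
qed

text \<open>The maximum principle in projective form: the dual of the minimum lies below every
  sub-valuation that satisfies the conditions. The test of \<open>subval_bound\<close> at an affine
  point \<open>x\<close> is the definition of the dual at its class, the parameter \<open>t\<close>
  absorbing the scale of \<open>x\<close>.\<close>

lemma pdual_mhat_le:
  assumes c: "conditions m d f \<gamma>" and u: "subval u" "\<And>p. p \<in> I_W \<Longrightarrow> u p = \<infinity>"
    and ge: "\<And>k. k < m \<Longrightarrow> \<gamma> k \<le> u (f k)"
  shows "pdual (mhat m d f \<gamma>) p \<le> u p"
proof -
  let ?\<phi> = "mhat m d f \<gamma>"
  \<comment> \<open>Infinite thresholds may become 0: their forms lie in \<open>I_W\<close>, where
    \<open>u\<close> is \<infinity>.\<close>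
  define g where "g k = (if \<gamma> k = \<infinity> then 0 else real_of_ereal (\<gamma> k))" for k
  have g: "\<gamma> k = ereal (g k)" if "k < m" "\<gamma> k \<noteq> \<infinity>" for k
    using conditions_D(3)[OF c that(1)] that(2) by (cases "\<gamma> k") (auto simp: g_def)
  have forms: "pdual ?\<phi> q \<le> u q" if q: "homogeneous e q" "e \<ge> 1" for e q
  proof (rule ereal_le_by_reals)
    fix \<alpha> assume \<alpha>: "ereal \<alpha> \<le> pdual ?\<phi> q"
    show "ereal \<alpha> \<le> u q"
    proof (rule subval_bound[OF u(1), of m d f g I_W e])
      show "ereal (g k) \<le> u (f k)" if "k < m" for k
        using ge[OF that] g[OF that] conditions_D(4)[OF c that] u(2) by (cases "\<gamma> k = \<infinity>") auto
      show "u (hom_component i s) = \<infinity>" if "s \<in> I_W" for s i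
        using u(2) vanishing_component[OF that] by blast
      show "C = UNIV" if "is_subring C" "range Const \<subseteq> C" "I_W \<subseteq> C" "f ` {..<m} \<subseteq> C" for C
        using conditions_D(5)[OF c] that unfolding generating_def by blast
      fix x t
      assume x: "\<And>s. s \<in> I_W \<Longrightarrow> poly_eval s x = 0"
        and t: "\<And>k. k < m \<Longrightarrow> ereal (g k + real (d k) * t) \<le> v (poly_eval (f k) x)"
      show "ereal (\<alpha> + real e * t) \<le> v (poly_eval q x)"
      proof (cases "x = 0")
        case True
        then show ?thesis using poly_eval_homogeneous[OF q(1), of 0 x] q(2) by (auto simp: at_0 power_0_left)
      next
        case False
        let ?\<xi> = "abs_proj x"
        have \<xi>: "?\<xi> \<in> W" using abs_proj_in_W[OF False] x by blast
        obtain s where s: "tuple_val v x = ereal s" using tuple_val_finite[OF False] .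
        obtain h where h: "?\<phi> ?\<xi> = ereal h" using mhat_finite[OF c \<xi>] by (cases "?\<phi> ?\<xi>") auto
        have "ereal (t - s) \<le> ?\<phi> ?\<xi>"
          unfolding min_hat_def
        proof (rule INF_greatest)
          fix k assume "k \<in> {..<m}"
          then have k: "k < m" by simp
          note d = conditions_D(1,2)[OF c k]
          show "ereal (t - s) \<le> form_hat v (d k) (f k) ?\<xi> - \<gamma> k / ereal (real (d k))"
          proof (cases "\<gamma> k = \<infinity>")
            case True
            then show ?thesis using term_PInf[OF c k True \<xi>] d(1) by (simp add: form_hat_def)
          next
            case False
            show ?thesis
            proof (cases "v (poly_eval (f k) x)")
              case (real a)
              then have "g k + real (d k) * t \<le> a" using t[OF k] by simp
              then have "(t - s) * real (d k) \<le> a - real (d k) * s - g k" by (simp add: algebra_simps)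
              then have "t - s \<le> (a - real (d k) * s - g k) / real (d k)" using d(1) by (simp add: pos_le_divide_eq)
              then show ?thesis
                using d(1) real s g[OF k False] by (simp add: form_hat_def form_val_abs[OF \<open>x \<noteq> 0\<close> d(2)] diff_divide_distrib)
            next
              case PInf
              then show ?thesis using d(1) s g[OF k False] by (simp add: form_hat_def form_val_abs[OF \<open>x \<noteq> 0\<close> d(2)])
            qed (use not_MInf in blast)
          qed
        qed
        then have ts: "t - s \<le> h" using h by simp
        have "pdual ?\<phi> q \<le> form_val v e q ?\<xi> - ereal (real e) * ?\<phi> ?\<xi>"
          by (subst pdual_homogeneous[of ?\<phi> e q]) (use mhat_finite[OF c] q(1) INF_lower[OF \<xi>] in auto)
        then have *: "ereal \<alpha> \<le> form_val v e q ?\<xi> - ereal (real e) * ereal h"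
          using \<alpha> h by (auto intro: order_trans)
        show ?thesis
        proof (cases "v (poly_eval q x)")
          case (real a)
          then have "\<alpha> \<le> a - real e * s - real e * h"
            using * s by (simp add: form_val_abs[OF False q(1)])
          moreover have "real e * (t - s) \<le> real e * h" using ts by (intro mult_left_mono) auto
          ultimately show ?thesis using real by (simp add: algebra_simps)
        qed (use not_MInf in auto)
      qed
    qed (use q conditions_D(1,2)[OF c] in \<open>auto simp: Suc_le_eq\<close>)
  qed
  \<comment> \<open>Constants are outside the reach of \<open>subval_bound\<close>, which needs
    positive degree; on them the dual is \<open>v\<close>, unless \<open>W\<close> is empty and
    everything vanishes.\<close>
  have "pdual ?\<phi> (hom_component j p) \<le> u (hom_component j p)" for j
  proof (cases "j = 0")
    case False
    then show ?thesis using forms[OF homogeneous_hom_component] by simp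
  next
    case True
    define b where "b = Poly_Mapping.lookup p 0"
    have "\<alpha> = 0" if "mdeg \<alpha> = 0" for \<alpha> :: "'n \<Rightarrow>\<^sub>0 nat"
      using that by (intro poly_mapping_eqI) (simp add: mdeg_superset[of UNIV])
    then have p0: "hom_component j p = Const b"
      using True by (intro poly_mapping_eqI) (auto simp: lookup_hom_component lookup_single when_def b_def)
    show ?thesis
    proof (cases "W = {}")
      case True
      then have "hom_component j p \<in> I_W" by (simp add: vanishing_ideal_def)
      then show ?thesis using u(2) by simp
    next
      case False
      then show ?thesis
        unfolding p0 using pdual_Const[OF False mhat_finite[OF c]] subval_D(6)[OF u(1)] by simp
    qed
  qed
  then have "pdual ?\<phi> p \<le> u (\<Sum>j\<in>A. hom_component j p)" for A
    by (intro subval_ge_sum[OF u(1)])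
      (subst pdual_components[OF mhat_finite[OF c]], auto intro: INF_lower2)
  moreover obtain N where "\<And>m. m > N \<Longrightarrow> hom_component m p = 0" using hom_component_large by blast
  ultimately show ?thesis by (metis sum_hom_components)
qed

section \<open>The dual of a sub-valuation\<close>

definition sdual :: "(('n, 'k) mpoly \<Rightarrow> ereal) \<Rightarrow> ('k, 'n) proj \<Rightarrow> ereal" where
  "sdual u \<xi> = (INF (m, f)\<in>{(m, f). m \<ge> 1 \<and> homogeneous m f}. form_hat v m f \<xi> - u f / ereal (real m))"

text \<open>Finitely many conditions that \<open>u\<close> satisfies and that determine it on forms
  up to \<epsilon> per degree. The opposite comparison is \<open>pdual_mhat_le\<close>.\<close>

definition good :: "(('n, 'k) mpoly \<Rightarrow> ereal) \<Rightarrow> real \<Rightarrow> nat \<Rightarrow> (nat \<Rightarrow> nat) \<Rightarrow> (nat \<Rightarrow> ('n, 'k) mpoly) \<Rightarrow> (nat \<Rightarrow> ereal) \<Rightarrow> bool" where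
  "good u \<epsilon> m d f \<gamma> \<longleftrightarrow> conditions m d f \<gamma> \<and> (\<forall>k<m. \<gamma> k \<le> u (f k)) \<and>
     (\<forall>e q. e \<ge> 1 \<longrightarrow> homogeneous e q \<longrightarrow> u q \<le> pdual (mhat m d f \<gamma>) q + ereal (\<epsilon> * real e))"

text \<open>Every condition competes in the infimum that defines the dual, with a threshold no
  larger than \<open>u\<close>; and no competitor undercuts the minimum by more than \<epsilon>, as
  its value under \<open>u\<close> is bounded by the dual of the minimum.\<close>

lemma good_sdual:
  assumes good: "good u \<epsilon> m d f \<gamma>" and \<xi>: "\<xi> \<in> W"
  shows "mhat m d f \<gamma> \<xi> \<le> sdual u \<xi> + ereal \<epsilon>" "sdual u \<xi> \<le> mhat m d f \<gamma> \<xi>"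
proof -
  have c: "conditions m d f \<gamma>" and ge: "\<And>k. k < m \<Longrightarrow> \<gamma> k \<le> u (f k)"
    and le: "\<And>e q. e \<ge> 1 \<Longrightarrow> homogeneous e q \<Longrightarrow> u q \<le> pdual (mhat m d f \<gamma>) q + ereal (\<epsilon> * real e)"
    using good by (auto simp: good_def)
  obtain h where h: "mhat m d f \<gamma> \<xi> = ereal h" using mhat_finite[OF c \<xi>] by (cases "mhat m d f \<gamma> \<xi>") auto
  have "ereal (h - \<epsilon>) \<le> sdual u \<xi>"
    unfolding sdual_def
  proof (rule INF_greatest, clarify)
    fix e and q :: "('n, 'k) mpoly" assume q: "(1::nat) \<le> e" "homogeneous e q"
    have "pdual (mhat m d f \<gamma>) q \<le> form_val v e q \<xi> - ereal (real e) * mhat m d f \<gamma> \<xi>"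
      by (subst pdual_homogeneous[of "mhat m d f \<gamma>" e q]) (use mhat_finite[OF c] q INF_lower[OF \<xi>] in auto)
    then have "u q \<le> (form_val v e q \<xi> - ereal (real e) * ereal h) + ereal (\<epsilon> * real e)"
      using le[OF q] h by (auto intro: order_trans add_right_mono)
    then show "ereal (h - \<epsilon>) \<le> form_hat v e q \<xi> - u q / ereal (real e)"
      by (rule form_hat_minus_ge[OF q(1)])
  qed
  then show "mhat m d f \<gamma> \<xi> \<le> sdual u \<xi> + ereal \<epsilon>" using h by (cases "sdual u \<xi>") auto
  show "sdual u \<xi> \<le> mhat m d f \<gamma> \<xi>"
    unfolding min_hat_def
  proof (rule INF_greatest)
    fix k assume "k \<in> {..<m}"
    then have k: "k < m" by simp
    have "sdual u \<xi> \<le> form_hat v (d k) (f k) \<xi> - u (f k) / ereal (real (d k))"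
      unfolding sdual_def using conditions_D(1,2)[OF c k] by (intro INF_lower2[of "(d k, f k)"]) auto
    also have "\<dots> \<le> form_hat v (d k) (f k) \<xi> - \<gamma> k / ereal (real (d k))"
      using ge[OF k] conditions_D(1)[OF c k] by (intro ereal_minus_mono ereal_divide_right_mono) auto
    finally show "sdual u \<xi> \<le> form_hat v (d k) (f k) \<xi> - \<gamma> k / ereal (real (d k))" .
  qed
qed

lemma sdual_finite:
  assumes "good u \<epsilon> m d f \<gamma>" "\<xi> \<in> W"
  shows "\<bar>sdual u \<xi>\<bar> \<noteq> \<infinity>"
  using good_sdual[OF assms] mhat_finite[OF _ assms(2), of m d f \<gamma>] assms(1) unfolding good_def
  by (cases "sdual u \<xi>"; cases "mhat m d f \<gamma> \<xi>") auto

text \<open>That \<open>u\<close> lies below its double dual is formal on forms of positive degree.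
  The converse compares with the dual of a good minimum, which is below \<open>u\<close> by the
  maximum principle.\<close>

lemma pdual_sdual:
  assumes u: "subval u" "\<And>p. u p = \<infinity> \<longleftrightarrow> p \<in> I_W" "\<And>p. u p = (INF m. u (hom_component m p))"
    and good: "\<And>\<epsilon>. \<epsilon> > 0 \<Longrightarrow> \<exists>m d f \<gamma>. good u \<epsilon> m d f \<gamma>"
  shows "pdual (sdual u) p = u p"
proof -
  have fin: "\<And>\<xi>. \<xi> \<in> W \<Longrightarrow> \<bar>sdual u \<xi>\<bar> \<noteq> \<infinity>" using good[of 1] sdual_finite by fastforce
  have forms: "pdual (sdual u) q = u q" if q: "homogeneous e q" "e \<ge> 1" for e q
  proof (rule antisym)
    have eq: "pdual (sdual u) q = (INF \<xi>\<in>W. form_val v e q \<xi> - ereal (real e) * sdual u \<xi>)"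
      by (rule pdual_homogeneous[OF _ q(1)]) (rule fin)
    show "u q \<le> pdual (sdual u) q"
      unfolding eq
    proof (rule INF_greatest)
      fix \<xi> assume \<xi>: "\<xi> \<in> W"
      obtain h where h: "sdual u \<xi> = ereal h" using fin[OF \<xi>] by (cases "sdual u \<xi>") auto
      have "sdual u \<xi> \<le> form_hat v e q \<xi> - u q / ereal (real e)"
        unfolding sdual_def using q by (intro INF_lower2[of "(e, q)"]) auto
      then show "u q \<le> form_val v e q \<xi> - ereal (real e) * sdual u \<xi>"
        unfolding h using q(2) subval_D(1)[OF u(1)] u(2)[of q] vanishing_homogeneous[OF q(1), of W] \<xi>
        by (intro form_val_minus_ge) (auto simp: form_val_PInf_iff)
    qed
    show "pdual (sdual u) q \<le> u q"
    proof (rule ereal_le_by_epsilon)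
      fix \<epsilon> :: real assume "\<epsilon> > 0"
      then obtain m d f \<gamma> where g: "good u \<epsilon> m d f \<gamma>" using good by blast
      then have c: "conditions m d f \<gamma>" and ge: "\<And>k. k < m \<Longrightarrow> \<gamma> k \<le> u (f k)" by (auto simp: good_def)
      have "pdual (sdual u) q \<le> pdual (mhat m d f \<gamma>) q + ereal (\<epsilon> * real e)"
        by (rule pdual_mono[OF _ _ _ q(1)]) (rule fin mhat_finite[OF c] good_sdual(1)[OF g]; assumption)+
      also have "\<dots> \<le> u q + ereal (\<epsilon> * real e)"
        using u(2) by (intro add_right_mono pdual_mhat_le[OF c u(1)] ge) auto
      finally show "pdual (sdual u) q \<le> u q + ereal (\<epsilon> * real e)" .
    qed
  qed
  have "pdual (sdual u) (hom_component j p) = u (hom_component j p)" for j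
  proof (cases "j = 0")
    case True
    define b where "b = Poly_Mapping.lookup p 0"
    have "\<alpha> = 0" if "mdeg \<alpha> = 0" for \<alpha> :: "'n \<Rightarrow>\<^sub>0 nat"
      using that by (intro poly_mapping_eqI) (simp add: mdeg_superset[of UNIV])
    then have p0: "hom_component j p = Const b"
      using True by (intro poly_mapping_eqI) (auto simp: lookup_hom_component lookup_single when_def b_def)
    show ?thesis
    proof (cases "W = {}")
      case True
      then have I: "hom_component j p \<in> I_W" by (simp add: vanishing_ideal_def)
      then have "u (hom_component j p) = \<infinity>" using u(2) by blast
      moreover have "pdual (sdual u) (hom_component j p) = \<infinity>" using pdual_PInf_iff[of "sdual u"] fin I by blast
      ultimately show ?thesis by simp
    next
      case False
      then have "1 \<notin> I_W" using vanishing_homogeneous[of 0 "1 :: ('n, 'k) mpoly" W] homogeneous_Const[of "1::'k", where 'a = 'n]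
        by (auto simp: single_one poly_eval_simps)
      then have "u 1 \<noteq> \<infinity>" using u(2) by blast
      then have u1: "u 1 = 0"
        using subval_D(3)[OF u(1), of 1] subval_D(1)[OF u(1), of 1] by (cases "u 1") (auto simp: zero_ereal_def)
      have "u (Const b) = v b"
        using subval_Const_mult[OF u(1), of b 1] u1 subval_D(5)[OF u(1)] at_0 by (cases "b = 0") auto
      then show ?thesis unfolding p0 using pdual_Const[OF False, of "sdual u"] fin by simp
    qed
  qed (use forms[OF homogeneous_hom_component] in simp)
  then show ?thesis
    using u(3)[of p] pdual_components[of "sdual u" p] fin by simp
qed

text \<open>Powers bring the forms to the common degree \<open>D\<close>, and constants of suitable
  value absorb the thresholds.\<close>

lemma mhat_approx_virtual:
  fixes U :: "'l itself"
  assumes inj: "\<exists>j :: 'k \<Rightarrow> 'l. inj j" and c: "conditions m d f \<gamma>" and \<epsilon>: "\<epsilon> > 0"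
  shows "\<exists>D \<theta>. virtual_divisor_of_degree U v W D \<theta> \<and> (\<forall>\<xi>\<in>W. mhat m d f \<gamma> \<xi> \<le> \<theta> \<xi> \<and> \<theta> \<xi> \<le> mhat m d f \<gamma> \<xi> + ereal \<epsilon>)"
proof -
  define D where "D = (\<Prod>k<m. d k)"
  define N where "N k = D div d k" for k
  have D: "D \<ge> 1" unfolding D_def using conditions_D(1)[OF c] by (intro prod_ge_1) auto
  have N: "N k * d k = D" "N k > 0" if "k < m" for k
  proof -
    have "d k dvd D" unfolding D_def using that by (intro dvd_prodI) auto
    then show "N k * d k = D" by (simp add: N_def)
    then show "N k > 0" using D by (cases "N k") auto
  qed
  define g where "g k = real_of_ereal (\<gamma> k)" for k
  \<comment> \<open>The allowance is \<epsilon> times \<open>D\<close> because values are divided by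
    \<open>D\<close> in the end; overshooting only upwards keeps the result above the
    minimum.\<close>
  have "\<exists>b. b \<noteq> 0 \<and> ereal (- g k * real (N k)) \<le> v b \<and> v b \<le> ereal (- g k * real (N k) + \<epsilon> * real D)" for k
    using value_dense[of "- g k * real (N k)" "- g k * real (N k) + \<epsilon> * real D"] \<epsilon> D by (smt (verit) mult_pos_pos of_nat_0_less_iff less_le_trans zero_less_one)
  then obtain b where b: "\<And>k. b k \<noteq> 0" "\<And>k. ereal (- g k * real (N k)) \<le> v (b k)"
      "\<And>k. v (b k) \<le> ereal (- g k * real (N k) + \<epsilon> * real D)" by metis
  define F where "F k = Const (b k) * f k ^ N k" for k
  define \<theta> where "\<theta> \<xi> = ((INF k\<in>{..<m}. v (poly_eval (F k) (rep_proj \<xi>))) - ereal (real D) * tuple_val v (rep_proj \<xi>)) / ereal (real D)" for \<xi> :: "('k, 'n) proj"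
  let ?t = "\<lambda>k \<xi>. form_hat v (d k) (f k) \<xi> - \<gamma> k / ereal (real (d k))"
  let ?T = "\<lambda>k \<xi>. (v (poly_eval (F k) (rep_proj \<xi>)) - ereal (real D) * tuple_val v (rep_proj \<xi>)) / ereal (real D)"
  have terms: "?t k \<xi> \<le> ?T k \<xi> \<and> ?T k \<xi> \<le> ?t k \<xi> + ereal \<epsilon>" if k: "k < m" and \<xi>: "\<xi> \<in> W" for k \<xi>
  proof -
    obtain s where s: "tuple_val v (rep_proj \<xi>) = ereal s" by (rule rep_val_finite)
    have F: "v (poly_eval (F k) (rep_proj \<xi>)) = v (b k) + ereal (real (N k)) * v (poly_eval (f k) (rep_proj \<xi>))"
      by (simp add: F_def poly_eval_simps is_hom_power[OF is_hom_poly_eval] mult power)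
    obtain b' where b': "v (b k) = ereal b'" using finiteE[OF b(1)] .
    have d: "d k \<ge> 1" by (rule conditions_D(1)[OF c k])
    show ?thesis
    proof (cases "v (poly_eval (f k) (rep_proj \<xi>))")
      case (real a)
      have "\<gamma> k \<noteq> \<infinity>" using term_PInf[OF c k _ \<xi>] real s by (auto simp: form_val_def)
      then have \<gamma>: "\<gamma> k = ereal (g k)" using conditions_D(3)[OF c k] by (cases "\<gamma> k") (auto simp: g_def)
      have Dk: "real D = real (N k) * real (d k)" using N(1)[OF k] by (metis of_nat_mult)
      have Np: "real (N k) > 0" "real (d k) > 0" using N(2)[OF k] d by auto
      have t: "?t k \<xi> = ereal ((a - real (d k) * s - g k) / real (d k))"
        using d real s \<gamma> by (simp add: form_hat_def form_val_def diff_divide_distrib)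
      have T: "?T k \<xi> = ereal ((b' + real (N k) * a - real D * s) / real D)"
        using D real s b' by (simp add: F)
      have "(a - real (d k) * s - g k) / real (d k) = (- g k * real (N k) + real (N k) * a - real D * s) / real D"
        unfolding Dk using Np by (simp add: field_simps)
      moreover have "- g k * real (N k) \<le> b'" "b' \<le> - g k * real (N k) + \<epsilon> * real D"
        using b(2,3)[of k] b' by auto
      moreover have "(- g k * real (N k) + \<epsilon> * real D + real (N k) * a - real D * s) / real D =
          (- g k * real (N k) + real (N k) * a - real D * s) / real D + \<epsilon>"
        using D by (simp add: field_simps)
      ultimately show ?thesis unfolding t T using D
        by (simp add: divide_right_mono) (smt (verit) divide_right_mono of_nat_0_le_iff)
    next
      case PInf
      then have "?T k \<xi> = \<infinity>" using N(2)[OF k] D by (simp add: F b' s)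
      moreover have "?t k \<xi> = \<infinity>"
        using PInf d s conditions_D(3)[OF c k] by (cases "\<gamma> k") (simp_all add: form_hat_def form_val_def)
      ultimately show ?thesis by simp
    qed (use not_MInf in blast)
  qed
  have \<theta>_eq: "\<theta> \<xi> = (INF k\<in>{..<m}. ?T k \<xi>)" if \<xi>: "\<xi> \<in> W" for \<xi>
  proof -
    obtain s where s: "tuple_val v (rep_proj \<xi>) = ereal s" by (rule rep_val_finite)
    have "mono (\<lambda>y. (y - ereal (real D * s)) / ereal (real D))"
      using D by (intro monoI ereal_divide_right_mono ereal_minus_mono) auto
    moreover obtain k where k: "k < m" using mhat_attained[OF c \<xi>] by blast
    then have ne: "{..<m} \<noteq> {}" by blast
    let ?A = "(\<lambda>k. v (poly_eval (F k) (rep_proj \<xi>))) ` {..<m}"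
    have "(INF k\<in>{..<m}. v (poly_eval (F k) (rep_proj \<xi>))) = Min ?A" using ne by (subst cInf_eq_Min) auto
    moreover have "(INF k\<in>{..<m}. ?T k \<xi>) = Min ((\<lambda>y. (y - ereal (real D * s)) / ereal (real D)) ` ?A)"
      using ne s by (subst cInf_eq_Min) (auto simp: image_image)
    ultimately show ?thesis
      using mono_Min_commute[of "\<lambda>y. (y - ereal (real D * s)) / ereal (real D)" ?A] ne s by (simp add: \<theta>_def)
  qed
  have lower: "mhat m d f \<gamma> \<xi> \<le> \<theta> \<xi>" if \<xi>: "\<xi> \<in> W" for \<xi>
    unfolding \<theta>_eq[OF \<xi>] min_hat_def using terms[OF _ \<xi>] by (intro INF_mono) auto
  have upper: "\<theta> \<xi> \<le> mhat m d f \<gamma> \<xi> + ereal \<epsilon>" if \<xi>: "\<xi> \<in> W" for \<xi>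
  proof -
    obtain k where k: "k < m" "mhat m d f \<gamma> \<xi> = ?t k \<xi>" using mhat_attained[OF c \<xi>] by blast
    have "\<theta> \<xi> \<le> ?T k \<xi>" unfolding \<theta>_eq[OF \<xi>] using k(1) by (intro INF_lower) auto
    then show ?thesis using terms[OF k(1) \<xi>] k(2) by (auto intro: order_trans)
  qed
  have "virtual_divisor_of_degree U v W D \<theta>"
  proof (rule min_of_forms_virtual[OF inj D, of m F])
    show "homogeneous D (F k)" if "k < m" for k
      using homogeneous_Const_mult[OF homogeneous_power[OF conditions_D(2)[OF c that], of "N k"], of "b k"] N(1)[OF that]
      by (simp add: F_def)
    show "\<bar>\<theta> \<xi>\<bar> \<noteq> \<infinity>" if "\<xi> \<in> W" for \<xi>
      using lower[OF that] upper[OF that] mhat_finite[OF c that] by (cases "\<theta> \<xi>"; cases "mhat m d f \<gamma> \<xi>") auto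
  qed (simp add: \<theta>_def)
  then show ?thesis using lower upper by blast
qed

lemma sdual_virtual:
  fixes U :: "'l itself"
  assumes inj: "\<exists>j :: 'k \<Rightarrow> 'l. inj j"
    and good: "\<And>\<epsilon>. \<epsilon> > 0 \<Longrightarrow> \<exists>m d f \<gamma>. good u \<epsilon> m d f \<gamma>"
  shows "virtual_divisor U v W (sdual u)"
proof -
  have fin: "\<And>\<xi>. \<xi> \<in> W \<Longrightarrow> \<bar>sdual u \<xi>\<bar> \<noteq> \<infinity>" using good[of 1] sdual_finite by fastforce
  have "\<exists>\<theta>. (\<exists>D. virtual_divisor_of_degree U v W D \<theta>) \<and> (\<forall>\<xi>\<in>W. ext_dist (\<theta> \<xi>) (sdual u \<xi>) \<le> ereal (1 / real (Suc i)))" for i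
  proof -
    define e where "e = 1 / real (Suc i)"
    have e: "e > 0" by (simp add: e_def)
    obtain m d f \<gamma> where g: "good u (e / 2) m d f \<gamma>" using good[of "e / 2"] e by auto
    then have c: "conditions m d f \<gamma>" by (simp add: good_def)
    obtain D \<theta> where \<theta>: "virtual_divisor_of_degree U v W D \<theta>"
        "\<And>\<xi>. \<xi> \<in> W \<Longrightarrow> mhat m d f \<gamma> \<xi> \<le> \<theta> \<xi>" "\<And>\<xi>. \<xi> \<in> W \<Longrightarrow> \<theta> \<xi> \<le> mhat m d f \<gamma> \<xi> + ereal (e / 2)"
      using mhat_approx_virtual[OF inj c, of "e / 2" U] e by auto
    have "ext_dist (\<theta> \<xi>) (sdual u \<xi>) \<le> ereal e" if \<xi>: "\<xi> \<in> W" for \<xi>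
    proof (rule ext_dist_I)
      obtain a b h where "\<theta> \<xi> = ereal a" "sdual u \<xi> = ereal b" "mhat m d f \<gamma> \<xi> = ereal h"
        using \<theta>(2,3)[OF \<xi>] mhat_finite[OF c \<xi>] fin[OF \<xi>]
        by (cases "\<theta> \<xi>"; cases "sdual u \<xi>"; cases "mhat m d f \<gamma> \<xi>") auto
      then show "\<theta> \<xi> \<le> sdual u \<xi> + ereal e" "sdual u \<xi> \<le> \<theta> \<xi> + ereal e"
        using \<theta>(2,3)[OF \<xi>] good_sdual[OF g \<xi>] e by auto
    qed (use e in simp)
    then show ?thesis using \<theta>(1) unfolding e_def by blast
  qed
  then obtain \<theta> where \<theta>: "\<And>i. \<exists>D. virtual_divisor_of_degree U v W D (\<theta> i)"
      "\<And>i \<xi>. \<xi> \<in> W \<Longrightarrow> ext_dist (\<theta> i \<xi>) (sdual u \<xi>) \<le> ereal (1 / real (Suc i))" by metis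
  have "ext_uniform_limit W \<theta> (sdual u)"
    unfolding ext_uniform_limit_def
  proof (intro allI impI)
    fix \<epsilon> :: real assume "\<epsilon> > 0"
    then obtain n where n: "1 / real (Suc n) < \<epsilon>" using nat_approx_posE by blast
    show "\<forall>\<^sub>F m in sequentially. \<forall>\<xi>\<in>W. ext_dist (\<theta> m \<xi>) (sdual u \<xi>) \<le> ereal \<epsilon>"
    proof (rule eventually_sequentiallyI[of n], intro ballI)
      fix m \<xi> assume "n \<le> m" "\<xi> \<in> W"
      have "1 / real (Suc m) \<le> 1 / real (Suc n)" using \<open>n \<le> m\<close> by (intro divide_left_mono) auto
      then have "ereal (1 / real (Suc m)) \<le> ereal \<epsilon>" using n by simp
      then show "ext_dist (\<theta> m \<xi>) (sdual u \<xi>) \<le> ereal \<epsilon>" using \<theta>(2)[OF \<open>\<xi> \<in> W\<close>, of m] by (rule order_trans[rotated])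
    qed
  qed
  then show ?thesis
    unfolding virtual_divisor_def by (intro conjI exI[of _ \<theta>] ballI allI fin \<theta>(1))
qed

end

section \<open>Sub-valuations on the coordinate ring\<close>

context projective_variety
begin

interpretation A: cring "coord_ring W" by (rule cring_coord_ring)

section \<open>Pulling sub-valuations back to K[X]\<close>

lemma subval_of_K_subvaluation:
  assumes "K_subvaluation (coord_ring W) (coord_const W) v w"
  shows "subval (\<lambda>p. w (coord_class W p))" "p \<in> I_W \<Longrightarrow> w (coord_class W p) = \<infinity>"
proof -
  have w: "subvaluation (coord_ring W) w" "\<And>c. v c \<le> w (coord_class W (Const c))"
    using assms by (auto simp: K_subvaluation_def coord_const_def)
  show "subval (\<lambda>p. w (coord_class W p))"
    using w unfolding subval_def subvaluation_def by (auto simp flip: coord_class_add coord_class_mult coord_class_0)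
  show "w (coord_class W p) = \<infinity>" if "p \<in> I_W"
    using w(1) coord_class_vanishing[OF that] unfolding subvaluation_def by (simp add: coord_class_0)
qed

lemma K_subvaluation_of_subval:
  assumes "subval (\<lambda>p. w (coord_class W p))"
  shows "K_subvaluation (coord_ring W) (coord_const W) v w"
  using subval_D[OF assms] unfolding K_subvaluation_def subvaluation_def
  by (auto simp: carrier_coord_ring coord_const_def coord_class_add coord_class_mult coord_class_0)

lemma homogeneous_subvaluation_iff:
  assumes w0: "w (coord_class W 0) = \<infinity>"
  shows "homogeneous_subvaluation (coord_ring W) (coord_grade W) w \<longleftrightarrow>
    (\<forall>p. w (coord_class W p) = (INF m. w (coord_class W (hom_component m p))))"
proof
  assume hom: "homogeneous_subvaluation (coord_ring W) (coord_grade W) w"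
  show "\<forall>p. w (coord_class W p) = (INF m. w (coord_class W (hom_component m p)))"
  proof
    fix p :: "('n, 'k) mpoly"
    obtain N where N: "\<And>m. m > N \<Longrightarrow> hom_component m p = 0" using hom_component_large by blast
    let ?g = "\<lambda>m. w (coord_class W (hom_component m p))"
    have "w (\<Oplus>\<^bsub>coord_ring W\<^esub>m\<in>{..N}. coord_class W (hom_component m p)) = (MIN m\<in>{..N}. ?g m)"
      using hom unfolding homogeneous_subvaluation_def by (auto simp: coord_grade_def)
    then have "w (coord_class W p) = (MIN m\<in>{..N}. ?g m)"
      by (simp add: coord_class_finsum sum_hom_components[OF N])
    also have "\<dots> = (INF m. ?g m)"
    proof (rule antisym)
      show "(MIN m\<in>{..N}. ?g m) \<le> (INF m. ?g m)"
      proof (rule INF_greatest)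
        fix m show "(MIN m\<in>{..N}. ?g m) \<le> ?g m" using N[of m] w0 by (cases "m \<le> N") (auto intro: Min_le)
      qed
      have "(MIN m\<in>{..N}. ?g m) \<in> ?g ` {..N}" by (intro Min_in) auto
      then show "(INF m. ?g m) \<le> (MIN m\<in>{..N}. ?g m)" by (auto intro: INF_lower2)
    qed
    finally show "w (coord_class W p) = (INF m. ?g m)" .
  qed
next
  assume *: "\<forall>p. w (coord_class W p) = (INF m. w (coord_class W (hom_component m p)))"
  show "homogeneous_subvaluation (coord_ring W) (coord_grade W) w"
    unfolding homogeneous_subvaluation_def
  proof (intro allI impI)
    fix N and a :: "nat \<Rightarrow> ('n, 'k) mpoly set" assume a: "\<forall>m\<le>N. a m \<in> coord_grade W m"
    then have "\<forall>m. \<exists>p. m \<le> N \<longrightarrow> homogeneous m p \<and> a m = coord_class W p"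
      unfolding coord_grade_def by blast
    then obtain p where p: "\<And>m. m \<le> N \<Longrightarrow> homogeneous m (p m)" "\<And>m. m \<le> N \<Longrightarrow> a m = coord_class W (p m)" by metis
    let ?s = "\<Sum>m\<in>{..N}. p m"
    have comp: "hom_component m ?s = (if m \<le> N then p m else 0)" for m
      using hom_component_of_sum[of "{..N}" p m] p(1) by simp
    have "(\<Oplus>\<^bsub>coord_ring W\<^esub>m\<in>{..N}. a m) = (\<Oplus>\<^bsub>coord_ring W\<^esub>m\<in>{..N}. coord_class W (p m))"
      by (intro A.finsum_cong') (auto simp: p(2))
    also have "\<dots> = coord_class W ?s" by (simp add: coord_class_finsum)
    finally have "w (\<Oplus>\<^bsub>coord_ring W\<^esub>m\<in>{..N}. a m) = (INF m. w (coord_class W (hom_component m ?s)))"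
      using *[rule_format, of ?s] by (rule arg_cong[THEN trans])
    also have "\<dots> = (MIN m\<in>{..N}. w (a m))"
    proof (rule antisym)
      have "(MIN m\<in>{..N}. w (a m)) \<in> (\<lambda>m. w (a m)) ` {..N}" by (intro Min_in) auto
      then obtain m where m: "m \<le> N" "(MIN m\<in>{..N}. w (a m)) = w (a m)" by blast
      show "(INF m. w (coord_class W (hom_component m ?s))) \<le> (MIN m\<in>{..N}. w (a m))"
        unfolding m(2) using m(1) p(2)[OF m(1)] by (intro INF_lower2[of m]) (simp_all add: comp)
      show "(MIN m\<in>{..N}. w (a m)) \<le> (INF m. w (coord_class W (hom_component m ?s)))"
      proof (rule INF_greatest)
        fix m show "(MIN m\<in>{..N}. w (a m)) \<le> w (coord_class W (hom_component m ?s))"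
        proof (cases "m \<le> N")
          case True
          then have "(MIN m\<in>{..N}. w (a m)) \<le> w (a m)" by (intro Min_le) auto
          then show ?thesis using True p(2)[OF True] by (simp add: comp)
        qed (simp add: comp w0)
      qed
    qed
    finally show "w (\<Oplus>\<^bsub>coord_ring W\<^esub>m\<in>{..N}. a m) = (MIN m\<in>{..N}. w (a m))" .
  qed
qed

lemma reduced_homogeneous_iff:
  "reduced_homogeneous_subvaluation v W u \<longleftrightarrow> subval (\<lambda>p. u (coord_class W p)) \<and>
    (\<forall>p. u (coord_class W p) = \<infinity> \<longleftrightarrow> p \<in> I_W) \<and>
    (\<forall>p. u (coord_class W p) = (INF m. u (coord_class W (hom_component m p))))"
proof -
  have red: "reduced_subvaluation (coord_ring W) u \<longleftrightarrow> (\<forall>p. u (coord_class W p) = \<infinity> \<longrightarrow> p \<in> I_W)"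
    by (auto simp: reduced_subvaluation_def carrier_coord_ring coord_class_0 coord_class_eq_iff)
  show ?thesis
  proof
    assume u: "reduced_homogeneous_subvaluation v W u"
    then have K: "K_subvaluation (coord_ring W) (coord_const W) v u" by (simp add: reduced_homogeneous_subvaluation_def)
    have "u (coord_class W 0) = \<infinity>" using subval_of_K_subvaluation(2)[OF K vI(1)] .
    then show "subval (\<lambda>p. u (coord_class W p)) \<and>
      (\<forall>p. u (coord_class W p) = \<infinity> \<longleftrightarrow> p \<in> I_W) \<and>
      (\<forall>p. u (coord_class W p) = (INF m. u (coord_class W (hom_component m p))))"
      using u subval_of_K_subvaluation[OF K] homogeneous_subvaluation_iff[of u] red
      unfolding reduced_homogeneous_subvaluation_def by blast
  next
    assume u: "subval (\<lambda>p. u (coord_class W p)) \<and>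
      (\<forall>p. u (coord_class W p) = \<infinity> \<longleftrightarrow> p \<in> I_W) \<and>
      (\<forall>p. u (coord_class W p) = (INF m. u (coord_class W (hom_component m p))))"
    then have "u (coord_class W 0) = \<infinity>" using vI(1) by blast
    then show "reduced_homogeneous_subvaluation v W u"
      unfolding reduced_homogeneous_subvaluation_def
      using u K_subvaluation_of_subval[of u] homogeneous_subvaluation_iff[of u] red by blast
  qed
qed

lemma reduced_homogeneous_D:
  assumes "reduced_homogeneous_subvaluation v W u"
  shows "subval (\<lambda>p. u (coord_class W p))" "u (coord_class W p) = \<infinity> \<longleftrightarrow> p \<in> I_W"
    "u (coord_class W p) = (INF m. u (coord_class W (hom_component m p)))"
    "u (coord_class W p) \<noteq> -\<infinity>"
proof -
  note u = assms[unfolded reduced_homogeneous_iff]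
  show "subval (\<lambda>p. u (coord_class W p))" "u (coord_class W p) = \<infinity> \<longleftrightarrow> p \<in> I_W"
    using u by blast+
  show "u (coord_class W p) = (INF m. u (coord_class W (hom_component m p)))"
    using u[THEN conjunct2, THEN conjunct2] by (rule spec)
  show "u (coord_class W p) \<noteq> -\<infinity>" by (rule subval_D(1)[OF u[THEN conjunct1]])
qed

lemma divisor_dual_class: "divisor_dual v W \<eta> (coord_class W p) = pdual \<eta> p"
proof -
  define f where "f = (SOME f. coord_class W f = coord_class W p)"
  have "coord_class W f = coord_class W p" unfolding f_def by (rule someI[of _ p]) simp
  then have "pdual \<eta> f = pdual \<eta> p" by (intro pdual_eq_mod) (simp add: coord_class_eq_iff)
  then show ?thesis by (simp add: divisor_dual_def f_def[symmetric] poly_dual_def)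
qed

lemma subvaluation_dual_eq: "subvaluation_dual v W u = sdual (\<lambda>p. u (coord_class W p))"
  by (rule ext) (simp add: subvaluation_dual_def sdual_def)

lemma divisor_dual_reduced_homogeneous:
  assumes \<eta>: "\<And>\<xi>. \<xi> \<in> W \<Longrightarrow> \<bar>\<eta> \<xi>\<bar> \<noteq> \<infinity>" and B: "\<And>\<xi>. \<xi> \<in> W \<Longrightarrow> \<eta> \<xi> \<le> ereal B"
  shows "reduced_homogeneous_subvaluation v W (divisor_dual v W \<eta>)"
proof -
  have "subval (pdual \<eta>)" by (rule pdual_subval[where B = B]) (use \<eta> B in auto)
  moreover have "pdual \<eta> p = \<infinity> \<longleftrightarrow> p \<in> I_W" for p by (rule pdual_PInf_iff) (rule \<eta>)
  moreover have "pdual \<eta> p = (INF m. pdual \<eta> (hom_component m p))" for p by (rule pdual_components) (rule \<eta>)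
  ultimately show ?thesis unfolding reduced_homogeneous_iff divisor_dual_class by blast
qed

lemma generates_algebra_generating:
  "generates_algebra (coord_ring W) (coord_const W) (coord_class W ` F) \<longleftrightarrow> generating F"
  unfolding generates_algebra_iff generating_def ..

lemma pdual_mhat_ge:
  assumes c: "conditions m d f \<gamma>" and k: "k < m"
  shows "\<gamma> k \<le> pdual (mhat m d f \<gamma>) (f k)"
proof -
  have eq: "pdual (mhat m d f \<gamma>) (f k) = (INF \<xi>\<in>W. form_val v (d k) (f k) \<xi> - ereal (real (d k)) * mhat m d f \<gamma> \<xi>)"
    by (rule pdual_homogeneous[OF _ conditions_D(2)[OF c k]]) (rule mhat_finite[OF c])
  show ?thesis
    unfolding eq
  proof (rule INF_greatest)
    fix \<xi> assume \<xi>: "\<xi> \<in> W"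
    obtain h where h: "mhat m d f \<gamma> \<xi> = ereal h" using mhat_finite[OF c \<xi>] by (cases "mhat m d f \<gamma> \<xi>") auto
    have "mhat m d f \<gamma> \<xi> \<le> form_hat v (d k) (f k) \<xi> - \<gamma> k / ereal (real (d k))"
      unfolding min_hat_def using k by (intro INF_lower) auto
    then show "\<gamma> k \<le> form_val v (d k) (f k) \<xi> - ereal (real (d k)) * mhat m d f \<gamma> \<xi>"
      unfolding h using conditions_D[OF c] k term_PInf[OF c k _ \<xi>] by (intro form_val_minus_ge) auto
  qed
qed

text \<open>A dual that meets the first \<open>m\<close> conditions dominates the least
  sub-valuation meeting them, and this one is uniformly close to \<open>u\<close>;
  \<open>tuple_degree_form_bound\<close> expresses the error by the degree of the form. The
  conditions need not be homogeneous.\<close>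

lemma almost_generated_bound:
  fixes p :: "nat \<Rightarrow> ('n, 'k) mpoly"
  assumes ag: "almost_finitely_generates (coord_ring W) (coord_const W) v (\<lambda>k. (coord_class W (p k), \<alpha> k)) u"
  shows "\<alpha> k \<le> u (coord_class W (p k))"
    and "\<epsilon> > 0 \<Longrightarrow> \<forall>\<^sub>F m in sequentially. generating (p ` {..<m}) \<and>
      (\<forall>\<eta> B. (\<forall>\<xi>\<in>W. \<bar>\<eta> \<xi>\<bar> \<noteq> \<infinity> \<and> \<eta> \<xi> \<le> ereal B) \<longrightarrow> (\<forall>k<m. \<alpha> k \<le> pdual \<eta> (p k)) \<longrightarrow>
        (\<forall>e q. homogeneous e q \<longrightarrow> u (coord_class W q) \<le> pdual \<eta> q + ereal (\<epsilon> * real e)))"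
proof -
  let ?C = "\<lambda>k. (coord_class W (p k), \<alpha> k)"
  obtain us where us: "\<forall>\<^sub>F m in sequentially. generated_subvaluation (coord_ring W) (coord_const W) v (?C ` {..<m}) (us m)"
    and "subvaluations_converge (coord_ring W) (coord_const W) us u"
    using ag unfolding almost_finitely_generates_def by blast
  then obtain cs where cs: "generates_algebra (coord_ring W) (coord_const W) (set cs)"
    and conv: "\<And>\<epsilon>. \<epsilon> > 0 \<Longrightarrow> \<forall>\<^sub>F m in sequentially. \<forall>a\<in>carrier (coord_ring W).
        ext_dist (u a) (us m a) \<le> ereal (\<epsilon> * real (tuple_degree (coord_ring W) (coord_const W) cs a))"
    unfolding subvaluations_converge_def by blast
  show "\<alpha> k \<le> u (coord_class W (p k))"
  proof (rule ereal_le_by_epsilon)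
    let ?t = "tuple_degree (coord_ring W) (coord_const W) cs (coord_class W (p k))"
    fix \<epsilon> :: real assume "\<epsilon> > 0"
    then have "\<forall>\<^sub>F m in sequentially. m > k \<and> generated_subvaluation (coord_ring W) (coord_const W) v (?C ` {..<m}) (us m) \<and>
      (\<forall>a\<in>carrier (coord_ring W). ext_dist (u a) (us m a) \<le> ereal (\<epsilon> * real (tuple_degree (coord_ring W) (coord_const W) cs a)))"
      using us conv eventually_gt_at_top[of k] by (intro eventually_conj) auto
    then obtain m where m: "m > k" "generated_subvaluation (coord_ring W) (coord_const W) v (?C ` {..<m}) (us m)"
        "ext_dist (u (coord_class W (p k))) (us m (coord_class W (p k))) \<le> ereal (\<epsilon> * real ?t)"
      unfolding eventually_sequentially by (meson coord_class_closed order_refl)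
    have "\<alpha> k \<le> us m (coord_class W (p k))"
      using m(1,2) unfolding generated_subvaluation_def by auto
    also have "\<dots> \<le> u (coord_class W (p k)) + ereal (\<epsilon> * real ?t)" by (rule ext_dist_D(2)[OF m(3)])
    finally show "\<alpha> k \<le> u (coord_class W (p k)) + ereal (\<epsilon> * real ?t)" .
  qed
  assume \<epsilon>: "\<epsilon> > 0"
  obtain M where M: "\<And>d q. homogeneous d q \<Longrightarrow> tuple_degree (coord_ring W) (coord_const W) cs (coord_class W q) \<le> M * d"
    using tuple_degree_form_bound[OF cs] by blast
  \<comment> \<open>The summand 1 covers the case \<open>M = 0\<close>.\<close>
  define \<delta> where "\<delta> = \<epsilon> / (real M + 1)"
  have \<delta>: "\<delta> > 0" "\<delta> * real M \<le> \<epsilon>"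
  proof -
    show "\<delta> > 0" using \<epsilon> by (simp add: \<delta>_def)
    have "\<delta> * real M \<le> \<delta> * (real M + 1)" using \<open>\<delta> > 0\<close> by (intro mult_left_mono) auto
    then show "\<delta> * real M \<le> \<epsilon>" by (simp add: \<delta>_def)
  qed
  show "\<forall>\<^sub>F m in sequentially. generating (p ` {..<m}) \<and>
      (\<forall>\<eta> B. (\<forall>\<xi>\<in>W. \<bar>\<eta> \<xi>\<bar> \<noteq> \<infinity> \<and> \<eta> \<xi> \<le> ereal B) \<longrightarrow> (\<forall>k<m. \<alpha> k \<le> pdual \<eta> (p k)) \<longrightarrow>
        (\<forall>e q. homogeneous e q \<longrightarrow> u (coord_class W q) \<le> pdual \<eta> q + ereal (\<epsilon> * real e)))"
    using us conv[OF \<delta>(1)]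
  proof eventually_elim
    case (elim m)
    have fst: "fst ` ?C ` {..<m} = coord_class W ` p ` {..<m}" by (auto simp: image_image)
    have gen: "generating (p ` {..<m})"
      using elim(1) unfolding generated_subvaluation_def fst generates_algebra_generating by blast
    have "u (coord_class W q) \<le> pdual \<eta> q + ereal (\<epsilon> * real e)"
      if \<eta>: "\<forall>\<xi>\<in>W. \<bar>\<eta> \<xi>\<bar> \<noteq> \<infinity> \<and> \<eta> \<xi> \<le> ereal B" and ge: "\<forall>k<m. \<alpha> k \<le> pdual \<eta> (p k)" and q: "homogeneous e q" for \<eta> B e q
    proof -
      have "reduced_homogeneous_subvaluation v W (divisor_dual v W \<eta>)"
        by (rule divisor_dual_reduced_homogeneous[where B = B]) (use \<eta> in auto)
      then have "K_subvaluation (coord_ring W) (coord_const W) v (divisor_dual v W \<eta>)"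
        by (simp add: reduced_homogeneous_subvaluation_def)
      moreover have "\<forall>(a, \<alpha>)\<in>?C ` {..<m}. \<alpha> \<le> divisor_dual v W \<eta> a"
        using ge by (auto simp: divisor_dual_class)
      ultimately have "us m (coord_class W q) \<le> divisor_dual v W \<eta> (coord_class W q)"
        using elim(1) unfolding generated_subvaluation_def by (meson coord_class_closed)
      then have us_le: "us m (coord_class W q) \<le> pdual \<eta> q" by (simp add: divisor_dual_class)
      let ?t = "tuple_degree (coord_ring W) (coord_const W) cs (coord_class W q)"
      have "u (coord_class W q) \<le> us m (coord_class W q) + ereal (\<delta> * real ?t)"
        using elim(2) by (intro ext_dist_D(1)) simp
      also have "\<dots> \<le> pdual \<eta> q + ereal (\<epsilon> * real e)"
      proof (intro add_mono us_le)
        have "real ?t \<le> real M * real e" using M[OF q] by (metis of_nat_le_iff of_nat_mult)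
        then have "\<delta> * real ?t \<le> \<delta> * (real M * real e)" using \<delta>(1) by (intro mult_left_mono) auto
        also have "\<dots> \<le> \<epsilon> * real e" using mult_right_mono[OF \<delta>(2), of "real e"] by (simp add: mult.assoc)
        finally show "ereal (\<delta> * real ?t) \<le> ereal (\<epsilon> * real e)" by simp
      qed
      finally show ?thesis .
    qed
    then show ?case using gen by blast
  qed
qed

lemma good_of_homogeneous_conditions:
  assumes u: "reduced_homogeneous_subvaluation v W u"
    and f: "\<And>k. d k \<ge> 1 \<and> homogeneous (d k) (f k)"
    and ag: "almost_finitely_generates (coord_ring W) (coord_const W) v (\<lambda>k. (coord_class W (f k), \<gamma> k)) u"
    and \<epsilon>: "\<epsilon> > 0"
  shows "\<forall>\<^sub>F m in sequentially. good (\<lambda>p. u (coord_class W p)) \<epsilon> m d f \<gamma>"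
  using almost_generated_bound(2)[OF ag \<epsilon>]
proof eventually_elim
  case (elim m)
  have \<gamma>: "\<gamma> k \<noteq> -\<infinity>" for k using ag by (auto simp: almost_finitely_generates_def)
  have ge: "\<gamma> k \<le> u (coord_class W (f k))" for k using almost_generated_bound(1)[OF ag] .
  have c: "conditions m d f \<gamma>"
    unfolding conditions_def
  proof (intro conjI allI impI)
    show "f k \<in> I_W" if "\<gamma> k = \<infinity>" for k using ge[of k] that reduced_homogeneous_D(2)[OF u] by auto
  qed (use f \<gamma> elim in auto)
  obtain B where "\<forall>\<xi>\<in>W. mhat m d f \<gamma> \<xi> \<le> ereal B" using mhat_upper[OF c] by blast
  then have "\<forall>\<xi>\<in>W. \<bar>mhat m d f \<gamma> \<xi>\<bar> \<noteq> \<infinity> \<and> mhat m d f \<gamma> \<xi> \<le> ereal B" by (simp add: mhat_finite[OF c])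
  moreover have "\<forall>k<m. \<gamma> k \<le> pdual (mhat m d f \<gamma>) (f k)" using pdual_mhat_ge[OF c] by blast
  ultimately show ?case
    using elim c ge unfolding good_def by blast
qed

text \<open>Arbitrary conditions are replaced by all their components of degrees 1 to
  \<open>N\<close>, with the value of \<open>u\<close> as threshold. The dual of that minimum
  satisfies the original conditions as well, so \<open>almost_generated_bound\<close> applies to
  it.\<close>

lemma good_of_almost_finitely_generated:
  assumes u: "reduced_homogeneous_subvaluation v W u"
    and ag: "almost_finitely_generated (coord_ring W) (coord_const W) v u" and \<epsilon>: "\<epsilon> > 0"
  shows "\<exists>m d f \<gamma>. good (\<lambda>p. u (coord_class W p)) \<epsilon> m d f \<gamma>"
proof -
  let ?u = "\<lambda>p. u (coord_class W p)"
  note u' = reduced_homogeneous_D[OF u]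
  obtain C where C: "almost_finitely_generates (coord_ring W) (coord_const W) v C u"
    using ag by (auto simp: almost_finitely_generated_def)
  have "\<exists>p. fst (C k) = coord_class W p" for k
    using C unfolding almost_finitely_generates_def generates_algebra_def carrier_coord_ring by blast
  then obtain p where "\<And>k. fst (C k) = coord_class W (p k)" by metis
  then have "(\<lambda>k. (coord_class W (p k), snd (C k))) = C" by (intro ext prod_eqI) auto
  then have ag': "almost_finitely_generates (coord_ring W) (coord_const W) v (\<lambda>k. (coord_class W (p k), snd (C k))) u"
    using C by simp
  obtain m where gen: "generating (p ` {..<m})"
    and bound: "\<forall>\<eta> B. (\<forall>\<xi>\<in>W. \<bar>\<eta> \<xi>\<bar> \<noteq> \<infinity> \<and> \<eta> \<xi> \<le> ereal B) \<longrightarrow> (\<forall>k<m. snd (C k) \<le> pdual \<eta> (p k)) \<longrightarrow>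
        (\<forall>e q. homogeneous e q \<longrightarrow> ?u q \<le> pdual \<eta> q + ereal (\<epsilon> * real e))"
    using eventually_happens'[OF sequentially_bot almost_generated_bound(2)[OF ag' \<epsilon>]] by (elim exE conjE) (rule that)
  have "\<forall>k. \<exists>N. \<forall>j>N. hom_component j (p k) = 0" using hom_component_large by metis
  then obtain N' where N': "\<And>k j. j > N' k \<Longrightarrow> hom_component j (p k) = 0" by metis
  define N where "N = Suc (\<Sum>k<m. N' k)"
  have N: "hom_component j (p k) = 0" if "k < m" "j > N" for k j
  proof (rule N')
    have "N' k \<le> (\<Sum>k<m. N' k)" using that(1) by (intro member_le_sum) auto
    then show "N' k < j" using that(2) by (simp add: N_def)
  qed
  have N0: "N > 0" by (simp add: N_def)
  \<comment> \<open>Index k * N + (j - 1) stands for the component of degree \<open>j\<close> of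
    \<open>p k\<close>.\<close>
  define d where "d i = Suc (i mod N)" for i
  define f where "f i = hom_component (d i) (p (i div N))" for i
  define \<gamma> where "\<gamma> i = ?u (f i)" for i
  have hit: "\<exists>i<m * N. f i = hom_component j (p k)" if "k < m" "1 \<le> j" "j \<le> N" for k j
  proof (intro exI conjI)
    let ?i = "k * N + (j - 1)"
    have "?i < Suc k * N" using that(2,3) by simp
    also have "\<dots> \<le> m * N" using that(1) by (intro mult_le_mono1) simp
    finally show "?i < m * N" .
    have l: "j = Suc (j - 1)" using that(2) by simp
    define l where "l = j - 1"
    with l have l: "j = Suc l" by simp
    then have "?i mod N = l" "?i div N = k" using that(3) by simp_all
    then show "f ?i = hom_component j (p k)" unfolding f_def d_def l by simp
  qed
  have split: "p k = hom_component 0 (p k) + (\<Sum>j\<in>{1..N}. hom_component j (p k))" if "k < m" for k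
  proof -
    have "p k = (\<Sum>j\<le>N. hom_component j (p k))" using N[OF that] by (simp add: sum_hom_components)
    also have "{..N} = insert 0 {1..N}" by auto
    finally show ?thesis by simp
  qed
  have comp0: "\<exists>b. hom_component 0 q = Const b" for q :: "('n, 'k) mpoly"
  proof -
    have "\<alpha> = 0" if "mdeg \<alpha> = 0" for \<alpha> :: "'n \<Rightarrow>\<^sub>0 nat"
      using that by (intro poly_mapping_eqI) (simp add: mdeg_superset[of UNIV])
    then have "hom_component 0 q = Const (Poly_Mapping.lookup q 0)"
      by (intro poly_mapping_eqI) (auto simp: lookup_hom_component lookup_single when_def)
    then show ?thesis by blast
  qed
  have c: "conditions (m * N) d f \<gamma>"
    unfolding conditions_def
  proof (intro conjI allI impI)
    show "generating (f ` {..<m * N})"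
      unfolding generating_def
    proof (intro allI impI)
      fix D :: "('n, 'k) mpoly set" assume D: "is_subring D" "range Const \<subseteq> D" "I_W \<subseteq> D" "f ` {..<m * N} \<subseteq> D"
      have "p k \<in> D" if k: "k < m" for k
      proof -
        have "hom_component j (p k) \<in> D" if "j \<in> {1..N}" for j
          using hit[OF k, of j] that D(4) by force
        moreover have "hom_component 0 (p k) \<in> D" using comp0[of "p k"] D(2) by auto
        ultimately have "hom_component 0 (p k) + (\<Sum>j\<in>{1..N}. hom_component j (p k)) \<in> D"
          by (intro is_subring_D(4)[OF D(1)] is_subring_sum[OF D(1)]) auto
        then show ?thesis using split[OF k] by simp
      qed
      then show "D = UNIV" using gen D unfolding generating_def by blast
    qed
    show "\<gamma> i \<noteq> -\<infinity>" for i unfolding \<gamma>_def by (rule u'(4))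
    show "f i \<in> I_W" if "\<gamma> i = \<infinity>" for i using that u'(2) unfolding \<gamma>_def by blast
  qed (simp_all add: d_def f_def)
  let ?\<phi> = "mhat (m * N) d f \<gamma>"
  have "?u q \<le> pdual ?\<phi> q + ereal (\<epsilon> * real e)" if "homogeneous e q" for e q
  proof -
    obtain B where "\<forall>\<xi>\<in>W. ?\<phi> \<xi> \<le> ereal B" using mhat_upper[OF c] by blast
    then have B: "\<forall>\<xi>\<in>W. \<bar>?\<phi> \<xi>\<bar> \<noteq> \<infinity> \<and> ?\<phi> \<xi> \<le> ereal B" by (simp add: mhat_finite[OF c])
    have sub: "subval (pdual ?\<phi>)" by (rule mhat_subval[OF c])
    have "snd (C k) \<le> pdual ?\<phi> (p k)" if k: "k < m" for k
    proof -
      have le: "?u (p k) \<le> ?u (hom_component j (p k))" for j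
        unfolding u'(3)[of "p k"] by (rule INF_lower) simp
      have "?u (p k) \<le> pdual ?\<phi> (hom_component j (p k))" if "j \<in> {1..N}" for j
      proof -
        obtain i where i: "i < m * N" "f i = hom_component j (p k)" using hit[OF k, of j] \<open>j \<in> {1..N}\<close> by auto
        show ?thesis using le[of j] pdual_mhat_ge[OF c i(1)] unfolding \<gamma>_def i(2) by (rule order_trans)
      qed
      \<comment> \<open>No condition was recorded in degree 0; there \<open>u\<close> and the dual
        both restrict to \<open>v\<close>, provided that \<open>W\<close> is nonempty.\<close>
      moreover have "?u (p k) \<le> pdual ?\<phi> (hom_component 0 (p k))"
      proof (cases "W = {}")
        case True
        then have "hom_component 0 (p k) \<in> I_W" by (simp add: vanishing_ideal_def)
        then have "pdual ?\<phi> (hom_component 0 (p k)) = \<infinity>" using pdual_PInf_iff[of ?\<phi>] mhat_finite[OF c] by blast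
        then show ?thesis by simp
      next
        case False
        obtain b where b: "hom_component 0 (p k) = Const b" using comp0 by blast
        have u: "subval ?u" by (rule u'(1))
        have "1 \<notin> I_W" using False vanishing_homogeneous[of 0 "1 :: ('n, 'k) mpoly" W] homogeneous_Const[of "1::'k", where 'a = 'n]
          by (auto simp: single_one poly_eval_simps)
        then have "?u 1 \<noteq> \<infinity>" using u'(2) by blast
        then have u1: "?u 1 = 0"
          using subval_D(3)[OF u, of 1] subval_D(1)[OF u, of 1] by (cases "?u 1") (auto simp: zero_ereal_def)
        have "?u (Const b) \<le> v b"
          using subval_Const_mult[OF u, of b 1] u1 at_0 by (cases "b = 0") auto
        then show ?thesis
          using le[of 0] pdual_Const[OF False, of ?\<phi> b] mhat_finite[OF c] unfolding b by (auto intro: order_trans)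
      qed
      ultimately have "?u (p k) \<le> pdual ?\<phi> (hom_component 0 (p k) + (\<Sum>j\<in>{1..N}. hom_component j (p k)))"
        using subval_D(4)[OF sub, of "hom_component 0 (p k)"] subval_ge_sum[OF sub, of "{1..N}" "?u (p k)"]
        by (meson min.boundedI order_trans)
      then have "?u (p k) \<le> pdual ?\<phi> (p k)" using split[OF k] by simp
      then show ?thesis using almost_generated_bound(1)[OF ag', of k] by (rule order_trans[rotated])
    qed
    then have "\<forall>k<m. snd (C k) \<le> pdual ?\<phi> (p k)" by simp
    from bound[THEN spec, THEN spec, THEN mp, OF B, THEN mp, OF this] show ?thesis using that by simp
  qed
  then have "good ?u \<epsilon> (m * N) d f \<gamma>"
    unfolding good_def using c by (simp add: \<gamma>_def)
  then show ?thesis by blast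
qed

lemma good_limit:
  assumes u: "reduced_homogeneous_subvaluation v W u"
    and good: "\<And>\<epsilon>. \<epsilon> > 0 \<Longrightarrow> \<exists>m d f \<gamma>. good (\<lambda>p. u (coord_class W p)) \<epsilon> m d f \<gamma>"
    and inj: "\<exists>j :: 'k \<Rightarrow> 'l. inj j"
  shows "virtual_divisor (U :: 'l itself) v W (subvaluation_dual v W u)"
    and "a \<in> carrier (coord_ring W) \<Longrightarrow> divisor_dual v W (subvaluation_dual v W u) a = u a"
proof -
  show "virtual_divisor U v W (subvaluation_dual v W u)"
    unfolding subvaluation_dual_eq by (rule sdual_virtual[OF inj good])
  assume "a \<in> carrier (coord_ring W)"
  then obtain p where a: "a = coord_class W p" by (auto simp: carrier_coord_ring)
  show "divisor_dual v W (subvaluation_dual v W u) a = u a"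
    unfolding a divisor_dual_class subvaluation_dual_eq
    by (rule pdual_sdual[OF reduced_homogeneous_D(1-3)[OF u] good])
qed

lemma uniform_limit_min_hat:
  assumes good: "\<And>\<epsilon>. \<epsilon> > 0 \<Longrightarrow> \<forall>\<^sub>F m in sequentially. good u \<epsilon> m d f \<gamma>"
  shows "ext_uniform_limit W (\<lambda>m. mhat m d f \<gamma>) (sdual u)"
  unfolding ext_uniform_limit_def
proof (intro allI impI)
  fix \<epsilon> :: real assume \<epsilon>: "\<epsilon> > 0"
  show "\<forall>\<^sub>F m in sequentially. \<forall>\<xi>\<in>W. ext_dist (mhat m d f \<gamma> \<xi>) (sdual u \<xi>) \<le> ereal \<epsilon>"
    using good[OF \<epsilon>]
  proof eventually_elim
    case (elim m)
    show ?case
    proof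
      fix \<xi> assume \<xi>: "\<xi> \<in> W"
      show "ext_dist (mhat m d f \<gamma> \<xi>) (sdual u \<xi>) \<le> ereal \<epsilon>"
      proof (rule ext_dist_I)
        have "sdual u \<xi> \<le> mhat m d f \<gamma> \<xi> + 0" using good_sdual(2)[OF elim \<xi>] by simp
        also have "\<dots> \<le> mhat m d f \<gamma> \<xi> + ereal \<epsilon>" using \<epsilon> by (intro add_left_mono) simp
        finally show "sdual u \<xi> \<le> mhat m d f \<gamma> \<xi> + ereal \<epsilon>" .
      qed (use good_sdual(1)[OF elim \<xi>] \<epsilon> in auto)
    qed
  qed
qed

text \<open>The other half of the contraction property: division by the degree turns an error
  proportional to the degree into a constant one.\<close>

lemma sdual_mono:
  assumes w: "\<And>q. w q \<noteq> -\<infinity>" "\<And>q. w q = \<infinity> \<Longrightarrow> q \<in> I_W" and fin: "\<bar>sdual w \<xi>\<bar> \<noteq> \<infinity>" and \<xi>: "\<xi> \<in> W"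
    and le: "\<And>e q. e \<ge> 1 \<Longrightarrow> homogeneous e q \<Longrightarrow> u q \<le> w q + ereal (\<delta> * real e)"
  shows "sdual w \<xi> \<le> sdual u \<xi> + ereal \<delta>"
proof -
  obtain h where h: "sdual w \<xi> = ereal h" using fin by (cases "sdual w \<xi>") auto
  have "ereal (h - \<delta>) \<le> sdual u \<xi>"
    unfolding sdual_def[of u]
  proof (rule INF_greatest, clarify)
    fix e and q :: "('n, 'k) mpoly" assume q: "(1::nat) \<le> e" "homogeneous e q"
    have "sdual w \<xi> \<le> form_hat v e q \<xi> - w q / ereal (real e)"
      unfolding sdual_def using q by (intro INF_lower2[of "(e, q)"]) auto
    then have "w q \<le> form_val v e q \<xi> - ereal (real e) * ereal h"
      unfolding h using q(1) w vanishing_homogeneous[OF q(2), of W] \<xi>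
      by (intro form_val_minus_ge) (auto simp: form_val_PInf_iff)
    then have "u q \<le> (form_val v e q \<xi> - ereal (real e) * ereal h) + ereal (\<delta> * real e)"
      using le[OF q] by (auto intro: order_trans add_right_mono)
    then show "ereal (h - \<delta>) \<le> form_hat v e q \<xi> - u q / ereal (real e)"
      by (rule form_hat_minus_ge[OF q(1)])
  qed
  then show ?thesis using h by (cases "sdual u \<xi>") auto
qed

text \<open>\<open>sdual_mono\<close> bounds the distance of the duals by that of the
  sub-valuations; \<open>pdual_mono\<close> bounds the distance of the double duals by that of the
  duals, and the double duals are \<open>u\<close> and \<open>w\<close>.\<close>

lemma duality_isometric:
  assumes u: "reduced_homogeneous_subvaluation v W u" "almost_finitely_generated (coord_ring W) (coord_const W) v u"
    and w: "reduced_homogeneous_subvaluation v W w" "almost_finitely_generated (coord_ring W) (coord_const W) v w"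
  shows "subvaluation_dist W u w = divisor_dist W (subvaluation_dual v W u) (subvaluation_dual v W w)"
proof -
  let ?u = "\<lambda>p. u (coord_class W p)" and ?w = "\<lambda>p. w (coord_class W p)"
  note gu = good_of_almost_finitely_generated[OF u] and gw = good_of_almost_finitely_generated[OF w]
  have fin: "\<bar>sdual ?u \<xi>\<bar> \<noteq> \<infinity>" "\<bar>sdual ?w \<xi>\<bar> \<noteq> \<infinity>" if "\<xi> \<in> W" for \<xi>
    using gu[of 1] gw[of 1] sdual_finite[OF _ that] by fastforce+
  have dd: "?u p = pdual (sdual ?u) p" "?w p = pdual (sdual ?w) p" for p
    by (rule pdual_sdual[OF reduced_homogeneous_D(1-3)[OF u(1)] gu, symmetric] pdual_sdual[OF reduced_homogeneous_D(1-3)[OF w(1)] gw, symmetric]; assumption)+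
  have ui: "?u q \<noteq> -\<infinity>" "?u q = \<infinity> \<Longrightarrow> q \<in> I_W" and wi: "?w q \<noteq> -\<infinity>" "?w q = \<infinity> \<Longrightarrow> q \<in> I_W" for q
    using reduced_homogeneous_D(2,4)[OF u(1)] reduced_homogeneous_D(2,4)[OF w(1)] by auto
  show ?thesis
    unfolding subvaluation_dual_eq
  proof (rule antisym)
    let ?\<Delta> = "divisor_dist W (sdual ?u) (sdual ?w)"
    have "0 \<le> ?\<Delta>" by (simp add: divisor_dist_def)
    show "subvaluation_dist W u w \<le> ?\<Delta>"
    proof (cases ?\<Delta>)
      case (real \<delta>)
      then have \<delta>: "0 \<le> \<delta>" using \<open>0 \<le> ?\<Delta>\<close> by simp
      have d: "ext_dist (sdual ?u \<xi>) (sdual ?w \<xi>) \<le> ereal \<delta>" if "\<xi> \<in> W" for \<xi>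
        unfolding real[symmetric] divisor_dist_def using that by (intro max.coboundedI2 SUP_upper)
      show ?thesis
        unfolding subvaluation_dist_def real
      proof (rule SUP_least, clarify)
        fix e a assume e: "(1::nat) \<le> e" "a \<in> coord_grade W e"
        then obtain q where q: "homogeneous e q" "a = coord_class W q" by (auto simp: coord_grade_def)
        have "pdual (sdual ?u) q \<le> pdual (sdual ?w) q + ereal (\<delta> * real e)"
          by (rule pdual_mono[OF _ _ _ q(1)]) (rule fin ext_dist_D(2)[OF d]; assumption)+
        moreover have "pdual (sdual ?w) q \<le> pdual (sdual ?u) q + ereal (\<delta> * real e)"
          by (rule pdual_mono[OF _ _ _ q(1)]) (rule fin ext_dist_D(1)[OF d]; assumption)+
        ultimately have "ext_dist (u a) (w a) \<le> ereal (\<delta> * real e)"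
          unfolding q(2) dd[of q] using \<delta> by (intro ext_dist_I) auto
        then show "ext_dist (u a) (w a) / ereal (real e) \<le> ereal \<delta>"
          using e(1) by (cases "ext_dist (u a) (w a)") (auto simp: pos_divide_le_eq)
      qed
    qed (use \<open>0 \<le> ?\<Delta>\<close> in auto)
  next
    let ?\<Delta> = "subvaluation_dist W u w"
    \<comment> \<open>The zero form contributes 0, so the supremum is not negative.\<close>
    have "(1, coord_class W 0) \<in> {(m, a). 1 \<le> m \<and> a \<in> coord_grade W m}" by (auto simp: coord_grade_def)
    moreover have "u (coord_class W 0) = \<infinity>" "w (coord_class W 0) = \<infinity>"
      using vI(1) reduced_homogeneous_D(2)[OF u(1)] reduced_homogeneous_D(2)[OF w(1)] by auto
    ultimately have "0 \<le> ?\<Delta>"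
      unfolding subvaluation_dist_def by (intro SUP_upper2[of "(1, coord_class W 0)"]) (auto simp: ext_dist_def)
    show "divisor_dist W (sdual ?u) (sdual ?w) \<le> ?\<Delta>"
    proof (cases ?\<Delta>)
      case (real \<delta>)
      then have \<delta>: "0 \<le> \<delta>" using \<open>0 \<le> ?\<Delta>\<close> by simp
      have d: "ext_dist (?u q) (?w q) \<le> ereal (\<delta> * real e)" if "e \<ge> 1" "homogeneous e q" for e q
      proof -
        have "ext_dist (?u q) (?w q) / ereal (real e) \<le> ereal \<delta>"
          unfolding real[symmetric] subvaluation_dist_def using that
          by (intro SUP_upper2[of "(e, coord_class W q)"]) (auto simp: coord_grade_def)
        then show ?thesis using that(1) by (cases "ext_dist (?u q) (?w q)") (auto simp: pos_divide_le_eq)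
      qed
      have "ext_dist (sdual ?u \<xi>) (sdual ?w \<xi>) \<le> ereal \<delta>" if \<xi>: "\<xi> \<in> W" for \<xi>
      proof (rule ext_dist_I[OF _ _ \<delta>])
        show "sdual ?u \<xi> \<le> sdual ?w \<xi> + ereal \<delta>"
          by (rule sdual_mono[OF ui fin(1)[OF \<xi>] \<xi>]) (use ext_dist_D(2)[OF d] in auto)
        show "sdual ?w \<xi> \<le> sdual ?u \<xi> + ereal \<delta>"
          by (rule sdual_mono[OF wi fin(2)[OF \<xi>] \<xi>]) (use ext_dist_D(1)[OF d] in auto)
      qed
      then show ?thesis
        unfolding real divisor_dist_def using \<delta> by (auto intro!: SUP_least)
    qed (use \<open>0 \<le> ?\<Delta>\<close> in auto)
  qed
qed

end

section \<open>Sub-valuations of virtual divisors\<close>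

context projective_variety
begin

text \<open>The approximation is one-sided, with all forms above \<eta>, so that the dual of \<eta>
  is nonnegative on them and thresholds 0 suffice.\<close>

lemma virtual_forms:
  fixes U :: "'l itself"
  assumes vd: "virtual_divisor U v W \<eta>" and \<epsilon>: "\<epsilon> > 0"
  shows "\<exists>D (r::nat) F. D \<ge> 1 \<and> (\<forall>i. homogeneous D (F i)) \<and>
    (\<forall>\<xi>\<in>W. (\<forall>i<r. \<eta> \<xi> \<le> form_hat v D (F i) \<xi>) \<and> (\<exists>i<r. form_hat v D (F i) \<xi> \<le> \<eta> \<xi> + ereal \<epsilon>))"
proof -
  have \<eta>: "\<And>\<xi>. \<xi> \<in> W \<Longrightarrow> \<bar>\<eta> \<xi>\<bar> \<noteq> \<infinity>" using vd by (simp add: virtual_divisor_def)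
  obtain \<theta> where \<theta>: "\<forall>m. \<exists>d. virtual_divisor_of_degree U v W d (\<theta> m)" "ext_uniform_limit W \<theta> \<eta>"
    using vd unfolding virtual_divisor_def by (elim conjE exE)
  have "\<epsilon> / 4 > 0" using \<epsilon> by simp
  then have "\<forall>\<^sub>F m in sequentially. \<forall>\<xi>\<in>W. ext_dist (\<theta> m \<xi>) (\<eta> \<xi>) \<le> ereal (\<epsilon> / 4)"
    using \<theta>(2) unfolding ext_uniform_limit_def by blast
  from eventually_happens'[OF sequentially_bot this] obtain m
    where m: "\<And>\<xi>. \<xi> \<in> W \<Longrightarrow> ext_dist (\<theta> m \<xi>) (\<eta> \<xi>) \<le> ereal (\<epsilon> / 4)" by blast
  obtain d where "virtual_divisor_of_degree U v W d (\<theta> m)" using \<theta>(1) by blast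
  then obtain L :: "'l ring" and w \<iota> a where d: "d \<ge> 1" and L: "field L" "valuation L w"
      "\<iota> \<in> ring_hom ring_of_type_algebra L" "\<forall>c. w (\<iota> c) = v c" "\<forall>\<alpha>. mdeg \<alpha> = d \<longrightarrow> a \<alpha> \<in> carrier L"
    and \<theta>m: "\<forall>\<xi>\<in>W. \<bar>\<theta> m \<xi>\<bar> \<noteq> \<infinity> \<and> \<theta> m \<xi> = (w (ext_form_eval L \<iota> d a (rep_proj \<xi>))
                    - ereal (real d) * tuple_val v (rep_proj \<xi>)) / ereal (real d)"
    unfolding virtual_divisor_of_degree_def by (elim conjE exE) (rule that)
  obtain r F c where F: "\<And>i. homogeneous d (F i)"
    and lo: "\<And>x. (INF i\<in>{..<r::nat}. v (poly_eval (F i) x) + ereal (c i)) \<le> w (ext_form_eval L \<iota> d a x)"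
    and up: "\<And>x. w (ext_form_eval L \<iota> d a x) \<le> (INF i\<in>{..<r}. v (poly_eval (F i) x) + ereal (c i)) + ereal (\<epsilon> / 4)"
    by (rule ext_form_approx[where d = d and a = a, OF L(1-3) L(4)[rule_format] L(5)[rule_format] \<open>\<epsilon> / 4 > 0\<close>]) (assumption, rule that)
  \<comment> \<open>The upward shift compensates the error \<epsilon> / 4 of
    \<open>ext_form_approx\<close> and, multiplied by the degree, the distance \<epsilon> / 4
    between \<eta> and \<open>\<theta> m\<close>.\<close>
  define s where "s = \<epsilon> / 4 + real d * \<epsilon> / 4"
  have "\<exists>b t. b \<noteq> 0 \<and> v b = ereal t \<and> c i + s \<le> t \<and> t \<le> c i + s + \<epsilon> / 8" for i
  proof -
    have "c i + s < c i + s + \<epsilon> / 8" using \<epsilon> by simp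
    then obtain b where b: "b \<noteq> 0" "ereal (c i + s) \<le> v b" "v b \<le> ereal (c i + s + \<epsilon> / 8)" by (rule value_dense)
    obtain t where "v b = ereal t" using finiteE[OF b(1)] .
    then show ?thesis using b by auto
  qed
  then obtain b t where b: "\<And>i. v (b i) = ereal (t i)" "\<And>i. c i + s \<le> t i" "\<And>i. t i \<le> c i + s + \<epsilon> / 8" by metis
  define G where "G i = Const (b i) * F i" for i
  show ?thesis
  proof (rule exI[of _ d], rule exI[of _ r], rule exI[of _ G], intro conjI allI ballI impI d)
    show "homogeneous d (G i)" for i unfolding G_def by (rule homogeneous_Const_mult[OF F])
    fix \<xi> :: "('k, 'n) proj" assume \<xi>: "\<xi> \<in> W"
    let ?x = "rep_proj \<xi>"
    have d0: "real d > 0" using d by simp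
    obtain t0 where t0: "tuple_val v ?x = ereal t0" by (rule rep_val_finite)
    obtain n where n: "\<eta> \<xi> = ereal n" using \<eta>[OF \<xi>] by (cases "\<eta> \<xi>") auto
    obtain h where h: "\<theta> m \<xi> = ereal h" using \<theta>m[rule_format, OF \<xi>, THEN conjunct1] by (cases "\<theta> m \<xi>") auto
    have nh: "n \<le> h + \<epsilon> / 4" "h \<le> n + \<epsilon> / 4" using ext_dist_D[OF m[OF \<xi>]] by (auto simp: n h)
    have "ereal h = (w (ext_form_eval L \<iota> d a ?x) - ereal (real d * t0)) / ereal (real d)"
      using \<theta>m[rule_format, OF \<xi>] by (simp add: h t0)
    then obtain e where e: "w (ext_form_eval L \<iota> d a ?x) = ereal e" "h = (e - real d * t0) / real d"
      using d0 by (cases "w (ext_form_eval L \<iota> d a ?x)") auto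
    have eh: "e = real d * h + real d * t0" using e(2) d0 by (simp add: field_simps)
    have hat: "form_hat v d (G i) \<xi> = ereal ((t i + y - real d * t0) / real d)" if "v (poly_eval (F i) ?x) = ereal y" for i y
      using that d0 by (simp add: form_hat_def form_val_def G_def poly_eval_simps mult b(1) t0)
    show "\<eta> \<xi> \<le> form_hat v d (G i) \<xi>" if i: "i < r" for i
    proof (cases "v (poly_eval (F i) ?x)")
      case (real y)
      have "ereal e \<le> (INF i\<in>{..<r}. v (poly_eval (F i) ?x) + ereal (c i)) + ereal (\<epsilon> / 4)"
        using up[of ?x] by (simp only: e(1))
      also have "\<dots> \<le> (v (poly_eval (F i) ?x) + ereal (c i)) + ereal (\<epsilon> / 4)"
        using i by (intro add_right_mono INF_lower) auto
      finally have "e \<le> y + c i + \<epsilon> / 4" by (simp add: real)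
      moreover have "n * real d \<le> (h + \<epsilon> / 4) * real d" using nh(1) d0 by (intro mult_right_mono) auto
      ultimately have "n * real d \<le> t i + y - real d * t0"
        using b(2)[of i] unfolding s_def eh by (simp add: algebra_simps)
      then show ?thesis unfolding hat[OF real] n using d0 by (simp add: pos_le_divide_eq)
    next
      case PInf
      then show ?thesis using d0 by (simp add: form_hat_def form_val_def G_def poly_eval_simps mult b(1) t0)
    next
      case MInf
      then show ?thesis using not_MInf by blast
    qed
    have "(INF i\<in>{..<r}. v (poly_eval (F i) ?x) + ereal (c i)) \<le> ereal e" using lo[of ?x] by (simp only: e(1))
    also have "\<dots> < ereal (e + \<epsilon> / 8)" using \<epsilon> by simp
    finally obtain i where i: "i < r" "v (poly_eval (F i) ?x) + ereal (c i) < ereal (e + \<epsilon> / 8)"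
      unfolding INF_less_iff by blast
    then obtain y where y: "v (poly_eval (F i) ?x) = ereal y"
      using not_MInf[of "poly_eval (F i) ?x"] by (cases "v (poly_eval (F i) ?x)") auto
    have "y + c i < e + \<epsilon> / 8" using i(2) by (simp add: y)
    then have "t i + y - real d * t0 \<le> real d * (h + \<epsilon> / 4) + \<epsilon> / 2"
      using b(3)[of i] unfolding s_def eh by (simp add: algebra_simps)
    also have "\<dots> \<le> real d * (h + \<epsilon> / 4) + real d * (\<epsilon> / 2)"
      using d \<epsilon> mult_right_mono[of 1 "real d" "\<epsilon> / 2"] by simp
    also have "\<dots> = (h + 3 * \<epsilon> / 4) * real d" by (simp add: algebra_simps)
    also have "\<dots> \<le> (n + \<epsilon>) * real d" using nh(2) d0 by (intro mult_right_mono) auto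
    finally have "form_hat v d (G i) \<xi> \<le> \<eta> \<xi> + ereal \<epsilon>"
      unfolding hat[OF y] n using d0 by (simp add: pos_divide_le_eq)
    then show "\<exists>i<r. form_hat v d (G i) \<xi> \<le> \<eta> \<xi> + ereal \<epsilon>" using i(1) by blast
  qed
qed

text \<open>Where \<eta> is finite, one of the approximating forms is nonzero, so
  \<open>forms_bounded_above\<close> applies to them.\<close>

lemma virtual_divisor_upper:
  fixes U :: "'l itself"
  assumes vd: "virtual_divisor U v W \<eta>"
  shows "\<exists>B. \<forall>\<xi>\<in>W. \<eta> \<xi> \<le> ereal B"
proof -
  obtain D r F where D: "D \<ge> 1" and F': "\<forall>i. homogeneous D (F i)"
    and bnd: "\<forall>\<xi>\<in>W. (\<forall>i<r::nat. \<eta> \<xi> \<le> form_hat v D (F i) \<xi>) \<and> (\<exists>i<r. form_hat v D (F i) \<xi> \<le> \<eta> \<xi> + ereal 1)"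
    using virtual_forms[OF vd zero_less_one] by (elim exE conjE)
  have F: "\<And>i. homogeneous D (F i)"
    and lo: "\<And>\<xi> i. \<xi> \<in> W \<Longrightarrow> i < r \<Longrightarrow> \<eta> \<xi> \<le> form_hat v D (F i) \<xi>"
    and up: "\<And>\<xi>. \<xi> \<in> W \<Longrightarrow> \<exists>i<r. form_hat v D (F i) \<xi> \<le> \<eta> \<xi> + ereal 1"
    using F' bnd by (blast, blast, blast)
  have "\<exists>B::real. \<forall>\<xi>\<in>W. \<exists>k<r. form_val v D (F k) \<xi> \<le> ereal B"
  proof (rule forms_bounded_above)
    fix \<xi> assume \<xi>: "\<xi> \<in> W"
    obtain i where i: "i < r" "form_hat v D (F i) \<xi> \<le> \<eta> \<xi> + ereal 1" using up[OF \<xi>] by blast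
    have "\<bar>\<eta> \<xi>\<bar> \<noteq> \<infinity>" using vd \<xi> by (simp add: virtual_divisor_def)
    then have "form_val v D (F i) \<xi> \<noteq> \<infinity>" using i(2) D by (cases "\<eta> \<xi>") (auto simp: form_hat_def)
    then show "\<exists>k<r. poly_eval (F k) (rep_proj \<xi>) \<noteq> 0" using i(1) by (auto simp: form_val_PInf_iff)
  qed (rule F)
  then obtain B :: real where B: "\<And>\<xi>. \<xi> \<in> W \<Longrightarrow> \<exists>k<r. form_val v D (F k) \<xi> \<le> ereal B" by blast
  have "\<eta> \<xi> \<le> ereal (B / real D)" if \<xi>: "\<xi> \<in> W" for \<xi>
  proof -
    obtain k where k: "k < r" "form_val v D (F k) \<xi> \<le> ereal B" using B[OF \<xi>] by blast
    have "\<eta> \<xi> \<le> form_hat v D (F k) \<xi>" by (rule lo[OF \<xi> k(1)])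
    also have "\<dots> \<le> ereal B / ereal (real D)" unfolding form_hat_def using D k(2) by (intro ereal_divide_right_mono) auto
    finally show ?thesis using D by simp
  qed
  then show ?thesis by blast
qed

lemma generating_variables:
  assumes b: "b \<noteq> 0" and F: "\<And>i. Const b * Var i \<in> F"
  shows "generating F"
  unfolding generating_def
proof (intro allI impI)
  fix C :: "('n, 'k) mpoly set" assume C: "is_subring C" "range Const \<subseteq> C" "I_W \<subseteq> C" "F \<subseteq> C"
  have "Var i \<in> C" for i
  proof -
    have "Const (inverse b) * (Const b * Var i) \<in> C"
      by (intro is_subring_D(5)[OF C(1)] subsetD[OF C(2) rangeI] subsetD[OF C(4) F])
    then show ?thesis using b by (simp add: mult.assoc[symmetric] mult_single)
  qed
  then have "peval Const Var p \<in> C" for p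
    unfolding peval_def mon_def using C(2)
    by (intro is_subring_sum[OF C(1)] is_subring_D(5)[OF C(1)] is_subring_prod[OF C(1)] is_subring_power[OF C(1)]) auto
  then show "C = UNIV" by (auto simp: peval_Var)
qed

lemma generating_mono: "generating F \<Longrightarrow> F \<subseteq> G \<Longrightarrow> generating G"
  unfolding generating_def by (intro allI impI) (meson order_trans)

text \<open>The approximating forms for the errors 1 / (j + 1) are listed in one sequence. Multiples
  of the variables are added to make it generate; all terms stay above \<eta>, so the minima
  decrease to \<eta>.\<close>

lemma virtual_sequence:
  fixes U :: "'l itself"
  assumes vd: "virtual_divisor U v W \<eta>"
  shows "\<exists>d f M. (\<forall>k::nat. d k \<ge> 1 \<and> homogeneous (d k) (f k)) \<and>
    (\<forall>k. \<forall>\<xi>\<in>W. \<eta> \<xi> \<le> form_hat v (d k) (f k) \<xi>) \<and>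
    (\<forall>m\<ge>M. conditions m d f (\<lambda>_. 0)) \<and>
    (\<forall>\<epsilon>>0. \<forall>\<^sub>F m in sequentially. \<forall>\<xi>\<in>W. mhat m d f (\<lambda>_. 0) \<xi> \<le> \<eta> \<xi> + ereal \<epsilon>)"
proof -
  obtain B where B: "\<And>\<xi>. \<xi> \<in> W \<Longrightarrow> \<eta> \<xi> \<le> ereal B" using virtual_divisor_upper[OF vd] by blast
  \<comment> \<open>Variables have nonnegative normalized value, so multiplied by \<open>b\<close>
    they lie above \<open>B\<close> and hence above \<eta>.\<close>
  obtain b where b: "b \<noteq> 0" "ereal B \<le> v b" using value_dense[of B "B + 1"] by auto
  have "\<exists>D (r::nat) F. D \<ge> 1 \<and> (\<forall>i. homogeneous D (F i)) \<and>
      (\<forall>\<xi>\<in>W. (\<forall>i<r. \<eta> \<xi> \<le> form_hat v D (F i) \<xi>) \<and> (\<exists>i<r. form_hat v D (F i) \<xi> \<le> \<eta> \<xi> + ereal (1 / real (Suc j))))" for j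
    by (rule virtual_forms[OF vd]) simp
  then obtain D r F where D: "\<And>j. D j \<ge> (1::nat)" and F: "\<And>j i. homogeneous (D j) (F j i)"
    and lo: "\<And>j \<xi> i. \<xi> \<in> W \<Longrightarrow> i < (r j :: nat) \<Longrightarrow> \<eta> \<xi> \<le> form_hat v (D j) (F j i) \<xi>"
    and up: "\<And>j \<xi>. \<xi> \<in> W \<Longrightarrow> \<exists>i<r j. form_hat v (D j) (F j i) \<xi> \<le> \<eta> \<xi> + ereal (1 / real (Suc j))"
    by metis
  define T where "T = range (\<lambda>i. (1::nat, Const b * Var i :: ('n, 'k) mpoly))"
  define S where "S j = (\<lambda>i. (D j, F j i)) ` {..<r j}" for j
  let ?A = "T \<union> (\<Union>j. S j)"
  have fin: "finite T" "\<And>j. finite (S j)" by (simp_all add: T_def S_def)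
  have A: "?A \<noteq> {}" "countable ?A" using fin by (auto simp: T_def intro: countable_finite)
  \<comment> \<open>The set may be finite; an enumeration with repetitions is enough.\<close>
  define g where "g = from_nat_into ?A"
  have rg: "range g = ?A" unfolding g_def by (rule range_from_nat_into[OF A])
  have reach: "\<exists>M. Q \<subseteq> g ` {..<M}" if Q: "finite Q" "Q \<subseteq> ?A" for Q
  proof -
    obtain C where C: "finite C" "Q = g ` C" using finite_subset_image[OF Q(1), of g UNIV] Q(2) rg by auto
    obtain M where "C \<subseteq> {..<M}" using finite_nat_bounded[OF C(1)] by blast
    then show ?thesis using C(2) by blast
  qed
  define d where "d k = fst (g k)" for k
  define f where "f k = snd (g k)" for k
  have gk: "g k \<in> T \<or> (\<exists>j. g k \<in> S j)" for k using rg by blast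
  have hom: "d k \<ge> 1 \<and> homogeneous (d k) (f k)" for k
    using gk[of k] D F homogeneous_Const_mult[OF homogeneous_Var] by (auto simp: T_def S_def d_def f_def)
  have ge: "\<eta> \<xi> \<le> form_hat v (d k) (f k) \<xi>" if \<xi>: "\<xi> \<in> W" for k \<xi>
    using gk[of k]
  proof
    assume "g k \<in> T"
    then obtain i where i: "g k = (1, Const b * Var i)" by (auto simp: T_def)
    obtain t where t: "tuple_val v (rep_proj \<xi>) = ereal t" by (rule rep_val_finite)
    obtain \<beta> where \<beta>: "v b = ereal \<beta>" using finiteE[OF b(1)] .
    have "ereal B \<le> ereal \<beta>" using b(2) by (simp add: \<beta>)
    also have "\<dots> \<le> form_hat v 1 (Const b * Var i) \<xi>"
      using tuple_val_le[of "rep_proj \<xi>" i] not_MInf[of "rep_proj \<xi> $ i"] t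
      by (cases "v (rep_proj \<xi> $ i)") (auto simp: form_hat_def form_val_def poly_eval_simps mult \<beta>)
    finally show ?thesis using B[OF \<xi>] i by (auto simp: d_def f_def intro: order_trans)
  qed (use lo[OF \<xi>] in \<open>auto simp: S_def d_def f_def\<close>)
  obtain M where M: "T \<subseteq> g ` {..<M}" using reach[OF fin(1)] by blast
  have cond: "conditions m d f (\<lambda>_. 0)" if m: "m \<ge> M" for m
    unfolding conditions_def
  proof (intro conjI allI impI)
    have "f ` {..<m} = snd ` g ` {..<m}" by (auto simp: f_def image_image)
    moreover have "{..<M} \<subseteq> {..<m}" using m by simp
    ultimately have sub: "snd ` T \<subseteq> f ` {..<m}" using M by (metis image_mono order_trans)
    have "generating (snd ` T)" by (rule generating_variables[OF b(1)]) (simp add: T_def image_image)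
    then show "generating (f ` {..<m})" using sub by (rule generating_mono)
  qed (use hom in auto)
  have lim: "\<forall>\<^sub>F m in sequentially. \<forall>\<xi>\<in>W. mhat m d f (\<lambda>_. 0) \<xi> \<le> \<eta> \<xi> + ereal \<epsilon>" if \<epsilon>: "\<epsilon> > 0" for \<epsilon>
  proof -
    obtain j where j: "inverse (real (Suc j)) < \<epsilon>" using reals_Archimedean[OF \<epsilon>] by blast
    obtain N where N: "S j \<subseteq> g ` {..<N}" using reach[OF fin(2)[of j]] by blast
    have "mhat m d f (\<lambda>_. 0) \<xi> \<le> \<eta> \<xi> + ereal \<epsilon>" if m: "m \<ge> N" and \<xi>: "\<xi> \<in> W" for m \<xi>
    proof -
      obtain i where i: "i < r j" "form_hat v (D j) (F j i) \<xi> \<le> \<eta> \<xi> + ereal (1 / real (Suc j))" using up[OF \<xi>] by blast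
      have "(D j, F j i) \<in> g ` {..<N}" using N i(1) by (auto simp: S_def)
      then obtain k where k: "k < N" "g k = (D j, F j i)" by fastforce
      have "mhat m d f (\<lambda>_. 0) \<xi> \<le> form_hat v (d k) (f k) \<xi> - 0 / ereal (real (d k))"
        unfolding min_hat_def using k(1) m by (intro INF_lower) auto
      also have "\<dots> = form_hat v (D j) (F j i) \<xi>" by (simp add: d_def f_def k(2))
      also note i(2)
      also have "\<eta> \<xi> + ereal (1 / real (Suc j)) \<le> \<eta> \<xi> + ereal \<epsilon>"
        using j by (intro add_left_mono) (simp add: inverse_eq_divide)
      finally show ?thesis .
    qed
    then show ?thesis unfolding eventually_sequentially by blast
  qed
  show ?thesis
    by (rule exI[of _ d], rule exI[of _ f], rule exI[of _ M]) (use hom ge cond lim in blast)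
qed

text \<open>The conditions hold for the dual of their minimum, and \<open>pdual_mhat_le\<close> is
  its leastness.\<close>

lemma divisor_dual_generated:
  assumes c: "conditions m d f \<gamma>"
  shows "generated_subvaluation (coord_ring W) (coord_const W) v ((\<lambda>k. (coord_class W (f k), \<gamma> k)) ` {..<m})
    (divisor_dual v W (mhat m d f \<gamma>))"
  unfolding generated_subvaluation_def
proof (intro conjI allI impI ballI)
  let ?C = "\<lambda>k. (coord_class W (f k), \<gamma> k)"
  have "fst ` ?C ` {..<m} = coord_class W ` f ` {..<m}" by (auto simp: image_image)
  then show "generates_algebra (coord_ring W) (coord_const W) (fst ` ?C ` {..<m})"
    using conditions_D(5)[OF c] by (simp only: generates_algebra_generating)
  obtain B where B: "\<And>\<xi>. \<xi> \<in> W \<Longrightarrow> mhat m d f \<gamma> \<xi> \<le> ereal B" using mhat_upper[OF c] by blast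
  have "reduced_homogeneous_subvaluation v W (divisor_dual v W (mhat m d f \<gamma>))"
    by (rule divisor_dual_reduced_homogeneous[where B = B]) (use mhat_finite[OF c] B in auto)
  then show "K_subvaluation (coord_ring W) (coord_const W) v (divisor_dual v W (mhat m d f \<gamma>))"
    by (simp add: reduced_homogeneous_subvaluation_def)
  show "case x of (a, \<alpha>) \<Rightarrow> \<alpha> \<le> divisor_dual v W (mhat m d f \<gamma>) a" if "x \<in> ?C ` {..<m}" for x
    using that pdual_mhat_ge[OF c] by (auto simp: divisor_dual_class)
  fix w a assume w: "K_subvaluation (coord_ring W) (coord_const W) v w \<and> (\<forall>(a, \<alpha>)\<in>?C ` {..<m}. \<alpha> \<le> w a)"
    and a: "a \<in> carrier (coord_ring W)"
  obtain p where p: "a = coord_class W p" using a by (auto simp: carrier_coord_ring)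
  show "divisor_dual v W (mhat m d f \<gamma>) a \<le> w a"
    unfolding p divisor_dual_class
    by (rule pdual_mhat_le[OF c, where u = "\<lambda>p. w (coord_class W p)"])
      (use w subval_of_K_subvaluation[of w] in auto)
qed

text \<open>Extends \<open>pdual_mono\<close> to polynomials of bounded degree, as uniform
  convergence on all of K[W] requires.\<close>

lemma pdual_approx:
  assumes \<eta>: "\<And>\<xi>. \<xi> \<in> W \<Longrightarrow> \<bar>\<eta> \<xi>\<bar> \<noteq> \<infinity>" and \<theta>: "\<And>\<xi>. \<xi> \<in> W \<Longrightarrow> \<bar>\<theta> \<xi>\<bar> \<noteq> \<infinity>"
    and le: "\<And>\<xi>. \<xi> \<in> W \<Longrightarrow> \<theta> \<xi> \<le> \<eta> \<xi> + ereal e" and e: "0 \<le> e" and q: "deg_le t q"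
  shows "pdual \<eta> q \<le> pdual \<theta> q + ereal (e * real t)"
proof -
  have comp: "pdual \<eta> q - ereal (e * real t) \<le> pdual \<theta> (hom_component j q)" for j
  proof (cases "j \<le> t")
    case True
    have eq: "pdual \<eta> q = (INF m. pdual \<eta> (hom_component m q))" by (rule pdual_components) (rule \<eta>)
    have "pdual \<eta> q \<le> pdual \<eta> (hom_component j q)"
      unfolding eq by (rule INF_lower) simp
    also have "\<dots> \<le> pdual \<theta> (hom_component j q) + ereal (e * real j)"
      by (rule pdual_mono[OF _ _ _ homogeneous_hom_component]) (rule \<eta> \<theta> le; assumption)+
    also have "\<dots> \<le> pdual \<theta> (hom_component j q) + ereal (e * real t)"
      using True e by (intro add_left_mono) (simp add: mult_left_mono)
    finally show ?thesis by (simp add: ereal_minus_le)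
  next
    case False
    then have "hom_component j q = 0" using q by (simp add: deg_le_def)
    moreover have "pdual \<theta> 0 = \<infinity>" using pdual_PInf_iff[of \<theta> 0] \<theta> vI(1) by blast
    ultimately show ?thesis by simp
  qed
  have "pdual \<eta> q - ereal (e * real t) \<le> (INF j. pdual \<theta> (hom_component j q))"
    by (rule INF_greatest) (rule comp)
  also have "\<dots> = pdual \<theta> q" by (rule pdual_components[symmetric]) (rule \<theta>)
  finally show ?thesis by (simp add: ereal_minus_le)
qed

text \<open>The minima of \<open>virtual_sequence\<close> converge to \<eta>, so their duals,
  generated by finitely many conditions with threshold 0, converge to the dual of \<eta>. The same
  minima are good for that dual, which makes its dual equal to \<eta>.\<close>

lemma virtual_divisor_dual:
  fixes U :: "'l itself"
  assumes vd: "virtual_divisor U v W \<eta>"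
  shows "reduced_homogeneous_subvaluation v W (divisor_dual v W \<eta>)"
    and "\<exists>f d. (\<forall>k. d k \<ge> 1 \<and> homogeneous (d k) (f k)) \<and>
      almost_finitely_generates (coord_ring W) (coord_const W) v (\<lambda>k::nat. (coord_class W (f k), 0)) (divisor_dual v W \<eta>)"
    and "\<xi> \<in> W \<Longrightarrow> subvaluation_dual v W (divisor_dual v W \<eta>) \<xi> = \<eta> \<xi>"
proof -
  have \<eta>: "\<And>\<xi>. \<xi> \<in> W \<Longrightarrow> \<bar>\<eta> \<xi>\<bar> \<noteq> \<infinity>" using vd by (simp add: virtual_divisor_def)
  obtain B where B: "\<And>\<xi>. \<xi> \<in> W \<Longrightarrow> \<eta> \<xi> \<le> ereal B" using virtual_divisor_upper[OF vd] by blast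
  show red: "reduced_homogeneous_subvaluation v W (divisor_dual v W \<eta>)"
    by (rule divisor_dual_reduced_homogeneous[where B = B]) (rule \<eta> B; assumption)+
  obtain d f M where hom: "\<forall>k::nat. d k \<ge> 1 \<and> homogeneous (d k) (f k)"
    and ge: "\<forall>k. \<forall>\<xi>\<in>W. \<eta> \<xi> \<le> form_hat v (d k) (f k) \<xi>"
    and cond: "\<forall>m\<ge>M. conditions m d f (\<lambda>_. 0)"
    and lim: "\<forall>\<epsilon>>0. \<forall>\<^sub>F m in sequentially. \<forall>\<xi>\<in>W. mhat m d f (\<lambda>_. 0) \<xi> \<le> \<eta> \<xi> + ereal \<epsilon>"
    using virtual_sequence[OF vd] by (elim exE conjE)
  let ?\<phi> = "\<lambda>m. mhat m d f (\<lambda>_. 0)"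
  let ?C = "\<lambda>k. (coord_class W (f k), 0::ereal)"
  have le_mhat: "\<eta> \<xi> \<le> ?\<phi> m \<xi>" if "\<xi> \<in> W" for m \<xi>
    unfolding min_hat_def using ge that by (intro INF_greatest) simp
  have fin: "\<bar>?\<phi> m \<xi>\<bar> \<noteq> \<infinity>" if "m \<ge> M" "\<xi> \<in> W" for m \<xi>
    by (rule mhat_finite[OF cond[rule_format, OF that(1)] that(2)])
  have approx: "\<forall>\<^sub>F m in sequentially. m \<ge> M \<and>
      (\<forall>t q. deg_le t q \<longrightarrow> pdual \<eta> q \<le> pdual (?\<phi> m) q + ereal (\<epsilon> * real t)) \<and> (\<forall>\<xi>\<in>W. ?\<phi> m \<xi> \<le> \<eta> \<xi> + ereal \<epsilon>)"
    if \<epsilon>: "\<epsilon> > 0" for \<epsilon>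
    using lim[rule_format, OF \<epsilon>] eventually_ge_at_top[of M]
  proof eventually_elim
    case (elim m)
    have "pdual \<eta> q \<le> pdual (?\<phi> m) q + ereal (\<epsilon> * real t)" if "deg_le t q" for t q
      by (rule pdual_approx[OF _ _ _ _ that]) (use elim \<eta> fin \<epsilon> in auto)
    then show ?case using elim by blast
  qed
  \<comment> \<open>The minima lie above \<eta>, so in this direction there is no error.\<close>
  have mono: "pdual (?\<phi> m) q \<le> pdual \<eta> q + ereal 0" if "m \<ge> M" for m q
  proof -
    obtain N where N: "\<And>j. j > N \<Longrightarrow> hom_component j q = 0" using hom_component_large by blast
    have "pdual (?\<phi> m) q \<le> pdual \<eta> q + ereal (0 * real N)"
      by (rule pdual_approx) (use le_mhat \<eta> fin[OF that] N in \<open>auto simp: deg_le_def\<close>)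
    then show ?thesis by simp
  qed
  have "almost_finitely_generates (coord_ring W) (coord_const W) v ?C (divisor_dual v W \<eta>)"
    unfolding almost_finitely_generates_def
  proof (intro conjI allI exI[of _ "\<lambda>m. divisor_dual v W (?\<phi> m)"])
    have "generating (range f)"
      by (rule generating_mono[OF conditions_D(5)[OF cond[rule_format, OF order_refl]]]) auto
    moreover have "range (\<lambda>k. fst (?C k)) = coord_class W ` range f" by (simp add: image_image)
    ultimately show "generates_algebra (coord_ring W) (coord_const W) (range (\<lambda>k. fst (?C k)))"
      by (simp only: generates_algebra_generating)
    show "\<forall>\<^sub>F m in sequentially. generated_subvaluation (coord_ring W) (coord_const W) v (?C ` {..<m}) (divisor_dual v W (?\<phi> m))"
      using eventually_ge_at_top[of M]
    proof eventually_elim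
      case (elim m)
      show ?case by (rule divisor_dual_generated[OF cond[rule_format, OF elim]])
    qed
    \<comment> \<open>For the tuple of the variables, the tuple degree of a class is the least
      degree of a representative, which is the one to which \<open>pdual_approx\<close> is
      applied.\<close>
    obtain es :: "'n list" where es: "set es = UNIV" using finite_list[of "UNIV :: 'n set"] by auto
    define cs where "cs = map (\<lambda>i. coord_class W (Var i :: ('n, 'k) mpoly)) es"
    have set_cs: "set cs = coord_class W ` range Var" using es by (auto simp: cs_def)
    have nth: "cs ! i = coord_class W (Var (es ! i))" if "i < length cs" for i using that by (simp add: cs_def)
    have "generating (range Var)" by (rule generating_variables[of 1]) (auto simp: mult_single)
    then have gen: "generates_algebra (coord_ring W) (coord_const W) (set cs)"
      unfolding set_cs generates_algebra_generating .
    show "subvaluations_converge (coord_ring W) (coord_const W) (\<lambda>m. divisor_dual v W (?\<phi> m)) (divisor_dual v W \<eta>)"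
      unfolding subvaluations_converge_def
    proof (intro exI[of _ cs] conjI gen allI impI)
      fix \<epsilon> :: real assume \<epsilon>: "\<epsilon> > 0"
      show "\<forall>\<^sub>F m in sequentially. \<forall>a\<in>carrier (coord_ring W). ext_dist (divisor_dual v W \<eta> a) (divisor_dual v W (?\<phi> m) a)
          \<le> ereal (\<epsilon> * real (tuple_degree (coord_ring W) (coord_const W) cs a))"
        using approx[OF \<epsilon>]
      proof eventually_elim
        case (elim m)
        show ?case
        proof
          fix a assume "a \<in> carrier (coord_ring W)"
          then obtain p where a: "a = coord_class W p" by (auto simp: carrier_coord_ring)
          let ?t = "tuple_degree (coord_ring W) (coord_const W) cs (coord_class W p)"
          obtain h where "mvars h \<subseteq> {..<length cs}"
            and h: "deg_le ?t h" "coord_class W (peval Const (\<lambda>i. Var (es ! i)) h) = coord_class W p"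
            by (rule tuple_degree_attained[OF gen nth])
          let ?q = "peval Const (\<lambda>i. Var (es ! i)) h :: ('n, 'k) mpoly"
          have "deg_le (1 * ?t) ?q"
            by (rule deg_le_peval[OF _ h(1)]) (simp add: deg_le_homogeneous)
          then have "pdual \<eta> ?q \<le> pdual (?\<phi> m) ?q + ereal (\<epsilon> * real ?t)" using elim by simp
          moreover have "pdual (?\<phi> m) ?q \<le> pdual \<eta> ?q + ereal (\<epsilon> * real ?t)"
          proof (rule order_trans[OF mono add_left_mono])
            show "M \<le> m" using elim by blast
            show "ereal 0 \<le> ereal (\<epsilon> * real ?t)" using \<epsilon> by simp
          qed
          ultimately have "ext_dist (divisor_dual v W \<eta> (coord_class W ?q)) (divisor_dual v W (?\<phi> m) (coord_class W ?q)) \<le> ereal (\<epsilon> * real ?t)"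
            unfolding divisor_dual_class using \<epsilon> by (intro ext_dist_I) auto
          then show "ext_dist (divisor_dual v W \<eta> a) (divisor_dual v W (?\<phi> m) a)
              \<le> ereal (\<epsilon> * real (tuple_degree (coord_ring W) (coord_const W) cs a))"
            unfolding a h(2) .
        qed
      qed
    qed
  qed simp
  then show "\<exists>f d. (\<forall>k. d k \<ge> 1 \<and> homogeneous (d k) (f k)) \<and>
      almost_finitely_generates (coord_ring W) (coord_const W) v (\<lambda>k::nat. (coord_class W (f k), 0)) (divisor_dual v W \<eta>)"
    using hom by blast
  assume \<xi>: "\<xi> \<in> W"
  have pos: "0 \<le> pdual \<eta> (f k)" for k
  proof -
    have eq: "pdual \<eta> (f k) = (INF \<xi>\<in>W. form_val v (d k) (f k) \<xi> - ereal (real (d k)) * \<eta> \<xi>)"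
      by (rule pdual_homogeneous) (use \<eta> hom in auto)
    show ?thesis
      unfolding eq
    proof (rule INF_greatest)
      fix \<zeta> assume \<zeta>: "\<zeta> \<in> W"
      obtain h where h: "\<eta> \<zeta> = ereal h" using \<eta>[OF \<zeta>] by (cases "\<eta> \<zeta>") auto
      have "ereal h \<le> form_hat v (d k) (f k) \<zeta>" using ge \<zeta> unfolding h[symmetric] by blast
      then show "0 \<le> form_val v (d k) (f k) \<zeta> - ereal (real (d k)) * \<eta> \<zeta>"
        unfolding h using hom by (intro form_val_minus_ge) auto
    qed
  qed
  have close: "sdual (pdual \<eta>) \<xi> \<le> \<eta> \<xi> + ereal (\<epsilon> * real 1) \<and> \<eta> \<xi> \<le> sdual (pdual \<eta>) \<xi> + ereal (\<epsilon> * real 1)"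
    if \<epsilon>: "\<epsilon> > 0" for \<epsilon>
  proof -
    obtain m where m: "m \<ge> M" "\<forall>t q. deg_le t q \<longrightarrow> pdual \<eta> q \<le> pdual (?\<phi> m) q + ereal (\<epsilon> * real t)"
        "\<forall>\<xi>\<in>W. ?\<phi> m \<xi> \<le> \<eta> \<xi> + ereal \<epsilon>"
      using eventually_happens'[OF sequentially_bot approx[OF \<epsilon>]] by (elim exE conjE)
    have "good (pdual \<eta>) \<epsilon> m d f (\<lambda>_. 0)"
      unfolding good_def
    proof (intro conjI allI impI)
      show "conditions m d f (\<lambda>_. 0)" by (rule cond[rule_format, OF m(1)])
      show "pdual \<eta> q \<le> pdual (?\<phi> m) q + ereal (\<epsilon> * real e)" if "homogeneous e q" for e q
        by (rule m(2)[rule_format, OF deg_le_homogeneous[OF that]])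
    qed (rule pos)
    note g = good_sdual[OF this \<xi>]
    have "sdual (pdual \<eta>) \<xi> \<le> \<eta> \<xi> + ereal \<epsilon>" using g(2) m(3) \<xi> by (blast intro: order_trans)
    moreover have "\<eta> \<xi> \<le> sdual (pdual \<eta>) \<xi> + ereal \<epsilon>" using g(1) le_mhat[OF \<xi>] by (rule order_trans[rotated])
    ultimately show ?thesis by simp
  qed
  have "sdual (pdual \<eta>) \<xi> = \<eta> \<xi>"
    by (rule antisym; rule ereal_le_by_epsilon[where d = 1]) (rule close[THEN conjunct1] close[THEN conjunct2]; assumption)+
  then show "subvaluation_dual v W (divisor_dual v W \<eta>) \<xi> = \<eta> \<xi>"
    by (simp add: subvaluation_dual_eq divisor_dual_class)
qed

end

theorem theorem3p12:
  fixes v :: "'k::alg_closed_field \<Rightarrow> ereal"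
    and W :: "('k, 'n::finite) proj set"
    and U :: "'l itself"
  assumes "valuation (ring_of_type_algebra :: 'k ring) v"
    and "complete_valuation v"
    and "\<exists>c. c \<noteq> 0 \<and> v c \<noteq> 0"
    and "zariski_closed W"
    and "\<exists>j :: 'k \<Rightarrow> 'l. inj j"
  shows
    "(\<forall>u f d \<gamma>.
        reduced_homogeneous_subvaluation v W u \<and>
        (\<forall>k. d k \<ge> 1 \<and> homogeneous (d k) (f k)) \<and>
        almost_finitely_generates (coord_ring W) (coord_const W) v
          (\<lambda>k::nat. (coord_class W (f k), \<gamma> k)) u
        \<longrightarrow>
        ext_uniform_limit W
          (\<lambda>m \<xi>. INF k\<in>{..<m}. form_hat v (d k) (f k) \<xi> - \<gamma> k / ereal (real (d k)))
          (subvaluation_dual v W u) \<and>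
        virtual_divisor U v W (subvaluation_dual v W u) \<and>
        (\<forall>a\<in>carrier (coord_ring W). divisor_dual v W (subvaluation_dual v W u) a = u a)) \<and>
     (\<forall>\<eta>. virtual_divisor U v W \<eta> \<longrightarrow>
        (\<exists>u f d.
           reduced_homogeneous_subvaluation v W u \<and>
           (\<forall>k. d k \<ge> 1 \<and> homogeneous (d k) (f k)) \<and>
           almost_finitely_generates (coord_ring W) (coord_const W) v
             (\<lambda>k::nat. (coord_class W (f k), 0)) u \<and>
           (\<forall>\<xi>\<in>W. subvaluation_dual v W u \<xi> = \<eta> \<xi>))) \<and>
     (\<forall>\<eta>. virtual_divisor U v W \<eta> \<longrightarrow>
        reduced_homogeneous_subvaluation v W (divisor_dual v W \<eta>) \<and>
        almost_finitely_generated (coord_ring W) (coord_const W) v (divisor_dual v W \<eta>) \<and>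
        (\<forall>\<xi>\<in>W. subvaluation_dual v W (divisor_dual v W \<eta>) \<xi> = \<eta> \<xi>)) \<and>
     (\<forall>u. reduced_homogeneous_subvaluation v W u \<and>
        almost_finitely_generated (coord_ring W) (coord_const W) v u
        \<longrightarrow>
        virtual_divisor U v W (subvaluation_dual v W u) \<and>
        (\<forall>a\<in>carrier (coord_ring W). divisor_dual v W (subvaluation_dual v W u) a = u a)) \<and>
     (\<forall>u w.
        reduced_homogeneous_subvaluation v W u \<and>
        almost_finitely_generated (coord_ring W) (coord_const W) v u \<and>
        reduced_homogeneous_subvaluation v W w \<and>
        almost_finitely_generated (coord_ring W) (coord_const W) v w
        \<longrightarrow>
        subvaluation_dist W u w =
          divisor_dist W (subvaluation_dual v W u) (subvaluation_dual v W w))"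
proof -
  have val: "v a \<noteq> -\<infinity>" "v a = \<infinity> \<longleftrightarrow> a = 0" "v (a * b) = v a + v b" "min (v a) (v b) \<le> v (a + b)" for a b
    using assms(1) unfolding valuation_def ring_of_type_algebra_def by auto
  \<comment> \<open>The value at 1 is not prescribed by \<open>valuation\<close>; it is 0, being
    finite and equal to its double.\<close>
  have "v 1 = v 1 + v 1" using val(3)[of 1 1] by simp
  then have "v 1 = 0" using val(1,2)[of 1] by (cases "v 1") auto
  then interpret projective_variety v W
    by unfold_locales (use val assms(2-4) in auto)
  show ?thesis
  proof (intro conjI allI impI)
    fix u f d \<gamma>
    assume *: "reduced_homogeneous_subvaluation v W u \<and> (\<forall>k. d k \<ge> 1 \<and> homogeneous (d k) (f k)) \<and>
        almost_finitely_generates (coord_ring W) (coord_const W) v (\<lambda>k::nat. (coord_class W (f k), \<gamma> k)) u"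
    have good: "\<forall>\<^sub>F m in sequentially. good (\<lambda>p. u (coord_class W p)) \<epsilon> m d f \<gamma>" if "\<epsilon> > 0" for \<epsilon>
      by (rule good_of_homogeneous_conditions) (use * that in auto)
    have "\<exists>m d f \<gamma>. good (\<lambda>p. u (coord_class W p)) \<epsilon> m d f \<gamma>" if "\<epsilon> > 0" for \<epsilon>
      using eventually_happens'[OF sequentially_bot good[OF that]] by (elim exE) (intro exI)
    note lim = good_limit[OF conjunct1[OF *] this assms(5)]
    show "virtual_divisor U v W (subvaluation_dual v W u)" by (rule lim(1))
    show "\<forall>a\<in>carrier (coord_ring W). divisor_dual v W (subvaluation_dual v W u) a = u a" by (intro ballI lim(2))
    show "ext_uniform_limit W
          (\<lambda>m \<xi>. INF k\<in>{..<m}. form_hat v (d k) (f k) \<xi> - \<gamma> k / ereal (real (d k)))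
          (subvaluation_dual v W u)"
      using uniform_limit_min_hat[OF good] unfolding min_hat_def[abs_def] subvaluation_dual_eq .
  next
    fix \<eta> assume \<eta>: "virtual_divisor U v W \<eta>"
    note dual = virtual_divisor_dual[OF \<eta>]
    show "\<exists>u f d. reduced_homogeneous_subvaluation v W u \<and> (\<forall>k. d k \<ge> 1 \<and> homogeneous (d k) (f k)) \<and>
           almost_finitely_generates (coord_ring W) (coord_const W) v (\<lambda>k::nat. (coord_class W (f k), 0)) u \<and>
           (\<forall>\<xi>\<in>W. subvaluation_dual v W u \<xi> = \<eta> \<xi>)"
      using dual by blast
    show "reduced_homogeneous_subvaluation v W (divisor_dual v W \<eta>)" by (rule dual(1))
    show "almost_finitely_generated (coord_ring W) (coord_const W) v (divisor_dual v W \<eta>)"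
      using dual(2) unfolding almost_finitely_generated_def by blast
    show "\<forall>\<xi>\<in>W. subvaluation_dual v W (divisor_dual v W \<eta>) \<xi> = \<eta> \<xi>" by (intro ballI dual(3))
  next
    fix u assume *: "reduced_homogeneous_subvaluation v W u \<and>
        almost_finitely_generated (coord_ring W) (coord_const W) v u"
    note lim = good_limit[OF conjunct1[OF *] good_of_almost_finitely_generated[OF conjunct1[OF *] conjunct2[OF *]] assms(5)]
    show "virtual_divisor U v W (subvaluation_dual v W u)" by (rule lim(1))
    show "\<forall>a\<in>carrier (coord_ring W). divisor_dual v W (subvaluation_dual v W u) a = u a" by (intro ballI lim(2))
  qed (elim conjE, rule duality_isometric)
qed

end
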